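(* The elements $$c^{\mathcal H}_0:=\mathbf 1\otimes\dot X_1,\qquad c^{\mathcal H}_1:=\mathbf 1\otimes\dot\delta^1_{1,1}$$ of $\mathbb C_\delta\otimes_{\mathcal U(\mathfrak{gl}_1)}\mathcal Q_1$ are cyclic cocycles. They are uniquely determined, via the relative characteristic map $\chi_{\rm rel}$, by the identities $\chi_{\rm rel}(c_0^{\mathcal H})=\Phi_{\rm C}(c_0)$ and $\chi_{\rm rel}(c_1^{\mathcal H})=\Phi_{\rm C}(c_1)$, where $c_0(\rho)\equiv1$ and $c_1(\rho_0,\rho_1)=\bigl(\frac{\rho_0''}{\rho_0'}-\frac{\rho_1''}{\rho_1'}\bigr)dx$. Their cohomology classes form a basis of $HP^\bullet(\mathcal H_1,\mathrm{GL}_1^+;\mathbb C_\delta)$.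
   Context: $\mathbf G$ is the discrete group of orientation preserving diffeomorphisms of $M=\mathbb R$, acting on $FM=\mathbb R\times\mathbb R^+$ by $\varphi(x,\mathbf y)=(\varphi(x),\varphi'(x)\mathbf y)$ (denoted $\tilde\varphi$). $\mathcal A=C_c^\infty(\mathbb R)\rtimes\mathbf G$ and $\tilde{\mathcal A}=C_c^\infty(FM)\rtimes\mathbf G$ consist of finite sums $\sum f_iU^*_{\varphi_i}$ with $fU^*_\varphi\,gU^*_\psi=f(g\circ\varphi)U^*_{\psi\varphi}$. $\mathcal H_1$ is the algebra of operators on $\tilde{\mathcal A}$ generated by $X_1=\mathbf y\,\partial_x$, $Y=\mathbf y\,\partial_{\mathbf y}$ (acting by $Z(fU^*_\varphi)=Z(f)U^*_\varphi$) and $\delta^1_{1,1}(fU^*_\varphi)=\mathbf y\frac{\varphi''(x)}{\varphi'(x)}fU^*_\varphi$; it is a Hopf algebra with coproduct determined by $h(ab)=h_{(1)}(a)h_{(2)}(b)$, counit by $h(1)=\varepsilon(h)1$, antipode $S$. $\delta$ is the character with $\delta(Y)=1$, $\delta(X_1)=\delta(\delta^1_{1,1})=0$; $S_\delta(h)=\delta(h_{(1)})S(h_{(2)})$. $\mathcal U(\mathfrak{gl}_1)=\mathbb C[Y]\subset\mathcal H_1$; $\mathcal Q_1=\mathcal H_1\otimes_{\mathcal U(\mathfrak{gl}_1)}\mathbb C$, $\dot h$ the class of $h$. $HP^\bullet(\mathcal H_1,\mathrm{GL}_1^+;\mathbb C_\delta)$ is the periodic cyclic cohomology of the cocyclic module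 $\mathbb C_\delta\otimes_{\mathcal U(\mathfrak{gl}_1)}\mathcal Q_1^{\otimes q}$ ($\mathcal U(\mathfrak{gl}_1)$ acting diagonally by left multiplication on $\mathcal Q_1^{\otimes q}$ and by $\delta$ on $\mathbb C_\delta$) with $d_0,d_{q+1}$ inserting $\dot1$ on the left, respectively right, $d_i$ the coproduct on the $i$-th factor, codegeneracies given by $\varepsilon$, and $\tau_q(\mathbf 1\otimes\dot h^1\otimes c^2\otimes\cdots\otimes c^q)=\mathbf 1\otimes S_\delta(h^1)\cdot(c^2\otimes\cdots\otimes c^q\otimes\dot1)$. A cyclic cocycle of degree $q$ is an element $c$ with $bc=0$, $\tau_q(c)=(-1)^qc$. Let $\tau(fU^*_\varphi)=\int_{\mathbb R}f\,dx$ if $\varphi=\mathrm{Id}$ and $0$ otherwise. For $c=\sum_\alpha\mathbf 1\otimes\dot h^1_\alpha\otimes\cdots\otimes\dot h^q_\alpha$, $$\chi_{\rm rel}(c)(a_0,\ldots,a_q)=\sum_\alpha\tau\bigl(\tilde a_0h^1_\alpha(\tilde a_1)\cdots h^q_\alpha(\tilde a_q)|_{\mathbf y=1}\bigr),\qquad a_i\in\mathcal A,$$ where for $a=fU^*_\varphi$, $\tilde a=\tilde fU^*_{\tilde\varphi}$ is the natural lift to $FM$ ($\tilde f(x,\mathbf y)=f(x)$), the product is computed by the rule of $\tilde{\mathcal A}$, and then coefficients are evaluated at $\mathbf y=1$. Connes' map $\Phi_{\rm C}$: let $\mathcal B=\Omega^*_c(\mathbb R)\otimes\wedge\,\mathbb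 C[\mathbf G\setminus\{e\}]$ with differential $d\otimes\mathrm{Id}$ and exterior generators $\gamma_\varphi$ ($\gamma_e=0$), and $\mathcal C=\mathcal B\rtimes\mathbf G$ with $U^*_\varphi\omega U_\varphi=\varphi^*\omega$, $U^*_{\varphi_1}\gamma_{\varphi_2}U_{\varphi_1}=\gamma_{\varphi_2\circ\varphi_1}-\gamma_{\varphi_1}$, $d(bU^*_\varphi)=db\,U^*_\varphi-(-1)^{\deg b}b\gamma_\varphi U^*_\varphi$. A homogeneous cochain $\lambda:\mathbf G^{q+1}\to\Omega^p(\mathbb R)$ (with $\lambda(\rho_0\rho,\ldots,\rho_q\rho)=\rho^*\lambda(\rho_0,\ldots,\rho_q)$) gives the linear form $\tilde\lambda$ on $\mathcal C$ with $\tilde\lambda(bU^*_\varphi)=0$ for $\varphi\ne e$, $\tilde\lambda(\omega\otimes\gamma_{\rho_1}\cdots\gamma_{\rho_q})=\int_{\mathbb R}\lambda(1,\rho_1,\ldots,\rho_q)\wedge\omega$, and $$\Phi_{\rm C}(\lambda)(a^0,\ldots,a^m)=\frac{p!}{(m+1)!}\sum_{j=0}^m(-1)^{j(m-j)}\tilde\lambda(da^{j+1}\cdots da^m\,a^0\,da^1\cdots da^j),\quad m=1-p+q.$$ *)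

theory Defs
  imports "HOL-Analysis.Analysis" "HOL-Library.Function_Algebras" "HOL-Library.Poly_Mapping"
begin

section \<open>Smooth functions and diffeomorphisms of the line\<close>

text \<open>The notion is meant for open \<open>S\<close>, the only case used below.\<close>

primrec Ck_on :: "nat \<Rightarrow> 'a::real_normed_vector set \<Rightarrow> ('a \<Rightarrow> 'b::real_normed_vector) \<Rightarrow> bool" where
  "Ck_on 0 S f \<longleftrightarrow> continuous_on S f"
| "Ck_on (Suc n) S f \<longleftrightarrow> (\<forall>x\<in>S. f differentiable (at x)) \<and>
      (\<forall>v. Ck_on n S (\<lambda>x. frechet_derivative f (at x) v))"

definition smooth_on :: "'a::real_normed_vector set \<Rightarrow> ('a \<Rightarrow> 'b::real_normed_vector) \<Rightarrow> bool" where
  "smooth_on S f \<longleftrightarrow> (\<forall>n. Ck_on n S f)"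

type_synonym diff = "real \<Rightarrow> real"

definition Diff :: "diff set" where
  "Diff = {\<phi>. bij \<phi> \<and> smooth_on UNIV \<phi> \<and> smooth_on UNIV (inv \<phi>) \<and> (\<forall>x. deriv \<phi> x > 0)}"

definition CcR :: "(real \<Rightarrow> complex) set" where
  "CcR = {f. smooth_on UNIV f \<and> (\<exists>K. compact K \<and> (\<forall>x. x \<notin> K \<longrightarrow> f x = 0))}"

text \<open>The frame bundle is the open half plane. Functions on it are represented by functions on
  the plane that vanish outside it, so that equality of functions is equality on \<open>FM\<close>.\<close>

definition FM :: "(real \<times> real) set" where
  "FM = UNIV \<times> {0<..}"

definition CinfFM :: "(real \<times> real \<Rightarrow> complex) set" where
  "CinfFM = {f. smooth_on FM f \<and> (\<forall>p. p \<notin> FM \<longrightarrow> f p = 0)}"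

definition CcFM :: "(real \<times> real \<Rightarrow> complex) set" where
  "CcFM = {f \<in> CinfFM. \<exists>K. compact K \<and> K \<subseteq> FM \<and> (\<forall>p. p \<notin> K \<longrightarrow> f p = 0)}"

definition lift_diff :: "diff \<Rightarrow> real \<times> real \<Rightarrow> real \<times> real" where
  "lift_diff \<phi> = (\<lambda>(x, y). (\<phi> x, deriv \<phi> x * y))"


section \<open>Crossed products\<close>

text \<open>The finite sum \<open>\<Sum>\<^sub>i f\<^sub>i U\<^sup>*\<^bsub>\<phi>\<^sub>i\<^esub>\<close> is the function sending \<open>\<phi>\<close> to the coefficient of \<open>U\<^sup>*\<^bsub>\<phi>\<^esub>\<close>.
  The lift of \<open>\<phi>\<close> to \<open>FM\<close> is determined by \<open>\<phi>\<close>, so \<open>\<phi>\<close> itself also indexes the crossed product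
  over \<open>FM\<close>.\<close>

type_synonym 'f cross = "diff \<Rightarrow> 'f"

definition crossed :: "'f::zero set \<Rightarrow> 'f cross set" where
  "crossed F = {a. finite {\<phi>. a \<phi> \<noteq> 0} \<and> (\<forall>\<phi>. a \<phi> \<noteq> 0 \<longrightarrow> \<phi> \<in> Diff \<and> a \<phi> \<in> F)}"

text \<open>Here \<open>act \<phi> g\<close> stands for \<open>U\<^sup>*\<^bsub>\<phi>\<^esub> g U\<^bsub>\<phi>\<^esub>\<close>, and \<open>f U\<^sup>*\<^bsub>\<phi>\<^esub> g U\<^sup>*\<^bsub>\<psi>\<^esub> = f (act \<phi> g) U\<^sup>*\<^bsub>\<psi>\<phi>\<^esub>\<close>.\<close>

definition cross_mult :: "('f \<Rightarrow> 'f \<Rightarrow> 'f) \<Rightarrow> (diff \<Rightarrow> 'f \<Rightarrow> 'f) \<Rightarrow> 'f cross \<Rightarrow> 'f cross \<Rightarrow> 'f::comm_monoid_add cross" where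
  "cross_mult mul act a b = (\<lambda>\<theta>.
     \<Sum>(\<phi>, \<psi>) \<in> {(\<phi>, \<psi>). a \<phi> \<noteq> 0 \<and> b \<psi> \<noteq> 0 \<and> \<psi> \<circ> \<phi> = \<theta>}. mul (a \<phi>) (act \<phi> (b \<psi>)))"

definition \<A> :: "(real \<Rightarrow> complex) cross set" where
  "\<A> = crossed CcR"

type_synonym fm_cross = "(real \<times> real \<Rightarrow> complex) cross"

definition At :: "fm_cross set" where
  "At = crossed CcFM"

text \<open>The unit and the lifts of elements of \<open>\<A>\<close> are not compactly supported along the fibres;
  they live in the following larger algebra.\<close>

definition Ahat :: "fm_cross set" where
  "Ahat = crossed CinfFM"

definition fm_mult :: "fm_cross \<Rightarrow> fm_cross \<Rightarrow> fm_cross" where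
  "fm_mult = cross_mult (\<lambda>f g p. f p * g p) (\<lambda>\<phi> g. g \<circ> lift_diff \<phi>)"

definition fm_scale :: "complex \<Rightarrow> fm_cross \<Rightarrow> fm_cross" where
  "fm_scale c a = (\<lambda>\<phi> p. c * a \<phi> p)"

definition fm_one :: fm_cross where
  "fm_one = (\<lambda>\<phi> p. if \<phi> = id \<and> p \<in> FM then 1 else 0)"

definition lift_elem :: "(real \<Rightarrow> complex) cross \<Rightarrow> fm_cross" where
  "lift_elem a = (\<lambda>\<phi> p. if p \<in> FM then a \<phi> (fst p) else 0)"

definition at_one :: "fm_cross \<Rightarrow> (real \<Rightarrow> complex) cross" where
  "at_one a = (\<lambda>\<phi> x. a \<phi> (x, 1))"

definition trace_tau :: "(real \<Rightarrow> complex) cross \<Rightarrow> complex" where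
  "trace_tau a = integral UNIV (a id)"


section \<open>The algebra of operators\<close>

definition X_op :: "fm_cross \<Rightarrow> fm_cross" where
  "X_op a = (\<lambda>\<phi> (x, y). complex_of_real y * vector_derivative (\<lambda>t. a \<phi> (t, y)) (at x))"

definition Y_op :: "fm_cross \<Rightarrow> fm_cross" where
  "Y_op a = (\<lambda>\<phi> (x, y). complex_of_real y * vector_derivative (\<lambda>t. a \<phi> (x, t)) (at y))"

definition delta1_op :: "fm_cross \<Rightarrow> fm_cross" where
  "delta1_op a = (\<lambda>\<phi> (x, y). complex_of_real (y * deriv (deriv \<phi>) x / deriv \<phi> x) * a \<phi> (x, y))"

text \<open>Operators on a subspace \<open>A\<close> are extended by \<open>0\<close> outside \<open>A\<close>, so that two operators are equal
  iff they agree on \<open>A\<close>.\<close>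

definition op_on :: "fm_cross set \<Rightarrow> (fm_cross \<Rightarrow> fm_cross) \<Rightarrow> fm_cross \<Rightarrow> fm_cross" where
  "op_on A h = (\<lambda>a. if a \<in> A then h a else 0)"

inductive_set op_alg :: "fm_cross set \<Rightarrow> (fm_cross \<Rightarrow> fm_cross) set" for A where
  one: "op_on A (\<lambda>a. a) \<in> op_alg A"
| X: "op_on A X_op \<in> op_alg A"
| Y: "op_on A Y_op \<in> op_alg A"
| delta1: "op_on A delta1_op \<in> op_alg A"
| add: "h \<in> op_alg A \<Longrightarrow> k \<in> op_alg A \<Longrightarrow> (\<lambda>a. h a + k a) \<in> op_alg A"
| scale: "h \<in> op_alg A \<Longrightarrow> (\<lambda>a. fm_scale c (h a)) \<in> op_alg A"
| mult: "h \<in> op_alg A \<Longrightarrow> k \<in> op_alg A \<Longrightarrow> h \<circ> k \<in> op_alg A"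

typedef H1 = "op_alg At"
  by (rule exI, rule op_alg.one)

setup_lifting type_definition_H1

lift_definition X1 :: H1 is "op_on At X_op" by (rule op_alg.X)
lift_definition Y1 :: H1 is "op_on At Y_op" by (rule op_alg.Y)
lift_definition delta1 :: H1 is "op_on At delta1_op" by (rule op_alg.delta1)

lift_definition h_scale :: "complex \<Rightarrow> H1 \<Rightarrow> H1" is "\<lambda>c h a. fm_scale c (h a)"
  by (rule op_alg.scale)

lemma op_alg_zero: "(\<lambda>a. 0) \<in> op_alg A"
proof -
  have "(\<lambda>a. fm_scale 0 (op_on A (\<lambda>a. a) a)) \<in> op_alg A"
    by (intro op_alg.scale op_alg.one)
  moreover have "(\<lambda>a. fm_scale 0 (op_on A (\<lambda>a. a) a)) = (\<lambda>a. 0)"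
    by (simp add: fm_scale_def fun_eq_iff)
  ultimately show ?thesis by simp
qed

lemma op_alg_uminus: "h \<in> op_alg A \<Longrightarrow> (\<lambda>a. - h a) \<in> op_alg A"
proof -
  assume "h \<in> op_alg A"
  then have "(\<lambda>a. fm_scale (-1) (h a)) \<in> op_alg A" by (rule op_alg.scale)
  moreover have "(\<lambda>a. fm_scale (-1) (h a)) = (\<lambda>a. - h a)"
    by (simp add: fm_scale_def fun_eq_iff)
  ultimately show ?thesis by simp
qed

instantiation H1 :: "{ab_group_add, one, times}"
begin

lift_definition one_H1 :: H1 is "op_on At (\<lambda>a. a)" by (rule op_alg.one)
lift_definition times_H1 :: "H1 \<Rightarrow> H1 \<Rightarrow> H1" is "(\<circ>)" by (rule op_alg.mult)
lift_definition zero_H1 :: H1 is "\<lambda>a. 0" by (rule op_alg_zero)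
lift_definition plus_H1 :: "H1 \<Rightarrow> H1 \<Rightarrow> H1" is "\<lambda>h k a. h a + k a" by (rule op_alg.add)
lift_definition uminus_H1 :: "H1 \<Rightarrow> H1" is "\<lambda>h a. - h a" by (rule op_alg_uminus)
definition minus_H1 :: "H1 \<Rightarrow> H1 \<Rightarrow> H1" where "minus_H1 h k = h + (- k)"

instance
proof
  fix h k l :: H1
  show "h + k + l = h + (k + l)" by transfer (simp add: add.assoc)
  show "h + k = k + h" by transfer (simp add: add.commute)
  show "0 + h = h" by transfer simp
  show "- h + h = 0" by transfer simp
  show "h - k = h + - k" by (rule minus_H1_def)
qed

end

text \<open>Elements of \<open>H1\<close> act on all of \<open>Ahat\<close> by the same differential expressions; as these are
  local, the extension is determined by the operator on \<open>At\<close>.\<close>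

definition H1_ext :: "H1 \<Rightarrow> fm_cross \<Rightarrow> fm_cross" where
  "H1_ext h = (THE k. k \<in> op_alg Ahat \<and> (\<forall>a\<in>At. k a = Rep_H1 h a))"


section \<open>The Hopf structure\<close>

definition counit :: "H1 \<Rightarrow> complex" where
  "counit h = (THE c. H1_ext h fm_one = fm_scale c fm_one)"

text \<open>Elements of tensor products are represented by finitely supported formal combinations of
  pure tensors.\<close>

definition is_coproduct :: "H1 \<Rightarrow> (H1 \<times> H1 \<Rightarrow>\<^sub>0 complex) \<Rightarrow> bool" where
  "is_coproduct h t \<longleftrightarrow> (\<forall>a\<in>At. \<forall>b\<in>At. Rep_H1 h (fm_mult a b) =
     (\<Sum>(k, l)\<in>Poly_Mapping.keys t. fm_scale (Poly_Mapping.lookup t (k, l))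
        (fm_mult (Rep_H1 k a) (Rep_H1 l b))))"

text \<open>A representative of the coproduct in \<open>H1 \<otimes> H1\<close>; which one is chosen is irrelevant wherever
  it is used, since it only enters through multilinear expressions.\<close>

definition coproduct :: "H1 \<Rightarrow> (H1 \<times> H1 \<Rightarrow>\<^sub>0 complex)" where
  "coproduct h = (SOME t. is_coproduct h t)"

definition H1_linear :: "(H1 \<Rightarrow> H1) \<Rightarrow> bool" where
  "H1_linear S \<longleftrightarrow> (\<forall>h k. S (h + k) = S h + S k) \<and> (\<forall>c h. S (h_scale c h) = h_scale c (S h))"

definition antipode :: "H1 \<Rightarrow> H1" where
  "antipode = (THE S. H1_linear S \<and> (\<forall>h.
     (\<Sum>(k, l)\<in>Poly_Mapping.keys (coproduct h).
        h_scale (Poly_Mapping.lookup (coproduct h) (k, l)) (S k * l)) = h_scale (counit h) 1 \<and>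
     (\<Sum>(k, l)\<in>Poly_Mapping.keys (coproduct h).
        h_scale (Poly_Mapping.lookup (coproduct h) (k, l)) (k * S l)) = h_scale (counit h) 1))"

definition is_character :: "(H1 \<Rightarrow> complex) \<Rightarrow> bool" where
  "is_character d \<longleftrightarrow> d 1 = 1 \<and> (\<forall>h k. d (h + k) = d h + d k) \<and>
     (\<forall>c h. d (h_scale c h) = c * d h) \<and> (\<forall>h k. d (h * k) = d h * d k)"

definition char_delta :: "H1 \<Rightarrow> complex" where
  "char_delta = (THE d. is_character d \<and> d Y1 = 1 \<and> d X1 = 0 \<and> d delta1 = 0)"

definition S_delta :: "H1 \<Rightarrow> H1" where
  "S_delta h = (\<Sum>(k, l)\<in>Poly_Mapping.keys (coproduct h).
     h_scale (Poly_Mapping.lookup (coproduct h) (k, l) * char_delta k) (antipode l))"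

inductive_set U_gl1 :: "H1 set" where
  one: "1 \<in> U_gl1"
| Y: "Y1 \<in> U_gl1"
| add: "u \<in> U_gl1 \<Longrightarrow> v \<in> U_gl1 \<Longrightarrow> u + v \<in> U_gl1"
| scale: "u \<in> U_gl1 \<Longrightarrow> h_scale c u \<in> U_gl1"
| mult: "u \<in> U_gl1 \<Longrightarrow> v \<in> U_gl1 \<Longrightarrow> u * v \<in> U_gl1"


section \<open>The cochain spaces\<close>

text \<open>The space \<open>\<Oplus>\<^sub>q \<complex>\<^sub>\<delta> \<otimes>\<^bsub>U(gl\<^sub>1)\<^esub> Q\<^sub>1\<^bsup>\<otimes>q\<^esup>\<close> is the free vector space on finite lists over \<open>H1\<close>, the list
  \<open>[h\<^sup>1, \<dots>, h\<^sup>q]\<close> standing for the tensor of the classes of the \<open>h\<^sup>i\<close>, modulo \<open>cochain_null\<close>.\<close>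

type_synonym cochain = "H1 list \<Rightarrow>\<^sub>0 complex"

definition c_scale :: "complex \<Rightarrow> cochain \<Rightarrow> cochain" where
  "c_scale c p = Poly_Mapping.map ((*) c) p"

lemma lookup_c_scale [simp]: "Poly_Mapping.lookup (c_scale c p) k = c * Poly_Mapping.lookup p k"
  by (simp add: c_scale_def Poly_Mapping.map.rep_eq when_def)

global_interpretation cc: vector_space c_scale
  by standard (auto intro!: poly_mapping_eqI simp: lookup_add algebra_simps)

definition tens :: "H1 list \<Rightarrow> cochain" where
  "tens hs = Poly_Mapping.single hs 1"

definition lin_ext :: "(H1 list \<Rightarrow> cochain) \<Rightarrow> cochain \<Rightarrow> cochain" where
  "lin_ext f p = (\<Sum>hs\<in>Poly_Mapping.keys p. c_scale (Poly_Mapping.lookup p hs) (f hs))"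

text \<open>The diagonal action \<open>h \<cdot> (k\<^sup>1 \<otimes> \<dots> \<otimes> k\<^sup>q)\<close> through the iterated coproduct (through the counit
  if \<open>q = 0\<close>).\<close>

fun diag_act :: "H1 \<Rightarrow> H1 list \<Rightarrow> cochain" where
  "diag_act h [] = c_scale (counit h) (tens [])"
| "diag_act h (k # ks) = (\<Sum>(h1, h2)\<in>Poly_Mapping.keys (coproduct h).
     c_scale (Poly_Mapping.lookup (coproduct h) (h1, h2))
       (lin_ext (\<lambda>ls. tens ((h1 * k) # ls)) (diag_act h2 ks)))"

definition multilinear_rels :: "cochain set" where
  "multilinear_rels =
     {tens (hs @ (h + k) # ks) - tens (hs @ h # ks) - tens (hs @ k # ks) | hs h k ks. True} \<union>
     {tens (hs @ h_scale c h # ks) - c_scale c (tens (hs @ h # ks)) | hs c h ks. True}"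

definition quotient_rels :: "cochain set" where
  "quotient_rels =
     {tens (hs @ (h * u) # ks) - c_scale (counit u) (tens (hs @ h # ks)) | hs h u ks. u \<in> U_gl1}"

definition balancing_rels :: "cochain set" where
  "balancing_rels = {c_scale (char_delta u) (tens hs) - diag_act u hs | u hs. u \<in> U_gl1}"

definition cochain_null :: "cochain set" where
  "cochain_null = cc.span (multilinear_rels \<union> quotient_rels \<union> balancing_rels)"

text \<open>Equality in \<open>\<Oplus>\<^sub>q \<complex>\<^sub>\<delta> \<otimes>\<^bsub>U(gl\<^sub>1)\<^esub> Q\<^sub>1\<^bsup>\<otimes>q\<^esup>\<close>.\<close>

definition cochain_eq :: "cochain \<Rightarrow> cochain \<Rightarrow> bool" (infix "\<approx>" 50) where
  "p \<approx> r \<longleftrightarrow> p - r \<in> cochain_null"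

definition of_degree :: "nat \<Rightarrow> cochain \<Rightarrow> bool" where
  "of_degree q p \<longleftrightarrow> (\<forall>hs\<in>Poly_Mapping.keys p. length hs = q)"


section \<open>Cocyclic structure and periodic cyclic cohomology\<close>

text \<open>On \<open>tens [h\<^sup>1, \<dots>, h\<^sup>q]\<close> the coface index runs from \<open>0\<close> to \<open>q + 1\<close>; list positions count from \<open>0\<close>.\<close>

definition coface :: "nat \<Rightarrow> H1 list \<Rightarrow> cochain" where
  "coface i hs =
     (if i = 0 then tens (1 # hs)
      else if i \<le> length hs then
        (\<Sum>(k, l)\<in>Poly_Mapping.keys (coproduct (hs ! (i - 1))).
           c_scale (Poly_Mapping.lookup (coproduct (hs ! (i - 1))) (k, l))
             (tens (take (i - 1) hs @ [k, l] @ drop i hs)))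
      else tens (hs @ [1]))"

definition codegeneracy :: "nat \<Rightarrow> H1 list \<Rightarrow> cochain" where
  "codegeneracy i hs = c_scale (counit (hs ! i)) (tens (take i hs @ drop (Suc i) hs))"

definition cyc :: "H1 list \<Rightarrow> cochain" where
  "cyc hs = (case hs of [] \<Rightarrow> tens [] | h # ks \<Rightarrow> diag_act (S_delta h) (ks @ [1]))"

definition tau :: "cochain \<Rightarrow> cochain" where
  "tau = lin_ext cyc"

definition b_map :: "cochain \<Rightarrow> cochain" where
  "b_map = lin_ext (\<lambda>hs. \<Sum>i\<le>Suc (length hs). c_scale ((-1) ^ i) (coface i hs))"

text \<open>The signed cyclic operator \<open>\<lambda> = (-1)\<^sup>q \<tau>\<^sub>q\<close> and the norm \<open>N = 1 + \<lambda> + \<dots> + \<lambda>\<^sup>q\<close> in degree \<open>q\<close>.\<close>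

definition cyc_sign :: "cochain \<Rightarrow> cochain" where
  "cyc_sign = lin_ext (\<lambda>hs. c_scale ((-1) ^ length hs) (cyc hs))"

definition cyc_norm :: "cochain \<Rightarrow> cochain" where
  "cyc_norm = lin_ext (\<lambda>hs. \<Sum>i\<le>length hs. (cyc_sign ^^ i) (tens hs))"

text \<open>The extra codegeneracy \<open>\<sigma>\<^sub>n \<circ> \<tau>\<^bsub>n+1\<^esub>\<close> from degree \<open>n + 1\<close> to degree \<open>n\<close>, and Connes' boundary
  \<open>B = N \<circ> \<sigma>\<^sub>n \<circ> \<tau>\<^bsub>n+1\<^esub> \<circ> (1 - \<lambda>)\<close>.\<close>

definition extra_codeg :: "cochain \<Rightarrow> cochain" where
  "extra_codeg p =
     lin_ext (\<lambda>hs. if hs = [] then 0 else codegeneracy (length hs - 1) hs) (tau p)"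

definition B_map :: "cochain \<Rightarrow> cochain" where
  "B_map = lin_ext (\<lambda>hs. if hs = [] then 0
                          else cyc_norm (extra_codeg (tens hs - cyc_sign (tens hs))))"

definition cyclic_cocycle :: "nat \<Rightarrow> cochain \<Rightarrow> bool" where
  "cyclic_cocycle q c \<longleftrightarrow> of_degree q c \<and> b_map c \<approx> 0 \<and> tau c \<approx> c_scale ((-1) ^ q) c"

text \<open>The \<open>\<int>/2\<close>-graded total complex of the \<open>(b, B)\<close>-bicomplex.\<close>

definition tot_diff :: "cochain \<Rightarrow> cochain" where
  "tot_diff = lin_ext (\<lambda>hs. b_map (tens hs) + B_map (tens hs))"

definition tot_cocycles :: "cochain set" where
  "tot_cocycles = {p. tot_diff p \<approx> 0}"

definition tot_coboundaries :: "cochain set" where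
  "tot_coboundaries = {p. \<exists>x. p \<approx> tot_diff x}"

lemma lin_ext_superset:
  assumes "finite S" "Poly_Mapping.keys p \<subseteq> S"
  shows "lin_ext f p = (\<Sum>hs\<in>S. c_scale (Poly_Mapping.lookup p hs) (f hs))"
  unfolding lin_ext_def
  by (rule sum.mono_neutral_left) (use assms in \<open>auto simp: in_keys_iff\<close>)

lemma lin_ext_add: "lin_ext f (p + r) = lin_ext f p + lin_ext f r"
proof -
  let ?S = "Poly_Mapping.keys p \<union> Poly_Mapping.keys r"
  have "Poly_Mapping.keys (p + r) \<subseteq> ?S" by (rule Poly_Mapping.keys_add)
  then show ?thesis
    by (simp add: lin_ext_superset[of ?S] lookup_add cc.scale_left_distrib sum.distrib)
qed

lemma lin_ext_scale: "lin_ext f (c_scale c p) = c_scale c (lin_ext f p)"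
proof -
  have "Poly_Mapping.keys (c_scale c p) \<subseteq> Poly_Mapping.keys p"
    by (auto simp: in_keys_iff)
  then show ?thesis
    by (simp add: lin_ext_superset[of "Poly_Mapping.keys p"] cc.scale_sum_right)
qed

lemma subspace_null: "cc.subspace cochain_null"
  unfolding cochain_null_def by (rule cc.subspace_span)

lemma tot_diff_add: "tot_diff (p + r) = tot_diff p + tot_diff r"
  and tot_diff_scale: "tot_diff (c_scale c p) = c_scale c (tot_diff p)"
  by (simp_all add: tot_diff_def lin_ext_add lin_ext_scale)

lemma tot_diff_zero: "tot_diff 0 = 0"
  by (simp add: tot_diff_def lin_ext_def)

lemma subspace_cocycles: "cc.subspace tot_cocycles"
  using subspace_null
  by (auto simp: cc.subspace_def tot_cocycles_def cochain_eq_def tot_diff_add tot_diff_scale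
      tot_diff_zero)

lemma subspace_coboundaries: "cc.subspace tot_coboundaries"
proof (rule cc.subspaceI)
  show "0 \<in> tot_coboundaries"
    using cc.subspace_0[OF subspace_null]
    by (auto simp: tot_coboundaries_def cochain_eq_def tot_diff_zero intro!: exI[of _ 0])
next
  fix p r assume "p \<in> tot_coboundaries" "r \<in> tot_coboundaries"
  then obtain x y where "p - tot_diff x \<in> cochain_null" "r - tot_diff y \<in> cochain_null"
    by (auto simp: tot_coboundaries_def cochain_eq_def)
  then have "(p - tot_diff x) + (r - tot_diff y) \<in> cochain_null"
    by (rule cc.subspace_add[OF subspace_null])
  then have "p + r - tot_diff (x + y) \<in> cochain_null"
    by (simp add: tot_diff_add algebra_simps)
  then show "p + r \<in> tot_coboundaries"
    by (auto simp: tot_coboundaries_def cochain_eq_def)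
next
  fix c p assume "p \<in> tot_coboundaries"
  then obtain x where "p - tot_diff x \<in> cochain_null"
    by (auto simp: tot_coboundaries_def cochain_eq_def)
  then have "c_scale c (p - tot_diff x) \<in> cochain_null"
    by (rule cc.subspace_scale[OF subspace_null])
  then have "c_scale c p - tot_diff (c_scale c x) \<in> cochain_null"
    by (simp add: tot_diff_scale cc.scale_right_diff_distrib)
  then show "c_scale c p \<in> tot_coboundaries"
    by (auto simp: tot_coboundaries_def cochain_eq_def)
qed

definition cohomologous :: "cochain \<Rightarrow> cochain \<Rightarrow> bool" where
  "cohomologous p r \<longleftrightarrow> p \<in> tot_cocycles \<and> r \<in> tot_cocycles \<and> p - r \<in> tot_coboundaries"

lemma part_equivp_cohomologous: "part_equivp cohomologous"
proof (rule part_equivpI)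
  show "\<exists>x. cohomologous x x"
    using cc.subspace_0[OF subspace_cocycles] cc.subspace_0[OF subspace_coboundaries]
    by (auto simp: cohomologous_def intro!: exI[of _ 0])
  show "symp cohomologous"
  proof (rule sympI)
    fix p r assume "cohomologous p r"
    then show "cohomologous r p"
      using cc.subspace_neg[OF subspace_coboundaries, of "p - r"]
      by (simp add: cohomologous_def)
  qed
  show "transp cohomologous"
  proof (rule transpI)
    fix p r s assume "cohomologous p r" "cohomologous r s"
    then show "cohomologous p s"
      using cc.subspace_add[OF subspace_coboundaries, of "p - r" "r - s"]
      by (simp add: cohomologous_def)
  qed
qed

text \<open>The sum of the even and the odd periodic cyclic cohomology.\<close>

quotient_type HP = cochain / partial: cohomologous morphisms rep_HP HP_class
  by (rule part_equivp_cohomologous)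

instantiation HP :: ab_group_add
begin

lift_definition zero_HP :: HP is 0
  using cc.subspace_0[OF subspace_cocycles] cc.subspace_0[OF subspace_coboundaries]
  by (simp add: cohomologous_def)

lift_definition plus_HP :: "HP \<Rightarrow> HP \<Rightarrow> HP" is "(+)"
  using cc.subspace_add[OF subspace_cocycles] cc.subspace_add[OF subspace_coboundaries]
  by (simp add: cohomologous_def add_diff_add)

lift_definition uminus_HP :: "HP \<Rightarrow> HP" is uminus
proof -
  fix p r assume "cohomologous p r"
  then show "cohomologous (- p) (- r)"
    using cc.subspace_neg[OF subspace_cocycles] cc.subspace_neg[OF subspace_coboundaries, of "p - r"]
    by (simp add: cohomologous_def)
qed

definition minus_HP :: "HP \<Rightarrow> HP \<Rightarrow> HP" where "minus_HP x y = x + (- y)"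

instance
proof
  fix x y z :: HP
  note closed = cc.subspace_0[OF subspace_cocycles] cc.subspace_0[OF subspace_coboundaries]
    cc.subspace_add[OF subspace_cocycles]
  show "x + y + z = x + (y + z)" by transfer (auto simp: cohomologous_def add.assoc closed)
  show "x + y = y + x" by transfer (auto simp: cohomologous_def add.commute closed)
  show "0 + x = x" by transfer (auto simp: cohomologous_def)
  show "- x + x = 0" by transfer (auto simp: cohomologous_def closed)
  show "x - y = x + - y" by (rule minus_HP_def)
qed

end

lift_definition HP_scale :: "complex \<Rightarrow> HP \<Rightarrow> HP" is c_scale
  using cc.subspace_scale[OF subspace_cocycles] cc.subspace_scale[OF subspace_coboundaries]
  by (auto simp: cohomologous_def simp flip: cc.scale_right_diff_distrib)

global_interpretation HP: vector_space HP_scale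
proof
  fix a b :: complex and x y :: HP
  note closed = cc.subspace_0[OF subspace_cocycles] cc.subspace_0[OF subspace_coboundaries]
    cc.subspace_add[OF subspace_cocycles] cc.subspace_scale[OF subspace_cocycles]
  show "HP_scale a (x + y) = HP_scale a x + HP_scale a y"
    by transfer (auto simp: cohomologous_def closed cc.scale_right_distrib)
  show "HP_scale (a + b) x = HP_scale a x + HP_scale b x"
    by transfer (auto simp: cohomologous_def closed cc.scale_left_distrib)
  show "HP_scale a (HP_scale b x) = HP_scale (a * b) x"
    by transfer (auto simp: cohomologous_def closed)
  show "HP_scale 1 x = x"
    by transfer (auto simp: cohomologous_def)
qed


section \<open>The relative characteristic map\<close>

text \<open>This is evaluated on a given sum of pure tensors. It does not descend to the quotient by
  \<open>balancing_rels\<close>: \<open>[1]\<close> is null, because \<open>char_delta Y1 = 1\<close> and \<open>Y1\<close> vanishes in \<open>Q\<^sub>1\<close>, but its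
  image under \<open>chi_rel\<close> is \<open>\<tau>(a\<^sub>0 a\<^sub>1)\<close>.\<close>

definition chi_rel :: "cochain \<Rightarrow> (real \<Rightarrow> complex) cross list \<Rightarrow> complex" where
  "chi_rel c as = (\<Sum>hs\<in>Poly_Mapping.keys c. Poly_Mapping.lookup c hs *
     trace_tau (at_one (foldl fm_mult (lift_elem (hd as))
       (map2 (\<lambda>h a. H1_ext h (lift_elem a)) hs (tl as)))))"


section \<open>Connes' map\<close>

text \<open>The pair \<open>(f, g)\<close> is the differential form \<open>f + g dx\<close>.\<close>

type_synonym form = "(real \<Rightarrow> complex) \<times> (real \<Rightarrow> complex)"

definition form_scale :: "complex \<Rightarrow> form \<Rightarrow> form" where
  "form_scale c = (\<lambda>(f, g). (\<lambda>x. c * f x, \<lambda>x. c * g x))"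

definition wedge :: "form \<Rightarrow> form \<Rightarrow> form" where
  "wedge = (\<lambda>(f, g) (f', g'). (\<lambda>x. f x * f' x, \<lambda>x. f x * g' x + g x * f' x))"

definition form_d :: "form \<Rightarrow> form" where
  "form_d = (\<lambda>(f, g). (0, \<lambda>x. vector_derivative f (at x)))"

definition pullback :: "diff \<Rightarrow> form \<Rightarrow> form" where
  "pullback \<phi> = (\<lambda>(f, g). (f \<circ> \<phi>, \<lambda>x. g (\<phi> x) * complex_of_real (deriv \<phi> x)))"

definition form_integral :: "form \<Rightarrow> complex" where
  "form_integral \<omega> = integral UNIV (snd \<omega>)"

text \<open>\<open>grade_sign k\<close> multiplies the component of form degree \<open>r\<close> by \<open>(-1)\<^bsup>k r\<^esup>\<close>.\<close>

definition grade_sign :: "nat \<Rightarrow> form \<Rightarrow> form" where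
  "grade_sign k = (\<lambda>(f, g). (f, \<lambda>x. (-1) ^ k * g x))"

text \<open>For a (fixed, arbitrary) linear order, the exterior algebra has as basis the monomials
  \<open>\<gamma>\<^sub>A = \<gamma>\<^bsub>\<rho>\<^sub>1\<^esub> \<cdots> \<gamma>\<^bsub>\<rho>\<^sub>k\<^esub>\<close> indexed by finite sets \<open>A = {\<rho>\<^sub>1 < \<dots> < \<rho>\<^sub>k}\<close>. An element of \<open>\<B>\<close> sends
  \<open>A\<close> to the coefficient of \<open>\<gamma>\<^sub>A\<close>.\<close>

definition diff_order :: "(diff \<times> diff) set" where
  "diff_order = (SOME r. linear_order r)"

definition enum :: "diff set \<Rightarrow> diff list" where
  "enum A = (THE \<rho>s. set \<rho>s = A \<and> distinct \<rho>s \<and> sorted_wrt (\<lambda>\<rho> \<sigma>. (\<rho>, \<sigma>) \<in> diff_order) \<rho>s)"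

text \<open>For disjoint \<open>A\<close> and \<open>B\<close>, \<open>\<gamma>\<^sub>A \<gamma>\<^sub>B = shuffle_sign A B \<gamma>\<^bsub>A \<union> B\<^esub>\<close>.\<close>

definition shuffle_sign :: "diff set \<Rightarrow> diff set \<Rightarrow> complex" where
  "shuffle_sign A B = (-1) ^ card {(\<rho>, \<sigma>). \<rho> \<in> A \<and> \<sigma> \<in> B \<and> (\<sigma>, \<rho>) \<in> diff_order}"

type_synonym bform = "diff set \<Rightarrow> form"

text \<open>The product of the graded tensor product:
  \<open>(\<omega> \<gamma>\<^sub>A) (\<omega>' \<gamma>\<^sub>B) = (-1)\<^bsup>|A| deg \<omega>'\<^esup> \<omega> \<and> \<omega>' \<gamma>\<^sub>A \<gamma>\<^sub>B\<close>.\<close>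

definition b_mult :: "bform \<Rightarrow> bform \<Rightarrow> bform" where
  "b_mult b b' = (\<lambda>D. \<Sum>A\<in>Pow D. form_scale (shuffle_sign A (D - A))
     (wedge (b A) (grade_sign (card A) (b' (D - A)))))"

definition b_form :: "form \<Rightarrow> bform" where
  "b_form \<omega> = (\<lambda>D. if D = {} then \<omega> else 0)"

definition b_one :: bform where
  "b_one = b_form (\<lambda>x. 1, 0)"

definition gam :: "diff \<Rightarrow> bform" where
  "gam \<rho> = (\<lambda>D. if \<rho> \<noteq> id \<and> D = {\<rho>} then (\<lambda>x. 1, 0) else 0)"

definition b_diff :: "bform \<Rightarrow> bform" where
  "b_diff b = (\<lambda>A. form_d (b A))"

text \<open>Multiplication by \<open>(-1)\<^bsup>deg b\<^esup>\<close> for the total degree.\<close>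

definition b_sign :: "bform \<Rightarrow> bform" where
  "b_sign b = (\<lambda>A. form_scale ((-1) ^ card A) (grade_sign 1 (b A)))"

text \<open>The automorphism \<open>b \<mapsto> U\<^sup>*\<^bsub>\<phi>\<^esub> b U\<^bsub>\<phi>\<^esub>\<close>.\<close>

definition b_act :: "diff \<Rightarrow> bform \<Rightarrow> bform" where
  "b_act \<phi> b = (\<Sum>A | b A \<noteq> 0. b_mult (b_form (pullback \<phi> (b A)))
     (foldr b_mult (map (\<lambda>\<rho>. gam (\<rho> \<circ> \<phi>) - gam \<phi>) (enum A)) b_one))"

type_synonym ccross = "bform cross"

definition cc_mult :: "ccross \<Rightarrow> ccross \<Rightarrow> ccross" where
  "cc_mult = cross_mult b_mult b_act"

definition cc_one :: ccross where
  "cc_one = (\<lambda>\<phi>. if \<phi> = id then b_one else 0)"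

definition cc_diff :: "ccross \<Rightarrow> ccross" where
  "cc_diff c = (\<lambda>\<phi>. b_diff (c \<phi>) - b_mult (b_sign (c \<phi>)) (gam \<phi>))"

definition cc_embed :: "(real \<Rightarrow> complex) cross \<Rightarrow> ccross" where
  "cc_embed a = (\<lambda>\<phi>. b_form (a \<phi>, 0))"

text \<open>A group cochain of degree \<open>q\<close> is a function of lists of length \<open>q + 1\<close>; as everywhere in
  this construction it is alternating.\<close>

definition tilde :: "nat \<Rightarrow> (diff list \<Rightarrow> form) \<Rightarrow> ccross \<Rightarrow> complex" where
  "tilde q l c = (\<Sum>A | finite A \<and> card A = q \<and> c id A \<noteq> 0.
     form_integral (wedge (l (id # enum A)) (c id A)))"

text \<open>\<open>p\<close> is the form degree and \<open>q\<close> the group degree of \<open>l\<close>; \<open>as = [a\<^sup>0, \<dots>, a\<^sup>m]\<close>.\<close>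

definition Phi_C :: "nat \<Rightarrow> nat \<Rightarrow> (diff list \<Rightarrow> form) \<Rightarrow> (real \<Rightarrow> complex) cross list \<Rightarrow> complex" where
  "Phi_C p q l as = (let m = 1 + q - p; e = cc_embed; de = cc_diff \<circ> cc_embed in
     fact p / fact (m + 1) * (\<Sum>j\<le>m. (-1) ^ (j * (m - j)) *
       tilde q l (foldr cc_mult
         (map de (drop (j + 1) as) @ [e (as ! 0)] @ map de (take j (tl as))) cc_one)))"

definition c0 :: "diff list \<Rightarrow> form" where
  "c0 \<rho>s = (\<lambda>x. 1, 0)"

definition c1 :: "diff list \<Rightarrow> form" where
  "c1 \<rho>s = (0, \<lambda>x. complex_of_real
     (deriv (deriv (\<rho>s ! 0)) x / deriv (\<rho>s ! 0) x - deriv (deriv (\<rho>s ! 1)) x / deriv (\<rho>s ! 1) x))"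

text \<open>Equality of \<open>(m + 1)\<close>-linear forms on \<open>\<A>\<close>.\<close>

definition eq_on_A :: "nat \<Rightarrow> ((real \<Rightarrow> complex) cross list \<Rightarrow> complex) \<Rightarrow>
    ((real \<Rightarrow> complex) cross list \<Rightarrow> complex) \<Rightarrow> bool" where
  "eq_on_A m F G \<longleftrightarrow> (\<forall>as. length as = m + 1 \<and> set as \<subseteq> \<A> \<longrightarrow> F as = G as)"

definition cH0 :: cochain where
  "cH0 = tens [X1]"

definition cH1 :: cochain where
  "cH1 = tens [delta1]"

end

theory Submission
  imports Defs
begin

text \<open>The two classes are found by making every object of the statement explicit in coordinates. An
  operator in \<open>H1\<close> acts separately on the coefficient of each
  \<open>U\<^sup>*\<^bsub>\<phi>\<^esub>\<close>, and does so locally, so it is known from its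
  effect on germs of functions. Three families of functionals on \<open>H1\<close> suffice:
  \<open>eps\<close>, the value on constants, which is the counit; \<open>omega\<close>, the
  character \<open>\<delta>\<close>; and \<open>xi z\<close>, which reads off the coefficient of
  \<open>X1\<close> (for \<open>z = True\<close>) or of \<open>delta1\<close> (for \<open>z =
  False\<close>). They come from the action of \<open>H1\<close> on germs of affine functions at
  the identity, and on polynomials in \<open>y\<close> at a diffeomorphism with \<open>\<phi>'' /
  \<phi>' = 1\<close> near \<open>0\<close>. The lemma \<open>xi_rules\<close> records the twisted
  Leibniz rule \<open>\<xi>(h k) = \<omega>(h) \<xi>(k) + \<xi>(h) \<epsilon>(k)\<close>.

  For the coproduct the essential point is that tensors in \<open>H1 \<otimes> H1\<close> are
  determined by their action on pairs (\<open>tensor_separation\<close>). It holds because the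
  affine group acts simply transitively on \<open>FM\<close> and commutes with \<open>H1\<close>.
  Every sum over the coproduct can therefore be computed on the generators, which gives
  counitality and coassociativity. The antipode is the transpose with respect to the measure
  \<open>dx dy / y\<close>, conjugated by the inversion of the groupoid
  (\<open>antipode_eq_anti\<close>), and it acts on the functionals by
  \<open>\<omega>(S\<^sub>\<delta>(h)) = \<epsilon>(h)\<close> and
  \<open>\<xi>(S\<^sub>\<delta>(h)) = - \<xi>(h)\<close> (\<open>S_delta_functionals\<close>).

  Commuting \<open>Y1\<close> past a word in \<open>X1\<close> and \<open>delta1\<close> counts
  the letters of the word. The balancing over \<open>U(gl\<^sub>1)\<close> with \<open>\<delta>(Y)
  = 1\<close> therefore leaves only tensors with exactly one letter in total
  (\<open>form_weight\<close>). The cochains of degree \<open>q\<close> thus have the \<open>2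
  q\<close> coordinates \<open>coord z q i\<close> with \<open>z\<close> a letter and \<open>i <
  q\<close> its position (\<open>null_iff\<close>), and on these coordinates the cocyclic
  operators do not mix the two letters. In coordinates the cyclic operator is a shift, the
  Hochschild coboundary is a bidiagonal matrix that is exact in all degrees above \<open>1\<close>
  (\<open>b_coord_exact\<close>), and in degree \<open>1\<close> each letter gives a single class,
  represented by \<open>cH0\<close> or \<open>cH1\<close>. Removing the top component of a total
  cocycle degree by degree ends in a combination of these two (\<open>HP_basis\<close>).

  The identities with Connes' map compare two explicit sums of integrals over the line
  (\<open>chi_pair_gen\<close> and \<open>Phi_C_eq\<close>). Uniqueness follows because an
  operator whose pairings all vanish annihilates lifted functions everywhere on \<open>FM\<close>:
  left multiplication by dilations moves the fibre coordinate \<open>1\<close> to every other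
  value, and this forces both \<open>xi z\<close> to vanish
  (\<open>annihilating_operator\<close>).\<close>

section \<open>Smooth functions\<close>

lemma Ck_on_SucD:
  assumes "Ck_on (Suc n) S f"
  shows "x \<in> S \<Longrightarrow> (f has_derivative frechet_derivative f (at x)) (at x)"
    and "Ck_on n S (\<lambda>x. frechet_derivative f (at x) v)"
  using assms by (auto simp: frechet_derivative_works[symmetric])

text \<open>Frechet derivatives at the points of an open set only depend on the function on that set.\<close>

lemma Ck_on_cong:
  assumes "open S" "\<And>x. x \<in> S \<Longrightarrow> f x = g x" "Ck_on n S f"
  shows "Ck_on n S g"
  using assms
proof (induction n arbitrary: f g)
  case 0
  then show ?case by (simp cong: continuous_on_cong)
next
  case (Suc n)
  have d: "(g has_derivative frechet_derivative f (at x)) (at x)" if "x \<in> S" for x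
    using has_derivative_transform_within_open[OF Ck_on_SucD(1)[OF Suc.prems(3) that] Suc.prems(1) that]
      Suc.prems(2) by simp
  then have e: "frechet_derivative f (at x) = frechet_derivative g (at x)" if "x \<in> S" for x
    using frechet_derivative_at that by metis
  have "Ck_on n S (\<lambda>x. frechet_derivative g (at x) v)" for v
    by (rule Suc.IH[OF Suc.prems(1) _ Ck_on_SucD(2)[OF Suc.prems(3), of v]]) (simp add: e)
  then show ?case using d by (auto simp: differentiable_def)
qed

text \<open>This is how membership is established in practice: any formula for the derivative will do, and
  only its own regularity has to be checked.\<close>

lemma Ck_on_SucI:
  assumes "open S" "\<And>x. x \<in> S \<Longrightarrow> (f has_derivative f' x) (at x)" "\<And>v. Ck_on n S (\<lambda>x. f' x v)"
  shows "Ck_on (Suc n) S f"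
proof -
  have e: "f' x = frechet_derivative f (at x)" if "x \<in> S" for x
    using frechet_derivative_at assms(2)[OF that] by metis
  have "Ck_on n S (\<lambda>x. frechet_derivative f (at x) v)" for v
    by (rule Ck_on_cong[OF assms(1) _ assms(3)[of v]]) (simp add: e)
  then show ?thesis using assms(2) by (auto simp: differentiable_def)
qed

lemma Ck_on_Suc_imp: "Ck_on (Suc n) S f \<Longrightarrow> Ck_on n S f"
proof (induction n arbitrary: f)
  case 0
  then show ?case
    by (auto intro!: continuous_at_imp_continuous_on differentiable_imp_continuous_within)
next
  case (Suc n)
  show ?case
    using Suc.prems Suc.IH by (auto simp del: Ck_on.simps simp: Ck_on.simps(2)[of "Suc n"] intro!: Ck_on.simps(2)[THEN iffD2])
qed

lemma Ck_on_subset: "Ck_on n S f \<Longrightarrow> T \<subseteq> S \<Longrightarrow> Ck_on n T f"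
proof (induction n arbitrary: f)
  case 0
  then show ?case by (auto intro: continuous_on_subset)
next
  case (Suc n)
  then show ?case by auto
qed

lemma Ck_on_Un:
  assumes "open S" "open T"
  shows "Ck_on n S f \<Longrightarrow> Ck_on n T f \<Longrightarrow> Ck_on n (S \<union> T) f"
proof (induction n arbitrary: f)
  case 0
  then show ?case using assms by (auto intro: continuous_on_open_Un)
next
  case (Suc n)
  then show ?case by auto
qed

lemma Ck_on_const: "Ck_on n S (\<lambda>x. c)"
proof (induction n arbitrary: c)
  case (Suc n)
  then show ?case by (simp add: frechet_derivative_const)
qed simp

lemma Ck_on_bounded_linear:
  assumes "bounded_linear L"
  shows "open S \<Longrightarrow> Ck_on n S L"
proof (cases n)
  case 0
  then show ?thesis using assms by (simp add: linear_continuous_on)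
next
  case (Suc m)
  assume "open S"
  then have "Ck_on (Suc m) S L"
    by (rule Ck_on_SucI[where f' = "\<lambda>_. L"])
       (auto intro: bounded_linear_imp_has_derivative assms Ck_on_const)
  then show ?thesis using Suc by simp
qed

lemma Ck_on_add:
  assumes "open S"
  shows "Ck_on n S f \<Longrightarrow> Ck_on n S g \<Longrightarrow> Ck_on n S (\<lambda>x. f x + g x)"
proof (induction n arbitrary: f g)
  case 0
  then show ?case by (auto intro: continuous_on_add)
next
  case (Suc n)
  show ?case
    by (rule Ck_on_SucI[OF assms, where f' = "\<lambda>x v. frechet_derivative f (at x) v + frechet_derivative g (at x) v"])
       (auto intro!: has_derivative_add Ck_on_SucD[OF Suc.prems(1)] Ck_on_SucD[OF Suc.prems(2)] Suc.IH
          simp del: Ck_on.simps)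
qed

lemma Ck_on_sum:
  assumes "open S" "finite I" "\<And>i. i \<in> I \<Longrightarrow> Ck_on n S (f i)"
  shows "Ck_on n S (\<lambda>x. \<Sum>i\<in>I. f i x)"
  using assms(2,3)
proof (induction I)
  case empty
  then show ?case by (simp add: Ck_on_const)
next
  case (insert i I)
  then show ?case by (simp add: Ck_on_add[OF assms(1)])
qed

text \<open>By the product rule the derivative is again a sum of products of functions of class one less, so
  induction applies.\<close>

lemma Ck_on_bilinear:
  assumes "bounded_bilinear pr" "open S"
  shows "Ck_on n S f \<Longrightarrow> Ck_on n S g \<Longrightarrow> Ck_on n S (\<lambda>x. pr (f x) (g x))"
proof (induction n arbitrary: f g)
  case 0
  then show ?case by (auto intro: bounded_bilinear.continuous_on[OF assms(1)])
next
  case (Suc n)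
  show ?case
    by (rule Ck_on_SucI[OF assms(2), where f' = "\<lambda>x v. pr (f x) (frechet_derivative g (at x) v) + pr (frechet_derivative f (at x) v) (g x)"])
       (auto intro!: bounded_bilinear.FDERIV[OF assms(1)] Ck_on_add[OF assms(2)] Ck_on_SucD[OF Suc.prems(1)] Ck_on_SucD[OF Suc.prems(2)] Suc.IH
          Ck_on_Suc_imp[OF Suc.prems(1)] Ck_on_Suc_imp[OF Suc.prems(2)] simp del: Ck_on.simps)
qed

lemma Ck_on_linear_image:
  assumes "bounded_linear L" "open S" "Ck_on n S f"
  shows "Ck_on n S (\<lambda>x. L (f x))"
  using assms(3)
proof (induction n arbitrary: f)
  case 0
  then show ?case by (auto intro: bounded_linear.continuous_on[OF assms(1)])
next
  case (Suc n)
  show ?case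
    by (rule Ck_on_SucI[OF assms(2), where f' = "\<lambda>x v. L (frechet_derivative f (at x) v)"])
       (auto intro!: bounded_linear.has_derivative[OF assms(1)] Ck_on_SucD[OF Suc.prems] Suc.IH simp del: Ck_on.simps)
qed

text \<open>The target is finite-dimensional, so the chain rule can be expanded in a basis. The derivative
  then is a sum of products of functions for which the induction hypothesis or the product rule is
  available.\<close>

lemma Ck_on_compose:
  fixes F :: "'a::real_normed_vector \<Rightarrow> 'b::euclidean_space"
  assumes "open S" "open T" "F ` S \<subseteq> T"
  shows "Ck_on n T g \<Longrightarrow> Ck_on n S F \<Longrightarrow> Ck_on n S (\<lambda>x. g (F x))"
proof (induction n arbitrary: g)
  case 0
  then show ?case using assms(3) by (auto intro: continuous_on_compose2)
next
  case (Suc n)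
  let ?f' = "\<lambda>x v. \<Sum>b\<in>Basis. (frechet_derivative F (at x) v \<bullet> b) *\<^sub>R frechet_derivative g (at (F x)) b"
  show ?case
  proof (rule Ck_on_SucI[OF assms(1), where f' = ?f'])
    fix x assume x: "x \<in> S"
    then have Fx: "F x \<in> T" using assms(3) by auto
    have dg: "(g has_derivative frechet_derivative g (at (F x))) (at (F x))"
      by (rule Ck_on_SucD(1)[OF Suc.prems(1) Fx])
    have comp: "((\<lambda>x. g (F x)) has_derivative (\<lambda>v. frechet_derivative g (at (F x)) (frechet_derivative F (at x) v))) (at x)"
      by (rule has_derivative_compose[OF Ck_on_SucD(1)[OF Suc.prems(2) x] dg])
    have lin: "frechet_derivative g (at (F x)) w = (\<Sum>b\<in>Basis. (w \<bullet> b) *\<^sub>R frechet_derivative g (at (F x)) b)" for w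
    proof -
      interpret linear "frechet_derivative g (at (F x))"
        using has_derivative_linear[OF dg] .
      have "frechet_derivative g (at (F x)) (\<Sum>b\<in>Basis. (w \<bullet> b) *\<^sub>R b) = (\<Sum>b\<in>Basis. (w \<bullet> b) *\<^sub>R frechet_derivative g (at (F x)) b)"
        by (simp add: sum scale)
      then show ?thesis by (simp add: euclidean_representation)
    qed
    show "((\<lambda>x. g (F x)) has_derivative ?f' x) (at x)"
      by (rule has_derivative_eq_rhs[OF comp]) (rule ext, rule lin)
  next
    fix v
    show "Ck_on n S (\<lambda>x. ?f' x v)"
      by (intro Ck_on_sum[OF assms(1)] Ck_on_bilinear[OF bounded_bilinear_scaleR assms(1)] finite_Basis
          Ck_on_linear_image[OF bounded_linear_inner_left assms(1)] Ck_on_SucD(2)[OF Suc.prems(2)]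
          Suc.IH[OF Ck_on_SucD(2)[OF Suc.prems(1)] Ck_on_Suc_imp[OF Suc.prems(2)]])
  qed
qed

lemma Ck_on_real_SucI:
  fixes f :: "real \<Rightarrow> 'b::real_normed_vector"
  assumes "open S" "\<And>x. x \<in> S \<Longrightarrow> (f has_vector_derivative f' x) (at x)" "Ck_on n S f'"
  shows "Ck_on (Suc n) S f"
  by (rule Ck_on_SucI[OF assms(1), where f' = "\<lambda>x v. v *\<^sub>R f' x"])
     (use assms in \<open>auto simp: has_vector_derivative_def intro!: Ck_on_linear_image[OF bounded_linear_scaleR_right]\<close>)

lemma Ck_on_exp: "Ck_on n UNIV (exp :: real \<Rightarrow> real)"
proof (induction n)
  case (Suc n)
  then show ?case
    by (intro Ck_on_real_SucI[where f' = exp])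
       (auto simp flip: has_real_derivative_iff_has_vector_derivative intro: DERIV_exp)
qed (auto intro: continuous_intros)

text \<open>The derivative \<open>- (1 / x)\<^sup>2\<close> is a polynomial in the function itself, so the
  order of differentiability bootstraps.\<close>

lemma Ck_on_inverse: "Ck_on n (- {0}) (inverse :: real \<Rightarrow> real)"
proof (induction n)
  case 0
  show ?case by (auto intro!: continuous_intros)
next
  case (Suc n)
  have o: "open (- {0::real})" by auto
  have "Ck_on n (- {0}) (\<lambda>x::real. - (inverse x * inverse x))"
    by (intro Ck_on_linear_image[OF bounded_linear_minus[OF bounded_linear_ident] o] Ck_on_bilinear[OF bounded_bilinear_mult o] Suc)
  moreover have "(inverse has_vector_derivative - (inverse x * inverse x)) (at x)" if "x \<in> - {0}" for x :: real
    using DERIV_inverse[of x] that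
    by (simp add: has_real_derivative_iff_has_vector_derivative[symmetric] power2_eq_square numeral_2_eq_2)
  ultimately show ?case
    by (intro Ck_on_real_SucI[OF o, where f' = "\<lambda>x. - (inverse x * inverse x)"]) auto
qed

lemma smooth_on_add: "open S \<Longrightarrow> smooth_on S f \<Longrightarrow> smooth_on S g \<Longrightarrow> smooth_on S (\<lambda>x. f x + g x)"
  by (auto simp: smooth_on_def intro: Ck_on_add)

lemma smooth_on_const: "smooth_on S (\<lambda>x. c)"
  by (auto simp: smooth_on_def intro: Ck_on_const)

lemma smooth_on_bounded_linear: "bounded_linear L \<Longrightarrow> open S \<Longrightarrow> smooth_on S L"
  by (auto simp: smooth_on_def intro: Ck_on_bounded_linear)

lemma smooth_on_subset: "smooth_on S f \<Longrightarrow> T \<subseteq> S \<Longrightarrow> smooth_on T f"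
  by (auto simp: smooth_on_def intro: Ck_on_subset)

lemma smooth_on_Un: "open S \<Longrightarrow> open T \<Longrightarrow> smooth_on S f \<Longrightarrow> smooth_on T f \<Longrightarrow> smooth_on (S \<union> T) f"
  by (auto simp: smooth_on_def intro: Ck_on_Un)

lemma smooth_on_bilinear:
  "bounded_bilinear pr \<Longrightarrow> open S \<Longrightarrow> smooth_on S f \<Longrightarrow> smooth_on S g \<Longrightarrow> smooth_on S (\<lambda>x. pr (f x) (g x))"
  by (auto simp: smooth_on_def intro: Ck_on_bilinear)

lemma smooth_on_linear_image:
  "bounded_linear L \<Longrightarrow> open S \<Longrightarrow> smooth_on S f \<Longrightarrow> smooth_on S (\<lambda>x. L (f x))"
  by (auto simp: smooth_on_def intro: Ck_on_linear_image)

lemma smooth_on_imp_continuous: "smooth_on S f \<Longrightarrow> continuous_on S f"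
  unfolding smooth_on_def by (metis Ck_on.simps(1))

lemma smooth_on_cong: "open S \<Longrightarrow> (\<And>x. x \<in> S \<Longrightarrow> f x = g x) \<Longrightarrow> smooth_on S f \<Longrightarrow> smooth_on S g"
  using Ck_on_cong unfolding smooth_on_def by blast

lemma smooth_on_compose:
  fixes F :: "'a::real_normed_vector \<Rightarrow> 'b::euclidean_space"
  shows "open S \<Longrightarrow> open T \<Longrightarrow> F ` S \<subseteq> T \<Longrightarrow> smooth_on T g \<Longrightarrow> smooth_on S F \<Longrightarrow> smooth_on S (\<lambda>x. g (F x))"
  unfolding smooth_on_def using Ck_on_compose by blast

lemma smooth_on_has_derivative:
  "smooth_on S f \<Longrightarrow> x \<in> S \<Longrightarrow> (f has_derivative frechet_derivative f (at x)) (at x)"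
  unfolding smooth_on_def using Ck_on_SucD(1) by blast

lemma smooth_on_frechet: "smooth_on S f \<Longrightarrow> smooth_on S (\<lambda>x. frechet_derivative f (at x) v)"
  unfolding smooth_on_def using Ck_on_SucD(2) by blast

lemmas smooth_on_mult = smooth_on_bilinear[OF bounded_bilinear_mult]
lemmas smooth_on_of_real = smooth_on_linear_image[OF bounded_linear_of_real]

lemma smooth_on_divide:
  fixes f g :: "'a::real_normed_vector \<Rightarrow> real"
  assumes "open S" "smooth_on S f" "smooth_on S g" "\<And>x. x \<in> S \<Longrightarrow> g x \<noteq> 0"
  shows "smooth_on S (\<lambda>x. f x / g x)"
proof -
  have "smooth_on S (\<lambda>x. inverse (g x))"
    by (rule smooth_on_compose[where T = "- {0}"]) (use assms Ck_on_inverse in \<open>auto simp: smooth_on_def\<close>)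
  from smooth_on_mult[OF assms(1,2) this] show ?thesis by (simp add: divide_inverse)
qed

lemma smooth_on_Pair:
  fixes f :: "'a::real_normed_vector \<Rightarrow> 'b::real_normed_vector" and g :: "'a \<Rightarrow> 'c::real_normed_vector"
  assumes "open S" "smooth_on S f" "smooth_on S g"
  shows "smooth_on S (\<lambda>x. (f x, g x))"
proof -
  have 1: "bounded_linear (\<lambda>u::'b. (u, 0::'c))" and 2: "bounded_linear (\<lambda>v::'c. (0::'b, v))"
    by (auto intro: bounded_linear_Pair bounded_linear_ident bounded_linear_zero)
  show ?thesis
    using smooth_on_add[OF assms(1) smooth_on_linear_image[OF 1 assms(1,2)] smooth_on_linear_image[OF 2 assms(1,3)]]
    by simp
qed

section \<open>Smooth functions of one real variable\<close>

lemma smooth_on_vector_derivative: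
  fixes f :: "real \<Rightarrow> 'b::real_normed_vector"
  assumes "open S" "smooth_on S f"
  shows "x \<in> S \<Longrightarrow> (f has_vector_derivative vector_derivative f (at x)) (at x)"
    and "smooth_on S (\<lambda>x. vector_derivative f (at x))"
proof -
  show d: "(f has_vector_derivative vector_derivative f (at x)) (at x)" if "x \<in> S" for x
    using smooth_on_has_derivative[OF assms(2) that]
    by (metis differentiableI vector_derivative_works)
  have "frechet_derivative f (at x) 1 = vector_derivative f (at x)" if "x \<in> S" for x
    using frechet_derivative_at[OF d[OF that, unfolded has_vector_derivative_def]] by (metis scaleR_one)
  then show "smooth_on S (\<lambda>x. vector_derivative f (at x))"
    by (intro smooth_on_cong[OF assms(1) _ smooth_on_frechet[OF assms(2), of 1]])
qed

lemma smooth_on_DERIV: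
  fixes f :: "real \<Rightarrow> real"
  assumes "open S" "smooth_on S f"
  shows "x \<in> S \<Longrightarrow> (f has_real_derivative deriv f x) (at x)"
    and "smooth_on S (deriv f)"
proof -
  have d: "(f has_real_derivative vector_derivative f (at x)) (at x)" if "x \<in> S" for x
    using smooth_on_vector_derivative(1)[OF assms that] by (simp add: has_real_derivative_iff_has_vector_derivative)
  then have e: "vector_derivative f (at x) = deriv f x" if "x \<in> S" for x
    using DERIV_imp_deriv that by metis
  show "x \<in> S \<Longrightarrow> (f has_real_derivative deriv f x) (at x)" using d e by metis
  show "smooth_on S (deriv f)"
    by (rule smooth_on_cong[OF assms(1) e smooth_on_vector_derivative(2)[OF assms]])
qed

lemma smooth_on_real_derivI:
  fixes f :: "real \<Rightarrow> 'b::real_normed_vector"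
  assumes "open S" "\<And>x. x \<in> S \<Longrightarrow> (f has_vector_derivative f' x) (at x)" "smooth_on S f'"
  shows "smooth_on S f"
proof -
  have "Ck_on (Suc n) S f" for n
    by (rule Ck_on_real_SucI[OF assms(1,2)]) (use assms(3) in \<open>auto simp: smooth_on_def\<close>)
  then show ?thesis using Ck_on_Suc_imp by (auto simp: smooth_on_def simp del: Ck_on.simps)
qed

section \<open>Bump functions\<close>

text \<open>The functions \<open>p(1 / t) exp(- 1 / t)\<close>, continued by \<open>0\<close> to \<open>t
  \<le> 0\<close>, form a family closed under differentiation. This makes all of them smooth.\<close>

definition flat_poly :: "real poly \<Rightarrow> real \<Rightarrow> real" where
  "flat_poly p t = (if t > 0 then poly p (1 / t) * exp (- (1 / t)) else 0)"

lemma poly_times_exp_tendsto_0: "((\<lambda>s. poly p s * exp (- s)) \<longlongrightarrow> (0::real)) at_top"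
proof -
  have "((\<lambda>s. \<Sum>i\<le>degree p. coeff p i * (s ^ i / exp s)) \<longlongrightarrow> (\<Sum>i\<le>degree p. coeff p i * 0)) at_top"
    by (intro tendsto_intros tendsto_power_div_exp_0)
  then show ?thesis
    by (simp add: poly_altdef sum_distrib_right exp_minus divide_inverse mult.assoc)
qed

text \<open>At \<open>t = 0\<close> the difference quotient is again of the form \<open>q(s) exp(-
  s)\<close> with \<open>s = 1 / t\<close>, which tends to \<open>0\<close>.\<close>

lemma flat_poly_DERIV:
  "(flat_poly p has_real_derivative flat_poly (monom 1 2 * (p - pderiv p)) t) (at t)"
proof -
  consider "t > 0" | "t < 0" | "t = 0" by linarith
  then show ?thesis
  proof cases
    case 1
    have "((\<lambda>t. poly p (1 / t) * exp (- (1 / t))) has_real_derivative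
        (poly p (1 / t) * (exp (- (1 / t)) * (1 / t\<^sup>2)) + (poly (pderiv p) (1 / t) * (- 1 / t\<^sup>2)) * exp (- (1 / t)))) (at t)"
      using 1 by (auto intro!: derivative_eq_intros simp: power2_eq_square)
    moreover have "poly p (1 / t) * (exp (- (1 / t)) * (1 / t\<^sup>2)) + (poly (pderiv p) (1 / t) * (- 1 / t\<^sup>2)) * exp (- (1 / t))
        = flat_poly (monom 1 2 * (p - pderiv p)) t"
      using 1 by (simp add: flat_poly_def poly_monom field_simps)
    moreover have "\<forall>\<^sub>F u in nhds t. poly p (1 / u) * exp (- (1 / u)) = flat_poly p u"
      using eventually_nhds_in_open[of "{0<..}" t] 1 by (auto simp: flat_poly_def elim!: eventually_mono)
    ultimately show ?thesis
      by (subst (asm) DERIV_cong_ev[OF refl _ refl, where g = "flat_poly p"]) auto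
  next
    case 2
    have "\<forall>\<^sub>F u in nhds t. 0 = flat_poly p u"
      using eventually_nhds_in_open[of "{..<0}" t] 2 by (auto simp: flat_poly_def elim!: eventually_mono)
    then have "((\<lambda>_. 0) has_real_derivative 0) (at t) \<longleftrightarrow> (flat_poly p has_real_derivative 0) (at t)"
      by (intro DERIV_cong_ev) auto
    then show ?thesis using 2 by (simp add: flat_poly_def)
  next
    case 3
    have "((\<lambda>h. poly (pCons 0 p) (inverse h) * exp (- inverse h)) \<longlongrightarrow> 0) (at_right 0)"
      using poly_times_exp_tendsto_0 filterlim_inverse_at_top_right by (rule filterlim_compose)
    then have "((\<lambda>h. flat_poly p h / h) \<longlongrightarrow> 0) (at_right 0)"
      by (rule Lim_transform_eventually)
         (auto simp: flat_poly_def eventually_at_filter field_simps)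
    moreover have "((\<lambda>h. flat_poly p h / h) \<longlongrightarrow> 0) (at_left 0)"
      by (rule Lim_transform_eventually[OF tendsto_const])
         (auto simp: flat_poly_def eventually_at_filter)
    ultimately have "((\<lambda>h. flat_poly p h / h) \<longlongrightarrow> 0) (at 0)"
      by (simp add: filterlim_split_at)
    then show ?thesis
      using 3 by (simp add: DERIV_def flat_poly_def)
  qed
qed

lemma smooth_flat_poly: "smooth_on UNIV (flat_poly p)"
proof -
  have "Ck_on n UNIV (flat_poly p)" for n
  proof (induction n arbitrary: p)
    case 0
    then show ?case
      by (auto intro!: continuous_at_imp_continuous_on DERIV_isCont flat_poly_DERIV)
  next
    case (Suc n)
    show ?case
      by (rule Ck_on_real_SucI[OF open_UNIV _ Suc.IH])
         (use flat_poly_DERIV in \<open>auto simp: has_real_derivative_iff_has_vector_derivative\<close>)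
  qed
  then show ?thesis by (simp add: smooth_on_def)
qed

definition smooth_step :: "real \<Rightarrow> real" where
  "smooth_step t = flat_poly 1 t / (flat_poly 1 t + flat_poly 1 (1 - t))"

lemma flat_poly_1: "flat_poly 1 t \<ge> 0" "flat_poly 1 t > 0 \<longleftrightarrow> t > 0" "flat_poly 1 t = 0 \<longleftrightarrow> t \<le> 0"
  by (auto simp: flat_poly_def)

lemma smooth_step_simps: "t \<le> 0 \<Longrightarrow> smooth_step t = 0" "t \<ge> 1 \<Longrightarrow> smooth_step t = 1"
  by (auto simp: smooth_step_def flat_poly_def)

lemma smooth_on_affine: "smooth_on UNIV (\<lambda>x::real. s * x + b)"
  by (intro smooth_on_add smooth_on_const smooth_on_bounded_linear bounded_linear_mult_right open_UNIV)

lemma smooth_smooth_step: "smooth_on UNIV smooth_step"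
proof -
  have "smooth_on UNIV (\<lambda>t. flat_poly 1 (1 - t))"
    using smooth_on_compose[OF open_UNIV open_UNIV _ smooth_flat_poly[of 1] smooth_on_affine[of "-1" 1]]
    by simp
  moreover have "flat_poly 1 t + flat_poly 1 (1 - t) \<noteq> 0" for t
    by (smt (verit) flat_poly_1)
  ultimately show ?thesis
    unfolding smooth_step_def
    by (intro smooth_on_divide smooth_on_add smooth_flat_poly open_UNIV) auto
qed

text \<open>A bump function that is \<open>1\<close> on \<open>[a, b]\<close> and \<open>0\<close> outside
  \<open>[a - e, b + e]\<close>, provided \<open>e > 0\<close>.\<close>

definition plateau :: "real \<Rightarrow> real \<Rightarrow> real \<Rightarrow> real \<Rightarrow> real" where
  "plateau a b e x = smooth_step (1 + (x - a) / e) * smooth_step (1 + (b - x) / e)"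

lemma plateau_1: "e > 0 \<Longrightarrow> a \<le> x \<Longrightarrow> x \<le> b \<Longrightarrow> plateau a b e x = 1"
  by (simp add: plateau_def smooth_step_simps)

lemma plateau_0: "e > 0 \<Longrightarrow> x \<le> a - e \<or> x \<ge> b + e \<Longrightarrow> plateau a b e x = 0"
  by (auto simp: plateau_def intro!: smooth_step_simps) (simp_all add: field_simps)

lemma smooth_plateau: "smooth_on UNIV (plateau a b e)"
proof -
  have 1: "(\<lambda>x. smooth_step (1 + (x - a) / e)) = (\<lambda>x. smooth_step ((1 / e) * x + (1 - a / e)))"
    and 2: "(\<lambda>x. smooth_step (1 + (b - x) / e)) = (\<lambda>x. smooth_step ((- 1 / e) * x + (1 + b / e)))"
    by (auto simp: diff_divide_distrib add_divide_distrib algebra_simps)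
  have "smooth_on UNIV (\<lambda>x. smooth_step (1 + (x - a) / e))" "smooth_on UNIV (\<lambda>x. smooth_step (1 + (b - x) / e))"
    unfolding 1 2
    by (rule smooth_on_compose[OF open_UNIV open_UNIV _ smooth_smooth_step smooth_on_affine], simp)+
  then show ?thesis
    unfolding plateau_def by (rule smooth_on_mult[OF open_UNIV])
qed

section \<open>The diffeomorphism group\<close>

text \<open>The logarithmic derivative of \<open>deriv \<phi>\<close>. By \<open>nonlin_comp\<close> it is a
  1-cocycle of the diffeomorphism group with values in 1-forms; it defines \<open>delta1\<close>
  as well as \<open>c1\<close>.\<close>

definition nonlin :: "diff \<Rightarrow> real \<Rightarrow> real" where
  "nonlin \<phi> x = deriv (deriv \<phi>) x / deriv \<phi> x"

lemma DiffD:
  assumes "\<phi> \<in> Diff"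
  shows Diff_bij: "bij \<phi>" and Diff_smooth: "smooth_on UNIV \<phi>" and Diff_deriv_pos: "deriv \<phi> x > 0"
    and Diff_DERIV: "(\<phi> has_real_derivative deriv \<phi> x) (at x)"
    and Diff_smooth_deriv: "smooth_on UNIV (deriv \<phi>)"
    and Diff_DERIV2: "(deriv \<phi> has_real_derivative deriv (deriv \<phi>) x) (at x)"
    and Diff_smooth_deriv2: "smooth_on UNIV (deriv (deriv \<phi>))"
  using assms smooth_on_DERIV[OF open_UNIV, of \<phi>] smooth_on_DERIV[OF open_UNIV, of "deriv \<phi>"]
  by (auto simp: Diff_def)

lemma Diff_inv_simps [simp]:
  assumes "\<phi> \<in> Diff"
  shows "inv \<phi> (\<phi> x) = x" "\<phi> (inv \<phi> x) = x" "\<phi> \<circ> inv \<phi> = id" "inv \<phi> \<circ> \<phi> = id" "inv (inv \<phi>) = \<phi>"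
  using Diff_bij[OF assms] by (auto simp: bij_def surj_f_inv_f fun_eq_iff inv_inv_eq)

lemma smooth_nonlin: "\<phi> \<in> Diff \<Longrightarrow> smooth_on UNIV (nonlin \<phi>)"
  unfolding nonlin_def
  by (rule smooth_on_divide[OF open_UNIV])
     (auto intro: Diff_smooth_deriv Diff_smooth_deriv2, metis Diff_deriv_pos less_irrefl)

lemma DERIV_inv_pos:
  assumes "bij \<phi>" "\<And>x. (\<phi> has_real_derivative \<phi>' x) (at x)" "\<And>x. \<phi>' x > 0"
  shows "(inv \<phi> has_real_derivative inverse (\<phi>' (inv \<phi> x))) (at x)"
proof (rule DERIV_inverse_function[where f = \<phi> and a = "x - 1" and b = "x + 1"])
  have i: "inv \<phi> (\<phi> z) = z" "\<phi> (inv \<phi> z) = z" for z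
    using assms(1) by (auto simp: bij_def surj_f_inv_f)
  have "isCont (inv \<phi>) (\<phi> (inv \<phi> x))"
    by (rule isCont_inverse_function[where d = 1]) (auto simp: i intro: DERIV_isCont assms(2))
  then show "isCont (inv \<phi>) x" by (simp add: i)
  show "\<phi>' (inv \<phi> x) \<noteq> 0" using assms(3) less_irrefl by metis
  show "\<phi> (inv \<phi> y) = y" for y by (simp add: i)
qed (auto intro: assms)

text \<open>The derivative of the inverse is a smooth expression in the inverse itself, so differentiability
  of order \<open>n\<close> gives order \<open>n + 1\<close>.\<close>

lemma DiffI:
  assumes "bij \<phi>" "smooth_on UNIV \<phi>" "\<And>x. deriv \<phi> x > 0"
  shows "\<phi> \<in> Diff"
proof -
  note D = smooth_on_DERIV[OF open_UNIV assms(2)]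
  have i: "(inv \<phi> has_vector_derivative inverse (deriv \<phi> (inv \<phi> x))) (at x)" for x
    using DERIV_inv_pos[OF assms(1) D(1) assms(3)] by (simp add: has_real_derivative_iff_has_vector_derivative)
  have "Ck_on n UNIV (inv \<phi>)" for n
  proof (induction n)
    case 0
    show ?case
      by (auto intro!: continuous_at_imp_continuous_on DERIV_isCont DERIV_inv_pos[OF assms(1) D(1) assms(3)])
  next
    case (Suc n)
    have "Ck_on n UNIV (\<lambda>x. deriv \<phi> (inv \<phi> x))"
      by (rule Ck_on_compose[OF open_UNIV open_UNIV]) (use D(2) Suc in \<open>auto simp: smooth_on_def\<close>)
    then have "Ck_on n UNIV (\<lambda>x. inverse (deriv \<phi> (inv \<phi> x)))"
      by (intro Ck_on_compose[OF _ _ _ Ck_on_inverse]) (use assms(3) less_irrefl in \<open>auto, metis\<close>)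
    then show ?case by (rule Ck_on_real_SucI[OF open_UNIV i])
  qed
  then show ?thesis using assms by (simp add: Diff_def smooth_on_def)
qed

lemma deriv_comp_Diff:
  "\<phi> \<in> Diff \<Longrightarrow> \<psi> \<in> Diff \<Longrightarrow> deriv (\<psi> \<circ> \<phi>) x = deriv \<psi> (\<phi> x) * deriv \<phi> x"
  unfolding o_def
  by (rule DERIV_imp_deriv, rule DERIV_chain2[where f = \<psi> and g = \<phi>]) (auto intro: Diff_DERIV)

lemma Diff_comp [intro]:
  assumes "\<phi> \<in> Diff" "\<psi> \<in> Diff" shows "\<psi> \<circ> \<phi> \<in> Diff"
proof (rule DiffI)
  show "bij (\<psi> \<circ> \<phi>)" using assms by (simp add: Diff_bij bij_comp)
  show "smooth_on UNIV (\<psi> \<circ> \<phi>)"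
    unfolding o_def by (rule smooth_on_compose[OF open_UNIV open_UNIV]) (auto intro: Diff_smooth assms)
  show "0 < deriv (\<psi> \<circ> \<phi>) x" for x
    by (simp add: deriv_comp_Diff assms Diff_deriv_pos)
qed

lemma Diff_inv [intro]: "\<phi> \<in> Diff \<Longrightarrow> inv \<phi> \<in> Diff"
proof -
  assume a: "\<phi> \<in> Diff"
  have "deriv (inv \<phi>) x = inverse (deriv \<phi> (inv \<phi> x))" for x
    by (rule DERIV_imp_deriv, rule DERIV_inv_pos) (auto intro: Diff_bij Diff_DERIV Diff_deriv_pos a)
  then show ?thesis
    using a Diff_deriv_pos[OF a] by (auto simp: Diff_def bij_imp_bij_inv)
qed

definition aff :: "real \<Rightarrow> real \<Rightarrow> diff" where "aff s b = (\<lambda>x. s * x + b)"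

lemma deriv_aff: "deriv (aff s b) = (\<lambda>_. s)"
  unfolding aff_def by (rule ext, rule DERIV_imp_deriv) (auto intro!: derivative_eq_intros)

lemma aff_Diff: "s > 0 \<Longrightarrow> aff s b \<in> Diff"
proof (rule DiffI)
  assume s: "s > 0"
  show "bij (aff s b)"
    by (rule bij_betw_byWitness[where f' = "\<lambda>y. (y - b) / s"]) (use s in \<open>auto simp: aff_def\<close>)
  show "smooth_on UNIV (aff s b)" unfolding aff_def by (rule smooth_on_affine)
  show "deriv (aff s b) x > 0" for x using s by (simp add: deriv_aff)
qed

lemma id_Diff [simp, intro]: "id \<in> Diff"
  using aff_Diff[of 1 0] by (simp add: aff_def id_def)

lemma nonlin_aff [simp]: "nonlin (aff s b) x = 0"
  by (simp add: nonlin_def deriv_aff)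

lemma nonlin_id [simp]: "nonlin id x = 0"
  by (simp add: nonlin_def)

lemma nonlin_comp:
  assumes "\<phi> \<in> Diff" "\<psi> \<in> Diff"
  shows "nonlin (\<psi> \<circ> \<phi>) x = nonlin \<psi> (\<phi> x) * deriv \<phi> x + nonlin \<phi> x"
proof -
  have 1: "deriv (\<psi> \<circ> \<phi>) = (\<lambda>x. deriv \<psi> (\<phi> x) * deriv \<phi> x)"
    using deriv_comp_Diff[OF assms] by auto
  have "((\<lambda>x. deriv \<psi> (\<phi> x) * deriv \<phi> x) has_real_derivative
      (deriv \<psi> (\<phi> x) * deriv (deriv \<phi>) x + (deriv (deriv \<psi>) (\<phi> x) * deriv \<phi> x) * deriv \<phi> x)) (at x)"
    by (intro DERIV_mult' DERIV_chain2[where f = "deriv \<psi>"] Diff_DERIV Diff_DERIV2 assms)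
  then have "deriv (deriv (\<psi> \<circ> \<phi>)) x = deriv \<psi> (\<phi> x) * deriv (deriv \<phi>) x + (deriv (deriv \<psi>) (\<phi> x) * deriv \<phi> x) * deriv \<phi> x"
    unfolding 1 by (rule DERIV_imp_deriv)
  then show ?thesis
    using Diff_deriv_pos[OF assms(1), of x] Diff_deriv_pos[OF assms(2), of "\<phi> x"]
    by (simp add: nonlin_def deriv_comp_Diff assms field_simps)
qed

lemma nonlin_inv:
  assumes "\<phi> \<in> Diff"
  shows "nonlin (inv \<phi>) (\<phi> x) * deriv \<phi> x = - nonlin \<phi> x"
  using nonlin_comp[OF assms Diff_inv[OF assms], of x] assms by simp

lemma Diff_comp_cancel:
  assumes "\<phi> \<in> Diff"
  shows "(\<psi> \<circ> \<phi> = \<theta>) \<longleftrightarrow> \<psi> = \<theta> \<circ> inv \<phi>"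
  using Diff_inv_simps[OF assms] by (metis comp_assoc comp_id)

subsection \<open>A diffeomorphism that is exponential near 0\<close>

text \<open>The antiderivative of \<open>exp(\<chi>(t) t)\<close> for a cutoff function
  \<open>\<chi>\<close>. For \<open>|x| < 1\<close> it is \<open>exp\<close> up to an additive
  constant, and there \<open>\<phi>'' = \<phi>'\<close>. At this diffeomorphism
  \<open>delta1\<close> acts as multiplication by \<open>y\<close>.\<close>

lemma ex_Diff_nonlin_one:
  "\<exists>\<phi>\<in>Diff. \<forall>x. \<bar>x\<bar> < 1 \<longrightarrow> nonlin \<phi> x = 1"
proof -
  define g where "g = (\<lambda>t. exp (plateau (-1) 1 1 t * t))"
  have sg: "smooth_on UNIV g"
  proof -
    have "smooth_on UNIV (\<lambda>t. plateau (-1) 1 1 t * t)"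
      by (intro smooth_on_mult open_UNIV smooth_plateau smooth_on_bounded_linear bounded_linear_ident)
    then show ?thesis
      unfolding g_def by (rule smooth_on_compose[OF open_UNIV open_UNIV, rotated 2])
        (auto simp: smooth_on_def intro: Ck_on_exp)
  qed
  then have "isCont g x" for x
    using smooth_on_imp_continuous continuous_on_eq_continuous_at open_UNIV by blast
  then have "\<exists>F. \<forall>x. (- \<infinity>::ereal) < ereal x \<longrightarrow> ereal x < \<infinity> \<longrightarrow> (F has_vector_derivative g x) (at x)"
    by (intro einterval_antiderivative) auto
  then obtain F where F: "\<And>x. (F has_vector_derivative g x) (at x)" by auto
  have FD: "(F has_real_derivative g x) (at x)" for x
    using F by (simp add: has_real_derivative_iff_has_vector_derivative)
  have dF: "deriv F = g" using DERIV_imp_deriv[OF FD] by auto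
  have g_pos: "g x > 0" for x by (simp add: g_def)
  have sm: "strict_mono F"
    using DERIV_pos_imp_increasing FD g_pos by (auto intro!: strict_monoI) blast
  \<comment> \<open>Outside a bounded interval \<open>F\<close> has slope 1, so its range is unbounded in both directions.\<close>
  have far: "F y - F x = y - x" if "x < y" "y \<le> -2 \<or> x \<ge> 2" for x y
  proof -
    from MVT2[OF that(1), of F g] FD obtain z where "x < z" "z < y" "F y - F x = (y - x) * g z" by auto
    moreover have "g z = 1" using that \<open>x < z\<close> \<open>z < y\<close> by (auto simp: g_def intro!: plateau_0)
    ultimately show ?thesis by simp
  qed
  have "\<exists>x. F x = y" for y
  proof -
    define u where "u = max 3 (2 + (y - F 2))"
    define l where "l = min (-3) (-2 + (y - F (-2)))"
    have "l < -2" "l \<le> -2 + (y - F (-2))" "u > 2" "u \<ge> 2 + (y - F 2)"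
      by (auto simp: l_def u_def)
    then have "F l \<le> y" "y \<le> F u" using far[of l "-2"] far[of 2 u] by linarith+
    moreover note this(2)
    moreover have "l \<le> u" by (simp add: l_def u_def)
    ultimately show ?thesis
      using IVT[of F l y u] DERIV_isCont[OF FD] by auto
  qed
  then have "bij F"
    using strict_mono_imp_inj_on[OF sm] by (auto simp: bij_def surj_def) metis
  moreover have "smooth_on UNIV F" by (rule smooth_on_real_derivI[OF open_UNIV F sg])
  ultimately have "F \<in> Diff" by (rule DiffI) (simp add: dF g_pos)
  moreover have "nonlin F x = 1" if "\<bar>x\<bar> < 1" for x
  proof -
    have "\<forall>\<^sub>F u in nhds x. exp u = g u"
      by (rule eventually_mono[OF eventually_nhds_in_open[of "{-1<..<1}" x]])
         (use that in \<open>auto simp: g_def plateau_1\<close>)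
    then have "(exp has_real_derivative exp x) (at x) \<longleftrightarrow> (g has_real_derivative exp x) (at x)"
      by (intro DERIV_cong_ev) auto
    then have "deriv g x = exp x" by (simp add: DERIV_imp_deriv)
    moreover have "g x = exp x" using that by (simp add: g_def plateau_1)
    ultimately show ?thesis by (simp add: nonlin_def dF)
  qed
  ultimately show ?thesis by blast
qed

section \<open>Functions on the frame bundle\<close>

definition X_fun :: "(real \<times> real \<Rightarrow> complex) \<Rightarrow> real \<times> real \<Rightarrow> complex" where
  "X_fun f = (\<lambda>(x, y). complex_of_real y * vector_derivative (\<lambda>t. f (t, y)) (at x))"

definition Y_fun :: "(real \<times> real \<Rightarrow> complex) \<Rightarrow> real \<times> real \<Rightarrow> complex" where
  "Y_fun f = (\<lambda>(x, y). complex_of_real y * vector_derivative (\<lambda>t. f (x, t)) (at y))"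

definition D_fun :: "diff \<Rightarrow> (real \<times> real \<Rightarrow> complex) \<Rightarrow> real \<times> real \<Rightarrow> complex" where
  "D_fun \<phi> f = (\<lambda>(x, y). complex_of_real (y * nonlin \<phi> x) * f (x, y))"

lemma ops_fun: "X_op a \<phi> = X_fun (a \<phi>)" "Y_op a \<phi> = Y_fun (a \<phi>)" "delta1_op a \<phi> = D_fun \<phi> (a \<phi>)"
  by (simp_all add: X_op_def Y_op_def delta1_op_def X_fun_def Y_fun_def D_fun_def nonlin_def)

lemma open_FM [simp]: "open FM"
  unfolding FM_def by (intro open_Times) auto

lemma mem_FM [simp]: "(x, y) \<in> FM \<longleftrightarrow> y > 0"
  by (auto simp: FM_def)

lemma has_vector_derivative_slices:
  fixes f :: "real \<times> real \<Rightarrow> complex"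
  assumes "(f has_derivative f') (at (x, y))"
  shows "((\<lambda>t. f (t, y)) has_vector_derivative f' (1, 0)) (at x)"
    and "((\<lambda>t. f (x, t)) has_vector_derivative f' (0, 1)) (at y)"
proof -
  interpret linear f' using has_derivative_linear[OF assms] .
  have "((\<lambda>t. (t, y)) has_derivative (\<lambda>h. (h, 0))) (at x)"
    by (auto intro!: derivative_eq_intros)
  from has_derivative_compose[OF this, of f f'] assms
  have d1: "((\<lambda>t. f (t, y)) has_derivative (\<lambda>h. f' (h, 0))) (at x)" by simp
  have e1: "f' (h, 0) = h *\<^sub>R f' (1, 0)" for h using scale[of h "(1, 0)"] by simp
  show "((\<lambda>t. f (t, y)) has_vector_derivative f' (1, 0)) (at x)"
    unfolding has_vector_derivative_def by (rule has_derivative_eq_rhs[OF d1]) (rule ext, rule e1)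
  have "((\<lambda>t. (x, t)) has_derivative (\<lambda>h. (0, h))) (at y)"
    by (auto intro!: derivative_eq_intros)
  from has_derivative_compose[OF this, of f f'] assms
  have d2: "((\<lambda>t. f (x, t)) has_derivative (\<lambda>h. f' (0, h))) (at y)" by simp
  have e2: "f' (0, h) = h *\<^sub>R f' (0, 1)" for h using scale[of h "(0, 1)"] by simp
  show "((\<lambda>t. f (x, t)) has_vector_derivative f' (0, 1)) (at y)"
    unfolding has_vector_derivative_def by (rule has_derivative_eq_rhs[OF d2]) (rule ext, rule e2)
qed

lemma XY_fun_eqI:
  assumes "(f has_derivative f') (at (x, y))"
  shows "X_fun f (x, y) = of_real y * f' (1, 0)" "Y_fun f (x, y) = of_real y * f' (0, 1)"
  using has_vector_derivative_slices[OF assms]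
  by (simp_all add: X_fun_def Y_fun_def vector_derivative_at)

text \<open>The partial derivatives at \<open>p\<close> only depend on the function near \<open>p\<close>.\<close>

lemma XY_fun_local:
  assumes "open U" "p \<in> U" "\<And>q. q \<in> U \<Longrightarrow> f q = g q"
  shows "X_fun f p = X_fun g p" "Y_fun f p = Y_fun g p"
proof -
  obtain x y where p: "p = (x, y)" by fastforce
  have 1: "\<forall>\<^sub>F t in nhds x. f (t, y) = g (t, y)"
  proof -
    have "((\<lambda>t. (t, y)) \<longlongrightarrow> (x, y)) (nhds x)"
      by (intro tendsto_intros) (simp add: filterlim_ident)
    then have "\<forall>\<^sub>F t in nhds x. (t, y) \<in> U"
      using assms(1,2) p by (auto simp: tendsto_def)
    then show ?thesis by (rule eventually_mono) (rule assms(3))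
  qed
  have 2: "\<forall>\<^sub>F t in nhds y. f (x, t) = g (x, t)"
  proof -
    have "((\<lambda>t. (x, t)) \<longlongrightarrow> (x, y)) (nhds y)"
      by (intro tendsto_intros) (simp add: filterlim_ident)
    then have "\<forall>\<^sub>F t in nhds y. (x, t) \<in> U"
      using assms(1,2) p by (auto simp: tendsto_def)
    then show ?thesis by (rule eventually_mono) (rule assms(3))
  qed
  have "vector_derivative (\<lambda>t. f (t, y)) (at x) = vector_derivative (\<lambda>t. g (t, y)) (at x)"
    by (rule vector_derivative_cong_eq) (use 1 in auto)
  moreover have "vector_derivative (\<lambda>t. f (x, t)) (at y) = vector_derivative (\<lambda>t. g (x, t)) (at y)"
    by (rule vector_derivative_cong_eq) (use 2 in auto)
  ultimately show "X_fun f p = X_fun g p" "Y_fun f p = Y_fun g p"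
    by (simp_all add: X_fun_def Y_fun_def p)
qed

lemma fun_zero_ops [simp]: "X_fun 0 = 0" "Y_fun 0 = 0" "D_fun \<phi> 0 = 0"
  by (auto simp: X_fun_def Y_fun_def D_fun_def fun_eq_iff)

lemma smooth_fst_snd: "smooth_on S (fst :: 'a::real_normed_vector \<times> 'b::real_normed_vector \<Rightarrow> 'a)"
  "smooth_on S (snd :: 'a \<times> 'b \<Rightarrow> 'b)"
  by (rule smooth_on_subset[OF smooth_on_bounded_linear[OF _ open_UNIV]]; simp add: bounded_linear_fst bounded_linear_snd)+

lemma smooth_snd_complex: "smooth_on S (\<lambda>p::real \<times> real. complex_of_real (snd p))"
  by (rule smooth_on_subset[OF smooth_on_of_real[OF open_UNIV smooth_fst_snd(2)]]) simp

lemma smooth_fst_comp: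
  fixes f :: "real \<Rightarrow> 'b::real_normed_vector"
  assumes "smooth_on UNIV f"
  shows "smooth_on S (\<lambda>p::real \<times> real. f (fst p))"
  by (rule smooth_on_subset[OF smooth_on_compose[OF open_UNIV open_UNIV _ assms smooth_fst_snd(1)]]) simp_all

lemma CinfFM_D: "f \<in> CinfFM \<Longrightarrow> smooth_on FM f" "f \<in> CinfFM \<Longrightarrow> y \<le> 0 \<Longrightarrow> f (x, y) = 0"
  by (auto simp: CinfFM_def)

lemma CcFM_CinfFM: "f \<in> CcFM \<Longrightarrow> f \<in> CinfFM"
  by (simp add: CcFM_def)

lemma CinfFM_XY:
  assumes "f \<in> CinfFM"
  shows "X_fun f \<in> CinfFM" "Y_fun f \<in> CinfFM"
proof -
  note s = CinfFM_D(1)[OF assms]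
  have d: "(f has_derivative frechet_derivative f (at p)) (at p)" if "p \<in> FM" for p
    using smooth_on_has_derivative[OF s that] .
  have e: "of_real (snd p) * frechet_derivative f (at p) (1, 0) = X_fun f p"
     "of_real (snd p) * frechet_derivative f (at p) (0, 1) = Y_fun f p" if "p \<in> FM" for p
    using XY_fun_eqI[of f _ "fst p" "snd p"] d[OF that] by simp_all
  have "smooth_on FM (X_fun f)"
    by (rule smooth_on_cong[OF open_FM e(1)]) (auto intro!: smooth_on_mult open_FM smooth_snd_complex smooth_on_frechet s)
  moreover have "smooth_on FM (Y_fun f)"
    by (rule smooth_on_cong[OF open_FM e(2)]) (auto intro!: smooth_on_mult open_FM smooth_snd_complex smooth_on_frechet s)
  moreover have "X_fun f (x, y) = 0" "Y_fun f (x, y) = 0" if "y \<le> 0" for x y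
  proof -
    show "X_fun f (x, y) = 0" using CinfFM_D(2)[OF assms that] by (simp add: X_fun_def)
    show "Y_fun f (x, y) = 0"
    proof (cases "y = 0")
      case False
      then have "Y_fun f (x, y) = Y_fun 0 (x, y)"
        using that CinfFM_D(2)[OF assms]
        by (intro XY_fun_local(2)[of "UNIV \<times> {..<0}"] open_Times) auto
      then show ?thesis by simp
    qed (simp add: Y_fun_def)
  qed
  ultimately show "X_fun f \<in> CinfFM" "Y_fun f \<in> CinfFM"
    by (auto simp: CinfFM_def)
qed

lemma CinfFM_mult:
  assumes "g \<in> CinfFM" "smooth_on FM c"
  shows "(\<lambda>p. c p * g p) \<in> CinfFM"
  using assms by (auto simp: CinfFM_def intro: smooth_on_mult)

lemma CinfFM_D_fun:
  assumes "f \<in> CinfFM" "\<phi> \<in> Diff"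
  shows "D_fun \<phi> f \<in> CinfFM"
proof -
  have "smooth_on FM (\<lambda>p. complex_of_real (snd p * nonlin \<phi> (fst p)))"
    by (intro smooth_on_of_real smooth_on_mult open_FM smooth_fst_snd smooth_fst_comp smooth_nonlin assms)
  from CinfFM_mult[OF assms(1) this] show ?thesis
    by (simp add: D_fun_def case_prod_unfold)
qed

lemma CinfFM_add: "f \<in> CinfFM \<Longrightarrow> g \<in> CinfFM \<Longrightarrow> f + g \<in> CinfFM"
  by (auto simp: CinfFM_def plus_fun_def intro: smooth_on_add)

lemma CinfFM_scale: "f \<in> CinfFM \<Longrightarrow> (\<lambda>p. c * f p) \<in> CinfFM"
  by (rule CinfFM_mult) (auto intro: smooth_on_const)

lemma zero_CinfFM [simp]: "0 \<in> CinfFM" and zero_CcFM [simp]: "0 \<in> CcFM"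
  by (auto simp: CinfFM_def CcFM_def zero_fun_def intro: smooth_on_const)

lemma CcFM_I:
  assumes "f \<in> CinfFM" "compact K" "K \<subseteq> FM" "\<And>p. p \<in> FM \<Longrightarrow> p \<notin> K \<Longrightarrow> f p = 0"
  shows "f \<in> CcFM"
  using assms unfolding CcFM_def CinfFM_def by blast

lemma CcFM_E:
  assumes "f \<in> CcFM"
  obtains K where "f \<in> CinfFM" "compact K" "K \<subseteq> FM" "\<And>p. p \<notin> K \<Longrightarrow> f p = 0"
  using assms by (auto simp: CcFM_def)

lemma CcFM_ops:
  assumes "f \<in> CcFM"
  shows "X_fun f \<in> CcFM" "Y_fun f \<in> CcFM" "\<phi> \<in> Diff \<Longrightarrow> D_fun \<phi> f \<in> CcFM" "(\<lambda>p. c * f p) \<in> CcFM"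
    "smooth_on FM k \<Longrightarrow> (\<lambda>p. k p * f p) \<in> CcFM"
proof -
  obtain K where K: "f \<in> CinfFM" "compact K" "K \<subseteq> FM" "\<And>p. p \<notin> K \<Longrightarrow> f p = 0"
    using CcFM_E[OF assms] by metis
  have o: "open (- K)" using K(2) by (simp add: compact_imp_closed open_Compl)
  show "X_fun f \<in> CcFM"
    by (rule CcFM_I[OF CinfFM_XY(1)[OF K(1)] K(2,3)], subst XY_fun_local(1)[OF o, where g = 0]) (auto simp: K(4))
  show "Y_fun f \<in> CcFM"
    by (rule CcFM_I[OF CinfFM_XY(2)[OF K(1)] K(2,3)], subst XY_fun_local(2)[OF o, where g = 0]) (auto simp: K(4))
  show "D_fun \<phi> f \<in> CcFM" if "\<phi> \<in> Diff"
    by (rule CcFM_I[OF CinfFM_D_fun[OF K(1) that] K(2,3)]) (auto simp: D_fun_def K(4))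
  show "(\<lambda>p. c * f p) \<in> CcFM"
    by (rule CcFM_I[OF CinfFM_scale[OF K(1)] K(2,3)]) (auto simp: K(4))
  show "(\<lambda>p. k p * f p) \<in> CcFM" if "smooth_on FM k"
    by (rule CcFM_I[OF CinfFM_mult[OF K(1) that] K(2,3)]) (auto simp: K(4))
qed

lemma CcFM_add:
  assumes "f \<in> CcFM" "g \<in> CcFM" shows "f + g \<in> CcFM"
proof -
  obtain K where K: "f \<in> CinfFM" "compact K" "K \<subseteq> FM" "\<And>p. p \<notin> K \<Longrightarrow> f p = 0"
    using CcFM_E[OF assms(1)] by metis
  obtain L where L: "g \<in> CinfFM" "compact L" "L \<subseteq> FM" "\<And>p. p \<notin> L \<Longrightarrow> g p = 0"
    using CcFM_E[OF assms(2)] by metis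
  show ?thesis
    by (rule CcFM_I[OF CinfFM_add[OF K(1) L(1)], of "K \<union> L"]) (use K L in auto)
qed

lemma CcFM_sum: "(\<And>i. i \<in> I \<Longrightarrow> f i \<in> CcFM) \<Longrightarrow> sum f I \<in> CcFM"
  by (induction I rule: infinite_finite_induct) (auto intro: CcFM_add)

lemma CinfFM_sum: "(\<And>i. i \<in> I \<Longrightarrow> f i \<in> CinfFM) \<Longrightarrow> sum f I \<in> CinfFM"
  by (induction I rule: infinite_finite_induct) (auto intro: CinfFM_add)

subsection \<open>Lifted diffeomorphisms\<close>

lemma lift_diff_id [simp]: "lift_diff id = id"
  by (auto simp: lift_diff_def fun_eq_iff)

lemma lift_diff_comp: "\<phi> \<in> Diff \<Longrightarrow> \<psi> \<in> Diff \<Longrightarrow> lift_diff (\<psi> \<circ> \<phi>) = lift_diff \<psi> \<circ> lift_diff \<phi>"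
  by (auto simp: lift_diff_def fun_eq_iff deriv_comp_Diff)

lemma lift_diff_inv [simp]:
  assumes "\<phi> \<in> Diff"
  shows "lift_diff (inv \<phi>) (lift_diff \<phi> p) = p" "lift_diff \<phi> (lift_diff (inv \<phi>) p) = p"
    "lift_diff (inv \<phi>) \<circ> lift_diff \<phi> = id" "lift_diff \<phi> \<circ> lift_diff (inv \<phi>) = id"
proof -
  show 1: "lift_diff (inv \<phi>) (lift_diff \<phi> p) = p" "lift_diff \<phi> (lift_diff (inv \<phi>) p) = p" for p
    using lift_diff_comp[OF assms Diff_inv[OF assms]] lift_diff_comp[OF Diff_inv[OF assms] assms] assms
    by (simp_all flip: o_apply[of "lift_diff _" "lift_diff _"])
  show "lift_diff (inv \<phi>) \<circ> lift_diff \<phi> = id" "lift_diff \<phi> \<circ> lift_diff (inv \<phi>) = id"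
    using 1 by auto
qed

lemma lift_diff_FM [simp]:
  assumes "\<phi> \<in> Diff"
  shows "lift_diff \<phi> p \<in> FM \<longleftrightarrow> p \<in> FM"
  using Diff_deriv_pos[OF assms, of "fst p"]
  by (cases p) (simp add: lift_diff_def zero_less_mult_iff)

lemma smooth_lift_diff: "\<phi> \<in> Diff \<Longrightarrow> smooth_on S (lift_diff \<phi>)"
proof -
  assume a: "\<phi> \<in> Diff"
  have "smooth_on UNIV (\<lambda>p::real \<times> real. (\<phi> (fst p), deriv \<phi> (fst p) * snd p))"
    by (intro smooth_on_Pair open_UNIV smooth_on_mult smooth_fst_comp smooth_fst_snd Diff_smooth Diff_smooth_deriv a)
  then show ?thesis
    using smooth_on_subset[OF _ subset_UNIV] by (simp add: lift_diff_def case_prod_unfold)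
qed

lemma CinfFM_lift:
  assumes "f \<in> CinfFM" "\<phi> \<in> Diff"
  shows "f \<circ> lift_diff \<phi> \<in> CinfFM"
proof -
  have "smooth_on FM (\<lambda>p. f (lift_diff \<phi> p))"
    by (rule smooth_on_compose[OF open_FM open_FM _ CinfFM_D(1)[OF assms(1)] smooth_lift_diff[OF assms(2)]])
       (use assms(2) in auto)
  then show ?thesis using assms(1) lift_diff_FM[OF assms(2)] unfolding CinfFM_def o_def by blast
qed

lemma CcFM_lift:
  assumes "f \<in> CcFM" "\<phi> \<in> Diff"
  shows "f \<circ> lift_diff \<phi> \<in> CcFM"
proof -
  obtain K where K: "f \<in> CinfFM" "compact K" "K \<subseteq> FM" "\<And>p. p \<notin> K \<Longrightarrow> f p = 0"
    using CcFM_E[OF assms(1)] by metis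
  have "continuous_on K (lift_diff (inv \<phi>))"
    by (rule smooth_on_imp_continuous[OF smooth_lift_diff]) (use assms in auto)
  then have "compact (lift_diff (inv \<phi>) ` K)" using K(2) by (rule compact_continuous_image)
  moreover have "lift_diff (inv \<phi>) ` K \<subseteq> FM" using K(3) assms(2) Diff_inv[OF assms(2)] by auto
  moreover have "(f \<circ> lift_diff \<phi>) p = 0" if "p \<notin> lift_diff (inv \<phi>) ` K" for p
    using that K(4)[of "lift_diff \<phi> p"] assms(2) by (metis comp_apply imageI lift_diff_inv(1))
  ultimately show ?thesis by (intro CcFM_I[OF CinfFM_lift[OF K(1) assms(2)]]) auto
qed

text \<open>Functions compactly supported in the half plane extend by \<open>0\<close> to smooth functions
  on the plane, so that integration and differentiation can take place on all of
  \<open>\<real>\<^sup>2\<close>.\<close>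

lemma CcFM_smooth_UNIV:
  assumes "f \<in> CcFM"
  shows "smooth_on UNIV f"
proof -
  obtain K where K: "f \<in> CinfFM" "compact K" "K \<subseteq> FM" "\<And>p. p \<notin> K \<Longrightarrow> f p = 0"
    using CcFM_E[OF assms(1)] by metis
  have o: "open (- K)" using K(2) by (simp add: compact_imp_closed open_Compl)
  have "smooth_on (- K) f"
    by (rule smooth_on_cong[OF o _ smooth_on_const[of _ 0]]) (simp add: K(4))
  from smooth_on_Un[OF open_FM o CinfFM_D(1)[OF K(1)] this] K(3) show ?thesis
    by (metis (no_types, lifting) Compl_partition Un_mono subset_UNIV subset_antisym order_refl)
qed

subsection \<open>Cutoff functions\<close>

lemma compact_FM_box:
  assumes "compact K" "K \<subseteq> FM"
  obtains r e where "0 < e" "e < r" "K \<subseteq> {-r..r} \<times> {e..r}"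
proof (cases "K = {}")
  case True
  then show ?thesis using that[of 1 2] by auto
next
  case False
  obtain B where B: "\<And>p. p \<in> K \<Longrightarrow> norm p \<le> B"
    using compact_imp_bounded[OF assms(1)] by (auto simp: bounded_iff)
  obtain q where q: "q \<in> K" "\<And>p. p \<in> K \<Longrightarrow> snd q \<le> snd p"
    using continuous_attains_inf[OF assms(1) False, of snd] continuous_on_snd[OF continuous_on_id] by blast
  have qp: "snd q > 0" using q(1) assms(2) by (cases q) auto
  have "\<bar>fst p\<bar> \<le> B" "\<bar>snd p\<bar> \<le> B" if "p \<in> K" for p
    using B[OF that] norm_fst_le[of "fst p" "snd p"] norm_snd_le[of "snd p" "fst p"] by auto
  then have "K \<subseteq> {-(B + snd q + 1)..B + snd q + 1} \<times> {snd q..B + snd q + 1}"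
    using q(2) qp by (force simp: abs_le_iff)
  moreover have "B \<ge> 0" using B[OF q(1)] norm_ge_zero order_trans by blast
  ultimately show ?thesis using that[of "snd q" "B + snd q + 1"] qp by auto
qed

definition FM_cutoff :: "real \<Rightarrow> real \<Rightarrow> real \<times> real \<Rightarrow> complex" where
  "FM_cutoff r e = (\<lambda>(x, y). complex_of_real (plateau (-r) r 1 x * plateau e r (e / 2) y))"

lemma FM_cutoff_CcFM:
  assumes "e > 0"
  shows "FM_cutoff r e \<in> CcFM"
proof (rule CcFM_I[of _ "{-r - 1..r + 1} \<times> {e / 2..r + e / 2}"])
  have "smooth_on UNIV (\<lambda>p::real \<times> real. plateau e r (e / 2) (snd p))"
    by (rule smooth_on_compose[OF open_UNIV open_UNIV _ smooth_plateau smooth_fst_snd(2)]) simp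
  then have "smooth_on UNIV (FM_cutoff r e)"
    unfolding FM_cutoff_def case_prod_unfold
    by (intro smooth_on_of_real smooth_on_mult open_UNIV smooth_fst_comp smooth_plateau)
  moreover have c0: "FM_cutoff r e p = 0" if "p \<notin> {-r - 1..r + 1} \<times> {e / 2..r + e / 2}" for p
    using that plateau_0[of 1 "fst p" "-r" r] plateau_0[of "e / 2" "snd p" e r] assms
    by (cases p) (auto simp: FM_cutoff_def)
  moreover have "{-r - 1..r + 1} \<times> {e / 2..r + e / 2} \<subseteq> FM"
    using assms by auto
  moreover have "FM_cutoff r e p = 0" if "p \<notin> FM" for p
    using that c0[of p] \<open>_ \<subseteq> FM\<close> by blast
  ultimately show "FM_cutoff r e \<in> CinfFM" "{-r - 1..r + 1} \<times> {e / 2..r + e / 2} \<subseteq> FM"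
     "\<And>p. p \<notin> {-r - 1..r + 1} \<times> {e / 2..r + e / 2} \<Longrightarrow> FM_cutoff r e p = 0"
    unfolding CinfFM_def using smooth_on_subset[OF _ subset_UNIV] by blast+
qed (auto intro: compact_Times)

lemma FM_cutoff_1: "0 < e \<Longrightarrow> p \<in> {-r..r} \<times> {e..r} \<Longrightarrow> FM_cutoff r e p = 1"
  by (auto simp: FM_cutoff_def plateau_1)

section \<open>The algebra of operators acts fibrewise\<close>

lemma At_Ahat: "a \<in> At \<Longrightarrow> a \<in> Ahat"
  by (auto simp: At_def Ahat_def crossed_def CcFM_CinfFM)

lemma At_mem: "a \<in> At \<Longrightarrow> a \<phi> \<in> CcFM" and Ahat_mem: "b \<in> Ahat \<Longrightarrow> b \<phi> \<in> CinfFM"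
  unfolding At_def Ahat_def crossed_def by (cases "a \<phi> = 0"; cases "b \<phi> = 0"; auto)+

lemma At_finite: "a \<in> At \<Longrightarrow> finite {\<phi>. a \<phi> \<noteq> 0}" and Ahat_finite: "b \<in> Ahat \<Longrightarrow> finite {\<phi>. b \<phi> \<noteq> 0}"
  and At_Diff: "a \<in> At \<Longrightarrow> a \<phi> \<noteq> 0 \<Longrightarrow> \<phi> \<in> Diff" and Ahat_Diff: "b \<in> Ahat \<Longrightarrow> b \<phi> \<noteq> 0 \<Longrightarrow> \<phi> \<in> Diff"
  by (auto simp: At_def Ahat_def crossed_def)

lemma AtI: "finite S \<Longrightarrow> S \<subseteq> Diff \<Longrightarrow> (\<And>\<phi>. \<phi> \<in> S \<Longrightarrow> a \<phi> \<in> CcFM) \<Longrightarrow> (\<And>\<phi>. \<phi> \<notin> S \<Longrightarrow> a \<phi> = 0) \<Longrightarrow> a \<in> At"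
  unfolding At_def crossed_def by (auto intro: finite_subset[of _ S])

lemma AhatI: "finite S \<Longrightarrow> S \<subseteq> Diff \<Longrightarrow> (\<And>\<phi>. \<phi> \<in> S \<Longrightarrow> a \<phi> \<in> CinfFM) \<Longrightarrow> (\<And>\<phi>. \<phi> \<notin> S \<Longrightarrow> a \<phi> = 0) \<Longrightarrow> a \<in> Ahat"
  unfolding Ahat_def crossed_def by (auto intro: finite_subset[of _ S])

lemma At_map:
  assumes "a \<in> At" "\<And>\<phi>. a \<phi> = 0 \<Longrightarrow> b \<phi> = 0" "\<And>\<phi>. \<phi> \<in> Diff \<Longrightarrow> a \<phi> \<in> CcFM \<Longrightarrow> b \<phi> \<in> CcFM"
  shows "b \<in> At"
  by (rule AtI[of "{\<phi>. a \<phi> \<noteq> 0}"]) (use assms in \<open>auto intro: At_finite At_mem At_Diff\<close>)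

lemma Ahat_map:
  assumes "a \<in> Ahat" "\<And>\<phi>. a \<phi> = 0 \<Longrightarrow> b \<phi> = 0" "\<And>\<phi>. \<phi> \<in> Diff \<Longrightarrow> a \<phi> \<in> CinfFM \<Longrightarrow> b \<phi> \<in> CinfFM"
  shows "b \<in> Ahat"
  by (rule AhatI[of "{\<phi>. a \<phi> \<noteq> 0}"]) (use assms in \<open>auto intro: Ahat_finite Ahat_mem Ahat_Diff\<close>)

lemma zero_At [simp]: "0 \<in> At" and zero_Ahat [simp]: "0 \<in> Ahat"
  by (auto intro: AtI[of "{}"] AhatI[of "{}"])

lemma At_add: "a \<in> At \<Longrightarrow> b \<in> At \<Longrightarrow> a + b \<in> At"
  by (rule AtI[of "{\<phi>. a \<phi> \<noteq> 0} \<union> {\<phi>. b \<phi> \<noteq> 0}"]) (auto intro: At_finite At_Diff CcFM_add At_mem)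

lemma Ahat_add: "a \<in> Ahat \<Longrightarrow> b \<in> Ahat \<Longrightarrow> a + b \<in> Ahat"
  by (rule AhatI[of "{\<phi>. a \<phi> \<noteq> 0} \<union> {\<phi>. b \<phi> \<noteq> 0}"]) (auto intro: Ahat_finite Ahat_Diff CinfFM_add Ahat_mem)

lemma At_sum: "(\<And>i. i \<in> I \<Longrightarrow> f i \<in> At) \<Longrightarrow> sum f I \<in> At"
  by (induction I rule: infinite_finite_induct) (auto intro: At_add)

lemma At_ops:
  assumes "a \<in> At"
  shows "X_op a \<in> At" "Y_op a \<in> At" "delta1_op a \<in> At" "fm_scale c a \<in> At"
  by (rule At_map[OF assms]; auto simp: ops_fun fm_scale_def zero_fun_def[symmetric] intro: CcFM_ops; simp add: zero_fun_def)+

lemma Ahat_ops: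
  assumes "a \<in> Ahat"
  shows "X_op a \<in> Ahat" "Y_op a \<in> Ahat" "delta1_op a \<in> Ahat" "fm_scale c a \<in> Ahat"
  by (rule Ahat_map[OF assms]; auto simp: ops_fun fm_scale_def intro: CinfFM_XY CinfFM_D_fun CinfFM_scale; simp add: zero_fun_def)+

lemma op_alg_Ahat_closed: "k \<in> op_alg Ahat \<Longrightarrow> (a \<in> Ahat \<longrightarrow> k a \<in> Ahat) \<and> k 0 = 0 \<and> (a \<notin> Ahat \<longrightarrow> k a = 0)"
proof (induction k arbitrary: a rule: op_alg.induct)
  case (scale h c)
  then show ?case using Ahat_ops(4) by (auto simp: fm_scale_def fun_eq_iff)
next
  case (mult h k)
  then show ?case by (metis comp_apply)
qed (auto simp: op_on_def intro: Ahat_ops Ahat_add; auto simp: fun_eq_iff ops_fun)+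

text \<open>All generators are differential operators or multiplications, hence do not enlarge supports.\<close>

lemma op_alg_local:
  assumes "k \<in> op_alg Ahat" "open U" "U \<subseteq> FM" "a \<in> Ahat" "b \<in> Ahat" "\<And>p. p \<in> U \<Longrightarrow> a \<phi> p = b \<phi> p"
  shows "p \<in> U \<Longrightarrow> k a \<phi> p = k b \<phi> p"
  using assms(1,4-)
proof (induction k arbitrary: a b p rule: op_alg.induct)
  case X
  have "X_fun (a \<phi>) p = X_fun (b \<phi>) p"
    by (rule XY_fun_local(1)[OF assms(2) X(1) X(4)])
  then show ?case using X by (simp add: op_on_def ops_fun)
next
  case Y
  have "Y_fun (a \<phi>) p = Y_fun (b \<phi>) p"
    by (rule XY_fun_local(2)[OF assms(2) Y(1) Y(4)])
  then show ?case using Y by (simp add: op_on_def ops_fun)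
next
  case (mult h k)
  have "h (k a) \<phi> p = h (k b) \<phi> p"
    by (rule mult.IH(1)[OF mult.prems(1)])
       (auto intro!: mult.IH(2) mult.prems op_alg_Ahat_closed[OF mult.hyps(2), THEN conjunct1, rule_format])
  then show ?case by simp
next
  case one
  then show ?case by (simp add: op_on_def)
next
  case delta1
  then show ?case by (cases p) (simp add: op_on_def ops_fun D_fun_def)
next
  case (add h k)
  show ?case using add.IH(1)[OF add.prems] add.IH(2)[OF add.prems] by simp
next
  case (scale h c)
  show ?case using scale.IH[OF scale.prems] by (simp add: fm_scale_def)
qed

text \<open>The same word in the generators acts on the larger algebra.\<close>

lemma op_alg_extend:
  "h \<in> op_alg At \<Longrightarrow> \<exists>k\<in>op_alg Ahat. \<forall>a\<in>At. k a = h a \<and> h a \<in> At"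
proof (induction h rule: op_alg.induct)
  case one
  show ?case by (rule bexI[OF _ op_alg.one]) (auto simp: op_on_def At_Ahat)
next
  case X
  show ?case by (rule bexI[OF _ op_alg.X]) (auto simp: op_on_def At_Ahat At_ops)
next
  case Y
  show ?case by (rule bexI[OF _ op_alg.Y]) (auto simp: op_on_def At_Ahat At_ops)
next
  case delta1
  show ?case by (rule bexI[OF _ op_alg.delta1]) (auto simp: op_on_def At_Ahat At_ops)
next
  case (add h k)
  then obtain h' k' where "h' \<in> op_alg Ahat" "k' \<in> op_alg Ahat"
    "\<forall>a\<in>At. h' a = h a \<and> h a \<in> At" "\<forall>a\<in>At. k' a = k a \<and> k a \<in> At" by blast
  moreover from this have "\<forall>a\<in>At. h' a + k' a = h a + k a \<and> h a + k a \<in> At"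
    by (metis At_add)
  ultimately show ?case by (intro bexI[of _ "\<lambda>a. h' a + k' a"] op_alg.add)
next
  case (scale h c)
  then obtain h' where "h' \<in> op_alg Ahat" "\<forall>a\<in>At. h' a = h a \<and> h a \<in> At" by blast
  moreover from this have "\<forall>a\<in>At. fm_scale c (h' a) = fm_scale c (h a) \<and> fm_scale c (h a) \<in> At"
    by (metis At_ops(4))
  ultimately show ?case by (intro bexI[of _ "\<lambda>a. fm_scale c (h' a)"] op_alg.scale)
next
  case (mult h k)
  then obtain h' k' where "h' \<in> op_alg Ahat" "k' \<in> op_alg Ahat"
    "\<forall>a\<in>At. h' a = h a \<and> h a \<in> At" "\<forall>a\<in>At. k' a = k a \<and> k a \<in> At" by blast
  then show ?case by (intro bexI[of _ "h' \<circ> k'"] op_alg.mult) auto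
qed

text \<open>Near any point an element of \<open>Ahat\<close> agrees with an element of \<open>At\<close>,
  namely its product with a cutoff function. By locality two extensions give the same value there.\<close>

lemma op_alg_extension_unique:
  assumes "k \<in> op_alg Ahat" "k' \<in> op_alg Ahat" "\<And>a. a \<in> At \<Longrightarrow> k a = k' a"
  shows "k = k'"
proof (rule ext)
  fix a
  show "k a = k' a"
  proof (cases "a \<in> Ahat")
    case True
    have "k a \<phi> p = k' a \<phi> p" for \<phi> p
    proof (cases "p \<in> FM")
      case False
      then show ?thesis
        using Ahat_mem[of "k a" \<phi>] Ahat_mem[of "k' a" \<phi>] True op_alg_Ahat_closed[OF assms(1), of a]
          op_alg_Ahat_closed[OF assms(2), of a]
        by (simp add: CinfFM_def del: mem_FM split_paired_All)
    next
      case p: True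
      have "compact {p}" "{p} \<subseteq> FM" using p by auto
      then obtain r e where re: "0 < e" "e < r" "{p} \<subseteq> {-r..r} \<times> {e..r}" by (rule compact_FM_box)
      \<comment> \<open>The cutoff function is \<open>1\<close> on a box slightly larger than the neighbourhood
        \<open>U\<close> of \<open>p\<close>.\<close>
      define U where "U = {-(r+1)<..<r+1} \<times> {e/2<..<r+1}"
      define b where "b = (\<lambda>\<phi> q. FM_cutoff (r+1) (e/2) q * a \<phi> q)"
      have b: "b \<in> At"
      proof (rule AtI[of "{\<phi>. a \<phi> \<noteq> 0}"])
        show "b \<phi> \<in> CcFM" for \<phi>
          using CcFM_ops(5)[OF FM_cutoff_CcFM[of "e/2" "r+1"] CinfFM_D(1)[OF Ahat_mem[OF True]], of \<phi>] re
          by (simp add: b_def mult.commute)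
        show "b \<phi> = 0" if "\<phi> \<notin> {\<phi>. a \<phi> \<noteq> 0}" for \<phi>
          using that by (simp add: b_def) (simp add: fun_eq_iff)
      qed (use Ahat_finite[OF True] Ahat_Diff[OF True] in auto)
      have "open U" "U \<subseteq> FM" "p \<in> U" using re by (auto simp: U_def intro: open_Times)
      moreover have "a \<phi> q = b \<phi> q" if "q \<in> U" for q
      proof -
        have "FM_cutoff (r+1) (e/2) q = 1"
          by (rule FM_cutoff_1) (use that re in \<open>auto simp: U_def\<close>)
        then show ?thesis by (simp add: b_def)
      qed
      ultimately have "k a \<phi> p = k b \<phi> p" "k' a \<phi> p = k' b \<phi> p"
        using op_alg_local[OF assms(1), of U a b \<phi> p] op_alg_local[OF assms(2), of U a b \<phi> p] True b At_Ahat by auto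
      then show ?thesis using assms(3)[OF b] by simp
    qed
    then show ?thesis by (auto simp: fun_eq_iff)
  next
    case False
    then show ?thesis using op_alg_Ahat_closed assms(1,2) by metis
  qed
qed

lemma H1_ext_spec: "H1_ext h \<in> op_alg Ahat" "a \<in> At \<Longrightarrow> H1_ext h a = Rep_H1 h a"
  and Rep_At: "a \<in> At \<Longrightarrow> Rep_H1 h a \<in> At"
proof -
  obtain k where k: "k \<in> op_alg Ahat" "\<forall>a\<in>At. k a = Rep_H1 h a \<and> Rep_H1 h a \<in> At"
    using op_alg_extend[OF Rep_H1[of h]] by blast
  have "H1_ext h = k"
    unfolding H1_ext_def using k by (intro the_equality) (auto intro: op_alg_extension_unique)
  then show "H1_ext h \<in> op_alg Ahat" "a \<in> At \<Longrightarrow> H1_ext h a = Rep_H1 h a" "a \<in> At \<Longrightarrow> Rep_H1 h a \<in> At"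
    using k by auto
qed

lemma H1_ext_eqI:
  assumes "k \<in> op_alg Ahat" "\<And>a. a \<in> At \<Longrightarrow> k a = Rep_H1 h a"
  shows "H1_ext h = k"
  by (rule op_alg_extension_unique[OF H1_ext_spec(1) assms(1)]) (simp add: H1_ext_spec assms)

lemma H1_ext_rules:
  "H1_ext 1 = op_on Ahat (\<lambda>a. a)" "H1_ext X1 = op_on Ahat X_op" "H1_ext Y1 = op_on Ahat Y_op"
  "H1_ext delta1 = op_on Ahat delta1_op" "H1_ext (h + k) = (\<lambda>a. H1_ext h a + H1_ext k a)"
  "H1_ext (h_scale c h) = (\<lambda>a. fm_scale c (H1_ext h a))" "H1_ext (h * k) = H1_ext h \<circ> H1_ext k"
  by (rule H1_ext_eqI; (intro op_alg.intros H1_ext_spec(1))?;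
      simp add: one_H1.rep_eq X1.rep_eq Y1.rep_eq delta1.rep_eq plus_H1.rep_eq h_scale.rep_eq times_H1.rep_eq
        H1_ext_spec Rep_At op_on_def At_Ahat)+

text \<open>The induction principle by which all properties of the Hopf algebra are reduced to the
  generators.\<close>

lemma H1_induct [case_names one X Y delta1 add scale mult]:
  assumes "P 1" "P X1" "P Y1" "P delta1" "\<And>h k. P h \<Longrightarrow> P k \<Longrightarrow> P (h + k)"
    "\<And>h c. P h \<Longrightarrow> P (h_scale c h)" "\<And>h k. P h \<Longrightarrow> P k \<Longrightarrow> P (h * k)"
  shows "P h"
proof -
  have "P (Abs_H1 k)" if "k \<in> op_alg At" for k
    using that
  proof (induction k rule: op_alg.induct)
    case one then show ?case using assms(1) by (simp add: one_H1_def)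
  next
    case X then show ?case using assms(2) by (simp add: X1_def)
  next
    case Y then show ?case using assms(3) by (simp add: Y1_def)
  next
    case delta1 then show ?case using assms(4) by (simp add: delta1_def)
  next
    case (add h k)
    have "Abs_H1 h + Abs_H1 k = Abs_H1 (\<lambda>a. h a + k a)"
      by (simp only: Rep_H1_inject[symmetric] plus_H1.rep_eq Abs_H1_inverse add.hyps op_alg.add)
    then show ?case using assms(5)[OF add.IH] by (simp only:)
  next
    case (scale h c) then show ?case using assms(6)[OF scale.IH, of c] by (simp add: h_scale_def Abs_H1_inverse)
  next
    case (mult h k)
    have "Abs_H1 h * Abs_H1 k = Abs_H1 (h \<circ> k)"
      by (simp only: Rep_H1_inject[symmetric] times_H1.rep_eq Abs_H1_inverse mult.hyps op_alg.mult)
    then show ?case using assms(7)[OF mult.IH] by (simp only:)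
  qed
  from this[OF Rep_H1[of h]] show ?thesis by (simp add: Rep_H1_inverse)
qed

text \<open>The monomial \<open>f U\<^sup>*\<^bsub>\<phi>\<^esub>\<close>.\<close>

definition single :: "diff \<Rightarrow> (real \<times> real \<Rightarrow> complex) \<Rightarrow> fm_cross" where
  "single \<phi> f = (\<lambda>\<psi>. if \<psi> = \<phi> then f else 0)"

lemma single_apply [simp]: "single \<phi> f \<phi> = f" "\<psi> \<noteq> \<phi> \<Longrightarrow> single \<phi> f \<psi> = 0"
  by (auto simp: single_def)

lemma single_At: "\<phi> \<in> Diff \<Longrightarrow> f \<in> CcFM \<Longrightarrow> single \<phi> f \<in> At"
  by (rule AtI[of "{\<phi>}"]) auto

lemma single_Ahat: "\<phi> \<in> Diff \<Longrightarrow> f \<in> CinfFM \<Longrightarrow> single \<phi> f \<in> Ahat"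
  by (rule AhatI[of "{\<phi>}"]) auto

text \<open>The operators of \<open>H1\<close> preserve the span of the monomials \<open>f
  U\<^sup>*\<^bsub>\<phi>\<^esub>\<close> for fixed \<open>\<phi>\<close>; here \<open>dop h
  \<phi>\<close> is the differential operator by which \<open>h\<close> acts on the coefficient
  \<open>f\<close>.\<close>

definition dop :: "H1 \<Rightarrow> diff \<Rightarrow> (real \<times> real \<Rightarrow> complex) \<Rightarrow> real \<times> real \<Rightarrow> complex" where
  "dop h \<phi> f = H1_ext h (single \<phi> f) \<phi>"

lemma H1_ext_Ahat: "a \<in> Ahat \<Longrightarrow> H1_ext h a \<in> Ahat"
  using op_alg_Ahat_closed[OF H1_ext_spec(1)] by blast

lemma H1_ext_zero [simp]: "H1_ext h 0 = 0"
  using op_alg_Ahat_closed[OF H1_ext_spec(1)] by blast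

lemma dop_CinfFM: "\<phi> \<in> Diff \<Longrightarrow> f \<in> CinfFM \<Longrightarrow> dop h \<phi> f \<in> CinfFM"
  unfolding dop_def by (rule Ahat_mem[OF H1_ext_Ahat[OF single_Ahat]])

lemma dop_CcFM: "\<phi> \<in> Diff \<Longrightarrow> f \<in> CcFM \<Longrightarrow> dop h \<phi> f \<in> CcFM"
  using At_mem[OF Rep_At[OF single_At], of \<phi> f h \<phi>] by (simp only: dop_def H1_ext_spec(2) single_At)

lemma dop_zero [simp]: "dop h \<phi> 0 = 0"
proof -
  have "single \<phi> 0 = 0" by (auto simp: single_def)
  then show ?thesis by (simp add: dop_def)
qed

lemma CinfFM_eqI:
  assumes "f \<in> CinfFM" "g \<in> CinfFM" "\<And>p. p \<in> FM \<Longrightarrow> f p = g p"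
  shows "f = g"
proof (rule ext)
  fix p
  show "f p = g p"
  proof (cases "p \<in> FM")
    case False
    then have "f p = 0" "g p = 0" using assms(1,2) unfolding CinfFM_def by blast+
    then show ?thesis by simp
  qed (rule assms(3))
qed

lemma H1_ext_apply:
  assumes "a \<in> Ahat"
  shows "H1_ext h a \<phi> = dop h \<phi> (a \<phi>)"
proof (cases "\<phi> \<in> Diff")
  case True
  then have s: "single \<phi> (a \<phi>) \<in> Ahat" using single_Ahat Ahat_mem assms by blast
  show ?thesis
    unfolding dop_def
  proof (rule CinfFM_eqI)
    show "H1_ext h a \<phi> p = H1_ext h (single \<phi> (a \<phi>)) \<phi> p" if "p \<in> FM" for p
      by (rule op_alg_local[OF H1_ext_spec(1) open_FM order_refl assms s _ that]) simp
    show "H1_ext h a \<phi> \<in> CinfFM" by (rule Ahat_mem[OF H1_ext_Ahat[OF assms]])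
    show "H1_ext h (single \<phi> (a \<phi>)) \<phi> \<in> CinfFM" by (rule Ahat_mem[OF H1_ext_Ahat[OF s]])
  qed
next
  case False
  then have "a \<phi> = 0" "H1_ext h a \<phi> = 0" using Ahat_Diff H1_ext_Ahat assms by blast+
  then show ?thesis by simp
qed

lemma Rep_H1_apply: "a \<in> At \<Longrightarrow> Rep_H1 h a \<phi> = dop h \<phi> (a \<phi>)"
  using H1_ext_apply[OF At_Ahat] by (simp add: H1_ext_spec)

text \<open>An element of \<open>H1\<close> is an operator on \<open>At\<close>, hence is determined by its
  effect on monomials.\<close>

lemma H1_eqI:
  assumes "\<And>\<phi> f. \<phi> \<in> Diff \<Longrightarrow> f \<in> CcFM \<Longrightarrow> dop h \<phi> f = dop k \<phi> f"
  shows "h = k"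
proof -
  have z: "Rep_H1 h a = 0" if "a \<notin> At" for h a
  proof -
    have "k \<in> op_alg At \<Longrightarrow> (a \<notin> At \<longrightarrow> k a = 0) \<and> k 0 = 0" for k
    proof (induction k arbitrary: a rule: op_alg.induct)
      case (mult h k)
      then show ?case by (metis comp_apply)
    qed (auto simp: op_on_def fm_scale_def ops_fun fun_eq_iff)
    then show ?thesis using Rep_H1 that by blast
  qed
  have "Rep_H1 h a = Rep_H1 k a" for a
  proof (cases "a \<in> At")
    case True
    have "Rep_H1 h a \<phi> = Rep_H1 k a \<phi>" for \<phi>
      using assms[OF At_Diff[OF True] At_mem[OF True]]
      by (cases "a \<phi> = 0") (simp_all only: Rep_H1_apply[OF True] dop_zero)
    then show ?thesis by (rule ext)
  qed (simp add: z)
  then show ?thesis by (auto simp: Rep_H1_inject[symmetric])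
qed

lemma dop_rules:
  assumes "\<phi> \<in> Diff" "f \<in> CinfFM"
  shows "dop 1 \<phi> f = f" "dop X1 \<phi> f = X_fun f" "dop Y1 \<phi> f = Y_fun f" "dop delta1 \<phi> f = D_fun \<phi> f"
    "dop (h * k) \<phi> f = dop h \<phi> (dop k \<phi> f)"
  using single_Ahat[OF assms]
  by (simp_all add: dop_def H1_ext_rules op_on_def ops_fun)
     (metis H1_ext_Ahat H1_ext_apply dop_def)

lemma dop_add: "dop (h + k) \<phi> f = dop h \<phi> f + dop k \<phi> f"
  and dop_scale: "dop (h_scale c h) \<phi> f = (\<lambda>p. c * dop h \<phi> f p)"
  by (simp_all add: dop_def H1_ext_rules fm_scale_def)

lemma dop_zero_H1 [simp]: "dop 0 \<phi> f = 0"
  using dop_add[of 0 0 \<phi> f] by simp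

lemma dop_uminus: "dop (- h) \<phi> f = - dop h \<phi> f"
  using dop_add[of h "- h" \<phi> f] by (simp add: eq_neg_iff_add_eq_0 add.commute)

lemma dop_diff: "dop (h - k) \<phi> f = dop h \<phi> f - dop k \<phi> f"
  using dop_add[of h "- k" \<phi> f] by (simp add: dop_uminus)

lemma dop_sum: "dop (\<Sum>i\<in>I. h i) \<phi> f = (\<Sum>i\<in>I. dop (h i) \<phi> f)"
  by (induction I rule: infinite_finite_induct) (auto simp: dop_add)

lemma dop_linear:
  assumes "\<phi> \<in> Diff" "f \<in> CinfFM" "g \<in> CinfFM"
  shows "dop h \<phi> (f + g) = dop h \<phi> f + dop h \<phi> g \<and> dop h \<phi> (\<lambda>p. c * f p) = (\<lambda>p. c * dop h \<phi> f p)"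
  using assms(2,3)
proof (induction h arbitrary: f g c rule: H1_induct)
  case one
  then show ?case by (simp only: dop_rules[OF assms(1)] CinfFM_add CinfFM_scale simp_thms)
next
  case X
  have "X_fun (f + g) = X_fun f + X_fun g \<and> X_fun (\<lambda>p. c * f p) = (\<lambda>p. c * X_fun f p)"
  proof (intro conjI; rule CinfFM_eqI)
    fix p assume "p \<in> FM"
    then obtain x y where p: "p = (x, y)" "(x, y) \<in> FM" by (cases p) auto
    note d = smooth_on_has_derivative[OF CinfFM_D(1) p(2), of f, OF X(1)] smooth_on_has_derivative[OF CinfFM_D(1) p(2), of g, OF X(2)]
    show "X_fun (f + g) p = (X_fun f + X_fun g) p"
      using XY_fun_eqI(1)[OF has_derivative_add[OF d]] XY_fun_eqI(1)[OF d(1)] XY_fun_eqI(1)[OF d(2)]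
      by (simp add: p plus_fun_def algebra_simps)
    show "X_fun (\<lambda>p. c * f p) p = c * X_fun f p"
      using XY_fun_eqI(1)[OF has_derivative_mult_right[OF d(1), of c]] XY_fun_eqI(1)[OF d(1)]
      by (simp add: p algebra_simps)
  qed (intro CinfFM_XY CinfFM_add CinfFM_scale X)+
  then show ?case by (simp only: dop_rules[OF assms(1)] CinfFM_add CinfFM_scale X simp_thms)
next
  case Y
  have "Y_fun (f + g) = Y_fun f + Y_fun g \<and> Y_fun (\<lambda>p. c * f p) = (\<lambda>p. c * Y_fun f p)"
  proof (intro conjI; rule CinfFM_eqI)
    fix p assume "p \<in> FM"
    then obtain x y where p: "p = (x, y)" "(x, y) \<in> FM" by (cases p) auto
    note d = smooth_on_has_derivative[OF CinfFM_D(1) p(2), of f, OF Y(1)] smooth_on_has_derivative[OF CinfFM_D(1) p(2), of g, OF Y(2)]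
    show "Y_fun (f + g) p = (Y_fun f + Y_fun g) p"
      using XY_fun_eqI(2)[OF has_derivative_add[OF d]] XY_fun_eqI(2)[OF d(1)] XY_fun_eqI(2)[OF d(2)]
      by (simp add: p plus_fun_def algebra_simps)
    show "Y_fun (\<lambda>p. c * f p) p = c * Y_fun f p"
      using XY_fun_eqI(2)[OF has_derivative_mult_right[OF d(1), of c]] XY_fun_eqI(2)[OF d(1)]
      by (simp add: p algebra_simps)
  qed (intro CinfFM_XY CinfFM_add CinfFM_scale Y)+
  then show ?case by (simp only: dop_rules[OF assms(1)] CinfFM_add CinfFM_scale Y simp_thms)
next
  case delta1
  have "D_fun \<phi> (f + g) = D_fun \<phi> f + D_fun \<phi> g \<and> D_fun \<phi> (\<lambda>p. c * f p) = (\<lambda>p. c * D_fun \<phi> f p)"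
    by (auto simp: D_fun_def fun_eq_iff algebra_simps)
  then show ?case by (simp only: dop_rules[OF assms(1)] CinfFM_add CinfFM_scale delta1 simp_thms)
next
  case (add h k)
  show ?case using add.IH(1)[OF add.prems, of c] add.IH(2)[OF add.prems, of c]
    by (auto simp only: dop_add) (auto simp: fun_eq_iff algebra_simps)
next
  case (scale h d)
  show ?case using scale.IH[OF scale.prems, of c]
    by (auto simp only: dop_scale) (auto simp: fun_eq_iff algebra_simps)
next
  case (mult h k)
  show ?case
    using mult.IH(2)[OF mult.prems, of c] mult.IH(1)[of "dop k \<phi> f" "dop k \<phi> g" c]
    by (simp only: dop_rules[OF assms(1)] CinfFM_add CinfFM_scale dop_CinfFM[OF assms(1)] mult.prems simp_thms)
qed

lemma dop_sum_fun:
  assumes "\<phi> \<in> Diff" "\<And>i. i \<in> I \<Longrightarrow> f i \<in> CinfFM"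
  shows "dop h \<phi> (\<Sum>i\<in>I. f i) = (\<Sum>i\<in>I. dop h \<phi> (f i))"
  using assms(2)
proof (induction I rule: infinite_finite_induct)
  case (insert i I)
  then have "dop h \<phi> (f i + (\<Sum>i\<in>I. f i)) = dop h \<phi> (f i) + dop h \<phi> (\<Sum>i\<in>I. f i)"
    by (intro dop_linear[THEN conjunct1] assms(1) CinfFM_sum) auto
  then show ?case using insert by (simp only: sum.insert insert_iff simp_thms)
qed simp_all

section \<open>The counit, the modular character and the first-order coefficients\<close>

definition exp_diff :: diff where
  "exp_diff = (SOME \<phi>. \<phi> \<in> Diff \<and> (\<forall>x. \<bar>x\<bar> < 1 \<longrightarrow> nonlin \<phi> x = 1))"

lemma exp_diff: "exp_diff \<in> Diff" "\<bar>x\<bar> < 1 \<Longrightarrow> nonlin exp_diff x = 1"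
  using someI_ex[of "\<lambda>\<phi>. \<phi> \<in> Diff \<and> (\<forall>x. \<bar>x\<bar> < 1 \<longrightarrow> nonlin \<phi> x = 1)"] ex_Diff_nonlin_one
  unfolding exp_diff_def by blast+

definition affine_fun :: "complex \<Rightarrow> complex \<Rightarrow> complex \<Rightarrow> real \<times> real \<Rightarrow> complex" where
  "affine_fun c \<alpha> \<beta> = (\<lambda>(x, y). c + \<alpha> * of_real x + \<beta> * of_real y)"

definition poly_fun :: "complex poly \<Rightarrow> real \<times> real \<Rightarrow> complex" where
  "poly_fun q = (\<lambda>(x, y). poly q (of_real y))"

lemma XY_affine_fun: "X_fun (affine_fun c \<alpha> \<beta>) = affine_fun 0 0 \<alpha>" "Y_fun (affine_fun c \<alpha> \<beta>) = affine_fun 0 0 \<beta>"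
proof -
  have "((\<lambda>t. c + \<alpha> * of_real t + \<beta> * of_real y) has_vector_derivative \<alpha>) (at x)" for x y :: real
    by (auto intro!: derivative_eq_intros)
  moreover have "((\<lambda>t. c + \<alpha> * of_real x + \<beta> * of_real t) has_vector_derivative \<beta>) (at y)" for x y :: real
    by (auto intro!: derivative_eq_intros)
  ultimately show "X_fun (affine_fun c \<alpha> \<beta>) = affine_fun 0 0 \<alpha>" "Y_fun (affine_fun c \<alpha> \<beta>) = affine_fun 0 0 \<beta>"
    by (auto simp: X_fun_def Y_fun_def affine_fun_def fun_eq_iff vector_derivative_at)
qed

lemma XY_poly_fun: "X_fun (poly_fun q) = poly_fun 0" "Y_fun (poly_fun q) = poly_fun (pCons 0 (pderiv q))"
proof -
  have "((\<lambda>t. poly q (of_real t)) has_vector_derivative poly (pderiv q) (of_real y)) (at y)" for y :: real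
    by (rule has_vector_derivative_real_field) (rule poly_DERIV)
  then show "X_fun (poly_fun q) = poly_fun 0" "Y_fun (poly_fun q) = poly_fun (pCons 0 (pderiv q))"
    by (auto simp: X_fun_def Y_fun_def poly_fun_def fun_eq_iff vector_derivative_at)
qed

definition strip :: "(real \<times> real) set" where "strip = {-1<..<1} \<times> {0<..}"

lemma strip: "open strip" "strip \<subseteq> FM"
  by (auto simp: strip_def intro: open_Times)

text \<open>The generators map polynomials in \<open>y\<close> to polynomials in \<open>y\<close> at
  \<open>exp_diff\<close>: \<open>X1\<close> kills them, \<open>Y1\<close> is the Euler operator,
  and \<open>delta1\<close> multiplies by \<open>y\<close>. The property is stated for germs, on
  arbitrary open subsets of \<open>strip\<close>, in order to be stable under composition.\<close>

definition acts_on_polys :: "H1 \<Rightarrow> (complex poly \<Rightarrow> complex poly) \<Rightarrow> bool" where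
  "acts_on_polys h T \<longleftrightarrow> (\<forall>q f U. f \<in> CinfFM \<longrightarrow> open U \<longrightarrow> U \<subseteq> strip \<longrightarrow> (\<forall>p\<in>U. f p = poly_fun q p) \<longrightarrow>
     (\<forall>p\<in>U. dop h exp_diff f p = poly_fun (T q) p))"

lemma acts_on_polysD:
  assumes "acts_on_polys h T" "f \<in> CinfFM" "open U" "U \<subseteq> strip" "\<And>p. p \<in> U \<Longrightarrow> f p = poly_fun q p" "p \<in> U"
  shows "dop h exp_diff f p = poly_fun (T q) p"
  by (rule assms(1)[unfolded acts_on_polys_def, rule_format, OF assms(2-4) _ assms(6)]) (rule assms(5))

lemma acts_on_polysI:
  assumes "\<And>q f U p. f \<in> CinfFM \<Longrightarrow> open U \<Longrightarrow> U \<subseteq> strip \<Longrightarrow> (\<And>p. p \<in> U \<Longrightarrow> f p = poly_fun q p) \<Longrightarrow> p \<in> U \<Longrightarrow>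
       dop h exp_diff f p = poly_fun (T q) p"
  shows "acts_on_polys h T"
  unfolding acts_on_polys_def
proof (intro allI impI ballI)
  fix q f U p assume "f \<in> CinfFM" "open U" "U \<subseteq> strip" "\<forall>p\<in>U. f p = poly_fun q p" "p \<in> U"
  then show "dop h exp_diff f p = poly_fun (T q) p" by (intro assms(1)) auto
qed

text \<open>The parameters are the scalars \<open>e\<close> by which \<open>h\<close> acts on constants and
  \<open>w\<close> by which it acts on the fibre coordinate \<open>y\<close>, and the coefficients
  \<open>u\<close> and \<open>d\<close> of \<open>X1\<close> and \<open>delta1\<close>. At the
  identity \<open>delta1\<close> vanishes, so the affine functions \<open>c + \<alpha> x + \<beta>
  y\<close> span a representation that sees \<open>e\<close>, \<open>w\<close> and
  \<open>u\<close>. The coefficient \<open>d\<close> is the linear term of the image of the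
  constant \<open>1\<close> at \<open>exp_diff\<close>. The polynomials without terms of order
  \<open>0\<close> and \<open>1\<close> form an invariant subspace, so the action on the quotient
  by it is given by these parameters.\<close>

definition jet :: "H1 \<Rightarrow> complex \<Rightarrow> complex \<Rightarrow> complex \<Rightarrow> complex \<Rightarrow> bool" where
  "jet h e w u d \<longleftrightarrow>
    (\<forall>f U c \<alpha> \<beta>. f \<in> CinfFM \<longrightarrow> open U \<longrightarrow> U \<subseteq> FM \<longrightarrow> (\<forall>p\<in>U. f p = affine_fun c \<alpha> \<beta> p) \<longrightarrow>
       (\<forall>p\<in>U. dop h id f p = affine_fun (e * c) (e * \<alpha>) (u * \<alpha> + w * \<beta>) p)) \<and>
    (\<exists>T. acts_on_polys h T \<and> (\<forall>q. coeff (T q) 0 = e * coeff q 0 \<and> coeff (T q) 1 = w * coeff q 1 + d * coeff q 0))"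

lemma jetD1:
  assumes "jet h e w u d" "f \<in> CinfFM" "open U" "U \<subseteq> FM" "\<And>p. p \<in> U \<Longrightarrow> f p = affine_fun c \<alpha> \<beta> p" "p \<in> U"
  shows "dop h id f p = affine_fun (e * c) (e * \<alpha>) (u * \<alpha> + w * \<beta>) p"
  by (rule assms(1)[unfolded jet_def, THEN conjunct1, rule_format, OF assms(2-4) _ assms(6)]) (rule assms(5))

lemma jetD2:
  "jet h e w u d \<Longrightarrow> \<exists>T. acts_on_polys h T \<and> (\<forall>q. coeff (T q) 0 = e * coeff q 0 \<and> coeff (T q) 1 = w * coeff q 1 + d * coeff q 0)"
  unfolding jet_def by (rule conjunct2)

lemma jetI:
  assumes "\<And>f U c \<alpha> \<beta> p. f \<in> CinfFM \<Longrightarrow> open U \<Longrightarrow> U \<subseteq> FM \<Longrightarrow> (\<And>p. p \<in> U \<Longrightarrow> f p = affine_fun c \<alpha> \<beta> p) \<Longrightarrow>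
       p \<in> U \<Longrightarrow> dop h id f p = affine_fun (e * c) (e * \<alpha>) (u * \<alpha> + w * \<beta>) p"
    "\<And>q. coeff (T q) 0 = e * coeff q 0" "\<And>q. coeff (T q) 1 = w * coeff q 1 + d * coeff q 0"
    "\<And>q f U p. f \<in> CinfFM \<Longrightarrow> open U \<Longrightarrow> U \<subseteq> strip \<Longrightarrow> (\<And>p. p \<in> U \<Longrightarrow> f p = poly_fun q p) \<Longrightarrow> p \<in> U \<Longrightarrow>
       dop h exp_diff f p = poly_fun (T q) p"
  shows "jet h e w u d"
  unfolding jet_def
proof (intro conjI exI[of _ T] allI impI ballI)
  show "acts_on_polys h T" by (rule acts_on_polysI) (rule assms(4))
next
  fix q show "coeff (T q) 0 = e * coeff q 0" "coeff (T q) 1 = w * coeff q 1 + d * coeff q 0"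
    by (rule assms(2), rule assms(3))
next
  fix f U c \<alpha> \<beta> p assume "f \<in> CinfFM" "open U" "U \<subseteq> FM" "\<forall>p\<in>U. f p = affine_fun c \<alpha> \<beta> p" "p \<in> U"
  then show "dop h id f p = affine_fun (e * c) (e * \<alpha>) (u * \<alpha> + w * \<beta>) p" by (intro assms(1)) auto
qed

lemma jet_1: "jet 1 1 1 0 0"
  by (rule jetI[where T = "\<lambda>q. q"]) (simp_all add: dop_rules exp_diff)

lemma jet_X: "jet X1 0 0 1 0"
proof (rule jetI[where T = "\<lambda>q. 0"])
  fix f U c \<alpha> \<beta> p assume a: "f \<in> CinfFM" "open U" "U \<subseteq> FM" "\<And>p. p \<in> U \<Longrightarrow> f p = affine_fun c \<alpha> \<beta> p" "p \<in> U"
  show "dop X1 id f p = affine_fun (0 * c) (0 * \<alpha>) (1 * \<alpha> + 0 * \<beta>) p"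
    using XY_fun_local(1)[OF a(2,5), of f "affine_fun c \<alpha> \<beta>"] a(1,4) by (simp add: dop_rules XY_affine_fun)
next
  fix q f U p assume a: "f \<in> CinfFM" "open U" "U \<subseteq> strip" "\<And>p. p \<in> U \<Longrightarrow> f p = poly_fun q p" "p \<in> U"
  show "dop X1 exp_diff f p = poly_fun 0 p"
    using XY_fun_local(1)[OF a(2,5), of f "poly_fun q"] a(1,4) by (simp add: dop_rules exp_diff XY_poly_fun)
qed auto

lemma jet_Y: "jet Y1 0 1 0 0"
proof (rule jetI[where T = "\<lambda>q. pCons 0 (pderiv q)"])
  fix f U c \<alpha> \<beta> p assume a: "f \<in> CinfFM" "open U" "U \<subseteq> FM" "\<And>p. p \<in> U \<Longrightarrow> f p = affine_fun c \<alpha> \<beta> p" "p \<in> U"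
  show "dop Y1 id f p = affine_fun (0 * c) (0 * \<alpha>) (0 * \<alpha> + 1 * \<beta>) p"
    using XY_fun_local(2)[OF a(2,5), of f "affine_fun c \<alpha> \<beta>"] a(1,4) by (simp add: dop_rules XY_affine_fun)
next
  fix q f U p assume a: "f \<in> CinfFM" "open U" "U \<subseteq> strip" "\<And>p. p \<in> U \<Longrightarrow> f p = poly_fun q p" "p \<in> U"
  show "dop Y1 exp_diff f p = poly_fun (pCons 0 (pderiv q)) p"
    using XY_fun_local(2)[OF a(2,5), of f "poly_fun q"] a(1,4) by (simp add: dop_rules exp_diff XY_poly_fun)
qed (auto simp: coeff_pderiv)

lemma jet_delta1: "jet delta1 0 0 0 1"
proof (rule jetI[where T = "\<lambda>q. pCons 0 q"])
  fix f U c \<alpha> \<beta> p assume a: "f \<in> CinfFM" "open U" "U \<subseteq> FM" "\<And>p. p \<in> U \<Longrightarrow> f p = affine_fun c \<alpha> \<beta> p" "p \<in> U"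
  show "dop delta1 id f p = affine_fun (0 * c) (0 * \<alpha>) (0 * \<alpha> + 0 * \<beta>) p"
    using a(1) by (cases p) (simp add: dop_rules D_fun_def affine_fun_def)
next
  fix q f U p assume a: "f \<in> CinfFM" "open U" "U \<subseteq> strip" "\<And>p. p \<in> U \<Longrightarrow> f p = poly_fun q p" "p \<in> U"
  obtain x y where p: "p = (x, y)" by (cases p)
  have "(x, y) \<in> strip" using a(3,5) p by blast
  then have "\<bar>x\<bar> < 1" by (auto simp: strip_def)
  then show "dop delta1 exp_diff f p = poly_fun (pCons 0 q) p"
    using a(1) a(4)[OF a(5)] by (simp add: p dop_rules exp_diff D_fun_def poly_fun_def)
qed auto

lemma jet_add:
  assumes "jet h e w u d" "jet h' e' w' u' d'"
  shows "jet (h + h') (e + e') (w + w') (u + u') (d + d')"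
proof -
  obtain T where T: "acts_on_polys h T" "\<And>q. coeff (T q) 0 = e * coeff q 0" "\<And>q. coeff (T q) 1 = w * coeff q 1 + d * coeff q 0"
    using jetD2[OF assms(1)] by blast
  obtain T' where T': "acts_on_polys h' T'" "\<And>q. coeff (T' q) 0 = e' * coeff q 0" "\<And>q. coeff (T' q) 1 = w' * coeff q 1 + d' * coeff q 0"
    using jetD2[OF assms(2)] by blast
  show ?thesis
  proof (rule jetI[where T = "\<lambda>q. T q + T' q"])
    fix f U c \<alpha> \<beta> p assume a: "f \<in> CinfFM" "open U" "U \<subseteq> FM" "\<And>p. p \<in> U \<Longrightarrow> f p = affine_fun c \<alpha> \<beta> p" "p \<in> U"
    show "dop (h + h') id f p = affine_fun ((e + e') * c) ((e + e') * \<alpha>) ((u + u') * \<alpha> + (w + w') * \<beta>) p"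
      using jetD1[OF assms(1) a] jetD1[OF assms(2) a]
      by (cases p) (simp add: dop_add affine_fun_def algebra_simps)
  next
    fix q f U p assume a: "f \<in> CinfFM" "open U" "U \<subseteq> strip" "\<And>p. p \<in> U \<Longrightarrow> f p = poly_fun q p" "p \<in> U"
    show "dop (h + h') exp_diff f p = poly_fun (T q + T' q) p"
      using acts_on_polysD[OF T(1) a] acts_on_polysD[OF T'(1) a] by (cases p) (simp add: dop_add poly_fun_def)
  qed (auto simp: T T' algebra_simps simp del: One_nat_def)
qed

lemma jet_scale:
  assumes "jet h e w u d"
  shows "jet (h_scale k h) (k * e) (k * w) (k * u) (k * d)"
proof -
  obtain T where T: "acts_on_polys h T" "\<And>q. coeff (T q) 0 = e * coeff q 0" "\<And>q. coeff (T q) 1 = w * coeff q 1 + d * coeff q 0"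
    using jetD2[OF assms(1)] by blast
  show ?thesis
  proof (rule jetI[where T = "\<lambda>q. smult k (T q)"])
    fix f U c \<alpha> \<beta> p assume a: "f \<in> CinfFM" "open U" "U \<subseteq> FM" "\<And>p. p \<in> U \<Longrightarrow> f p = affine_fun c \<alpha> \<beta> p" "p \<in> U"
    show "dop (h_scale k h) id f p = affine_fun ((k * e) * c) ((k * e) * \<alpha>) ((k * u) * \<alpha> + (k * w) * \<beta>) p"
      using jetD1[OF assms(1) a]
      by (cases p) (simp add: dop_scale affine_fun_def algebra_simps)
  next
    fix q f U p assume a: "f \<in> CinfFM" "open U" "U \<subseteq> strip" "\<And>p. p \<in> U \<Longrightarrow> f p = poly_fun q p" "p \<in> U"
    show "dop (h_scale k h) exp_diff f p = poly_fun (smult k (T q)) p"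
      using acts_on_polysD[OF T(1) a] by (cases p) (simp add: dop_scale poly_fun_def)
  qed (auto simp: T algebra_simps simp del: One_nat_def)
qed

text \<open>Composition of triangular matrices: \<open>y\<close> spans an invariant line modulo higher
  order, on which \<open>h\<close> acts by \<open>w\<close>.\<close>

lemma jet_mult:
  assumes "jet h e w u d" "jet h' e' w' u' d'"
  shows "jet (h * h') (e * e') (w * w') (w * u' + u * e') (w * d' + d * e')"
proof -
  obtain T where T: "acts_on_polys h T" "\<And>q. coeff (T q) 0 = e * coeff q 0" "\<And>q. coeff (T q) 1 = w * coeff q 1 + d * coeff q 0"
    using jetD2[OF assms(1)] by blast
  obtain T' where T': "acts_on_polys h' T'" "\<And>q. coeff (T' q) 0 = e' * coeff q 0" "\<And>q. coeff (T' q) 1 = w' * coeff q 1 + d' * coeff q 0"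
    using jetD2[OF assms(2)] by blast
  show ?thesis
  proof (rule jetI[where T = "\<lambda>q. T (T' q)"])
    fix f U c \<alpha> \<beta> p assume a: "f \<in> CinfFM" "open U" "U \<subseteq> FM" "\<And>p. p \<in> U \<Longrightarrow> f p = affine_fun c \<alpha> \<beta> p" "p \<in> U"
    have "dop h id (dop h' id f) p = affine_fun (e * (e' * c)) (e * (e' * \<alpha>)) (u * (e' * \<alpha>) + w * (u' * \<alpha> + w' * \<beta>)) p"
      by (rule jetD1[OF assms(1) dop_CinfFM[OF id_Diff a(1)] a(2,3) _ a(5)]) (rule jetD1[OF assms(2) a(1-4)])
    then show "dop (h * h') id f p = affine_fun ((e * e') * c) ((e * e') * \<alpha>) ((w * u' + u * e') * \<alpha> + (w * w') * \<beta>) p"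
      by (simp add: dop_rules a algebra_simps)
  next
    fix q f U p assume a: "f \<in> CinfFM" "open U" "U \<subseteq> strip" "\<And>p. p \<in> U \<Longrightarrow> f p = poly_fun q p" "p \<in> U"
    have "dop h exp_diff (dop h' exp_diff f) p = poly_fun (T (T' q)) p"
      by (rule acts_on_polysD[OF T(1) dop_CinfFM[OF exp_diff(1) a(1)] a(2,3) _ a(5)]) (rule acts_on_polysD[OF T'(1) a(1-4)])
    then show "dop (h * h') exp_diff f p = poly_fun (T (T' q)) p"
      by (simp add: dop_rules a exp_diff)
  qed (auto simp: T T' algebra_simps simp del: One_nat_def)
qed

lemma ex_jet: "\<exists>e w u d. jet h e w u d"
  by (induction h rule: H1_induct) (blast intro: jet_1 jet_X jet_Y jet_delta1 jet_add jet_scale jet_mult)+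

lemma smooth_affine_fun: "smooth_on S (affine_fun c \<alpha> \<beta>)"
proof -
  have "smooth_on UNIV (\<lambda>p. c + \<alpha> * complex_of_real (fst p) + \<beta> * complex_of_real (snd p))"
    by (intro smooth_on_add smooth_on_mult smooth_on_const smooth_on_of_real smooth_fst_snd open_UNIV)
  then show ?thesis using smooth_on_subset[OF _ subset_UNIV] by (simp add: affine_fun_def case_prod_unfold)
qed

definition restrict_FM :: "(real \<times> real \<Rightarrow> complex) \<Rightarrow> real \<times> real \<Rightarrow> complex" where
  "restrict_FM f = (\<lambda>p. if p \<in> FM then f p else 0)"

lemma restrict_FM:
  assumes "smooth_on FM f"
  shows "restrict_FM f \<in> CinfFM"
proof -
  have "smooth_on FM (restrict_FM f)"
    by (rule smooth_on_cong[OF open_FM _ assms]) (simp add: restrict_FM_def)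
  then show ?thesis by (simp add: CinfFM_def restrict_FM_def del: mem_FM)
qed

lemma poly_fun_eq_on_strip:
  assumes "\<And>p. p \<in> strip \<Longrightarrow> poly_fun q p = poly_fun r p"
  shows "q = r"
proof -
  have "poly (q - r) (complex_of_real y) = 0" if "y > 0" for y
    using assms[of "(0, y)"] that by (simp add: strip_def poly_fun_def)
  then have "complex_of_real ` {0<..} \<subseteq> {z. poly (q - r) z = 0}" by auto
  moreover have "infinite (complex_of_real ` {0<..})"
    using infinite_Ioi by (simp add: finite_image_iff inj_on_def)
  ultimately have "\<not> finite {z. poly (q - r) z = 0}" using finite_subset by blast
  then have "q - r = 0" using poly_roots_finite by blast
  then show ?thesis by simp
qed

text \<open>Evaluate on \<open>1\<close>, \<open>x\<close> and \<open>y\<close> at the point \<open>(0,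
  1)\<close>, and on the constant \<open>1\<close> at \<open>exp_diff\<close>.\<close>

lemma jet_unique:
  assumes "jet h e w u d" "jet h e' w' u' d'"
  shows "e = e' \<and> w = w' \<and> u = u' \<and> d = d'"
proof -
  have eq: "affine_fun (e * c) (e * \<alpha>) (u * \<alpha> + w * \<beta>) (0, 1) = affine_fun (e' * c) (e' * \<alpha>) (u' * \<alpha> + w' * \<beta>) (0, 1)" for c \<alpha> \<beta>
    using jetD1[OF assms(1) restrict_FM[OF smooth_affine_fun] open_FM order_refl, of c \<alpha> \<beta> c \<alpha> \<beta> "(0,1)"]
      jetD1[OF assms(2) restrict_FM[OF smooth_affine_fun] open_FM order_refl, of c \<alpha> \<beta> c \<alpha> \<beta> "(0,1)"]
    by (simp add: restrict_FM_def)
  have 1: "e = e'" "u = u'" "w = w'" using eq[of 1 0 0] eq[of 0 1 0] eq[of 0 0 1] by (auto simp: affine_fun_def)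
  obtain T where T: "acts_on_polys h T" "\<And>q. coeff (T q) 0 = e * coeff q 0" "\<And>q. coeff (T q) 1 = w * coeff q 1 + d * coeff q 0"
    using jetD2[OF assms(1)] by blast
  obtain T' where T': "acts_on_polys h T'" "\<And>q. coeff (T' q) 0 = e' * coeff q 0" "\<And>q. coeff (T' q) 1 = w' * coeff q 1 + d' * coeff q 0"
    using jetD2[OF assms(2)] by blast
  have one: "restrict_FM (affine_fun 1 0 0) p = poly_fun 1 p" if "p \<in> strip" for p
    using that strip by (auto simp: restrict_FM_def affine_fun_def poly_fun_def)
  have "T 1 = T' 1"
    by (rule poly_fun_eq_on_strip)
       (use acts_on_polysD[OF T(1) restrict_FM[OF smooth_affine_fun] strip(1) order_refl one] acts_on_polysD[OF T'(1) restrict_FM[OF smooth_affine_fun] strip(1) order_refl one] in simp)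
  then have "d = d'" using T(3)[of 1] T'(3)[of 1] 1 by simp
  with 1 show ?thesis by simp
qed

text \<open>The parameters of \<open>jet\<close>, which are functions of \<open>h\<close>. They turn out to
  be the counit (\<open>counit_eq_eps\<close>) and the character \<open>\<delta>\<close>
  (\<open>char_delta_eq_omega\<close>). The functional \<open>xi z\<close> is the coefficient of
  \<open>gen z\<close>, where \<open>True\<close> stands for \<open>X1\<close> and
  \<open>False\<close> for \<open>delta1\<close>.\<close>

definition eps :: "H1 \<Rightarrow> complex" where "eps h = (THE e. \<exists>w u d. jet h e w u d)"
definition omega :: "H1 \<Rightarrow> complex" where "omega h = (THE w. \<exists>e u d. jet h e w u d)"
definition xi :: "bool \<Rightarrow> H1 \<Rightarrow> complex" where
  "xi z h = (if z then THE u. \<exists>e w d. jet h e w u d else THE d. \<exists>e w u. jet h e w u d)"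
definition gen :: "bool \<Rightarrow> H1" where "gen z = (if z then X1 else delta1)"

lemma jet_eqs:
  assumes "jet h e w u d"
  shows "eps h = e" "omega h = w" "xi True h = u" "xi False h = d"
  unfolding eps_def omega_def xi_def if_True if_False
  by (rule the_equality; use assms jet_unique in blast)+

lemma jet_spec: "jet h (eps h) (omega h) (xi True h) (xi False h)"
  using ex_jet[of h] jet_eqs by metis

lemma eps_rules:
  "eps 1 = 1" "eps Y1 = 0" "eps X1 = 0" "eps delta1 = 0"
  "eps (h + k) = eps h + eps k" "eps (h_scale c h) = c * eps h" "eps (h * k) = eps h * eps k"
  by (rule jet_eqs(1)[OF jet_1] jet_eqs(1)[OF jet_Y] jet_eqs(1)[OF jet_X] jet_eqs(1)[OF jet_delta1]
      jet_eqs(1)[OF jet_add[OF jet_spec jet_spec]] jet_eqs(1)[OF jet_scale[OF jet_spec]]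
      jet_eqs(1)[OF jet_mult[OF jet_spec jet_spec]])+

lemma omega_rules:
  "omega 1 = 1" "omega Y1 = 1" "omega X1 = 0" "omega delta1 = 0"
  "omega (h + k) = omega h + omega k" "omega (h_scale c h) = c * omega h" "omega (h * k) = omega h * omega k"
  by (rule jet_eqs(2)[OF jet_1] jet_eqs(2)[OF jet_Y] jet_eqs(2)[OF jet_X] jet_eqs(2)[OF jet_delta1]
      jet_eqs(2)[OF jet_add[OF jet_spec jet_spec]] jet_eqs(2)[OF jet_scale[OF jet_spec]]
      jet_eqs(2)[OF jet_mult[OF jet_spec jet_spec]])+

lemma xi_rules:
  "xi z 1 = 0" "xi z Y1 = 0" "xi z X1 = (if z then 1 else 0)" "xi z delta1 = (if z then 0 else 1)"
  "xi z (h + k) = xi z h + xi z k" "xi z (h_scale c h) = c * xi z h"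
  "xi z (h * k) = omega h * xi z k + xi z h * eps k"
  by (cases z; simp only: if_True if_False;
      rule jet_eqs(3,4)[OF jet_1] jet_eqs(3,4)[OF jet_Y] jet_eqs(3,4)[OF jet_X] jet_eqs(3,4)[OF jet_delta1]
      jet_eqs(3,4)[OF jet_add[OF jet_spec jet_spec]] jet_eqs(3,4)[OF jet_scale[OF jet_spec]]
      jet_eqs(3,4)[OF jet_mult[OF jet_spec jet_spec]])+

lemma gen_rules:
  "xi z (gen z') = (if z = z' then 1 else 0)" "eps (gen z) = 0" "omega (gen z) = 0"
  by (auto simp: gen_def eps_rules omega_rules xi_rules)

lemmas functionals_rules = eps_rules omega_rules xi_rules gen_rules

lemma functionals_zero [simp]: "eps 0 = 0" "omega 0 = 0" "xi z 0 = 0"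
  using eps_rules(5)[of 0 0] omega_rules(5)[of 0 0] xi_rules(5)[of z 0 0] by simp_all

lemma fm_one_Ahat: "fm_one \<in> Ahat"
proof -
  have e: "fm_one = single id (restrict_FM (affine_fun 1 0 0))"
    by (auto simp: fm_one_def single_def restrict_FM_def affine_fun_def fun_eq_iff)
  show ?thesis unfolding e by (rule single_Ahat[OF id_Diff restrict_FM[OF smooth_affine_fun]])
qed

lemma counit_eq_eps: "counit h = eps h"
  unfolding counit_def
proof (rule the_equality)
  have f: "fm_one = single id (restrict_FM (affine_fun 1 0 0))"
    by (auto simp: fm_one_def single_def restrict_FM_def affine_fun_def fun_eq_iff)
  have "H1_ext h fm_one \<phi> p = fm_scale (eps h) fm_one \<phi> p" for \<phi> p
  proof (cases "\<phi> = id")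
    case True
    have "H1_ext h fm_one id p = dop h id (restrict_FM (affine_fun 1 0 0)) p"
      by (subst H1_ext_apply[OF fm_one_Ahat]) (simp add: f)
    also have "\<dots> = fm_scale (eps h) fm_one id p"
    proof (cases "p \<in> FM")
      case p: True
      show ?thesis
        using jetD1[OF jet_spec restrict_FM[OF smooth_affine_fun] open_FM order_refl _ p, of 1 0 0 1 0 0] p
        by (cases p) (simp add: restrict_FM_def fm_scale_def fm_one_def affine_fun_def)
    next
      case False
      then show ?thesis
        using dop_CinfFM[OF id_Diff restrict_FM[OF smooth_affine_fun], of h 1 0 0]
        by (simp add: CinfFM_def fm_scale_def fm_one_def del: mem_FM split_paired_All)
    qed
    finally show ?thesis using True by simp
  next
    case False
    then show ?thesis
      by (subst H1_ext_apply[OF fm_one_Ahat]) (simp add: f fm_scale_def)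
  qed
  then show e: "H1_ext h fm_one = fm_scale (eps h) fm_one" by (intro ext)
  fix c assume "H1_ext h fm_one = fm_scale c fm_one"
  then have "fm_scale c fm_one id (0, 1) = fm_scale (eps h) fm_one id (0, 1)"
    using e by simp
  then show "c = eps h" by (simp add: fm_scale_def fm_one_def)
qed

lemma char_delta_eq_omega: "char_delta = omega"
  unfolding char_delta_def
proof (rule the_equality)
  show "is_character omega \<and> omega Y1 = 1 \<and> omega X1 = 0 \<and> omega delta1 = 0"
    by (simp add: is_character_def functionals_rules)
  fix d assume d: "is_character d \<and> d Y1 = 1 \<and> d X1 = 0 \<and> d delta1 = 0"
  have "d h = omega h" for h
    by (induction h rule: H1_induct) (use d in \<open>simp_all add: is_character_def functionals_rules\<close>)
  then show "d = omega" by auto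
qed

text \<open>Consequently \<open>xi z\<close> descends to the quotient \<open>Q\<^sub>1\<close>.\<close>

lemma U_gl1_functionals: "u \<in> U_gl1 \<Longrightarrow> xi z u = 0"
  by (induction rule: U_gl1.induct) (simp_all add: functionals_rules)

section \<open>Leibniz rules in the crossed product\<close>

lemma sum_fun_apply: "(\<Sum>i\<in>I. f i) x = (\<Sum>i\<in>I. f i x)"
  by (induction I rule: infinite_finite_induct) auto

definition supp :: "'f::zero cross \<Rightarrow> diff set" where "supp a = {\<phi>. a \<phi> \<noteq> 0}"

text \<open>For invertible \<open>\<phi>\<close> the equation \<open>\<psi> \<circ> \<phi> =
  \<theta>\<close> has exactly one solution \<open>\<psi>\<close>, so that the product is a single
  sum over the first support.\<close>

lemma cross_mult_eq:
  assumes S: "finite S" "S \<subseteq> Diff" "supp a \<subseteq> S"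
    and z: "\<And>x. mul 0 x = 0" "\<And>x \<phi>. \<phi> \<in> Diff \<Longrightarrow> mul x (act \<phi> 0) = 0"
  shows "cross_mult mul act a b \<theta> = (\<Sum>\<phi>\<in>S. mul (a \<phi>) (act \<phi> (b (\<theta> \<circ> inv \<phi>))))"
proof -
  define T where "T = {\<phi>\<in>S. a \<phi> \<noteq> 0 \<and> b (\<theta> \<circ> inv \<phi>) \<noteq> 0}"
  have "{(\<phi>, \<psi>). a \<phi> \<noteq> 0 \<and> b \<psi> \<noteq> 0 \<and> \<psi> \<circ> \<phi> = \<theta>} = (\<lambda>\<phi>. (\<phi>, \<theta> \<circ> inv \<phi>)) ` T"
  proof -
    have "\<psi> = \<theta> \<circ> inv \<phi>" if "a \<phi> \<noteq> 0" "\<psi> \<circ> \<phi> = \<theta>" for \<phi> \<psi>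
      using Diff_comp_cancel[of \<phi> \<psi> \<theta>] S that by (auto simp: supp_def)
    moreover have "(\<theta> \<circ> inv \<phi>) \<circ> \<phi> = \<theta>" if "\<phi> \<in> S" for \<phi>
      using Diff_comp_cancel[of \<phi> "\<theta> \<circ> inv \<phi>" \<theta>] S that by blast
    ultimately show ?thesis using S(3) unfolding T_def supp_def by auto
  qed
  then have "cross_mult mul act a b \<theta> = (\<Sum>x\<in>(\<lambda>\<phi>. (\<phi>, \<theta> \<circ> inv \<phi>)) ` T. case x of (\<phi>, \<psi>) \<Rightarrow> mul (a \<phi>) (act \<phi> (b \<psi>)))"
    by (simp only: cross_mult_def)
  also have "\<dots> = (\<Sum>\<phi>\<in>T. mul (a \<phi>) (act \<phi> (b (\<theta> \<circ> inv \<phi>))))"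
    by (subst sum.reindex) (auto simp: inj_on_def)
  also have "\<dots> = (\<Sum>\<phi>\<in>S. mul (a \<phi>) (act \<phi> (b (\<theta> \<circ> inv \<phi>))))"
  proof (rule sum.mono_neutral_left[OF S(1)])
    show "\<forall>\<phi>\<in>S - T. mul (a \<phi>) (act \<phi> (b (\<theta> \<circ> inv \<phi>))) = 0"
    proof
      fix \<phi> assume \<phi>: "\<phi> \<in> S - T"
      then consider "a \<phi> = 0" | "b (\<theta> \<circ> inv \<phi>) = 0" by (auto simp: T_def)
      then show "mul (a \<phi>) (act \<phi> (b (\<theta> \<circ> inv \<phi>))) = 0"
        by cases (use z S(2) \<phi> in auto)
    qed
  qed (auto simp: T_def)
  finally show ?thesis .
qed

lemma fm_mult_eq:
  assumes "finite S" "S \<subseteq> Diff" "supp a \<subseteq> S"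
  shows "fm_mult a b \<theta> = (\<Sum>\<phi>\<in>S. (\<lambda>p. a \<phi> p * b (\<theta> \<circ> inv \<phi>) (lift_diff \<phi> p)))"
  unfolding fm_mult_def
  by (subst cross_mult_eq[OF assms]) (auto simp: fun_eq_iff)

lemma supp_At: "a \<in> At \<Longrightarrow> finite (supp a)" "a \<in> At \<Longrightarrow> supp a \<subseteq> Diff"
  and supp_Ahat: "b \<in> Ahat \<Longrightarrow> finite (supp b)" "b \<in> Ahat \<Longrightarrow> supp b \<subseteq> Diff"
  using At_finite At_Diff Ahat_finite Ahat_Diff by (auto simp: supp_def)

lemma fm_mult_apply:
  assumes "finite S" "S \<subseteq> Diff" "supp a \<subseteq> S"
  shows "fm_mult a b \<theta> p = (\<Sum>\<phi>\<in>S. a \<phi> p * b (\<theta> \<circ> inv \<phi>) (lift_diff \<phi> p))"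
  by (subst fm_mult_eq[OF assms]) (auto simp: sum_fun_apply)

lemma fm_mult_At:
  assumes "a \<in> At" "b \<in> Ahat"
  shows "fm_mult a b \<in> At"
proof (rule AtI[of "(\<lambda>(\<phi>, \<psi>). \<psi> \<circ> \<phi>) ` (supp a \<times> supp b)"])
  show "finite ((\<lambda>(\<phi>, \<psi>). \<psi> \<circ> \<phi>) ` (supp a \<times> supp b))"
    using supp_At(1)[OF assms(1)] supp_Ahat(1)[OF assms(2)] by auto
  show "(\<lambda>(\<phi>, \<psi>). \<psi> \<circ> \<phi>) ` (supp a \<times> supp b) \<subseteq> Diff"
    using supp_At(2)[OF assms(1)] supp_Ahat(2)[OF assms(2)] by auto
  show "fm_mult a b \<theta> = 0" if "\<theta> \<notin> (\<lambda>(\<phi>, \<psi>). \<psi> \<circ> \<phi>) ` (supp a \<times> supp b)" for \<theta>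
  proof -
    have e: "{(\<phi>, \<psi>). a \<phi> \<noteq> 0 \<and> b \<psi> \<noteq> 0 \<and> \<psi> \<circ> \<phi> = \<theta>} = {}" using that by (auto simp: supp_def)
    show ?thesis unfolding fm_mult_def cross_mult_def e by simp
  qed
  show "fm_mult a b \<theta> \<in> CcFM" for \<theta>
    unfolding fm_mult_eq[of "supp a" a b, OF supp_At(1)[OF assms(1)] supp_At(2)[OF assms(1)] order_refl]
  proof (rule CcFM_sum)
    fix \<phi> assume "\<phi> \<in> supp a"
    then have "\<phi> \<in> Diff" using supp_At(2)[OF assms(1)] by auto
    from CcFM_ops(5)[OF At_mem[OF assms(1)] CinfFM_D(1)[OF CinfFM_lift[OF Ahat_mem[OF assms(2)] this]], of "\<theta> \<circ> inv \<phi>" \<phi>]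
    show "(\<lambda>p. a \<phi> p * b (\<theta> \<circ> inv \<phi>) (lift_diff \<phi> p)) \<in> CcFM"
      by (simp add: mult.commute)
  qed
qed

lemma fm_mult_linear_left:
  assumes "\<And>i. i \<in> I \<Longrightarrow> a i \<in> At" "finite I"
  shows "fm_mult (\<Sum>i\<in>I. fm_scale (c i) (a i)) b \<theta> p = (\<Sum>i\<in>I. c i * fm_mult (a i) b \<theta> p)"
proof -
  define S where "S = (\<Union>i\<in>I. supp (a i))"
  have S: "finite S" "S \<subseteq> Diff" using supp_At assms by (auto simp: S_def)
  have 1: "supp (\<Sum>i\<in>I. fm_scale (c i) (a i)) \<subseteq> S"
  proof
    fix \<phi> assume m: "\<phi> \<in> supp (\<Sum>i\<in>I. fm_scale (c i) (a i))"
    show "\<phi> \<in> S"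
    proof (rule ccontr)
      assume n: "\<phi> \<notin> S"
      have "fm_scale (c i) (a i) \<phi> = 0" if "i \<in> I" for i
        using n that by (auto simp: S_def supp_def fm_scale_def fun_eq_iff)
      with m show False by (simp add: supp_def sum_fun_apply)
    qed
  qed
  have 2: "supp (a i) \<subseteq> S" if "i \<in> I" for i using that by (auto simp: S_def)
  have "(\<Sum>i\<in>I. c i * fm_mult (a i) b \<theta> p) = (\<Sum>i\<in>I. \<Sum>\<phi>\<in>S. c i * (a i \<phi> p * b (\<theta> \<circ> inv \<phi>) (lift_diff \<phi> p)))"
    by (rule sum.cong[OF refl]) (simp add: fm_mult_apply[OF S 2] sum_distrib_left)
  also have "\<dots> = (\<Sum>\<phi>\<in>S. \<Sum>i\<in>I. c i * (a i \<phi> p * b (\<theta> \<circ> inv \<phi>) (lift_diff \<phi> p)))" by (rule sum.swap)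
  also have "\<dots> = fm_mult (\<Sum>i\<in>I. fm_scale (c i) (a i)) b \<theta> p"
    unfolding fm_mult_apply[OF S 1]
    by (rule sum.cong[OF refl]) (simp add: sum_fun_apply fm_scale_def sum_distrib_right mult.assoc)
  finally show ?thesis by simp
qed

lemma XY_mult:
  assumes "f \<in> CinfFM" "g \<in> CinfFM" "p \<in> FM"
  shows "X_fun (\<lambda>p. f p * g p) p = X_fun f p * g p + f p * X_fun g p"
    "Y_fun (\<lambda>p. f p * g p) p = Y_fun f p * g p + f p * Y_fun g p"
proof -
  obtain x y where p: "p = (x, y)" by (cases p)
  have d: "(f has_derivative frechet_derivative f (at (x, y))) (at (x, y))" "(g has_derivative frechet_derivative g (at (x, y))) (at (x, y))"
    using smooth_on_has_derivative[OF CinfFM_D(1)] assms p by auto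
  show "X_fun (\<lambda>p. f p * g p) p = X_fun f p * g p + f p * X_fun g p"
    "Y_fun (\<lambda>p. f p * g p) p = Y_fun f p * g p + f p * Y_fun g p"
    unfolding p XY_fun_eqI[OF has_derivative_mult[OF d]] XY_fun_eqI[OF d(1)] XY_fun_eqI[OF d(2)]
    by (auto simp: algebra_simps)
qed

text \<open>The lift of \<open>\<phi>\<close> preserves \<open>Y\<close> but not \<open>X\<close>: the
  derivative of \<open>\<phi>'(x) y\<close> along \<open>x\<close> contributes a multiple of
  \<open>Y\<close> with coefficient \<open>y \<phi>'' / \<phi>'\<close>. This is the origin of the
  operator \<open>delta1\<close>.\<close>

lemma XY_lift:
  assumes "g \<in> CinfFM" "\<phi> \<in> Diff" "p \<in> FM"
  shows "X_fun (g \<circ> lift_diff \<phi>) p = X_fun g (lift_diff \<phi> p) + of_real (snd p * nonlin \<phi> (fst p)) * Y_fun g (lift_diff \<phi> p)"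
    "Y_fun (g \<circ> lift_diff \<phi>) p = Y_fun g (lift_diff \<phi> p)"
proof -
  obtain x y where p: "p = (x, y)" by (cases p)
  let ?q = "(\<phi> x, deriv \<phi> x * y)"
  have q: "lift_diff \<phi> (x, y) = ?q" by (simp add: lift_diff_def)
  have "?q \<in> FM" using lift_diff_FM[OF assms(2), of p] assms(3) by (simp only: p q)
  then have d: "(g has_derivative frechet_derivative g (at ?q)) (at ?q)"
    using smooth_on_has_derivative[OF CinfFM_D(1)[OF assms(1)]] by blast
  interpret linear "frechet_derivative g (at ?q)" using has_derivative_linear[OF d] .
  have d1: "((\<lambda>p. \<phi> (fst p)) has_derivative (\<lambda>v. deriv \<phi> x * fst v)) (at (x, y))"
  proof -
    have "(\<phi> has_derivative (\<lambda>h. deriv \<phi> x * h)) (at (fst (x, y)))"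
      using Diff_DERIV[OF assms(2), of x] by (simp add: has_field_derivative_def)
    from has_derivative_compose[OF has_derivative_fst[OF has_derivative_ident] this] show ?thesis by simp
  qed
  have d2: "((\<lambda>p. deriv \<phi> (fst p)) has_derivative (\<lambda>v. deriv (deriv \<phi>) x * fst v)) (at (x, y))"
  proof -
    have "(deriv \<phi> has_derivative (\<lambda>h. deriv (deriv \<phi>) x * h)) (at (fst (x, y)))"
      using Diff_DERIV2[OF assms(2), of x] by (simp add: has_field_derivative_def)
    from has_derivative_compose[OF has_derivative_fst[OF has_derivative_ident] this] show ?thesis by simp
  qed
  have dl: "(lift_diff \<phi> has_derivative (\<lambda>v. (deriv \<phi> x * fst v, deriv \<phi> x * snd v + deriv (deriv \<phi>) x * fst v * y))) (at (x, y))"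
  proof -
    have "((\<lambda>p. deriv \<phi> (fst p) * snd p) has_derivative (\<lambda>v. deriv \<phi> x * snd v + deriv (deriv \<phi>) x * fst v * y)) (at (x, y))"
      using has_derivative_mult[OF d2 has_derivative_snd[OF has_derivative_ident]] by simp
    from has_derivative_Pair[OF d1 this] show ?thesis by (simp add: lift_diff_def case_prod_unfold)
  qed
  have "(g \<circ> lift_diff \<phi> has_derivative (\<lambda>v. frechet_derivative g (at ?q) (deriv \<phi> x * fst v, deriv \<phi> x * snd v + deriv (deriv \<phi>) x * fst v * y))) (at (x, y))"
    using has_derivative_compose[OF dl, of g "frechet_derivative g (at ?q)"] d unfolding q o_def by blast
  note e = XY_fun_eqI[OF this] XY_fun_eqI[OF d]
  have s: "frechet_derivative g (at ?q) (s, t) = of_real s * frechet_derivative g (at ?q) (1, 0) + of_real t * frechet_derivative g (at ?q) (0, 1)" for s t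
    using add[of "s *\<^sub>R (1, 0)" "t *\<^sub>R (0, 1)"] scale[of s "(1, 0)"] scale[of t "(0, 1)"] by (simp add: scaleR_conv_of_real)
  show "X_fun (g \<circ> lift_diff \<phi>) p = X_fun g (lift_diff \<phi> p) + of_real (snd p * nonlin \<phi> (fst p)) * Y_fun g (lift_diff \<phi> p)"
    unfolding p q e using Diff_deriv_pos[OF assms(2), of x]
    by (subst s) (simp add: nonlin_def algebra_simps)
  show "Y_fun (g \<circ> lift_diff \<phi>) p = Y_fun g (lift_diff \<phi> p)"
    unfolding p q e by (subst s) simp
qed

lemma XY_sum:
  assumes "\<And>i. i \<in> I \<Longrightarrow> f i \<in> CinfFM"
  shows "X_fun (\<Sum>i\<in>I. f i) = (\<Sum>i\<in>I. X_fun (f i))" "Y_fun (\<Sum>i\<in>I. f i) = (\<Sum>i\<in>I. Y_fun (f i))"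
proof -
  have "dop h id (\<Sum>i\<in>I. f i) = (\<Sum>i\<in>I. dop h id (f i))" for h
    by (rule dop_sum_fun[OF id_Diff assms])
  from this[of X1] this[of Y1] show "X_fun (\<Sum>i\<in>I. f i) = (\<Sum>i\<in>I. X_fun (f i))" "Y_fun (\<Sum>i\<in>I. f i) = (\<Sum>i\<in>I. Y_fun (f i))"
    by (simp_all only: dop_rules[OF id_Diff] CinfFM_sum[OF assms] assms cong: sum.cong)
qed

lemma term_CinfFM:
  assumes "a \<in> At" "b \<in> At" "\<phi> \<in> supp a"
  shows "(\<lambda>p. a \<phi> p * b (\<theta> \<circ> inv \<phi>) (lift_diff \<phi> p)) \<in> CinfFM"
proof -
  have "\<phi> \<in> Diff" using supp_At(2)[OF assms(1)] assms(3) by auto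
  from CinfFM_mult[OF CinfFM_lift[OF CcFM_CinfFM[OF At_mem[OF assms(2)]] this] CinfFM_D(1)[OF CcFM_CinfFM[OF At_mem[OF assms(1)]]], of \<phi> "\<theta> \<circ> inv \<phi>"]
  show ?thesis by simp
qed

text \<open>The extra term in the rule for \<open>X\<close> comes from \<open>XY_lift\<close>, the rule for
  \<open>delta1\<close> is the cocycle identity of \<open>nonlin\<close>.\<close>

lemma leibniz:
  assumes "a \<in> At" "b \<in> At"
  shows "Y_op (fm_mult a b) = fm_mult (Y_op a) b + fm_mult a (Y_op b)"
    "delta1_op (fm_mult a b) = fm_mult (delta1_op a) b + fm_mult a (delta1_op b)"
    "X_op (fm_mult a b) = fm_mult (X_op a) b + fm_mult a (X_op b) + fm_mult (delta1_op a) (Y_op b)"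
proof -
  note S = supp_At(1,2)[OF assms(1)] order_refl
  have sub: "supp (Y_op a) \<subseteq> supp a" "supp (X_op a) \<subseteq> supp a" "supp (delta1_op a) \<subseteq> supp a"
    unfolding supp_def by (rule Collect_mono, metis ops_fun fun_zero_ops)+
  note E = fm_mult_apply[OF S(1,2,3)] fm_mult_apply[OF S(1,2) sub(1)] fm_mult_apply[OF S(1,2) sub(2)] fm_mult_apply[OF S(1,2) sub(3)]
  have ext: "u = v" if "\<And>\<theta> p. p \<in> FM \<Longrightarrow> u \<theta> p = v \<theta> p" "u \<in> At" "v \<in> At" for u v :: fm_cross
    by (rule ext, rule CinfFM_eqI) (use that At_mem CcFM_CinfFM in auto)
  note c = At_ops fm_mult_At At_add assms At_Ahat
  have Diff: "\<phi> \<in> Diff" if "\<phi> \<in> supp a" for \<phi> using that S(2) by auto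
  have ca: "a \<phi> \<in> CinfFM" "b \<phi> \<in> CinfFM" for \<phi> using assms At_mem CcFM_CinfFM by auto
  show "Y_op (fm_mult a b) = fm_mult (Y_op a) b + fm_mult a (Y_op b)"
  proof (rule ext)
    fix \<theta> p assume p: "p \<in> FM"
    have "Y_op (fm_mult a b) \<theta> p = (\<Sum>\<phi>\<in>supp a. Y_fun (\<lambda>p. a \<phi> p * b (\<theta> \<circ> inv \<phi>) (lift_diff \<phi> p)) p)"
      unfolding ops_fun fm_mult_eq[OF S(1,2,3)] by (subst XY_sum(2)) (auto intro: term_CinfFM assms simp: sum_fun_apply)
    also have "\<dots> = (fm_mult (Y_op a) b + fm_mult a (Y_op b)) \<theta> p"
      unfolding plus_fun_apply E sum.distrib[symmetric] ops_fun
    proof (rule sum.cong[OF refl])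
      fix \<phi> assume "\<phi> \<in> supp a"
      note D = Diff[OF this]
      show "Y_fun (\<lambda>p. a \<phi> p * b (\<theta> \<circ> inv \<phi>) (lift_diff \<phi> p)) p =
         Y_fun (a \<phi>) p * b (\<theta> \<circ> inv \<phi>) (lift_diff \<phi> p) + a \<phi> p * Y_fun (b (\<theta> \<circ> inv \<phi>)) (lift_diff \<phi> p)"
        using XY_mult(2)[OF ca(1) CinfFM_lift[OF ca(2) D] p] XY_lift(2)[OF ca(2) D p] by simp
    qed
    finally show "Y_op (fm_mult a b) \<theta> p = (fm_mult (Y_op a) b + fm_mult a (Y_op b)) \<theta> p" .
  qed (intro c)+
  show "X_op (fm_mult a b) = fm_mult (X_op a) b + fm_mult a (X_op b) + fm_mult (delta1_op a) (Y_op b)"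
  proof (rule ext)
    fix \<theta> p assume p: "p \<in> FM"
    have "X_op (fm_mult a b) \<theta> p = (\<Sum>\<phi>\<in>supp a. X_fun (\<lambda>p. a \<phi> p * b (\<theta> \<circ> inv \<phi>) (lift_diff \<phi> p)) p)"
      unfolding ops_fun fm_mult_eq[OF S(1,2,3)] by (subst XY_sum(1)) (auto intro: term_CinfFM assms simp: sum_fun_apply)
    also have "\<dots> = (fm_mult (X_op a) b + fm_mult a (X_op b) + fm_mult (delta1_op a) (Y_op b)) \<theta> p"
      unfolding plus_fun_apply E sum.distrib[symmetric] ops_fun
    proof (rule sum.cong[OF refl])
      fix \<phi> assume "\<phi> \<in> supp a"
      note D = Diff[OF this]
      have "D_fun \<phi> (a \<phi>) p = of_real (snd p * nonlin \<phi> (fst p)) * a \<phi> p" by (cases p) (simp add: D_fun_def)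
      then show "X_fun (\<lambda>p. a \<phi> p * b (\<theta> \<circ> inv \<phi>) (lift_diff \<phi> p)) p =
         X_fun (a \<phi>) p * b (\<theta> \<circ> inv \<phi>) (lift_diff \<phi> p) + a \<phi> p * X_fun (b (\<theta> \<circ> inv \<phi>)) (lift_diff \<phi> p)
         + D_fun \<phi> (a \<phi>) p * Y_fun (b (\<theta> \<circ> inv \<phi>)) (lift_diff \<phi> p)"
        using XY_mult(1)[OF ca(1) CinfFM_lift[OF ca(2) D] p] XY_lift(1)[OF ca(2) D p] by (simp add: algebra_simps)
    qed
    finally show "X_op (fm_mult a b) \<theta> p = (fm_mult (X_op a) b + fm_mult a (X_op b) + fm_mult (delta1_op a) (Y_op b)) \<theta> p" .
  qed (intro c)+
  show "delta1_op (fm_mult a b) = fm_mult (delta1_op a) b + fm_mult a (delta1_op b)"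
  proof (rule ext)
    fix \<theta> p assume p: "p \<in> FM"
    have "delta1_op (fm_mult a b) \<theta> p = (\<Sum>\<phi>\<in>supp a. of_real (snd p * nonlin \<theta> (fst p)) * (a \<phi> p * b (\<theta> \<circ> inv \<phi>) (lift_diff \<phi> p)))"
      by (cases p) (simp add: ops_fun D_fun_def E sum_distrib_left)
    also have "\<dots> = (fm_mult (delta1_op a) b + fm_mult a (delta1_op b)) \<theta> p"
      unfolding plus_fun_apply E sum.distrib[symmetric] ops_fun
    proof (rule sum.cong[OF refl])
      fix \<phi> assume "\<phi> \<in> supp a"
      note D = Diff[OF this]
      show "of_real (snd p * nonlin \<theta> (fst p)) * (a \<phi> p * b (\<theta> \<circ> inv \<phi>) (lift_diff \<phi> p)) =
         D_fun \<phi> (a \<phi>) p * b (\<theta> \<circ> inv \<phi>) (lift_diff \<phi> p) + a \<phi> p * D_fun (\<theta> \<circ> inv \<phi>) (b (\<theta> \<circ> inv \<phi>)) (lift_diff \<phi> p)"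
      proof (cases "b (\<theta> \<circ> inv \<phi>) = 0")
        case False
        then have "\<theta> \<circ> inv \<phi> \<in> Diff" using At_Diff assms(2) by blast
        from nonlin_comp[OF D this, of "fst p"] have "nonlin \<theta> (fst p) = nonlin (\<theta> \<circ> inv \<phi>) (\<phi> (fst p)) * deriv \<phi> (fst p) + nonlin \<phi> (fst p)"
          using D by (simp add: comp_assoc)
        then show ?thesis by (cases p) (simp add: D_fun_def lift_diff_def algebra_simps)
      qed simp
    qed
    finally show "delta1_op (fm_mult a b) \<theta> p = (fm_mult (delta1_op a) b + fm_mult a (delta1_op b)) \<theta> p" .
  qed (intro c)+
qed

section \<open>Commutation relations\<close>

text \<open>Integrating the mixed derivative \<open>G = \<partial>\<^sub>y f\<^sub>x\<close> in
  \<open>y\<close> gives \<open>f\<^sub>x\<close>, and integrating this in \<open>x\<close> gives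
  \<open>f\<close>. Exchanging the order of integration over rectangles gives \<open>f\<^sub>y(u,
  v) - f\<^sub>y(a, v) = \<integral> G(x, v) dx\<close>, which is then differentiated in
  \<open>u\<close>.\<close>

lemma mixed_partials:
  fixes f :: "real \<times> real \<Rightarrow> complex"
  assumes s: "smooth_on UNIV f"
  defines "fx \<equiv> \<lambda>p. frechet_derivative f (at p) (1, 0)" and "fy \<equiv> \<lambda>p. frechet_derivative f (at p) (0, 1)"
  shows "frechet_derivative fx (at (x, y)) (0, 1) = frechet_derivative fy (at (x, y)) (1, 0)"
proof -
  define G where "G = (\<lambda>p. frechet_derivative fx (at p) (0, 1))"
  have sfx: "smooth_on UNIV fx" and sfy: "smooth_on UNIV fy" unfolding fx_def fy_def by (intro smooth_on_frechet s)+
  note d = smooth_on_has_derivative[OF s UNIV_I] smooth_on_has_derivative[OF sfx UNIV_I] smooth_on_has_derivative[OF sfy UNIV_I]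
  have sx: "((\<lambda>t. f (t, y)) has_vector_derivative fx (x, y)) (at x)" for x y
    using has_vector_derivative_slices(1)[OF d(1)] by (simp add: fx_def)
  have sy: "((\<lambda>t. f (x, t)) has_vector_derivative fy (x, y)) (at y)" for x y
    using has_vector_derivative_slices(2)[OF d(1)] by (simp add: fy_def)
  have sxy: "((\<lambda>t. fx (x, t)) has_vector_derivative G (x, y)) (at y)" for x y
    using has_vector_derivative_slices(2)[OF d(2)] by (simp add: G_def)
  have contG: "continuous_on UNIV G"
    unfolding G_def by (intro smooth_on_imp_continuous smooth_on_frechet sfx)
  have cG: "continuous_on S (\<lambda>(x, y). G (x, y))" for S
    using continuous_on_subset[OF contG] by simp
  have cG1: "continuous_on S (\<lambda>x. G (x, y))" for S y
    by (rule continuous_on_compose2[OF contG]) (auto intro: continuous_intros)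
  have i1: "integral {c..s} (\<lambda>t. G (x, t)) = fx (x, s) - fx (x, c)" if "c \<le> s" for c s x
    by (rule integral_unique, rule fundamental_theorem_of_calculus[OF that])
       (rule has_vector_derivative_at_within[OF sxy])
  have i2: "((\<lambda>u. fx (u, s)) has_integral f (x, s) - f (a, s)) {a..x}" if "a \<le> x" for a x s
    by (rule fundamental_theorem_of_calculus[OF that])
       (rule has_vector_derivative_at_within[OF sx])
  \<comment> \<open>Comparison of the derivatives at \<open>v\<close> of two expressions for
    \<open>\<integral>\<integral> G\<close> over \<open>[a, u] \<times> [v - 1, s]\<close>, as
    functions of \<open>s\<close>.\<close>
  have key: "fy (u, v) = fy (a, v) + integral {a..u} (\<lambda>x. G (x, v))" if au: "a \<le> u" for a u v
  proof -
    define H where "H = (\<lambda>t. integral {a..u} (\<lambda>x. G (x, t)))"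
    have cH: "continuous_on {v - 1..v + 1} H"
    proof -
      have "continuous_on ({v - 1..v + 1} \<times> cbox a u) (\<lambda>(t, x). G (x, t))"
        unfolding case_prod_unfold
        by (rule continuous_on_compose2[OF contG]) (auto intro!: continuous_intros)
      from integral_continuous_on_param[OF this] show ?thesis by (simp add: H_def)
    qed
    have int: "integral {v - 1..s} H = f (u, s) - (f (a, s) + (f (u, v - 1) - f (a, v - 1)))" if "s \<in> {v - 1..v + 1}" for s
    proof -
      have "integral {v - 1..s} H = integral {a..u} (\<lambda>x. integral {v - 1..s} (\<lambda>t. G (x, t)))"
        using integral_swap_continuous[OF cG, of a u "v - 1" s] by (simp add: H_def)
      also have "\<dots> = integral {a..u} (\<lambda>x. fx (x, s) - fx (x, v - 1))"
        using that by (simp add: i1)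
      also have "\<dots> = (f (u, s) - f (a, s)) - (f (u, v - 1) - f (a, v - 1))"
        by (rule integral_unique, rule has_integral_diff[OF i2[OF au] i2[OF au]])
      finally show ?thesis by simp
    qed
    have "((\<lambda>s. integral {v - 1..s} H) has_vector_derivative H v) (at v within {v - 1..v + 1})"
      by (rule integral_has_vector_derivative[OF cH]) simp
    then have "((\<lambda>s. f (u, s) - (f (a, s) + (f (u, v - 1) - f (a, v - 1)))) has_vector_derivative H v) (at v within {v - 1..v + 1})"
      by (rule has_vector_derivative_transform[rotated 2]) (auto simp: int)
    then have "((\<lambda>s. f (u, s) - (f (a, s) + (f (u, v - 1) - f (a, v - 1)))) has_vector_derivative H v) (at v)"
      by (simp add: at_within_Icc_at)
    moreover have "((\<lambda>s. f (u, s) - (f (a, s) + (f (u, v - 1) - f (a, v - 1)))) has_vector_derivative fy (u, v) - (fy (a, v) + 0)) (at v)"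
      by (intro has_vector_derivative_diff has_vector_derivative_add sy has_vector_derivative_const)
    ultimately have "H v = fy (u, v) - (fy (a, v) + 0)" by (rule vector_derivative_unique_at)
    then show ?thesis by (simp add: H_def)
  qed
  have "((\<lambda>u. integral {x - 1..u} (\<lambda>t. G (t, y))) has_vector_derivative G (x, y)) (at x within {x - 1..x + 1})"
    by (rule integral_has_vector_derivative[OF cG1]) simp
  then have "((\<lambda>u. fy (x - 1, y) + integral {x - 1..u} (\<lambda>t. G (t, y))) has_vector_derivative 0 + G (x, y)) (at x within {x - 1..x + 1})"
    by (intro has_vector_derivative_add has_vector_derivative_const)
  then have "((\<lambda>u. fy (u, y)) has_vector_derivative 0 + G (x, y)) (at x within {x - 1..x + 1})"
    by (rule has_vector_derivative_transform[rotated 2]) (auto simp: key)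
  then have "((\<lambda>u. fy (u, y)) has_vector_derivative G (x, y)) (at x)"
    by (simp add: at_within_Icc_at)
  moreover have "((\<lambda>t. fy (t, y)) has_vector_derivative frechet_derivative fy (at (x, y)) (1, 0)) (at x)"
    using has_vector_derivative_slices(1)[OF d(3)] by simp
  ultimately show ?thesis unfolding G_def by (rule vector_derivative_unique_at)
qed

text \<open>Both commutators of this section say that \<open>X1\<close> and \<open>delta1\<close> are
  homogeneous of degree \<open>1\<close> in \<open>y\<close>.\<close>

lemma YX: "Y1 * X1 = X1 * Y1 + X1"
proof (rule H1_eqI)
  fix \<phi> f assume \<phi>: "\<phi> \<in> Diff" and f: "f \<in> CcFM"
  note s = CcFM_smooth_UNIV[OF f]
  define fx where "fx = (\<lambda>p. frechet_derivative f (at p) (1, 0))"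
  define fy where "fy = (\<lambda>p. frechet_derivative f (at p) (0, 1))"
  have sfx: "smooth_on UNIV fx" and sfy: "smooth_on UNIV fy" unfolding fx_def fy_def by (intro smooth_on_frechet s)+
  have X: "X_fun f = (\<lambda>p. of_real (snd p) * fx p)" and Y: "Y_fun f = (\<lambda>p. of_real (snd p) * fy p)"
    using XY_fun_eqI[OF smooth_on_has_derivative[OF s UNIV_I]] by (auto simp: fx_def fy_def fun_eq_iff)
  have "Y_fun (X_fun f) (x, y) = X_fun (Y_fun f) (x, y) + X_fun f (x, y)" for x y
  proof -
    have 1: "((\<lambda>t. fx (x, t)) has_vector_derivative frechet_derivative fx (at (x, y)) (0, 1)) (at y)"
      by (rule has_vector_derivative_slices(2)[OF smooth_on_has_derivative[OF sfx UNIV_I]])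
    have "((\<lambda>t. complex_of_real t * fx (x, t)) has_vector_derivative of_real y * frechet_derivative fx (at (x, y)) (0, 1) + of_real 1 * fx (x, y)) (at y)"
      by (rule has_vector_derivative_mult[OF _ 1]) (auto intro!: derivative_eq_intros)
    moreover have "((\<lambda>t. complex_of_real y * fy (t, y)) has_vector_derivative of_real y * frechet_derivative fy (at (x, y)) (1, 0)) (at x)"
      by (rule has_vector_derivative_mult_right[OF has_vector_derivative_slices(1)[OF smooth_on_has_derivative[OF sfy UNIV_I]]])
    ultimately show ?thesis
      unfolding X Y using mixed_partials[OF s, of x y]
      by (simp add: X_fun_def Y_fun_def vector_derivative_at fx_def[symmetric] fy_def[symmetric] algebra_simps)
  qed
  then show "dop (Y1 * X1) \<phi> f = dop (X1 * Y1 + X1) \<phi> f"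
    by (simp add: dop_rules[OF \<phi>] dop_add CcFM_CinfFM[OF f] CinfFM_XY fun_eq_iff)
qed

lemma Ydelta: "Y1 * delta1 = delta1 * Y1 + delta1"
proof (rule H1_eqI)
  fix \<phi> f assume \<phi>: "\<phi> \<in> Diff" and f: "f \<in> CcFM"
  note s = CcFM_smooth_UNIV[OF f]
  have "Y_fun (D_fun \<phi> f) (x, y) = D_fun \<phi> (Y_fun f) (x, y) + D_fun \<phi> f (x, y)" for x y
  proof -
    have 1: "((\<lambda>t. f (x, t)) has_vector_derivative frechet_derivative f (at (x, y)) (0, 1)) (at y)"
      by (rule has_vector_derivative_slices(2)[OF smooth_on_has_derivative[OF s UNIV_I]])
    have "((\<lambda>t. complex_of_real (t * nonlin \<phi> x) * f (x, t)) has_vector_derivative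
       of_real (y * nonlin \<phi> x) * frechet_derivative f (at (x, y)) (0, 1) + of_real (nonlin \<phi> x) * f (x, y)) (at y)"
      by (rule has_vector_derivative_mult[OF _ 1]) (auto intro!: derivative_eq_intros simp: scaleR_conv_of_real)
    then show ?thesis
      using vector_derivative_at[OF 1]
      by (simp add: D_fun_def Y_fun_def vector_derivative_at algebra_simps)
  qed
  then show "dop (Y1 * delta1) \<phi> f = dop (delta1 * Y1 + delta1) \<phi> f"
    by (simp add: dop_rules[OF \<phi>] dop_add CcFM_CinfFM[OF f] CinfFM_XY CinfFM_D_fun[OF _ \<phi>] fun_eq_iff)
qed

section \<open>The coproduct on representatives\<close>

global_interpretation H1v: vector_space h_scale
proof
  fix a b :: complex and x y :: H1
  show "h_scale a (x + y) = h_scale a x + h_scale a y" by transfer (auto simp: fm_scale_def fun_eq_iff algebra_simps)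
  show "h_scale (a + b) x = h_scale a x + h_scale b x" by transfer (auto simp: fm_scale_def fun_eq_iff algebra_simps)
  show "h_scale a (h_scale b x) = h_scale (a * b) x" by transfer (auto simp: fm_scale_def fun_eq_iff algebra_simps)
  show "h_scale 1 x = x" by transfer (auto simp: fm_scale_def fun_eq_iff)
qed

lemma H1_mult:
  fixes h k l :: H1
  shows "h * (k * l) = (h * k) * l" "1 * h = h" "h * 1 = h" "(h + k) * l = h * l + k * l" "h * (k + l) = h * k + h * l"
   "h_scale c h * k = h_scale c (h * k)" "h * h_scale c k = h_scale c (h * k)" "0 * h = 0" "h * 0 = 0"
proof -
  have A: "\<phi> \<in> Diff \<Longrightarrow> f \<in> CcFM \<Longrightarrow> f \<in> CinfFM" for \<phi> f by (rule CcFM_CinfFM)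
  show "h * (k * l) = (h * k) * l" by transfer auto
  show "1 * h = h" by (rule H1_eqI) (simp add: dop_rules A dop_CinfFM)
  show "h * 1 = h" by (rule H1_eqI) (simp add: dop_rules A dop_CinfFM)
  show d: "(h + k) * l = h * l + k * l" for h k l :: H1 by (rule H1_eqI) (simp add: dop_rules dop_add A dop_CinfFM)
  show e: "h * (k + l) = h * k + h * l" for h k l :: H1
    by (rule H1_eqI) (simp only: dop_rules dop_add A dop_CinfFM dop_linear)
  show "h_scale c h * k = h_scale c (h * k)"
    by (rule H1_eqI) (simp add: dop_rules dop_scale A dop_CinfFM)
  show "h * h_scale c k = h_scale c (h * k)"
    by (rule H1_eqI) (simp add: dop_rules dop_scale A dop_CinfFM dop_linear[where g = 0 and f = "dop k _ _"])
  show "0 * h = 0" using d[of 0 0 h] by simp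
  show "h * 0 = 0" using e[of h 0 0] by simp
qed

definition lin :: "(H1 \<Rightarrow> complex) \<Rightarrow> bool" where
  "lin F \<longleftrightarrow> (\<forall>h k. F (h + k) = F h + F k) \<and> (\<forall>c h. F (h_scale c h) = c * F h)"

definition bilin :: "(H1 \<Rightarrow> H1 \<Rightarrow> complex) \<Rightarrow> bool" where
  "bilin G \<longleftrightarrow> (\<forall>k. lin (G k)) \<and> (\<forall>l. lin (\<lambda>k. G k l))"

lemma linD: "lin F \<Longrightarrow> F (h + k) = F h + F k" "lin F \<Longrightarrow> F (h_scale c h) = c * F h"
  by (auto simp: lin_def)

lemma lin_zero: "lin F \<Longrightarrow> F 0 = 0"
  using linD(1)[of F 0 0] by simp

lemma lin_sum:
  assumes "lin F" "finite I"
  shows "F (\<Sum>i\<in>I. h_scale (c i) (h i)) = (\<Sum>i\<in>I. c i * F (h i))"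
  using assms(2) by (induction I) (auto simp: lin_zero assms(1) linD)

lemma bilinI: "(\<And>k. lin (G k)) \<Longrightarrow> (\<And>l. lin (\<lambda>k. G k l)) \<Longrightarrow> bilin G"
  by (auto simp: bilin_def)

lemma bilinD: "bilin G \<Longrightarrow> lin (G k)" "bilin G \<Longrightarrow> lin (\<lambda>k. G k l)"
  by (auto simp: bilin_def)

text \<open>The value of the bilinear form \<open>G\<close> on the tensor represented by \<open>t\<close>.\<close>

definition tensor_eval :: "(H1 \<Rightarrow> H1 \<Rightarrow> complex) \<Rightarrow> (H1 \<times> H1 \<Rightarrow>\<^sub>0 complex) \<Rightarrow> complex" where
  "tensor_eval G t = (\<Sum>(k, l)\<in>Poly_Mapping.keys t. Poly_Mapping.lookup t (k, l) * G k l)"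

lemma tensor_eval_superset:
  assumes "finite S" "Poly_Mapping.keys t \<subseteq> S"
  shows "tensor_eval G t = (\<Sum>x\<in>S. Poly_Mapping.lookup t x * G (fst x) (snd x))"
  unfolding tensor_eval_def case_prod_unfold prod.collapse
  by (rule sum.mono_neutral_left) (use assms in \<open>auto simp: in_keys_iff\<close>)

lemma tensor_eval_add: "tensor_eval G (t + t') = tensor_eval G t + tensor_eval G t'"
proof -
  let ?S = "Poly_Mapping.keys t \<union> Poly_Mapping.keys t'"
  have "Poly_Mapping.keys (t + t') \<subseteq> ?S" by (rule Poly_Mapping.keys_add)
  then show ?thesis
    by (simp add: tensor_eval_superset[of ?S] lookup_add distrib_right sum.distrib)
qed

lemma tensor_eval_diff: "tensor_eval G (t - t') = tensor_eval G t - tensor_eval G t'"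
  using tensor_eval_add[of G "t - t'" t'] by simp

lemma tensor_eval_zero [simp]: "tensor_eval G 0 = 0"
  by (simp add: tensor_eval_def)

lemma tensor_eval_sum: "tensor_eval G (\<Sum>i\<in>I. t i) = (\<Sum>i\<in>I. tensor_eval G (t i))"
  by (induction I rule: infinite_finite_induct) (auto simp: tensor_eval_add)

lemma tensor_eval_single: "tensor_eval G (Poly_Mapping.single x c) = c * G (fst x) (snd x)"
  by (subst tensor_eval_superset[of "{x}"]) auto

definition tensor_scale :: "complex \<Rightarrow> (H1 \<times> H1 \<Rightarrow>\<^sub>0 complex) \<Rightarrow> (H1 \<times> H1 \<Rightarrow>\<^sub>0 complex)" where
  "tensor_scale c t = (\<Sum>x\<in>Poly_Mapping.keys t. Poly_Mapping.single x (c * Poly_Mapping.lookup t x))"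

lemma tensor_eval_scale: "tensor_eval G (tensor_scale c t) = c * tensor_eval G t"
  unfolding tensor_scale_def tensor_eval_sum tensor_eval_single
  by (simp add: tensor_eval_def sum_distrib_left case_prod_unfold mult.assoc)

definition tensor_mult :: "(H1 \<times> H1 \<Rightarrow>\<^sub>0 complex) \<Rightarrow> (H1 \<times> H1 \<Rightarrow>\<^sub>0 complex) \<Rightarrow> (H1 \<times> H1 \<Rightarrow>\<^sub>0 complex)" where
  "tensor_mult t t' = (\<Sum>x\<in>Poly_Mapping.keys t. \<Sum>y\<in>Poly_Mapping.keys t'.
     Poly_Mapping.single (fst x * fst y, snd x * snd y) (Poly_Mapping.lookup t x * Poly_Mapping.lookup t' y))"

lemma tensor_eval_tensor_mult: "tensor_eval G (tensor_mult t t') = tensor_eval (\<lambda>a b. tensor_eval (\<lambda>c d. G (a * c) (b * d)) t') t"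
  by (simp add: tensor_mult_def tensor_eval_sum tensor_eval_single) (simp add: tensor_eval_def case_prod_unfold sum_distrib_left mult.assoc)

text \<open>The form \<open>(k, l) \<mapsto> k(a) l(b)\<close>, evaluated at one point of one coefficient. A
  tensor is a coproduct of \<open>h\<close> iff all these forms take on it the value prescribed by
  \<open>h(a b)\<close>.\<close>

definition pair_eval :: "fm_cross \<Rightarrow> fm_cross \<Rightarrow> diff \<Rightarrow> real \<times> real \<Rightarrow> H1 \<Rightarrow> H1 \<Rightarrow> complex" where
  "pair_eval a b \<theta> p k l = fm_mult (Rep_H1 k a) (Rep_H1 l b) \<theta> p"

lemma is_coproduct_iff:
  "is_coproduct h t \<longleftrightarrow> (\<forall>a\<in>At. \<forall>b\<in>At. \<forall>\<theta> p. Rep_H1 h (fm_mult a b) \<theta> p = tensor_eval (pair_eval a b \<theta> p) t)"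
proof -
  have "(\<Sum>(k, l)\<in>Poly_Mapping.keys t. fm_scale (Poly_Mapping.lookup t (k, l)) (fm_mult (Rep_H1 k a) (Rep_H1 l b))) \<theta> p =
    tensor_eval (pair_eval a b \<theta> p) t" for a b \<theta> p
    by (simp add: sum_fun_apply tensor_eval_def pair_eval_def case_prod_unfold fm_scale_def)
  then show ?thesis by (auto simp: is_coproduct_def fun_eq_iff simp del: split_paired_All)
qed

lemma Rep_linear:
  assumes "\<And>i. i \<in> I \<Longrightarrow> u i \<in> At" "finite I"
  shows "Rep_H1 h (\<Sum>i\<in>I. fm_scale (c i) (u i)) \<theta> p = (\<Sum>i\<in>I. c i * Rep_H1 h (u i) \<theta> p)"
proof (cases "\<theta> \<in> Diff")
  case True
  have m: "fm_scale (c i) (u i) \<theta> \<in> CinfFM" if "i \<in> I" for i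
    using At_mem[OF At_ops(4)[OF assms(1)[OF that]]] CcFM_CinfFM by blast
  have "(\<Sum>i\<in>I. fm_scale (c i) (u i)) \<in> At" by (rule At_sum) (rule At_ops(4)[OF assms(1)])
  then have "Rep_H1 h (\<Sum>i\<in>I. fm_scale (c i) (u i)) \<theta> = dop h \<theta> (\<Sum>i\<in>I. fm_scale (c i) (u i) \<theta>)"
    by (simp add: Rep_H1_apply sum_fun_apply[abs_def])
  also have "\<dots> = (\<Sum>i\<in>I. dop h \<theta> (fm_scale (c i) (u i) \<theta>))" by (rule dop_sum_fun[OF True m])
  also have "\<dots> = (\<Sum>i\<in>I. (\<lambda>p. c i * dop h \<theta> (u i \<theta>) p))"
    by (rule sum.cong[OF refl], unfold fm_scale_def)
       (rule dop_linear[OF True CcFM_CinfFM[OF At_mem[OF assms(1)]] zero_CinfFM, THEN conjunct2])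
  finally show ?thesis by (simp add: sum_fun_apply Rep_H1_apply assms(1))
next
  case False
  have z: "v \<theta> = 0" if "v \<in> At" for v using False At_Diff that by blast
  have "(\<Sum>i\<in>I. fm_scale (c i) (u i)) \<in> At" by (rule At_sum) (rule At_ops(4)[OF assms(1)])
  from z[OF Rep_At[OF this]] z[OF Rep_At[OF assms(1)]] show ?thesis by simp
qed

lemma is_coproduct_1: "is_coproduct 1 (Poly_Mapping.single (1, 1) 1)"
  unfolding is_coproduct_iff by (auto simp: tensor_eval_single pair_eval_def one_H1.rep_eq op_on_def fm_mult_At At_Ahat)

text \<open>The Leibniz rules, read as coproducts.\<close>

lemma is_coproduct_X:
  "is_coproduct X1 (Poly_Mapping.single (X1, 1) 1 + Poly_Mapping.single (1, X1) 1 + Poly_Mapping.single (delta1, Y1) 1)"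
  unfolding is_coproduct_iff
  by (auto simp: tensor_eval_add tensor_eval_single pair_eval_def one_H1.rep_eq X1.rep_eq Y1.rep_eq delta1.rep_eq op_on_def
      fm_mult_At At_Ahat leibniz)

lemma is_coproduct_Y: "is_coproduct Y1 (Poly_Mapping.single (Y1, 1) 1 + Poly_Mapping.single (1, Y1) 1)"
  unfolding is_coproduct_iff
  by (auto simp: tensor_eval_add tensor_eval_single pair_eval_def one_H1.rep_eq Y1.rep_eq op_on_def fm_mult_At At_Ahat leibniz)

lemma is_coproduct_delta1:
  "is_coproduct delta1 (Poly_Mapping.single (delta1, 1) 1 + Poly_Mapping.single (1, delta1) 1)"
  unfolding is_coproduct_iff
  by (auto simp: tensor_eval_add tensor_eval_single pair_eval_def one_H1.rep_eq delta1.rep_eq op_on_def fm_mult_At At_Ahat leibniz)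

lemma is_coproduct_add: "is_coproduct h t \<Longrightarrow> is_coproduct k t' \<Longrightarrow> is_coproduct (h + k) (t + t')"
  by (auto simp: is_coproduct_iff tensor_eval_add plus_H1.rep_eq)

lemma is_coproduct_scale: "is_coproduct h t \<Longrightarrow> is_coproduct (h_scale c h) (tensor_scale c t)"
  by (auto simp: is_coproduct_iff tensor_eval_scale h_scale.rep_eq fm_scale_def)

text \<open>Apply the defining property first for \<open>k\<close> and then, to each of the resulting
  products, for \<open>h\<close>.\<close>

lemma is_coproduct_mult:
  assumes "is_coproduct h t" "is_coproduct k t'"
  shows "is_coproduct (h * k) (tensor_mult t t')"
  unfolding is_coproduct_iff
proof (intro ballI allI)
  fix a b \<theta> p assume ab: "a \<in> At" "b \<in> At"
  have k: "Rep_H1 k (fm_mult a b) = (\<Sum>x\<in>Poly_Mapping.keys t'. fm_scale (Poly_Mapping.lookup t' x) (fm_mult (Rep_H1 (fst x) a) (Rep_H1 (snd x) b)))"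
    using assms(2) ab by (simp add: is_coproduct_def case_prod_unfold)
  have "Rep_H1 (h * k) (fm_mult a b) \<theta> p = Rep_H1 h (Rep_H1 k (fm_mult a b)) \<theta> p"
    by (simp add: times_H1.rep_eq)
  also have "\<dots> = (\<Sum>x\<in>Poly_Mapping.keys t'. Poly_Mapping.lookup t' x * Rep_H1 h (fm_mult (Rep_H1 (fst x) a) (Rep_H1 (snd x) b)) \<theta> p)"
    unfolding k by (rule Rep_linear) (auto intro: fm_mult_At Rep_At At_Ahat ab)
  also have "\<dots> = (\<Sum>x\<in>Poly_Mapping.keys t'. Poly_Mapping.lookup t' x * tensor_eval (pair_eval (Rep_H1 (fst x) a) (Rep_H1 (snd x) b) \<theta> p) t)"
    by (simp only: assms(1)[unfolded is_coproduct_iff, rule_format, OF Rep_At[OF ab(1)] Rep_At[OF ab(2)]])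
  also have "\<dots> = tensor_eval (pair_eval a b \<theta> p) (tensor_mult t t')"
    unfolding tensor_eval_tensor_mult tensor_eval_def[of _ t] tensor_eval_def[of _ t'] case_prod_unfold sum_distrib_left
    by (subst sum.swap) (simp add: pair_eval_def times_H1.rep_eq mult.left_commute)
  finally show "Rep_H1 (h * k) (fm_mult a b) \<theta> p = tensor_eval (pair_eval a b \<theta> p) (tensor_mult t t')" .
qed

lemma is_coproduct_coproduct: "is_coproduct h (coproduct h)"
proof -
  have "\<exists>t. is_coproduct h t"
    by (induction h rule: H1_induct)
       (blast intro: is_coproduct_1 is_coproduct_X is_coproduct_Y is_coproduct_delta1 is_coproduct_add
          is_coproduct_scale is_coproduct_mult)+
  then show ?thesis unfolding coproduct_def by (rule someI_ex)
qed

subsection \<open>Uniqueness of the coproduct\<close>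

text \<open>Affine maps have vanishing \<open>nonlin\<close>. Hence their lifts commute with
  \<open>X\<close> and \<open>Y\<close>, and for an affine map \<open>\<alpha>\<close> the
  function \<open>y nonlin (\<psi> \<circ> \<alpha>)\<close> is the composition of \<open>y nonlin
  \<psi>\<close> with the lift of \<open>\<alpha>\<close>.\<close>

lemma dop_affine_right:
  assumes "s > 0" "\<psi> \<in> Diff" "f \<in> CinfFM"
  shows "dop h (\<psi> \<circ> aff s b) (f \<circ> lift_diff (aff s b)) = dop h \<psi> f \<circ> lift_diff (aff s b)"
  using assms(3)
proof (induction h arbitrary: f rule: H1_induct)
  note A = aff_Diff[OF assms(1), of b]
  note D = Diff_comp[OF A assms(2)]
  {
    case one
    then show ?case by (simp only: dop_rules D assms CinfFM_lift[OF _ A])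
  next
    case X
    have "X_fun (f \<circ> lift_diff (aff s b)) = X_fun f \<circ> lift_diff (aff s b)"
      by (rule CinfFM_eqI[OF CinfFM_XY(1)[OF CinfFM_lift[OF X A]] CinfFM_lift[OF CinfFM_XY(1)[OF X] A]])
         (simp add: XY_lift(1)[OF X A])
    then show ?case by (simp only: dop_rules D assms X CinfFM_lift[OF _ A])
  next
    case Y
    have "Y_fun (f \<circ> lift_diff (aff s b)) = Y_fun f \<circ> lift_diff (aff s b)"
      by (rule CinfFM_eqI[OF CinfFM_XY(2)[OF CinfFM_lift[OF Y A]] CinfFM_lift[OF CinfFM_XY(2)[OF Y] A]])
         (simp add: XY_lift(2)[OF Y A])
    then show ?case by (simp only: dop_rules D assms Y CinfFM_lift[OF _ A])
  next
    case delta1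
    have "D_fun (\<psi> \<circ> aff s b) (f \<circ> lift_diff (aff s b)) = D_fun \<psi> f \<circ> lift_diff (aff s b)"
      by (auto simp: D_fun_def lift_diff_def fun_eq_iff nonlin_comp[OF A assms(2)] deriv_aff)
    then show ?case by (simp only: dop_rules D assms delta1 CinfFM_lift[OF _ A])
  next
    case (add h k)
    then show ?case by (auto simp: dop_add fun_eq_iff)
  next
    case (scale h c)
    then show ?case by (auto simp: dop_scale fun_eq_iff)
  next
    case (mult h k)
    show ?case
      by (simp only: dop_rules D assms mult.prems CinfFM_lift[OF _ A] mult.IH(2) mult.IH(1)[OF dop_CinfFM[OF assms(2) mult.prems]])
  }
qed

text \<open>Left multiplication by an affine map does not change \<open>nonlin \<psi>\<close>, the only way
  in which \<open>\<psi>\<close> enters.\<close>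

lemma dop_affine_left:
  assumes "s > 0" "\<psi> \<in> Diff" "f \<in> CinfFM"
  shows "dop h (aff s b \<circ> \<psi>) f = dop h \<psi> f"
  using assms(3)
proof (induction h arbitrary: f rule: H1_induct)
  note A = aff_Diff[OF assms(1), of b]
  note D = Diff_comp[OF assms(2) A]
  {
    case delta1
    have "D_fun (aff s b \<circ> \<psi>) f = D_fun \<psi> f"
      by (auto simp: D_fun_def fun_eq_iff nonlin_comp[OF assms(2) A])
    then show ?case by (simp only: dop_rules D assms delta1)
  next
    case (add h k)
    then show ?case by (simp only: dop_add)
  next
    case (scale h c)
    then show ?case by (simp only: dop_scale)
  next
    case (mult h k)
    show ?case
      by (simp only: dop_rules D assms mult.prems mult.IH(2) mult.IH(1)[OF dop_CinfFM[OF assms(2) mult.prems]])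
  }
qed (simp_all only: dop_rules Diff_comp[OF assms(2) aff_Diff[OF assms(1), of b]] assms)

text \<open>The affine group of the line is simply transitive on its frames.\<close>

lemma affine_transitive:
  assumes "p \<in> FM" "q \<in> FM"
  obtains s b where "s > 0" "lift_diff (aff s b) p = q"
proof -
  obtain x y x' y' where p: "p = (x, y)" "q = (x', y')" by (cases p, cases q) auto
  then have "y > 0" "y' > 0" using assms by auto
  then show ?thesis using that[of "y' / y" "x' - y' / y * x"]
    by (simp add: p lift_diff_def deriv_aff) (simp add: aff_def)
qed

text \<open>A product \<open>w c\<close> with a monomial \<open>c = g
  U\<^sup>*\<^bsub>\<eta>\<^esub>\<close> has a single summand at
  \<open>U\<^sup>*\<^bsub>\<eta>\<phi>\<^esub>\<close>, so the hypothesis is a pointwise identity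
  between \<open>w\<^sub>i(p)\<close> at \<open>p\<close> and \<open>m\<^sub>i(g)\<close> at the
  image of \<open>p\<close>. Moving the latter point by affine maps, with which the operators
  \<open>m\<^sub>i\<close> commute, frees it from \<open>p\<close>. The numbers
  \<open>w\<^sub>i(p)\<close> then are the constant coefficients of a relation between the
  operators.\<close>

lemma annihilated_combination:
  assumes "finite I" "\<And>i. i \<in> I \<Longrightarrow> w i \<in> At"
    and null: "\<And>c \<theta> p. c \<in> At \<Longrightarrow> (\<Sum>i\<in>I. fm_mult (w i) (Rep_H1 (m i) c) \<theta> p) = 0"
  shows "(\<Sum>i\<in>I. h_scale (w i \<phi> p) (m i)) = 0"
proof (cases "\<phi> \<in> Diff \<and> p \<in> FM")
  case False
  have "w i \<phi> p = 0" if "i \<in> I" for i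
  proof (cases "\<phi> \<in> Diff")
    case True
    then show ?thesis using False CcFM_CinfFM[OF At_mem[OF assms(2)[OF that]], of \<phi>] unfolding CinfFM_def by blast
  next
    case False
    then have "w i \<phi> = 0" using At_Diff[OF assms(2)[OF that]] by blast
    then show ?thesis by simp
  qed
  then show ?thesis by simp
next
  case True
  show ?thesis
  proof (rule H1_eqI, unfold dop_zero_H1, rule CinfFM_eqI)
    fix \<psi> f q assume \<psi>: "\<psi> \<in> Diff" and f: "f \<in> CcFM" and q: "q \<in> FM"
    have "lift_diff \<phi> p \<in> FM" using True by simp
    then obtain s b where sb: "s > 0" "lift_diff (aff s b) (lift_diff \<phi> p) = q" using q by (rule affine_transitive)
    \<comment> \<open>The affine map \<open>\<alpha>\<close> sends the image of \<open>p\<close> to the given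
      point \<open>q\<close>; the monomial is chosen such that \<open>m\<^sub>i\<close> takes at
      the image of \<open>p\<close> the value of \<open>m\<^sub>i(f)\<close> at \<open>q\<close>.\<close>
    define \<alpha> where "\<alpha> = aff s b"
    have \<alpha>: "\<alpha> \<in> Diff" unfolding \<alpha>_def by (rule aff_Diff[OF sb(1)])
    define \<eta> where "\<eta> = \<psi> \<circ> \<alpha>"
    define g where "g = f \<circ> lift_diff \<alpha>"
    have \<eta>: "\<eta> \<in> Diff" and g: "g \<in> CcFM" unfolding \<eta>_def g_def using \<psi> \<alpha> f by (auto intro: CcFM_lift)
    have c: "single \<eta> g \<in> At" by (rule single_At[OF \<eta> g])
    have "fm_mult (w i) (Rep_H1 (m i) (single \<eta> g)) (\<eta> \<circ> \<phi>) p = w i \<phi> p * dop (m i) \<psi> f q" if i: "i \<in> I" for i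
    proof -
      note S = supp_At(1,2)[OF assms(2)[OF i]]
      have \<phi>D: "\<phi> \<in> Diff" using True by blast
      have "fm_mult (w i) (Rep_H1 (m i) (single \<eta> g)) (\<eta> \<circ> \<phi>) p =
         (\<Sum>\<zeta>\<in>insert \<phi> (supp (w i)). w i \<zeta> p * Rep_H1 (m i) (single \<eta> g) (\<eta> \<circ> \<phi> \<circ> inv \<zeta>) (lift_diff \<zeta> p))"
        by (rule fm_mult_apply) (use S True in auto)
      also have "\<dots> = (\<Sum>\<zeta>\<in>insert \<phi> (supp (w i)). if \<zeta> = \<phi> then w i \<phi> p * dop (m i) \<eta> g (lift_diff \<phi> p) else 0)"
      proof (rule sum.cong[OF refl])
        fix \<zeta> assume "\<zeta> \<in> insert \<phi> (supp (w i))"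
        then have \<zeta>: "\<zeta> \<in> Diff" using True S(2) by auto
        have "\<eta> \<circ> \<phi> \<circ> inv \<zeta> = \<eta> \<longleftrightarrow> \<zeta> = \<phi>"
        proof
          assume "\<eta> \<circ> \<phi> \<circ> inv \<zeta> = \<eta>"
          then have "\<eta> \<circ> \<phi> = \<eta> \<circ> \<zeta>" using Diff_comp_cancel[OF \<zeta>, of \<eta> "\<eta> \<circ> \<phi>"] by simp
          then have "inv \<eta> \<circ> (\<eta> \<circ> \<phi>) = inv \<eta> \<circ> (\<eta> \<circ> \<zeta>)" by simp
          then show "\<zeta> = \<phi>" using \<eta> by (simp add: comp_assoc[symmetric])
        next
          assume "\<zeta> = \<phi>"
          then show "\<eta> \<circ> \<phi> \<circ> inv \<zeta> = \<eta>" using \<phi>D by (simp add: comp_assoc)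
        qed
        note iff = this
        show "w i \<zeta> p * Rep_H1 (m i) (single \<eta> g) (\<eta> \<circ> \<phi> \<circ> inv \<zeta>) (lift_diff \<zeta> p) =
            (if \<zeta> = \<phi> then w i \<phi> p * dop (m i) \<eta> g (lift_diff \<phi> p) else 0)"
        proof (cases "\<zeta> = \<phi>")
          case True
          then have e: "\<eta> \<circ> \<phi> \<circ> inv \<zeta> = \<eta>" using iff by blast
          show ?thesis unfolding Rep_H1_apply[OF c] e by (simp add: True)
        next
          case False
          then have "single \<eta> g (\<eta> \<circ> \<phi> \<circ> inv \<zeta>) = 0" using iff by (simp add: single_def)
          then show ?thesis using False by (simp add: Rep_H1_apply[OF c])
        qed
      qed
      also have "\<dots> = w i \<phi> p * dop (m i) \<eta> g (lift_diff \<phi> p)"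
        using S(1) by simp
      also have "dop (m i) \<eta> g (lift_diff \<phi> p) = dop (m i) \<psi> f q"
        using dop_affine_right[OF sb(1) \<psi> CcFM_CinfFM[OF f], of "m i" b] sb(2) by (simp add: \<eta>_def g_def \<alpha>_def)
      finally show ?thesis .
    qed
    then have "(\<Sum>i\<in>I. w i \<phi> p * dop (m i) \<psi> f q) = 0" using null[OF c, of "\<eta> \<circ> \<phi>" p] by simp
    then show "dop (\<Sum>i\<in>I. h_scale (w i \<phi> p) (m i)) \<psi> f q = 0 q"
      by (simp add: dop_sum sum_fun_apply dop_scale)
  qed (auto intro: dop_CinfFM CcFM_CinfFM)
qed

lemma fm_mult_scale: "a \<in> At \<Longrightarrow> fm_mult (fm_scale c a) b \<theta> p = c * fm_mult a b \<theta> p"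
  using fm_mult_linear_left[of "{()}" "\<lambda>_. a" "\<lambda>_. c"] by simp

text \<open>Expand the right factors in a basis of \<open>H1\<close>. By
  \<open>annihilated_combination\<close> the values of the left factors are, at every point, the
  coefficients of a relation between the right factors. Comparing coordinates shows that the
  combination of left factors attached to each basis vector acts as zero, hence is zero.\<close>

lemma tensor_separation:
  assumes G: "bilin G" and null: "\<And>a b \<theta> p. a \<in> At \<Longrightarrow> b \<in> At \<Longrightarrow> tensor_eval (pair_eval a b \<theta> p) r = 0"
  shows "tensor_eval G r = 0"
proof -
  define I where "I = Poly_Mapping.keys r"
  define R where "R = Poly_Mapping.lookup r"
  define B where "B = H1v.extend_basis {}"
  define rep where "rep = H1v.representation B"
  have I: "finite I" by (simp add: I_def)
  have B: "H1v.independent B" "H1v.span B = UNIV"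
    unfolding B_def by (simp_all add: H1v.independent_extend_basis H1v.span_extend_basis H1v.independent_empty)
  have tI: "tensor_eval F r = (\<Sum>x\<in>I. R x * F (fst x) (snd x))" for F
    unfolding I_def R_def by (rule tensor_eval_superset) auto
  \<comment> \<open>For fixed \<open>a\<close> and a fixed point, the second factors satisfy a linear relation.\<close>
  have 1: "(\<Sum>x\<in>I. h_scale (R x * Rep_H1 (fst x) a \<phi> p) (snd x)) = 0" if a: "a \<in> At" for a \<phi> p
  proof -
    have "(\<Sum>x\<in>I. h_scale (fm_scale (R x) (Rep_H1 (fst x) a) \<phi> p) (snd x)) = 0"
    proof (rule annihilated_combination[OF I, where w = "\<lambda>x. fm_scale (R x) (Rep_H1 (fst x) a)" and m = snd])
      show "fm_scale (R x) (Rep_H1 (fst x) a) \<in> At" for x by (intro At_ops Rep_At a)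
      fix c \<theta> p assume "c \<in> At"
      from null[OF a this] show "(\<Sum>x\<in>I. fm_mult (fm_scale (R x) (Rep_H1 (fst x) a)) (Rep_H1 (snd x) c) \<theta> p) = 0"
        by (simp add: tI pair_eval_def fm_mult_scale Rep_At a)
    qed
    then show ?thesis by (simp add: fm_scale_def)
  qed
  \<comment> \<open>The coordinate of this relation at a basis vector \<open>b\<close>, read as an identity of
    operators in \<open>a\<close>.\<close>
  have 2: "(\<Sum>x\<in>I. h_scale (R x * rep (snd x) b) (fst x)) = 0" for b
  proof (rule H1_eqI, unfold dop_zero_H1, rule ext)
    fix \<phi> f p assume "\<phi> \<in> Diff" "f \<in> CcFM"
    then have s: "single \<phi> f \<in> At" by (rule single_At)
    have "0 = rep (\<Sum>x\<in>I. h_scale (R x * Rep_H1 (fst x) (single \<phi> f) \<phi> p) (snd x)) b"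
      unfolding 1[OF s] by (simp add: rep_def H1v.representation_zero)
    also have "\<dots> = (\<Sum>x\<in>I. R x * Rep_H1 (fst x) (single \<phi> f) \<phi> p * rep (snd x) b)"
      unfolding rep_def by (simp add: H1v.representation_sum[OF B(1)] H1v.representation_scale[OF B(1)] B(2))
    also have "\<dots> = dop (\<Sum>x\<in>I. h_scale (R x * rep (snd x) b) (fst x)) \<phi> f p"
      by (simp add: dop_sum dop_scale sum_fun_apply Rep_H1_apply[OF s] mult_ac)
    finally show "dop (\<Sum>x\<in>I. h_scale (R x * rep (snd x) b) (fst x)) \<phi> f p = 0 p" by simp
  qed
  define C where "C = (\<Union>x\<in>I. {b. rep (snd x) b \<noteq> 0})"
  have C: "finite C" unfolding C_def rep_def using I H1v.finite_representation by auto
  have 3: "(\<Sum>b\<in>C. h_scale (rep (snd x) b) b) = snd x" if "x \<in> I" for x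
  proof -
    have "(\<Sum>b\<in>C. h_scale (rep (snd x) b) b) = (\<Sum>b | rep (snd x) b \<noteq> 0. h_scale (rep (snd x) b) b)"
      by (rule sum.mono_neutral_right[OF C]) (use that in \<open>auto simp: C_def\<close>)
    also have "\<dots> = snd x" unfolding rep_def by (rule H1v.sum_nonzero_representation_eq[OF B(1)]) (simp add: B(2))
    finally show ?thesis .
  qed
  have "tensor_eval G r = (\<Sum>x\<in>I. R x * (\<Sum>b\<in>C. rep (snd x) b * G (fst x) b))"
    unfolding tI by (rule sum.cong[OF refl]) (simp add: lin_sum[OF bilinD(1)[OF G] C, symmetric] 3)
  also have "\<dots> = (\<Sum>b\<in>C. \<Sum>x\<in>I. (R x * rep (snd x) b) * G (fst x) b)"
    unfolding sum_distrib_left by (subst sum.swap) (simp add: mult.assoc)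
  also have "\<dots> = (\<Sum>b\<in>C. G (\<Sum>x\<in>I. h_scale (R x * rep (snd x) b) (fst x)) b)"
    by (simp add: lin_sum[OF bilinD(2)[OF G] I])
  also have "\<dots> = 0" unfolding 2 by (simp add: lin_zero[OF bilinD(2)[OF G]])
  finally show ?thesis .
qed

section \<open>Sums over the coproduct\<close>

text \<open>In Sweedler notation, \<open>G(h\<^sub>(\<^sub>1\<^sub>), h\<^sub>(\<^sub>2\<^sub>))\<close>.\<close>

definition cop_sum :: "H1 \<Rightarrow> (H1 \<Rightarrow> H1 \<Rightarrow> complex) \<Rightarrow> complex" where
  "cop_sum h G = tensor_eval G (coproduct h)"

text \<open>The sum over the coproduct of a bilinear form does not depend on the chosen representative, by
  \<open>tensor_separation\<close>.\<close>

lemma cop_sum_eq: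
  assumes "bilin G" "is_coproduct h t"
  shows "cop_sum h G = tensor_eval G t"
proof -
  have "tensor_eval G (coproduct h - t) = 0"
    by (rule tensor_separation[OF assms(1)])
       (simp only: tensor_eval_diff assms(2)[unfolded is_coproduct_iff, rule_format, symmetric]
         is_coproduct_coproduct[unfolded is_coproduct_iff, rule_format, symmetric] diff_self)
  then show ?thesis by (simp add: cop_sum_def tensor_eval_diff)
qed

lemma cop_sum_rules:
  assumes "bilin G"
  shows "cop_sum 1 G = G 1 1" "cop_sum X1 G = G X1 1 + G 1 X1 + G delta1 Y1" "cop_sum Y1 G = G Y1 1 + G 1 Y1"
    "cop_sum delta1 G = G delta1 1 + G 1 delta1" "cop_sum (h + k) G = cop_sum h G + cop_sum k G" "cop_sum (h_scale c h) G = c * cop_sum h G"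
    "cop_sum (h * k) G = cop_sum h (\<lambda>a b. cop_sum k (\<lambda>c d. G (a * c) (b * d)))"
  using cop_sum_eq[OF assms is_coproduct_1] cop_sum_eq[OF assms is_coproduct_X] cop_sum_eq[OF assms is_coproduct_Y]
    cop_sum_eq[OF assms is_coproduct_delta1]
    cop_sum_eq[OF assms is_coproduct_add[OF is_coproduct_coproduct is_coproduct_coproduct], of h k]
    cop_sum_eq[OF assms is_coproduct_scale[OF is_coproduct_coproduct], of c h]
    cop_sum_eq[OF assms is_coproduct_mult[OF is_coproduct_coproduct is_coproduct_coproduct], of h k]
  by (simp_all add: tensor_eval_add tensor_eval_single tensor_eval_scale tensor_eval_tensor_mult cop_sum_def)

lemma cop_sum_linear:
  "cop_sum h (\<lambda>a b. G a b + G' a b) = cop_sum h G + cop_sum h G'" "cop_sum h (\<lambda>a b. c * G a b) = c * cop_sum h G"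
  "cop_sum h (\<lambda>a b. G a b * c) = cop_sum h G * c" "cop_sum h (\<lambda>a b. - G a b) = - cop_sum h G"
  by (simp_all add: cop_sum_def tensor_eval_def case_prod_unfold distrib_left sum.distrib sum_distrib_left sum_distrib_right mult_ac sum_negf)

lemma cop_sum_swap: "cop_sum h (\<lambda>a b. cop_sum k (\<lambda>c d. F a b c d)) = cop_sum k (\<lambda>c d. cop_sum h (\<lambda>a b. F a b c d))"
  unfolding cop_sum_def tensor_eval_def case_prod_unfold sum_distrib_left
  by (subst sum.swap) (simp add: mult.left_commute)

lemma lin_eps: "lin eps" and lin_omega: "lin omega" and lin_xi: "lin (xi z)"
  by (auto simp: lin_def eps_rules omega_rules xi_rules)

lemma lin_intros:
  "lin F \<Longrightarrow> lin (\<lambda>k. F (k * l))" "lin F \<Longrightarrow> lin (\<lambda>k. F (l * k))" "lin F \<Longrightarrow> lin (\<lambda>k. c * F k)" "lin F \<Longrightarrow> lin (\<lambda>k. F k * c)"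
  "lin F \<Longrightarrow> lin F' \<Longrightarrow> lin (\<lambda>k. F k + F' k)" "lin (\<lambda>k. 0)"
  by (auto simp: lin_def H1_mult algebra_simps)

lemma lin_sum_fun: "(\<And>i. i \<in> I \<Longrightarrow> lin (F i)) \<Longrightarrow> lin (\<lambda>k. \<Sum>i\<in>I. F i k)"
  by (induction I rule: infinite_finite_induct) (auto simp: lin_intros)

lemma lin_cop_sum: "(\<And>a b. lin (\<lambda>k. G k a b)) \<Longrightarrow> lin (\<lambda>k. cop_sum h (G k))"
  unfolding cop_sum_def tensor_eval_def case_prod_unfold by (intro lin_sum_fun lin_intros)

lemma lin_cop_sum_left: "bilin G \<Longrightarrow> lin (\<lambda>k. cop_sum k G)"
  by (auto simp: lin_def cop_sum_rules)

text \<open>As all sums over the coproduct are multiplicative in the sense of the last of the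
  \<open>cop_sum_rules\<close>, the axioms of a bialgebra only have to be checked on the
  generators.\<close>

lemma counit_left: "lin F \<Longrightarrow> cop_sum h (\<lambda>a b. eps a * F b) = F h"
proof (induction h arbitrary: F rule: H1_induct)
  case (mult h k)
  have b: "bilin (\<lambda>a b. eps a * F b)" by (intro bilinI lin_intros lin_eps mult.prems)
  have "cop_sum (h * k) (\<lambda>a b. eps a * F b) = cop_sum h (\<lambda>a b. eps a * cop_sum k (\<lambda>c d. eps c * F (b * d)))"
    by (simp add: cop_sum_rules[OF b] eps_rules cop_sum_linear(2)[symmetric] mult.assoc)
  also have "\<dots> = cop_sum h (\<lambda>a b. eps a * F (b * k))"
    by (subst mult.IH(2)) (rule lin_intros mult.prems refl)+
  also have "\<dots> = F (h * k)"
    by (rule mult.IH(1)) (rule lin_intros mult.prems)+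
  finally show ?case .
qed (subst cop_sum_rules, (intro bilinI lin_intros lin_eps; assumption), simp add: eps_rules linD lin_zero)+

lemma counit_right: "lin F \<Longrightarrow> cop_sum h (\<lambda>a b. F a * eps b) = F h"
proof (induction h arbitrary: F rule: H1_induct)
  case (mult h k)
  have b: "bilin (\<lambda>a b. F a * eps b)" by (intro bilinI lin_intros lin_eps mult.prems)
  have "cop_sum (h * k) (\<lambda>a b. F a * eps b) = cop_sum h (\<lambda>a b. cop_sum k (\<lambda>c d. F (a * c) * eps d) * eps b)"
  proof -
    have e: "F (a * c) * eps (b * d) = (F (a * c) * eps d) * eps b" for a b c d by (simp add: eps_rules)
    show ?thesis unfolding cop_sum_rules(7)[OF b] e cop_sum_linear(3) by (rule refl)
  qed
  also have "\<dots> = cop_sum h (\<lambda>a b. F (a * k) * eps b)"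
    by (subst mult.IH(2)) (rule lin_intros mult.prems refl)+
  also have "\<dots> = F (h * k)"
    by (rule mult.IH(1)) (rule lin_intros mult.prems)+
  finally show ?case .
qed (subst cop_sum_rules, (intro bilinI lin_intros lin_eps; assumption), simp add: eps_rules linD lin_zero)+

lemma coassoc:
  assumes "\<And>a b. lin (\<lambda>c. G a b c)" "\<And>a c. lin (\<lambda>b. G a b c)" "\<And>b c. lin (\<lambda>a. G a b c)"
  shows "cop_sum h (\<lambda>u c. cop_sum u (\<lambda>a b. G a b c)) = cop_sum h (\<lambda>a u. cop_sum u (\<lambda>b c. G a b c))"
  using assms
proof (induction h arbitrary: G rule: H1_induct)
  case (mult h k)
  have b0: "bilin (\<lambda>a b. G a b c)" "bilin (\<lambda>b c. G a b c)" for a c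
    using mult.prems by (auto intro: bilinI)
  have b1: "bilin (\<lambda>u c. cop_sum u (\<lambda>a b. G a b c))"
    by (intro bilinI lin_cop_sum lin_cop_sum_left b0 mult.prems)
  have b2: "bilin (\<lambda>a u. cop_sum u (\<lambda>b c. G a b c))"
    by (intro bilinI lin_cop_sum lin_cop_sum_left b0 mult.prems)
  have 1: "cop_sum k (\<lambda>u2 c2. cop_sum u1 (\<lambda>a1 b1. cop_sum u2 (\<lambda>a2 b2. G (a1 * a2) (b1 * b2) (c1 * c2))))
      = cop_sum u1 (\<lambda>a1 b1. cop_sum k (\<lambda>a2 u2. cop_sum u2 (\<lambda>b2 c2. G (a1 * a2) (b1 * b2) (c1 * c2))))" for u1 c1
    by (subst cop_sum_swap, subst mult.IH(2)) (rule refl lin_intros mult.prems)+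
  have 2: "cop_sum k (\<lambda>a2 u2. cop_sum u1 (\<lambda>b1 c1. cop_sum u2 (\<lambda>b2 c2. G (a1 * a2) (b1 * b2) (c1 * c2))))
      = cop_sum u1 (\<lambda>b1 c1. cop_sum k (\<lambda>a2 u2. cop_sum u2 (\<lambda>b2 c2. G (a1 * a2) (b1 * b2) (c1 * c2))))" for u1 a1
    by (rule cop_sum_swap)
  have "cop_sum (h * k) (\<lambda>u c. cop_sum u (\<lambda>a b. G a b c))
      = cop_sum h (\<lambda>u1 c1. cop_sum u1 (\<lambda>a1 b1. cop_sum k (\<lambda>a2 u2. cop_sum u2 (\<lambda>b2 c2. G (a1 * a2) (b1 * b2) (c1 * c2)))))"
    unfolding cop_sum_rules(7)[OF b1] cop_sum_rules(7)[OF b0(1)] 1 ..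
  also have "\<dots> = cop_sum h (\<lambda>a1 u1. cop_sum u1 (\<lambda>b1 c1. cop_sum k (\<lambda>a2 u2. cop_sum u2 (\<lambda>b2 c2. G (a1 * a2) (b1 * b2) (c1 * c2)))))"
  proof (rule mult.IH(1))
    show "lin (\<lambda>c1. cop_sum k (\<lambda>a2 u2. cop_sum u2 (\<lambda>b2 c2. G (a1 * a2) (b1 * b2) (c1 * c2))))" for a1 b1
      by (intro lin_cop_sum lin_intros(1)[OF mult.prems(1)])
    show "lin (\<lambda>b1. cop_sum k (\<lambda>a2 u2. cop_sum u2 (\<lambda>b2 c2. G (a1 * a2) (b1 * b2) (c1 * c2))))" for a1 c1
      by (intro lin_cop_sum lin_intros(1)[OF mult.prems(2)])
    show "lin (\<lambda>a1. cop_sum k (\<lambda>a2 u2. cop_sum u2 (\<lambda>b2 c2. G (a1 * a2) (b1 * b2) (c1 * c2))))" for b1 c1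
      by (intro lin_cop_sum lin_intros(1)[OF mult.prems(3)])
  qed
  also have "\<dots> = cop_sum (h * k) (\<lambda>a u. cop_sum u (\<lambda>b c. G a b c))"
    unfolding cop_sum_rules(7)[OF b2] cop_sum_rules(7)[OF b0(2)] 2 ..
  finally show ?case .
next
  case one
  have b0: "bilin (\<lambda>a b. G a b c)" "bilin (\<lambda>b c. G a b c)" for a c
    using one.prems by (auto intro: bilinI)
  have b1: "bilin (\<lambda>u c. cop_sum u (\<lambda>a b. G a b c))" "bilin (\<lambda>a u. cop_sum u (\<lambda>b c. G a b c))"
    by (intro bilinI lin_cop_sum lin_cop_sum_left b0 one.prems)+
  show ?case by (simp add: cop_sum_rules[OF b1(1)] cop_sum_rules[OF b1(2)] cop_sum_rules[OF b0(1)] cop_sum_rules[OF b0(2)])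
next
  case X
  have b0: "bilin (\<lambda>a b. G a b c)" "bilin (\<lambda>b c. G a b c)" for a c
    using X.prems by (auto intro: bilinI)
  have b1: "bilin (\<lambda>u c. cop_sum u (\<lambda>a b. G a b c))" "bilin (\<lambda>a u. cop_sum u (\<lambda>b c. G a b c))"
    by (intro bilinI lin_cop_sum lin_cop_sum_left b0 X.prems)+
  show ?case by (simp add: cop_sum_rules[OF b1(1)] cop_sum_rules[OF b1(2)] cop_sum_rules[OF b0(1)] cop_sum_rules[OF b0(2)])
next
  case Y
  have b0: "bilin (\<lambda>a b. G a b c)" "bilin (\<lambda>b c. G a b c)" for a c
    using Y.prems by (auto intro: bilinI)
  have b1: "bilin (\<lambda>u c. cop_sum u (\<lambda>a b. G a b c))" "bilin (\<lambda>a u. cop_sum u (\<lambda>b c. G a b c))"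
    by (intro bilinI lin_cop_sum lin_cop_sum_left b0 Y.prems)+
  show ?case by (simp add: cop_sum_rules[OF b1(1)] cop_sum_rules[OF b1(2)] cop_sum_rules[OF b0(1)] cop_sum_rules[OF b0(2)])
next
  case delta1
  have b0: "bilin (\<lambda>a b. G a b c)" "bilin (\<lambda>b c. G a b c)" for a c
    using delta1.prems by (auto intro: bilinI)
  have b1: "bilin (\<lambda>u c. cop_sum u (\<lambda>a b. G a b c))" "bilin (\<lambda>a u. cop_sum u (\<lambda>b c. G a b c))"
    by (intro bilinI lin_cop_sum lin_cop_sum_left b0 delta1.prems)+
  show ?case by (simp add: cop_sum_rules[OF b1(1)] cop_sum_rules[OF b1(2)] cop_sum_rules[OF b0(1)] cop_sum_rules[OF b0(2)])
next
  case (add h k)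
  have b0: "bilin (\<lambda>a b. G a b c)" "bilin (\<lambda>b c. G a b c)" for a c
    using add.prems by (auto intro: bilinI)
  have b1: "bilin (\<lambda>u c. cop_sum u (\<lambda>a b. G a b c))" "bilin (\<lambda>a u. cop_sum u (\<lambda>b c. G a b c))"
    by (intro bilinI lin_cop_sum lin_cop_sum_left b0 add.prems)+
  show ?case by (simp add: cop_sum_rules[OF b1(1)] cop_sum_rules[OF b1(2)] add)
next
  case (scale h k)
  have b0: "bilin (\<lambda>a b. G a b c)" "bilin (\<lambda>b c. G a b c)" for a c
    using scale.prems by (auto intro: bilinI)
  have b1: "bilin (\<lambda>u c. cop_sum u (\<lambda>a b. G a b c))" "bilin (\<lambda>a u. cop_sum u (\<lambda>b c. G a b c))"
    by (intro bilinI lin_cop_sum lin_cop_sum_left b0 scale.prems)+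
  show ?case by (simp add: cop_sum_rules[OF b1(1)] cop_sum_rules[OF b1(2)] scale)
qed

lemma lin_dop: "lin (\<lambda>h. dop h \<phi> f p)"
  by (simp add: lin_def dop_add dop_scale)

text \<open>The evaluations of \<open>dop\<close> at points are linear forms that separate the elements of
  \<open>H1\<close>.\<close>

lemma H1_eq_lin:
  assumes "\<And>F. lin F \<Longrightarrow> F h = F k"
  shows "h = k"
  by (rule H1_eqI) (rule ext, rule assms[OF lin_dop])

text \<open>Turns the sums in \<open>H1\<close> that occur in the definition of the antipode into sums of
  numbers.\<close>

lemma lin_coproduct_sum:
  assumes "lin F"
  shows "F (\<Sum>(k, l)\<in>Poly_Mapping.keys (coproduct h). h_scale (Poly_Mapping.lookup (coproduct h) (k, l)) (E k l)) = cop_sum h (\<lambda>k l. F (E k l))"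
  unfolding cop_sum_def tensor_eval_def case_prod_unfold by (rule lin_sum[OF assms]) simp

section \<open>Transposed operators with respect to a Haar measure\<close>

lemma integral_of_support:
  fixes G :: "'a::euclidean_space \<Rightarrow> 'b::banach"
  assumes "continuous_on (cbox a b) G" "\<And>p. p \<notin> cbox a b \<Longrightarrow> G p = 0"
  shows "G integrable_on UNIV" "integral UNIV G = integral (cbox a b) G"
proof -
  have "(G has_integral integral (cbox a b) G) UNIV"
    by (rule has_integral_on_superset[OF integrable_integral[OF integrable_continuous[OF assms(1)]]]) (use assms(2) in auto)
  then show "G integrable_on UNIV" "integral UNIV G = integral (cbox a b) G" by blast+
qed

text \<open>The integral for \<open>dx dy / y\<close>, which is invariant under the flows of both
  \<open>X\<close> and \<open>Y\<close>. With this measure \<open>X\<close> and \<open>Y\<close>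
  are skew-symmetric (\<open>haar_by_parts\<close>).\<close>

definition haar :: "(real \<times> real \<Rightarrow> complex) \<Rightarrow> complex" where
  "haar F = integral UNIV (\<lambda>p. F p / complex_of_real (snd p))"

lemma CcFM_box:
  assumes "F \<in> CcFM"
  obtains r e where "0 < e" "e < r" "\<And>p. p \<notin> cbox (-r, e) (r, r) \<Longrightarrow> F p = 0"
proof -
  obtain K where K: "compact K" "K \<subseteq> FM" "\<And>p. p \<notin> K \<Longrightarrow> F p = 0" using CcFM_E[OF assms] by metis
  obtain r e where "0 < e" "e < r" "K \<subseteq> {-r..r} \<times> {e..r}" by (rule compact_FM_box[OF K(1,2)])
  then show ?thesis using that[of e r] K(3) by (auto simp: cbox_Pair_eq)
qed

lemma haar_integrable:
  assumes "F \<in> CcFM"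
  shows "(\<lambda>p. F p / complex_of_real (snd p)) integrable_on UNIV"
proof -
  obtain r e where re: "0 < e" "e < r" "\<And>p. p \<notin> cbox (-r, e) (r, r) \<Longrightarrow> F p = 0" by (rule CcFM_box[OF assms]) blast
  have "continuous_on (cbox (-r, e) (r, r)) (\<lambda>p. F p / complex_of_real (snd p))"
    using re(1) smooth_on_imp_continuous[OF CcFM_smooth_UNIV[OF assms]]
    by (auto intro!: continuous_intros elim: continuous_on_subset simp: cbox_Pair_eq)
  then show ?thesis
    by (rule integral_of_support(1)) (simp add: re(3))
qed

lemma haar_linear:
  assumes "F \<in> CcFM" "G \<in> CcFM"
  shows "haar (\<lambda>p. F p + G p) = haar F + haar G" "haar (\<lambda>p. c * F p) = c * haar F"
proof -
  show "haar (\<lambda>p. F p + G p) = haar F + haar G"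
    unfolding haar_def add_divide_distrib by (rule integral_add[OF haar_integrable haar_integrable]) fact+
  show "haar (\<lambda>p. c * F p) = c * haar F"
    unfolding haar_def times_divide_eq_right[symmetric] by (rule integral_mult_right)
qed

text \<open>In each case the density \<open>1 / y\<close> cancels the factor \<open>y\<close>, and one of
  the two iterated integrals is that of the derivative of a compactly supported function.\<close>

lemma haar_XY:
  assumes "F \<in> CcFM"
  shows "haar (X_fun F) = 0" "haar (Y_fun F) = 0"
proof -
  note s = CcFM_smooth_UNIV[OF assms]
  obtain r e where re: "0 < e" "e < r" "\<And>p. p \<notin> cbox (-r, e) (r, r) \<Longrightarrow> F p = 0" by (rule CcFM_box[OF assms]) blast
  define G1 where "G1 = (\<lambda>p. frechet_derivative F (at p) (1, 0))"
  define G2 where "G2 = (\<lambda>p. frechet_derivative F (at p) (0, 1))"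
  note d = smooth_on_has_derivative[OF s UNIV_I]
  have d1: "((\<lambda>t. F (t, y)) has_vector_derivative G1 (x, y)) (at x)" for x y
    unfolding G1_def by (rule has_vector_derivative_slices(1)[OF d])
  have d2: "((\<lambda>t. F (x, t)) has_vector_derivative G2 (x, y)) (at y)" for x y
    unfolding G2_def by (rule has_vector_derivative_slices(2)[OF d])
  have c: "continuous_on S G1" "continuous_on S G2" for S
    unfolding G1_def G2_def by (rule continuous_on_subset[OF smooth_on_imp_continuous[OF smooth_on_frechet[OF s]]], simp)+
  let ?B = "cbox (-r - 1, e / 2) (r + 1, r + 1)"
  have z: "G1 (x, y) = 0 \<and> G2 (x, y) = 0" if "(x, y) \<notin> cbox (-r, e) (r, r)" for x y
  proof -
    have o: "open (- cbox (-r, e) (r, r))" by (intro open_Compl closed_cbox)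
    have "(F has_derivative (\<lambda>_. 0)) (at (x, y))"
      by (rule has_derivative_transform_within_open[OF has_derivative_const o]) (use that re(3) in auto)
    then have "frechet_derivative F (at (x, y)) = (\<lambda>_. 0)" by (metis frechet_derivative_at)
    then show ?thesis by (simp add: G1_def G2_def)
  qed
  have out: "G1 p = 0 \<and> G2 p = 0" if "p \<notin> ?B" for p
    using z[of "fst p" "snd p"] that re(1) by (cases p) (auto simp: cbox_Pair_eq)
  have X: "X_fun F p / of_real (snd p) = G1 p" and Y: "Y_fun F p / of_real (snd p) = G2 p" for p
  proof -
    obtain x y where p: "p = (x, y)" by (cases p)
    have "X_fun F p = of_real y * G1 p" "Y_fun F p = of_real y * G2 p"
      using XY_fun_eqI[OF d, of x y] by (simp_all add: p G1_def G2_def)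
    moreover have "y = 0 \<Longrightarrow> G1 p = 0 \<and> G2 p = 0" using z[of x y] re(1) p by (auto simp: cbox_Pair_eq)
    ultimately show "X_fun F p / of_real (snd p) = G1 p" "Y_fun F p / of_real (snd p) = G2 p"
      by (cases "y = 0"; simp add: p)+
  qed
  have "haar (X_fun F) = integral ?B G1"
    unfolding haar_def X by (rule integral_of_support(2)[OF c(1)]) (use out in blast)
  also have "\<dots> = integral (cbox (-r - 1) (r + 1)) (\<lambda>x. integral (cbox (e / 2) (r + 1)) (\<lambda>y. G1 (x, y)))"
    by (rule integral_prod_continuous[OF c(1)])
  also have "\<dots> = integral (cbox (e / 2) (r + 1)) (\<lambda>y. integral (cbox (-r - 1) (r + 1)) (\<lambda>x. G1 (x, y)))"
    by (rule integral_swap_continuous) (use c(1) in simp)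
  also have "(\<lambda>y. integral (cbox (-r - 1) (r + 1)) (\<lambda>x. G1 (x, y))) = (\<lambda>y. 0)"
  proof
    fix y
    have "((\<lambda>x. G1 (x, y)) has_integral F (r + 1, y) - F (-r - 1, y)) {-r - 1..r + 1}"
      by (rule fundamental_theorem_of_calculus) (use re in \<open>auto intro: has_vector_derivative_at_within d1\<close>)
    then show "integral (cbox (-r - 1) (r + 1)) (\<lambda>x. G1 (x, y)) = 0"
      using re(3)[of "(r + 1, y)"] re(3)[of "(-r - 1, y)"] by (simp add: integral_unique cbox_Pair_eq)
  qed
  finally show "haar (X_fun F) = 0" by simp
  have "haar (Y_fun F) = integral ?B G2"
    unfolding haar_def Y by (rule integral_of_support(2)[OF c(2)]) (use out in blast)
  also have "\<dots> = integral (cbox (-r - 1) (r + 1)) (\<lambda>x. integral (cbox (e / 2) (r + 1)) (\<lambda>y. G2 (x, y)))"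
    by (rule integral_prod_continuous[OF c(2)])
  also have "(\<lambda>x. integral (cbox (e / 2) (r + 1)) (\<lambda>y. G2 (x, y))) = (\<lambda>x. 0)"
  proof
    fix x
    have "((\<lambda>y. G2 (x, y)) has_integral F (x, r + 1) - F (x, e / 2)) {e / 2..r + 1}"
      by (rule fundamental_theorem_of_calculus) (use re in \<open>auto intro: has_vector_derivative_at_within d2\<close>)
    then show "integral (cbox (e / 2) (r + 1)) (\<lambda>y. G2 (x, y)) = 0"
      using re(3)[of "(x, r + 1)"] re(3)[of "(x, e / 2)"] re(1) by (simp add: integral_unique cbox_Pair_eq)
  qed
  finally show "haar (Y_fun F) = 0" by simp
qed

text \<open>Test with \<open>y\<close> times the complex conjugate of \<open>g\<close>, which turns the
  integral into that of \<open>|g|\<^sup>2\<close> for the Lebesgue measure.\<close>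

lemma haar_nondegenerate:
  assumes g: "g \<in> CcFM" and null: "\<And>f. f \<in> CcFM \<Longrightarrow> haar (\<lambda>p. f p * g p) = 0"
  shows "g = 0"
proof -
  obtain r e where re: "0 < e" "e < r" "\<And>p. p \<notin> cbox (-r, e) (r, r) \<Longrightarrow> g p = 0" by (rule CcFM_box[OF g]) blast
  have "(\<lambda>p. of_real (snd p) * cnj (g p)) \<in> CcFM"
  proof -
    obtain K where K: "g \<in> CinfFM" "compact K" "K \<subseteq> FM" "\<And>p. p \<notin> K \<Longrightarrow> g p = 0" using CcFM_E[OF g] by metis
    have "smooth_on FM (\<lambda>p. cnj (g p))"
      by (rule smooth_on_linear_image[OF bounded_linear_cnj open_FM CinfFM_D(1)[OF K(1)]])
    then have "(\<lambda>p. cnj (g p)) \<in> CinfFM" using K(1) by (auto simp: CinfFM_def)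
    then have "(\<lambda>p. cnj (g p)) \<in> CcFM" by (rule CcFM_I[OF _ K(2,3)]) (simp add: K(4))
    then show ?thesis by (rule CcFM_ops(5)) (rule smooth_snd_complex)
  qed
  from null[OF this] have "integral UNIV (\<lambda>p. of_real (snd p) * cnj (g p) * g p / of_real (snd p)) = 0" by (simp add: haar_def)
  also have "(\<lambda>p. of_real (snd p) * cnj (g p) * g p / of_real (snd p)) = (\<lambda>p. complex_of_real ((cmod (g p))\<^sup>2))"
  proof
    fix p
    show "of_real (snd p) * cnj (g p) * g p / of_real (snd p) = complex_of_real ((cmod (g p))\<^sup>2)"
      using re(3)[of p] re(1) complex_norm_square[of "g p"]
      by (cases p; cases "snd p = 0") (auto simp: mult.commute cbox_Pair_eq)
  qed
  finally have i0: "integral UNIV (\<lambda>p. complex_of_real ((cmod (g p))\<^sup>2)) = 0" .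
  have cg: "continuous_on S g" for S
    by (rule continuous_on_subset[OF smooth_on_imp_continuous[OF CcFM_smooth_UNIV[OF g]]]) simp
  have c: "continuous_on S (\<lambda>p. complex_of_real ((cmod (g p))\<^sup>2))" "continuous_on S (\<lambda>p. (cmod (g p))\<^sup>2)" for S
    by (intro continuous_intros cg)+
  let ?B = "cbox (-r, e) (r, r)"
  have "integral UNIV (\<lambda>p. complex_of_real ((cmod (g p))\<^sup>2)) = integral ?B (\<lambda>p. complex_of_real ((cmod (g p))\<^sup>2))"
    by (rule integral_of_support(2)[OF c(1)]) (simp add: re(3))
  then have "integral ?B (\<lambda>p. complex_of_real ((cmod (g p))\<^sup>2)) = 0" using i0 by simp
  then have "integral ?B (Re \<circ> (\<lambda>p. complex_of_real ((cmod (g p))\<^sup>2))) = 0"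
    using integral_linear[OF integrable_continuous[OF c(1)] bounded_linear_Re, of "(-r, e)" "(r, r)"] by simp
  then have i: "integral ?B (\<lambda>p. (cmod (g p))\<^sup>2) = 0" by (simp add: o_def)
  have "box (-r, e) (r, r) \<noteq> {}"
    using re by (auto simp: box_ne_empty Basis_prod_def)
  from integral_cbox_eq_0_iff[OF c(2) this] i have "\<forall>p\<in>?B. (cmod (g p))\<^sup>2 = 0" by simp
  then have "g p = 0" if "p \<in> ?B" for p using that by simp
  then have "g p = 0" for p using re(3)[of p] by blast
  then show ?thesis by (simp add: fun_eq_iff del: split_paired_All)
qed

text \<open>The conjugate of the action of \<open>s\<close> by inversion in the groupoid of the action of
  the diffeomorphisms on \<open>FM\<close>, which exchanges the coefficients at
  \<open>\<phi>\<close> and \<open>\<phi>\<^sup>-\<^sup>1\<close>.\<close>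

definition Jdop :: "H1 \<Rightarrow> diff \<Rightarrow> (real \<times> real \<Rightarrow> complex) \<Rightarrow> real \<times> real \<Rightarrow> complex" where
  "Jdop s \<phi> g = dop s (inv \<phi>) (g \<circ> lift_diff (inv \<phi>)) \<circ> lift_diff \<phi>"

lemma Jdop_closed:
  assumes "\<phi> \<in> Diff"
  shows "g \<in> CcFM \<Longrightarrow> Jdop s \<phi> g \<in> CcFM" "g \<in> CinfFM \<Longrightarrow> Jdop s \<phi> g \<in> CinfFM"
  unfolding Jdop_def by (intro CcFM_lift CinfFM_lift dop_CcFM dop_CinfFM Diff_inv assms; assumption)+

text \<open>The lift of \<open>\<phi>\<close> turns \<open>X\<close> into \<open>X\<close> plus a multiple
  of \<open>Y\<close>, and inversion changes the sign of the cocycle \<open>nonlin\<close>.\<close>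

lemma Jdop_rules:
  assumes "\<phi> \<in> Diff" "g \<in> CinfFM"
  shows "Jdop 1 \<phi> g = g" "Jdop Y1 \<phi> g = Y_fun g" "Jdop delta1 \<phi> g = (\<lambda>p. - D_fun \<phi> g p)"
    "Jdop X1 \<phi> g = (\<lambda>p. X_fun g p - D_fun \<phi> (Y_fun g) p)" "Jdop (s * s') \<phi> g = Jdop s \<phi> (Jdop s' \<phi> g)"
    "Jdop (s + s') \<phi> g = (\<lambda>p. Jdop s \<phi> g p + Jdop s' \<phi> g p)" "Jdop (h_scale c s) \<phi> g = (\<lambda>p. c * Jdop s \<phi> g p)"
    "Jdop (- s) \<phi> g = (\<lambda>p. - Jdop s \<phi> g p)" "Jdop (s - s') \<phi> g = (\<lambda>p. Jdop s \<phi> g p - Jdop s' \<phi> g p)"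
proof -
  note I = Diff_inv[OF assms(1)]
  note gI = CinfFM_lift[OF assms(2) I]
  have c: "(u \<circ> lift_diff (inv \<phi>)) \<circ> lift_diff \<phi> = u" "(u \<circ> lift_diff \<phi>) \<circ> lift_diff (inv \<phi>) = u" for u :: "real \<times> real \<Rightarrow> complex"
    using assms(1) by (simp_all add: comp_assoc)
  have n: "deriv \<phi> x * nonlin (inv \<phi>) (\<phi> x) = - nonlin \<phi> x" for x
    using nonlin_inv[OF assms(1), of x] by (simp add: mult.commute)
  show "Jdop 1 \<phi> g = g" by (simp only: Jdop_def dop_rules[OF I gI] c)
  show "Jdop Y1 \<phi> g = Y_fun g"
  proof (rule CinfFM_eqI[OF Jdop_closed(2)[OF assms] CinfFM_XY(2)[OF assms(2)]])
    fix p assume p: "p \<in> FM"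
    then have q: "lift_diff \<phi> p \<in> FM" using assms(1) by simp
    show "Jdop Y1 \<phi> g p = Y_fun g p"
      using XY_lift(2)[OF assms(2) I q] assms(1) by (simp add: Jdop_def dop_rules[OF I gI])
  qed
  show "Jdop delta1 \<phi> g = (\<lambda>p. - D_fun \<phi> g p)"
  proof
    fix p :: "real \<times> real"
    obtain x y :: real where p: "p = (x, y)" by (cases p) auto
    have e: "deriv \<phi> x * y * nonlin (inv \<phi>) (\<phi> x) = - (y * nonlin \<phi> x)"
      using n[of x] by (simp add: mult.commute[of _ y] mult.assoc)
    have "Jdop delta1 \<phi> g p = of_real (deriv \<phi> x * y * nonlin (inv \<phi>) (\<phi> x)) * g (lift_diff (inv \<phi>) (lift_diff \<phi> p))"
      unfolding Jdop_def dop_rules[OF I gI] by (simp add: D_fun_def lift_diff_def[of \<phi>] p)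
    then show "Jdop delta1 \<phi> g p = - D_fun \<phi> g p"
      unfolding e using assms(1) by (simp add: p D_fun_def)
  qed
  show "Jdop X1 \<phi> g = (\<lambda>p. X_fun g p - D_fun \<phi> (Y_fun g) p)"
  proof (rule CinfFM_eqI)
    have "(\<lambda>p. X_fun g p + - 1 * D_fun \<phi> (Y_fun g) p) \<in> CinfFM"
      using CinfFM_add[OF CinfFM_XY(1)[OF assms(2)] CinfFM_scale[OF CinfFM_D_fun[OF CinfFM_XY(2)[OF assms(2)] assms(1)], of "-1"]]
      by (simp add: plus_fun_def)
    then show "(\<lambda>p. X_fun g p - D_fun \<phi> (Y_fun g) p) \<in> CinfFM" by simp
    fix p assume p: "p \<in> FM"
    then have q: "lift_diff \<phi> p \<in> FM" using assms(1) by simp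
    obtain x y where xy: "p = (x, y)" by (cases p)
    have "Jdop X1 \<phi> g p = X_fun g p + of_real (snd (lift_diff \<phi> p) * nonlin (inv \<phi>) (fst (lift_diff \<phi> p))) * Y_fun g p"
      using XY_lift(1)[OF assms(2) I q] assms(1) by (simp add: Jdop_def dop_rules[OF I gI])
    also have "snd (lift_diff \<phi> p) * nonlin (inv \<phi>) (fst (lift_diff \<phi> p)) = - (y * nonlin \<phi> x)"
      by (simp add: xy lift_diff_def mult.commute[of _ y] mult.assoc n)
    finally show "Jdop X1 \<phi> g p = X_fun g p - D_fun \<phi> (Y_fun g) p"
      by (simp add: xy D_fun_def)
  qed (rule Jdop_closed(2)[OF assms])
  show "Jdop (s * s') \<phi> g = Jdop s \<phi> (Jdop s' \<phi> g)"
    unfolding Jdop_def[of s'] unfolding Jdop_def c dop_rules(5)[OF I gI] ..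
  show "Jdop (s + s') \<phi> g = (\<lambda>p. Jdop s \<phi> g p + Jdop s' \<phi> g p)" "Jdop (h_scale c s) \<phi> g = (\<lambda>p. c * Jdop s \<phi> g p)"
    "Jdop (- s) \<phi> g = (\<lambda>p. - Jdop s \<phi> g p)" "Jdop (s - s') \<phi> g = (\<lambda>p. Jdop s \<phi> g p - Jdop s' \<phi> g p)"
    by (auto simp: Jdop_def dop_add dop_scale dop_uminus dop_diff)
qed

definition transposed :: "H1 \<Rightarrow> H1 \<Rightarrow> bool" where
  "transposed h s \<longleftrightarrow> (\<forall>\<phi>\<in>Diff. \<forall>f\<in>CcFM. \<forall>g\<in>CcFM. haar (\<lambda>p. dop h \<phi> f p * g p) = haar (\<lambda>p. f p * Jdop s \<phi> g p))"

lemma CcFM_mult: "f \<in> CcFM \<Longrightarrow> g \<in> CcFM \<Longrightarrow> (\<lambda>p. f p * g p) \<in> CcFM"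
  by (rule CcFM_ops(5)) (auto intro: CinfFM_D CcFM_CinfFM)

lemma haar_by_parts:
  assumes "f \<in> CcFM" "g \<in> CcFM"
  shows "haar (\<lambda>p. X_fun f p * g p) = - haar (\<lambda>p. f p * X_fun g p)" "haar (\<lambda>p. Y_fun f p * g p) = - haar (\<lambda>p. f p * Y_fun g p)"
proof -
  note fi = CcFM_CinfFM[OF assms(1)] CcFM_CinfFM[OF assms(2)]
  note m = CcFM_mult[OF CcFM_ops(1)[OF assms(1)] assms(2)] CcFM_mult[OF assms(1) CcFM_ops(1)[OF assms(2)]]
     CcFM_mult[OF CcFM_ops(2)[OF assms(1)] assms(2)] CcFM_mult[OF assms(1) CcFM_ops(2)[OF assms(2)]]
  have "X_fun (\<lambda>p. f p * g p) = (\<lambda>p. X_fun f p * g p + f p * X_fun g p)"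
    by (rule CinfFM_eqI[OF CcFM_CinfFM[OF CcFM_ops(1)[OF CcFM_mult[OF assms]]] CcFM_CinfFM[OF CcFM_add[OF m(1,2), unfolded plus_fun_def]]])
       (rule XY_mult(1)[OF fi])
  then have "haar (\<lambda>p. X_fun f p * g p) + haar (\<lambda>p. f p * X_fun g p) = 0"
    using haar_XY(1)[OF CcFM_mult[OF assms]] haar_linear(1)[OF m(1,2)] by simp
  then show "haar (\<lambda>p. X_fun f p * g p) = - haar (\<lambda>p. f p * X_fun g p)" by (simp add: eq_neg_iff_add_eq_0)
  have "Y_fun (\<lambda>p. f p * g p) = (\<lambda>p. Y_fun f p * g p + f p * Y_fun g p)"
    by (rule CinfFM_eqI[OF CcFM_CinfFM[OF CcFM_ops(2)[OF CcFM_mult[OF assms]]] CcFM_CinfFM[OF CcFM_add[OF m(3,4), unfolded plus_fun_def]]])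
       (rule XY_mult(2)[OF fi])
  then have "haar (\<lambda>p. Y_fun f p * g p) + haar (\<lambda>p. f p * Y_fun g p) = 0"
    using haar_XY(2)[OF CcFM_mult[OF assms]] haar_linear(1)[OF m(3,4)] by simp
  then show "haar (\<lambda>p. Y_fun f p * g p) = - haar (\<lambda>p. f p * Y_fun g p)" by (simp add: eq_neg_iff_add_eq_0)
qed

lemma haar_minus: "haar (\<lambda>p. - F p) = - haar F"
  by (simp add: haar_def)

text \<open>Transposition reverses products, while conjugation by an involution preserves them. This makes
  the transpose an anti-homomorphism. On the generators it is given by integration by parts and
  \<open>Jdop_rules\<close>.\<close>

lemma transposed_rules:
  "transposed 1 1" "transposed Y1 (- Y1)" "transposed delta1 (- delta1)"
  "transposed X1 (- X1 + delta1 * Y1)"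
  "transposed h s \<Longrightarrow> transposed k s' \<Longrightarrow> transposed (h + k) (s + s')"
  "transposed h s \<Longrightarrow> transposed (h_scale c h) (h_scale c s)"
  "transposed h s \<Longrightarrow> transposed k s' \<Longrightarrow> transposed (h * k) (s' * s)"
proof -
  have C: "f \<in> CinfFM" if "f \<in> CcFM" for f using that by (rule CcFM_CinfFM)
  note R = dop_rules Jdop_rules C CinfFM_XY
  show "transposed 1 1" by (simp add: transposed_def R)
  show "transposed Y1 (- Y1)"
    by (auto simp: transposed_def R haar_by_parts haar_minus)
  show "transposed delta1 (- delta1)"
    by (auto simp: transposed_def R D_fun_def case_prod_unfold intro!: arg_cong[of _ _ haar])
  show "transposed X1 (- X1 + delta1 * Y1)"
    by (auto simp: transposed_def R haar_by_parts haar_minus)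
  show "transposed (h + k) (s + s')" if "transposed h s" "transposed k s'"
    using that by (auto simp: transposed_def dop_add R distrib_left distrib_right haar_linear CcFM_mult dop_CcFM Jdop_closed)
  show "transposed (h_scale c h) (h_scale c s)" if "transposed h s"
  proof -
    have "haar (\<lambda>p. c * dop h \<phi> f p * g p) = haar (\<lambda>p. f p * (c * Jdop s \<phi> g p))" if "\<phi> \<in> Diff" "f \<in> CcFM" "g \<in> CcFM" for \<phi> f g
    proof -
      have "haar (\<lambda>p. c * dop h \<phi> f p * g p) = c * haar (\<lambda>p. dop h \<phi> f p * g p)"
        using haar_linear(2)[OF CcFM_mult[OF dop_CcFM[OF that(1,2)] that(3)] that(2), of c h] by (simp add: mult.assoc)
      also have "\<dots> = c * haar (\<lambda>p. f p * Jdop s \<phi> g p)" using \<open>transposed h s\<close> that by (simp add: transposed_def)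
      also have "\<dots> = haar (\<lambda>p. f p * (c * Jdop s \<phi> g p))"
        using haar_linear(2)[OF CcFM_mult[OF that(2) Jdop_closed(1)[OF that(1,3)]] that(2), of c s] by (simp add: mult.left_commute)
      finally show ?thesis .
    qed
    then show ?thesis by (simp add: transposed_def dop_scale R)
  qed
  show "transposed (h * k) (s' * s)" if "transposed h s" "transposed k s'"
    using that by (simp add: transposed_def R dop_CcFM Jdop_closed)
qed

text \<open>The measure is non-degenerate, and \<open>Jdop u\<close> determines \<open>u\<close>.\<close>

lemma transposed_unique:
  assumes "transposed h s" "transposed h s'"
  shows "s = s'"
proof -
  have "transposed (h + h_scale (-1) h) (s + h_scale (-1) s')"
    by (intro transposed_rules assms)
  \<comment> \<open>Subtracting the two hypotheses shows that \<open>u\<close> is a transpose of \<open>0\<close>.\<close>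
  moreover define u where "u = s - s'"
  ultimately have t: "transposed 0 u" by simp
  have J: "Jdop u \<phi> g = 0" if "\<phi> \<in> Diff" "g \<in> CcFM" for \<phi> g
  proof (rule haar_nondegenerate[OF Jdop_closed(1)[OF that]])
    fix f assume "f \<in> CcFM"
    then show "haar (\<lambda>p. f p * Jdop u \<phi> g p) = 0"
      using t that by (simp add: transposed_def haar_def)
  qed
  have "u = 0"
  proof (rule H1_eqI)
    fix \<phi> f assume a: "\<phi> \<in> Diff" "f \<in> CcFM"
    have z: "dop u \<phi> f \<circ> lift_diff (inv \<phi>) = 0"
      using J[OF Diff_inv[OF a(1)] CcFM_lift[OF a(2) Diff_inv[OF a(1)]]] a(1) by (simp add: Jdop_def comp_assoc)
    have "dop u \<phi> f p = 0" for p
    proof -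
      have "dop u \<phi> f p = (dop u \<phi> f \<circ> lift_diff (inv \<phi>)) (lift_diff \<phi> p)" using a(1) by simp
      also have "\<dots> = 0" unfolding z by simp
      finally show ?thesis .
    qed
    then show "dop u \<phi> f = dop 0 \<phi> f" by (simp add: fun_eq_iff del: split_paired_All)
  qed
  then show ?thesis by (simp add: u_def)
qed

section \<open>The antipode\<close>

lemma H1_mult_minus:
  fixes h k :: H1
  shows "- h * k = - (h * k)" "h * - k = - (h * k)"
  using H1_mult(6)[of "-1" h k] H1_mult(7)[of h "-1" k] by simp_all

lemma lin_minus: "lin F \<Longrightarrow> F (- h) = - F h" "lin F \<Longrightarrow> F (h - k) = F h - F k"
  using linD(2)[of F "-1" h] linD(2)[of F "-1" k] linD(1)[of F h "- k"] by simp_all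

definition anti :: "H1 \<Rightarrow> H1" where "anti h = (THE s. transposed h s)"

lemma transposed_anti: "transposed h (anti h)"
proof -
  have "\<exists>s. transposed h s" by (induction h rule: H1_induct) (blast intro: transposed_rules)+
  then have "\<exists>!s. transposed h s" using transposed_unique by blast
  then show ?thesis unfolding anti_def by (rule theI')
qed

lemma anti_eqI: "transposed h s \<Longrightarrow> anti h = s"
  using transposed_unique transposed_anti by blast

lemma anti_rules:
  "anti 1 = 1" "anti Y1 = - Y1" "anti delta1 = - delta1" "anti X1 = - X1 + delta1 * Y1"
  "anti (h + k) = anti h + anti k" "anti (h_scale c h) = h_scale c (anti h)" "anti (h * k) = anti k * anti h"
  by (rule anti_eqI, intro transposed_rules transposed_anti)+

lemma lin_anti: "lin F \<Longrightarrow> lin (\<lambda>h. F (anti h))"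
  by (simp add: lin_def anti_rules)

lemma bilin_anti: "lin F \<Longrightarrow> bilin (\<lambda>k l. F (anti k * l))" "lin F \<Longrightarrow> bilin (\<lambda>k l. F (k * anti l))"
  by (auto simp: lin_def bilin_def anti_rules H1_mult)

text \<open>Both antipode identities hold on generators and are compatible with products, because
  \<open>anti\<close> reverses them: in \<open>S(a c) b d\<close> the inner factors \<open>S(a)
  b\<close> can be summed first.\<close>

lemma anti_left: "lin F \<Longrightarrow> cop_sum h (\<lambda>k l. F (anti k * l)) = eps h * F 1"
proof (induction h arbitrary: F rule: H1_induct)
  case (mult h k)
  have "cop_sum (h * k) (\<lambda>k l. F (anti k * l)) = cop_sum k (\<lambda>c d. cop_sum h (\<lambda>a b. F (anti c * (anti a * b) * d)))"
    by (subst cop_sum_swap) (simp add: cop_sum_rules(7)[OF bilin_anti(1)[OF mult.prems]] anti_rules H1_mult)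
  also have "\<dots> = cop_sum k (\<lambda>c d. eps h * F (anti c * 1 * d))"
    by (subst mult.IH(1)[of "\<lambda>x. F (anti _ * x * _)"]) (auto intro!: lin_intros mult.prems simp: lin_def[of F])
  also have "\<dots> = eps (h * k) * F 1"
    by (simp add: cop_sum_linear H1_mult mult.IH(2)[OF mult.prems] eps_rules)
  finally show ?case .
next
  case X
  then show ?case by (simp add: cop_sum_rules[OF bilin_anti(1)[OF X]] anti_rules eps_rules H1_mult H1_mult_minus linD lin_minus)
next
  case one
  then show ?case by (simp add: cop_sum_rules[OF bilin_anti(1)[OF one]] anti_rules eps_rules H1_mult)
next
  case Y
  then show ?case by (simp add: cop_sum_rules[OF bilin_anti(1)[OF Y]] anti_rules eps_rules H1_mult H1_mult_minus linD lin_minus)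
next
  case delta1
  then show ?case by (simp add: cop_sum_rules[OF bilin_anti(1)[OF delta1]] anti_rules eps_rules H1_mult H1_mult_minus linD lin_minus)
next
  case (add h k)
  then show ?case by (simp add: cop_sum_rules[OF bilin_anti(1)[OF add.prems]] eps_rules algebra_simps)
next
  case (scale h c)
  then show ?case by (simp add: cop_sum_rules[OF bilin_anti(1)[OF scale.prems]] eps_rules)
qed

lemma anti_right: "lin F \<Longrightarrow> cop_sum h (\<lambda>k l. F (k * anti l)) = eps h * F 1"
proof (induction h arbitrary: F rule: H1_induct)
  case (mult h k)
  have "cop_sum (h * k) (\<lambda>k l. F (k * anti l)) = cop_sum h (\<lambda>a b. cop_sum k (\<lambda>c d. F (a * (c * anti d) * anti b)))"
    by (simp add: cop_sum_rules(7)[OF bilin_anti(2)[OF mult.prems]] anti_rules H1_mult)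
  also have "\<dots> = cop_sum h (\<lambda>a b. eps k * F (a * 1 * anti b))"
    by (subst mult.IH(2)[of "\<lambda>x. F (_ * x * anti _)"]) (auto intro!: lin_intros mult.prems simp: lin_def[of F])
  also have "\<dots> = eps (h * k) * F 1"
    by (simp add: cop_sum_linear H1_mult mult.IH(1)[OF mult.prems] eps_rules)
  finally show ?case .
next
  case X
  then show ?case by (simp add: cop_sum_rules[OF bilin_anti(2)[OF X]] anti_rules eps_rules H1_mult H1_mult_minus linD lin_minus)
next
  case one
  then show ?case by (simp add: cop_sum_rules[OF bilin_anti(2)[OF one]] anti_rules eps_rules H1_mult)
next
  case Y
  then show ?case by (simp add: cop_sum_rules[OF bilin_anti(2)[OF Y]] anti_rules eps_rules H1_mult H1_mult_minus linD lin_minus)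
next
  case delta1
  then show ?case by (simp add: cop_sum_rules[OF bilin_anti(2)[OF delta1]] anti_rules eps_rules H1_mult H1_mult_minus linD lin_minus)
next
  case (add h k)
  then show ?case by (simp add: cop_sum_rules[OF bilin_anti(2)[OF add.prems]] eps_rules algebra_simps)
next
  case (scale h c)
  then show ?case by (simp add: cop_sum_rules[OF bilin_anti(2)[OF scale.prems]] eps_rules)
qed

text \<open>The usual uniqueness of convolution inverses: \<open>S(h\<^sub>(\<^sub>1\<^sub>))
  h\<^sub>(\<^sub>2\<^sub>) S'(h\<^sub>(\<^sub>3\<^sub>))\<close> equals both \<open>S(h)\<close>
  and \<open>S'(h)\<close>.\<close>

lemma antipode_eq_anti: "antipode = anti"
  unfolding antipode_def
proof (rule the_equality)
  show "H1_linear anti \<and> (\<forall>h.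
     (\<Sum>(k, l)\<in>Poly_Mapping.keys (coproduct h). h_scale (Poly_Mapping.lookup (coproduct h) (k, l)) (anti k * l)) = h_scale (counit h) 1 \<and>
     (\<Sum>(k, l)\<in>Poly_Mapping.keys (coproduct h). h_scale (Poly_Mapping.lookup (coproduct h) (k, l)) (k * anti l)) = h_scale (counit h) 1)"
  proof (intro conjI allI)
    show "H1_linear anti" by (simp add: H1_linear_def anti_rules)
    fix h
    show "(\<Sum>(k, l)\<in>Poly_Mapping.keys (coproduct h). h_scale (Poly_Mapping.lookup (coproduct h) (k, l)) (anti k * l)) = h_scale (counit h) 1"
    proof (rule H1_eq_lin)
      fix F assume F: "lin F"
      show "F (\<Sum>(k, l)\<in>Poly_Mapping.keys (coproduct h). h_scale (Poly_Mapping.lookup (coproduct h) (k, l)) (anti k * l)) = F (h_scale (counit h) 1)"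
        unfolding lin_coproduct_sum[OF F] by (simp add: anti_left F linD counit_eq_eps)
    qed
    show "(\<Sum>(k, l)\<in>Poly_Mapping.keys (coproduct h). h_scale (Poly_Mapping.lookup (coproduct h) (k, l)) (k * anti l)) = h_scale (counit h) 1"
    proof (rule H1_eq_lin)
      fix F assume F: "lin F"
      show "F (\<Sum>(k, l)\<in>Poly_Mapping.keys (coproduct h). h_scale (Poly_Mapping.lookup (coproduct h) (k, l)) (k * anti l)) = F (h_scale (counit h) 1)"
        unfolding lin_coproduct_sum[OF F] by (simp add: anti_right F linD counit_eq_eps)
    qed
  qed
next
  fix S assume S: "H1_linear S \<and> (\<forall>h.
     (\<Sum>(k, l)\<in>Poly_Mapping.keys (coproduct h). h_scale (Poly_Mapping.lookup (coproduct h) (k, l)) (S k * l)) = h_scale (counit h) 1 \<and>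
     (\<Sum>(k, l)\<in>Poly_Mapping.keys (coproduct h). h_scale (Poly_Mapping.lookup (coproduct h) (k, l)) (k * S l)) = h_scale (counit h) 1)"
  show "S = anti"
  proof (rule ext, rule H1_eq_lin)
    fix h F assume F: "lin F"
    have SF: "cop_sum h (\<lambda>k l. F (S k * l)) = eps h * F 1" if "lin F" for h F
      using lin_coproduct_sum[OF that, of h "\<lambda>k l. S k * l"] S that by (simp add: linD counit_eq_eps)
    have Slin: "lin (\<lambda>h. F' (S h))" if "lin F'" for F' using S that by (simp add: H1_linear_def lin_def)
    have "F (S h) = cop_sum h (\<lambda>a b. F (S a) * eps b)" by (rule counit_right[OF Slin[OF F], symmetric])
    also have "\<dots> = cop_sum h (\<lambda>a u. cop_sum u (\<lambda>b c. F (S a * (b * anti c))))"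
      by (subst anti_right[of "\<lambda>x. F (S _ * x)"]) (auto intro!: lin_intros F simp: H1_mult mult.commute)
    also have "\<dots> = cop_sum h (\<lambda>u c. cop_sum u (\<lambda>a b. F (S a * (b * anti c))))"
      by (rule coassoc[symmetric]) (use F S in \<open>auto simp: lin_def H1_linear_def anti_rules H1_mult\<close>)
    also have "\<dots> = cop_sum h (\<lambda>u c. eps u * F (1 * anti c))"
      by (subst SF[of "\<lambda>x. F (x * anti _)", symmetric]) (auto intro!: lin_intros F simp: H1_mult)
    also have "\<dots> = F (anti h)" by (simp add: H1_mult counit_left[OF lin_anti[OF F]])
    finally show "F (S h) = F (anti h)" .
  qed
qed

lemma lin_S_delta: "lin F \<Longrightarrow> F (S_delta h) = cop_sum h (\<lambda>k l. omega k * F (anti l))"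
  unfolding S_delta_def char_delta_eq_omega antipode_eq_anti
  by (simp add: lin_coproduct_sum[where E = "\<lambda>k l. h_scale (omega k) (anti l)", simplified] linD)

text \<open>Apply \<open>omega\<close> and \<open>xi z\<close> to \<open>h\<^sub>(\<^sub>1\<^sub>)
  S(h\<^sub>(\<^sub>2\<^sub>)) = \<epsilon>(h) 1\<close> and use the twisted Leibniz rule.\<close>

lemma S_delta_functionals: "omega (S_delta h) = eps h" "xi z (S_delta h) = - xi z h"
proof -
  show "omega (S_delta h) = eps h"
    using anti_right[OF lin_omega, of h] by (simp add: lin_S_delta[OF lin_omega] omega_rules)
  \<comment> \<open>The counit of an antipode is the counit.\<close>
  have e: "eps (anti h) = eps h" for h
    using anti_right[OF lin_eps, of h] counit_left[OF lin_anti[OF lin_eps], of h] by (simp add: eps_rules)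
  have "cop_sum h (\<lambda>k l. omega k * xi z (anti l)) + cop_sum h (\<lambda>k l. xi z k * eps l) = 0"
    using anti_right[OF lin_xi[of z], of h] by (simp add: xi_rules e cop_sum_linear)
  then show "xi z (S_delta h) = - xi z h"
    unfolding lin_S_delta[OF lin_xi] counit_right[OF lin_xi] by (simp add: eq_neg_iff_add_eq_0)
qed

section \<open>Linear forms on cochains\<close>

text \<open>The linear extension of \<open>F\<close> from lists to cochains.\<close>

definition lin_eval :: "(H1 list \<Rightarrow> complex) \<Rightarrow> cochain \<Rightarrow> complex" where
  "lin_eval F p = (\<Sum>hs\<in>Poly_Mapping.keys p. Poly_Mapping.lookup p hs * F hs)"

lemma lin_eval_superset:
  assumes "finite S" "Poly_Mapping.keys p \<subseteq> S"
  shows "lin_eval F p = (\<Sum>hs\<in>S. Poly_Mapping.lookup p hs * F hs)"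
  unfolding lin_eval_def by (rule sum.mono_neutral_left) (use assms in \<open>auto simp: in_keys_iff\<close>)

lemma lin_eval_add: "lin_eval F (p + r) = lin_eval F p + lin_eval F r"
proof -
  let ?S = "Poly_Mapping.keys p \<union> Poly_Mapping.keys r"
  have "Poly_Mapping.keys (p + r) \<subseteq> ?S" by (rule Poly_Mapping.keys_add)
  then show ?thesis by (simp add: lin_eval_superset[of ?S] lookup_add distrib_right sum.distrib)
qed

lemma lin_eval_scale: "lin_eval F (c_scale c p) = c * lin_eval F p"
proof -
  have "Poly_Mapping.keys (c_scale c p) \<subseteq> Poly_Mapping.keys p" by (auto simp: in_keys_iff)
  then show ?thesis by (simp add: lin_eval_superset[of "Poly_Mapping.keys p"] sum_distrib_left mult.assoc)
qed

lemma lin_eval_zero [simp]: "lin_eval F 0 = 0"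
  by (simp add: lin_eval_def)

lemma lin_eval_diff: "lin_eval F (p - r) = lin_eval F p - lin_eval F r"
  using lin_eval_add[of F "p - r" r] by simp

lemma lin_eval_sum: "lin_eval F (\<Sum>i\<in>I. p i) = (\<Sum>i\<in>I. lin_eval F (p i))"
  by (induction I rule: infinite_finite_induct) (auto simp: lin_eval_add)

lemma lin_eval_tens [simp]: "lin_eval F (tens hs) = F hs"
  by (simp add: lin_eval_def tens_def)

lemma lin_eval_lin_ext: "lin_eval F (lin_ext f p) = lin_eval (\<lambda>hs. lin_eval F (f hs)) p"
  by (simp add: lin_ext_def lin_eval_sum lin_eval_scale lin_eval_def[of _ p])

lemma lin_eval_fun_linear:
  "lin_eval (\<lambda>hs. F hs + G hs) p = lin_eval F p + lin_eval G p" "lin_eval (\<lambda>hs. c * F hs) p = c * lin_eval F p" "lin_eval (\<lambda>hs. F hs - G hs) p = lin_eval F p - lin_eval G p"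
  "lin_eval (\<lambda>hs. 0) p = 0" "lin_eval (\<lambda>hs. \<Sum>i\<in>I. K i hs) p = (\<Sum>i\<in>I. lin_eval (K i) p)"
proof -
  show "lin_eval (\<lambda>hs. \<Sum>i\<in>I. K i hs) p = (\<Sum>i\<in>I. lin_eval (K i) p)"
    unfolding lin_eval_def sum_distrib_left by (rule sum.swap)
qed (simp_all add: lin_eval_def distrib_left right_diff_distrib sum.distrib sum_subtractf sum_distrib_left mult.left_commute)

lemma cochain_expand: "p = (\<Sum>hs\<in>Poly_Mapping.keys p. c_scale (Poly_Mapping.lookup p hs) (tens hs))"
proof (rule poly_mapping_eqI)
  fix k
  show "Poly_Mapping.lookup p k = Poly_Mapping.lookup (\<Sum>hs\<in>Poly_Mapping.keys p. c_scale (Poly_Mapping.lookup p hs) (tens hs)) k"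
    by (simp add: lookup_sum tens_def lookup_single when_def in_keys_iff if_distrib[of "\<lambda>x. _ * x"] cong: if_cong)
qed

definition multilin :: "(H1 list \<Rightarrow> complex) \<Rightarrow> bool" where
  "multilin F \<longleftrightarrow> (\<forall>hs ks. lin (\<lambda>h. F (hs @ h # ks)))"

text \<open>The functions on lists whose linear extension descends to the cochain space modulo
  \<open>cochain_null\<close>.\<close>

definition cochain_form :: "(H1 list \<Rightarrow> complex) \<Rightarrow> bool" where
  "cochain_form F \<longleftrightarrow> multilin F \<and> (\<forall>hs h u ks. u \<in> U_gl1 \<longrightarrow> F (hs @ (h * u) # ks) = eps u * F (hs @ h # ks)) \<and>
     (\<forall>u hs. u \<in> U_gl1 \<longrightarrow> lin_eval F (diag_act u hs) = omega u * F hs)"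

lemma formD:
  assumes "cochain_form F"
  shows "multilin F" "u \<in> U_gl1 \<Longrightarrow> F (hs @ (h * u) # ks) = eps u * F (hs @ h # ks)"
    "u \<in> U_gl1 \<Longrightarrow> lin_eval F (diag_act u hs) = omega u * F hs"
  using assms by (auto simp: cochain_form_def)

lemma multilinD: "multilin F \<Longrightarrow> lin (\<lambda>h. F (hs @ h # ks))"
  by (auto simp: multilin_def)

lemma form_null:
  assumes "cochain_form F" "p \<in> cochain_null"
  shows "lin_eval F p = 0"
  using assms(2) unfolding cochain_null_def
proof (induction rule: cc.span_induct)
  case base
  show ?case by (auto simp: cc.subspace_def lin_eval_add lin_eval_scale)
next
  case (step x)
  note m = multilinD[OF formD(1)[OF assms(1)]]
  from step show ?case
    unfolding multilinear_rels_def quotient_rels_def balancing_rels_def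
    using linD[OF m] formD(2,3)[OF assms(1)]
    by (auto simp: lin_eval_diff lin_eval_scale counit_eq_eps char_delta_eq_omega)
qed

text \<open>A vector outside a subspace is separated from it by a linear form. Its restriction to pure
  tensors satisfies the relations that define the subspace.\<close>

lemma ex_form:
  assumes "p \<notin> cochain_null"
  shows "\<exists>F. cochain_form F \<and> lin_eval F p \<noteq> 0"
proof -
  interpret L: vector_space_pair c_scale "(*) :: complex \<Rightarrow> complex \<Rightarrow> complex"
    by unfold_locales (auto simp: algebra_simps)
  obtain B where B: "B \<subseteq> cochain_null" "cc.independent B" "cochain_null \<subseteq> cc.span B"
    by (rule cc.maximal_independent_subset) blast
  have pB: "p \<notin> cc.span B" using assms B(1) subspace_null cc.span_minimal by blast
  then have "cc.independent (insert p B)" using B(2) by (simp add: cc.independent_insertI)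
  \<comment> \<open>A linear form that is \<open>1\<close> on \<open>p\<close> and \<open>0\<close> on a basis of
    the subspace.\<close>
  then obtain g where g: "Vector_Spaces.linear c_scale (*) g" "\<forall>x\<in>insert p B. g x = (if x = p then 1 else 0)"
    using L.linear_independent_extend[of "insert p B" "\<lambda>x. if x = p then 1 else 0"] by blast
  interpret g: Vector_Spaces.linear c_scale "(*)" g by (rule g(1))
  have "p \<notin> B" using pB cc.span_base by blast
  then have gB: "g x = 0" if "x \<in> B" for x using g(2) that by (cases "x = p") auto
  have "g x = 0" if "x \<in> cc.span B" for x
    by (rule L.linear_eq_0_on_span[OF g(1) gB that])
  then have g0: "g x = 0" if "x \<in> cochain_null" for x using B(3) that by blast
  define F where "F = (\<lambda>hs. g (tens hs))"
  have lF: "lin_eval F x = g x" for x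
    by (subst (2) cochain_expand) (simp add: g.sum g.scale lin_eval_def F_def)
  have "cochain_form F"
    unfolding cochain_form_def multilin_def lin_def
  proof (intro conjI allI impI)
    have base: "x \<in> multilinear_rels \<union> quotient_rels \<union> balancing_rels \<Longrightarrow> lin_eval F x = 0" for x
      unfolding lF by (rule g0) (simp add: cochain_null_def cc.span_base)
    fix hs h k ks c u
    have "tens (hs @ (h + k) # ks) - tens (hs @ h # ks) - tens (hs @ k # ks) \<in> multilinear_rels"
      unfolding multilinear_rels_def by blast
    then have "lin_eval F (tens (hs @ (h + k) # ks) - tens (hs @ h # ks) - tens (hs @ k # ks)) = 0" using base by blast
    then show "F (hs @ (h + k) # ks) = F (hs @ h # ks) + F (hs @ k # ks)"
      unfolding lin_eval_diff lin_eval_tens by (simp add: algebra_simps)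
    have "tens (hs @ h_scale c h # ks) - c_scale c (tens (hs @ h # ks)) \<in> multilinear_rels"
      unfolding multilinear_rels_def by blast
    then have "lin_eval F (tens (hs @ h_scale c h # ks) - c_scale c (tens (hs @ h # ks))) = 0" using base by blast
    then show "F (hs @ h_scale c h # ks) = c * F (hs @ h # ks)" by (simp add: lin_eval_diff lin_eval_scale)
    assume u: "u \<in> U_gl1"
    have "tens (hs @ (h * u) # ks) - c_scale (counit u) (tens (hs @ h # ks)) \<in> quotient_rels"
      unfolding quotient_rels_def using u by blast
    then have "lin_eval F (tens (hs @ (h * u) # ks) - c_scale (counit u) (tens (hs @ h # ks))) = 0" using base by blast
    then show "F (hs @ (h * u) # ks) = eps u * F (hs @ h # ks)" by (simp add: lin_eval_diff lin_eval_scale counit_eq_eps)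
    have "c_scale (char_delta u) (tens hs) - diag_act u hs \<in> balancing_rels"
      unfolding balancing_rels_def using u by blast
    then have "lin_eval F (c_scale (char_delta u) (tens hs) - diag_act u hs) = 0" using base by blast
    then show "lin_eval F (diag_act u hs) = omega u * F hs" by (simp add: lin_eval_diff lin_eval_scale char_delta_eq_omega)
  qed
  moreover have "lin_eval F p \<noteq> 0" using g(2) by (simp add: lF)
  ultimately show ?thesis by blast
qed

subsection \<open>The diagonal action\<close>

abbreviation act :: "(H1 list \<Rightarrow> complex) \<Rightarrow> H1 \<Rightarrow> H1 list \<Rightarrow> complex" where
  "act F h ks \<equiv> lin_eval F (diag_act h ks)"

lemma act_Nil: "act F h [] = eps h * F []"
  by (simp add: lin_eval_scale counit_eq_eps)

lemma act_Cons: "act F h (k # ks) = cop_sum h (\<lambda>a b. act (\<lambda>ls. F ((a * k) # ls)) b ks)"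
  by (simp add: lin_eval_sum lin_eval_scale lin_eval_lin_ext cop_sum_def tensor_eval_def case_prod_unfold)

lemma multilin_Cons:
  assumes "multilin F"
  shows "multilin (\<lambda>ls. F (k # ls))"
  unfolding multilin_def
proof (intro allI)
  fix hs ks
  show "lin (\<lambda>h. F (k # hs @ h # ks))" using multilinD[OF assms, of "k # hs" ks] by simp
qed

lemma lin_act_form:
  assumes "\<And>ls. lin (\<lambda>a. G a ls)"
  shows "lin (\<lambda>a. lin_eval (G a) p)"
  unfolding lin_eval_def by (intro lin_sum_fun lin_intros assms)

lemma lin_head: "multilin F \<Longrightarrow> lin (\<lambda>a. F ((a * k) # ls))"
  using lin_intros(1)[OF multilinD[of F "[]" ls]] by simp

lemma bilin_act:
  assumes "\<And>F. multilin F \<Longrightarrow> lin (\<lambda>h. act F h ks)" "multilin F"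
  shows "bilin (\<lambda>a b. act (\<lambda>ls. F ((a * k) # ls)) b ks)"
  by (intro bilinI assms(1) multilin_Cons[OF assms(2)] lin_act_form lin_head[OF assms(2)])

lemma lin_act: "multilin F \<Longrightarrow> lin (\<lambda>h. act F h ks)"
proof (induction ks arbitrary: F)
  case Nil
  show ?case unfolding act_Nil by (intro lin_intros lin_eps)
next
  case (Cons k ks)
  show ?case unfolding act_Cons by (rule lin_cop_sum_left[OF bilin_act[OF Cons.IH Cons.prems]])
qed

lemma act_one: "multilin F \<Longrightarrow> act F 1 ks = F ks"
proof (induction ks arbitrary: F)
  case Nil
  show ?case by (simp only: act_Nil eps_rules mult_1)
next
  case (Cons k ks)
  show ?case
    by (simp only: act_Cons cop_sum_rules(1)[OF bilin_act[OF lin_act Cons.prems]] H1_mult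
        Cons.IH[OF multilin_Cons[OF Cons.prems]])
qed

text \<open>Since \<open>Y1\<close> is primitive, it acts as a derivation.\<close>

lemma act_Y: "multilin F \<Longrightarrow> act F Y1 ks = (\<Sum>j<length ks. F (ks[j := Y1 * ks ! j]))"
proof (induction ks arbitrary: F)
  case Nil
  show ?case by (simp only: act_Nil eps_rules) simp
next
  case (Cons k ks)
  note m = multilin_Cons[OF Cons.prems]
  have "act F Y1 (k # ks) = F ((Y1 * k) # ks) + (\<Sum>j<length ks. F (k # ks[j := Y1 * ks ! j]))"
    by (simp only: act_Cons cop_sum_rules(3)[OF bilin_act[OF lin_act Cons.prems]] H1_mult act_one[OF m] Cons.IH[OF m])
  then show ?case by (simp only: length_Cons sum.lessThan_Suc_shift) simp
qed

lemma act_cong: "(\<And>ls. length ls = length ks \<Longrightarrow> F ls = G ls) \<Longrightarrow> act F h ks = act G h ks"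
proof (induction ks arbitrary: F G h)
  case Nil
  then show ?case by (simp only: act_Nil list.size)
next
  case (Cons k ks)
  show ?case unfolding act_Cons
    by (intro arg_cong[of _ _ "cop_sum h"] ext Cons.IH Cons.prems) simp
qed

section \<open>Coordinates on the cochain spaces\<close>

abbreviation eps_prod :: "H1 list \<Rightarrow> complex" where "eps_prod hs \<equiv> prod_list (map eps hs)"

text \<open>Applies \<open>xi z\<close> to the factor in position \<open>i\<close> and the counit to all
  others.\<close>

fun xi_at :: "bool \<Rightarrow> nat \<Rightarrow> H1 list \<Rightarrow> complex" where
  "xi_at z i [] = 0"
| "xi_at z 0 (h # hs) = xi z h * eps_prod hs"
| "xi_at z (Suc i) (h # hs) = eps h * xi_at z i hs"

lemma xi_at_beyond: "length hs \<le> i \<Longrightarrow> xi_at z i hs = 0"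
  by (induction z i hs rule: xi_at.induct) auto

lemma xi_at_append:
  "xi_at z i (hs @ ks) = (if i < length hs then xi_at z i hs * eps_prod ks else eps_prod hs * xi_at z (i - length hs) ks)"
  by (induction z i hs rule: xi_at.induct) auto

lemma act_scale: "act (\<lambda>ls. c * F ls) h ks = c * act F h ks"
  by (rule lin_eval_fun_linear)

lemma act_eps_prod: "act eps_prod h ks = eps h * eps_prod ks"
proof (induction ks arbitrary: h)
  case Nil
  show ?case by (simp only: act_Nil)
next
  case (Cons k ks)
  have "act eps_prod h (k # ks) = cop_sum h (\<lambda>a b. (eps a * eps b) * (eps k * eps_prod ks))"
    unfolding act_Cons by (simp add: act_scale Cons.IH eps_rules mult_ac del: diag_act.simps)
  then show ?case unfolding cop_sum_linear(3) counit_left[OF lin_eps] by simp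
qed

text \<open>The twisted Leibniz rule for \<open>xi z\<close> is what makes the diagonal action computable:
  only the factor in position \<open>i\<close> can absorb more than the counit of a component of
  \<open>h\<close>, and it absorbs it either through \<open>omega\<close> or through \<open>xi
  z\<close>.\<close>

lemma act_xi_at: "act (xi_at z i) h ks = omega h * xi_at z i ks + (if i < length ks then xi z h * eps_prod ks else 0)"
proof (induction ks arbitrary: h i)
  case Nil
  show ?case by (simp only: act_Nil) simp
next
  case (Cons k ks)
  show ?case
  proof (cases i)
    \<comment> \<open>The letter is in the first factor, and the rest of the diagonal action is evaluated by the
      counit.\<close>
    case 0
    have l: "lin (\<lambda>a. omega a * (xi z k * eps_prod ks) + xi z a * (eps k * eps_prod ks))"
      by (intro lin_intros lin_omega lin_xi)
    have "act (\<lambda>ls. xi_at z 0 ((a * k) # ls)) b ks = (omega a * xi z k + xi z a * eps k) * (eps b * eps_prod ks)" for a b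
      by (simp add: act_scale act_eps_prod xi_rules del: diag_act.simps)
    then have "act (xi_at z i) h (k # ks) = cop_sum h (\<lambda>a b. (omega a * (xi z k * eps_prod ks) + xi z a * (eps k * eps_prod ks)) * eps b)"
      unfolding act_Cons 0 by (simp add: algebra_simps del: diag_act.simps xi_at.simps)
    then show ?thesis unfolding counit_right[OF l] by (simp add: 0)
  next
    \<comment> \<open>The first factor is evaluated by the counit, which leaves all of \<open>h\<close> for the
      other factors.\<close>
    case (Suc i')
    have l: "lin (\<lambda>b. omega b * (eps k * xi_at z i' ks) + xi z b * (if i' < length ks then eps k * eps_prod ks else 0))"
      by (intro lin_intros lin_omega lin_xi)
    have "act (\<lambda>ls. xi_at z (Suc i') ((a * k) # ls)) b ks = (eps a * eps k) * (omega b * xi_at z i' ks + (if i' < length ks then xi z b * eps_prod ks else 0))" for a b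
      by (simp add: act_scale Cons.IH eps_rules del: diag_act.simps)
    then have "act (xi_at z i) h (k # ks) = cop_sum h (\<lambda>a b. eps a * (omega b * (eps k * xi_at z i' ks) + xi z b * (if i' < length ks then eps k * eps_prod ks else 0)))"
      unfolding act_Cons Suc by (simp add: algebra_simps del: diag_act.simps xi_at.simps)
    then show ?thesis unfolding counit_left[OF l] by (simp add: Suc)
  qed
qed

definition xi_at_deg :: "bool \<Rightarrow> nat \<Rightarrow> nat \<Rightarrow> H1 list \<Rightarrow> complex" where
  "xi_at_deg z q i hs = (if length hs = q then xi_at z i hs else 0)"

lemma xi_at_mid:
  "xi_at z i (hs @ h # ks) = (if i < length hs then xi_at z i hs * eps_prod ks * eps h
     else if i = length hs then eps_prod hs * eps_prod ks * xi z h else eps_prod hs * xi_at z (i - Suc (length hs)) ks * eps h)"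
proof (cases "i - length hs")
  case 0
  then show ?thesis by (auto simp: xi_at_append)
next
  case (Suc m)
  then have "i - Suc (length hs) = m" "\<not> i < length hs" "i \<noteq> length hs" by auto
  then show ?thesis by (simp add: xi_at_append Suc)
qed

text \<open>On \<open>U(gl\<^sub>1)\<close> the functional \<open>xi z\<close> vanishes, so by
  \<open>act_xi_at\<close> the diagonal action multiplies by \<open>omega\<close>, exactly as
  required by the balancing over \<open>\<complex>\<^sub>\<delta>\<close>.\<close>

lemma form_xi_at_deg: "cochain_form (xi_at_deg z q i)"
  unfolding cochain_form_def multilin_def
proof (intro conjI allI impI)
  fix hs ks
  show "lin (\<lambda>h. xi_at_deg z q i (hs @ h # ks))"
    unfolding xi_at_deg_def xi_at_mid by (cases "length (hs @ undefined # ks) = q") (auto intro!: lin_intros lin_eps lin_xi simp: lin_def eps_rules xi_rules algebra_simps)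
next
  fix hs h u ks assume u: "u \<in> U_gl1"
  show "xi_at_deg z q i (hs @ (h * u) # ks) = eps u * xi_at_deg z q i (hs @ h # ks)"
    unfolding xi_at_deg_def xi_at_mid by (simp add: eps_rules xi_rules U_gl1_functionals[OF u])
next
  fix u hs assume u: "u \<in> U_gl1"
  have "act (xi_at_deg z q i) u hs = (if length hs = q then act (xi_at z i) u hs else act (\<lambda>_. 0) u hs)"
    by (auto simp: xi_at_deg_def intro: act_cong)
  also have "\<dots> = omega u * xi_at_deg z q i hs"
    by (simp add: act_xi_at U_gl1_functionals[OF u] xi_at_deg_def lin_eval_fun_linear)
  finally show "act (xi_at_deg z q i) u hs = omega u * xi_at_deg z q i hs" .
qed

subsection \<open>Words in the generators\<close>

text \<open>Words in \<open>X1\<close> and \<open>delta1\<close>, together with their number of letters.\<close>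

inductive gen_word :: "H1 \<Rightarrow> nat \<Rightarrow> bool" where
  "gen_word 1 0"
| "gen_word w n \<Longrightarrow> gen_word (gen z * w) (Suc n)"

lemma Y_gen: "Y1 * gen z = gen z * Y1 + gen z"
  by (simp add: gen_def YX Ydelta)

text \<open>The adjoint action of \<open>Y1\<close> measures the length of a word.\<close>

lemma gen_word_Y: "gen_word w n \<Longrightarrow> Y1 * w = w * Y1 + h_scale (of_nat n) w"
proof (induction rule: gen_word.induct)
  case 1
  show ?case by (simp add: H1_mult)
next
  case (2 w n z)
  have "Y1 * (gen z * w) = (gen z * Y1 + gen z) * w" by (simp only: H1_mult(1) Y_gen)
  also have "\<dots> = gen z * (Y1 * w) + gen z * w" by (simp add: H1_mult)
  also have "\<dots> = gen z * w * Y1 + (h_scale (of_nat n) (gen z * w) + gen z * w)"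
    unfolding 2 by (simp add: H1_mult)
  also have "h_scale (of_nat n) (gen z * w) + gen z * w = h_scale (of_nat (Suc n)) (gen z * w)"
    by (simp add: H1v.scale_left_distrib)
  finally show ?case .
qed

definition words :: "H1 set" where "words = {w. \<exists>n. gen_word w n}"

text \<open>The elements that are combinations of words modulo the left ideal \<open>H1 Y1\<close>, which is
  what \<open>Q\<^sub>1\<close> divides by. All elements are of this kind
  (\<open>all_reduced\<close>).\<close>

definition reduced :: "H1 set" where "reduced = {v + k * Y1 | v k. v \<in> H1v.span words}"

lemma reduced_iff: "x \<in> reduced \<longleftrightarrow> (\<exists>v k. x = v + k * Y1 \<and> v \<in> H1v.span words)"
  by (auto simp: reduced_def)

lemma reducedE:
  assumes "x \<in> reduced"
  obtains v k where "x = v + k * Y1" "v \<in> H1v.span words"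
  using assms by (auto simp: reduced_def)

lemma reduced_subspace: "H1v.subspace reduced"
proof (rule H1v.subspaceI)
  have "0 = 0 + 0 * Y1" by (simp add: H1_mult)
  then show "0 \<in> reduced" unfolding reduced_iff using H1v.span_zero by blast
  show "x + y \<in> reduced" if xy: "x \<in> reduced" "y \<in> reduced" for x y
  proof -
    obtain v k where "x = v + k * Y1" "v \<in> H1v.span words" using xy(1) by (rule reducedE)
    moreover obtain v' k' where "y = v' + k' * Y1" "v' \<in> H1v.span words" using xy(2) by (rule reducedE)
    moreover from calculation have "x + y = (v + v') + (k + k') * Y1" by (simp add: H1_mult algebra_simps)
    ultimately show ?thesis unfolding reduced_iff using H1v.span_add by blast
  qed
  show "h_scale c x \<in> reduced" if xr: "x \<in> reduced" for c x
  proof -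
    obtain v k where "x = v + k * Y1" "v \<in> H1v.span words" using xr by (rule reducedE)
    moreover from this have "h_scale c x = h_scale c v + h_scale c k * Y1" by (simp add: H1_mult H1v.scale_right_distrib)
    ultimately show ?thesis unfolding reduced_iff using H1v.span_scale by blast
  qed
qed

lemma reduced_words: "v \<in> H1v.span words \<Longrightarrow> v \<in> reduced"
  unfolding reduced_iff by (rule exI[of _ v], rule exI[of _ 0]) (simp add: H1_mult)

lemma reduced_Y: "k * Y1 \<in> reduced"
  unfolding reduced_iff by (rule exI[of _ 0], rule exI[of _ k]) (simp add: H1v.span_zero)

lemma span_words_map:
  assumes "\<And>w. w \<in> words \<Longrightarrow> g * w \<in> reduced" "v \<in> H1v.span words"
  shows "g * v \<in> reduced"
  using assms(2)
proof (induction rule: H1v.span_induct)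
  case base
  show ?case using reduced_subspace
    by (simp add: H1v.subspace_def H1_mult)
next
  case (step x)
  then show ?case by (rule assms(1))
qed

lemma reduced_closed:
  assumes "\<And>w. w \<in> words \<Longrightarrow> g * w \<in> reduced" "x \<in> reduced"
  shows "g * x \<in> reduced"
proof -
  obtain v k where x: "x = v + k * Y1" "v \<in> H1v.span words" using assms(2) by (rule reducedE)
  have "g * x = g * v + (g * k) * Y1" by (simp add: x H1_mult)
  then show ?thesis using H1v.subspace_add[OF reduced_subspace span_words_map[OF assms(1) x(2)] reduced_Y] by simp
qed

lemma reduced_left: "x \<in> reduced \<Longrightarrow> h * x \<in> reduced"
proof (induction h arbitrary: x rule: H1_induct)
  case one
  then show ?case by (simp add: H1_mult)
next
  case X
  have "X1 * w \<in> reduced" if "w \<in> words" for w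
  proof -
    obtain n where "gen_word w n" using \<open>w \<in> words\<close> unfolding words_def by blast
    from gen_word.intros(2)[OF this, of True] have "X1 * w \<in> words" unfolding words_def gen_def by auto
    then show ?thesis by (intro reduced_words H1v.span_base)
  qed
  then show ?case using X by (rule reduced_closed)
next
  case delta1
  have "delta1 * w \<in> reduced" if "w \<in> words" for w
  proof -
    obtain n where "gen_word w n" using \<open>w \<in> words\<close> unfolding words_def by blast
    from gen_word.intros(2)[OF this, of False] have "delta1 * w \<in> words" unfolding words_def gen_def by auto
    then show ?thesis by (intro reduced_words H1v.span_base)
  qed
  then show ?case using delta1 by (rule reduced_closed)
next
  case Y
  have "Y1 * w \<in> reduced" if "w \<in> words" for w
  proof -
    obtain n where "gen_word w n" using \<open>w \<in> words\<close> unfolding words_def by blast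
    from gen_word_Y[OF this] show ?thesis
      using H1v.subspace_add[OF reduced_subspace reduced_Y reduced_words[OF H1v.span_scale[OF H1v.span_base[OF that]]], of w "of_nat n"] by simp
  qed
  then show ?case using Y by (rule reduced_closed)
next
  case (add h k)
  then show ?case using H1v.subspace_add[OF reduced_subspace] by (simp add: H1_mult)
next
  case (scale h c)
  then show ?case using H1v.subspace_scale[OF reduced_subspace] by (simp add: H1_mult)
next
  case (mult h k)
  then show ?case by (simp only: H1_mult(1)[symmetric])
qed

lemma all_reduced: "h \<in> reduced"
proof -
  have "1 \<in> words" unfolding words_def using gen_word.intros(1) by blast
  then have "1 \<in> reduced" by (intro reduced_words H1v.span_base)
  from reduced_left[OF this, of h] show ?thesis by (simp add: H1_mult)
qed

lemma lin_eq_words: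
  assumes "lin F" "lin G" "\<And>k. F (k * Y1) = 0" "\<And>k. G (k * Y1) = 0" "\<And>w. w \<in> words \<Longrightarrow> F w = G w"
  shows "F h = G h"
proof -
  obtain v k where h: "h = v + k * Y1" "v \<in> H1v.span words" using all_reduced[of h] by (rule reducedE)
  have "F v = G v" using h(2)
  proof (induction rule: H1v.span_induct)
    case base
    show ?case using assms(1,2) by (auto simp: H1v.subspace_def lin_zero linD)
  next
    case (step x)
    then show ?case by (rule assms(5))
  qed
  then show ?thesis using assms(1-4) by (simp add: h linD)
qed

text \<open>The part of the conditions of a \<open>cochain_form\<close> that makes it depend only on its
  values on words.\<close>

definition basic :: "(H1 list \<Rightarrow> complex) \<Rightarrow> bool" where
  "basic F \<longleftrightarrow> multilin F \<and> (\<forall>hs h ks. F (hs @ (h * Y1) # ks) = 0)"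

lemma form_basic: "cochain_form F \<Longrightarrow> basic F"
  using formD(2)[OF _ U_gl1.Y] by (auto simp: basic_def cochain_form_def eps_rules)

text \<open>The words span \<open>H1\<close> modulo \<open>H1 Y1\<close>, so the factors can be replaced by
  words one at a time.\<close>

lemma basic_eq_words:
  assumes "basic F" "basic G" "\<And>ws. set ws \<subseteq> words \<Longrightarrow> F ws = G ws"
  shows "F hs = G hs"
proof -
  have "set ws \<subseteq> words \<Longrightarrow> F (ws @ hs) = G (ws @ hs)" for ws
  proof (induction hs arbitrary: ws)
    case Nil
    then show ?case by (simp add: assms(3))
  next
    case (Cons h hs)
    show ?case
    proof (rule lin_eq_words[where F = "\<lambda>h. F (ws @ h # hs)" and G = "\<lambda>h. G (ws @ h # hs)"])
      fix w assume "w \<in> words"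
      then show "F (ws @ w # hs) = G (ws @ w # hs)" using Cons.IH[of "ws @ [w]"] Cons.prems by simp
    qed (use assms(1,2) in \<open>auto simp: basic_def multilin_def\<close>)
  qed
  from this[of "[]"] show ?thesis by simp
qed

text \<open>The tensor with \<open>gen z\<close> in position \<open>i\<close> and \<open>1\<close> in all
  other positions.\<close>

definition unit_tens :: "bool \<Rightarrow> nat \<Rightarrow> nat \<Rightarrow> H1 list" where
  "unit_tens z q i = (replicate q 1)[i := gen z]"

lemma unit_tens_simps: "unit_tens z (Suc q) 0 = gen z # replicate q 1" "unit_tens z (Suc q) (Suc i) = 1 # unit_tens z q i" "length (unit_tens z q i) = q"
  by (simp_all add: unit_tens_def)

lemma xi_at_unit_tens: "i < q \<Longrightarrow> xi_at z' i' (unit_tens z q i) = (if z' = z \<and> i' = i then 1 else 0)"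
proof -
  have r: "xi_at z i (replicate q 1) = 0" for z i q
  proof (induction q arbitrary: i)
    case (Suc q)
    then show ?case by (cases i) (auto simp: xi_rules)
  qed simp
  show "i < q \<Longrightarrow> ?thesis"
  proof (induction q arbitrary: i i')
    case (Suc q)
    have w: "eps_prod (unit_tens z q i) = 0" if "i < q" for i using that
    proof (induction q arbitrary: i)
      case (Suc q)
      then show ?case by (cases i) (auto simp: unit_tens_simps gen_rules eps_rules)
    qed simp
    show ?case
    proof (cases i)
      case 0
      then show ?thesis by (cases i') (auto simp: unit_tens_simps gen_rules eps_rules r)
    next
      case (Suc m)
      then show ?thesis using Suc.prems Suc.IH[of m] w[of m] by (cases i') (auto simp: unit_tens_simps xi_rules eps_rules)
    qed
  qed simp
qed

lemma words_weight:
  assumes "set ws \<subseteq> words"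
  obtains ns where "list_all2 gen_word ws ns"
  using assms
proof (induction ws arbitrary: thesis)
  case (Cons w ws)
  obtain n where "gen_word w n" using Cons.prems(2) unfolding words_def by auto
  moreover obtain ns where "list_all2 gen_word ws ns" using Cons.IH Cons.prems(2) by auto
  ultimately show ?case using Cons.prems(1)[of "n # ns"] by simp
qed simp

lemma gen_word_0: "gen_word w 0 \<Longrightarrow> w = 1"
  by (cases w "0::nat" rule: gen_word.cases) auto

lemma gen_word_1:
  assumes "gen_word w (Suc 0)"
  shows "\<exists>z. w = gen z"
  using assms
proof (cases w "Suc 0" rule: gen_word.cases)
  case (2 w' z)
  then show ?thesis using gen_word_0[of w'] by (auto simp: H1_mult)
qed

lemma weight_0: "list_all2 gen_word ws ns \<Longrightarrow> sum_list ns = 0 \<Longrightarrow> ws = replicate (length ws) 1"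
  by (induction ws ns rule: list_all2_induct) (auto dest: gen_word_0)

lemma weight_1: "list_all2 gen_word ws ns \<Longrightarrow> sum_list ns = 1 \<Longrightarrow> \<exists>z i. i < length ws \<and> ws = unit_tens z (length ws) i"
proof (induction ws ns rule: list_all2_induct)
  case (Cons w ws n ns)
  show ?case
  proof (cases n)
    case 0
    then obtain z i where "i < length ws" "ws = unit_tens z (length ws) i" using Cons by auto
    then show ?thesis using 0 Cons(1) gen_word_0[of w]
      by (intro exI[of _ z] exI[of _ "Suc i"]) (auto simp: unit_tens_simps)
  next
    case (Suc m)
    then have "n = Suc 0" "sum_list ns = 0" using Cons.prems by auto
    then obtain z where "w = gen z" "ws = replicate (length ws) 1" using Cons(1,2) gen_word_1[of w] weight_0[of ws ns] by auto
    then show ?thesis by (intro exI[of _ z] exI[of _ 0]) (auto simp: unit_tens_simps)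
  qed
qed simp

text \<open>The diagonal action of \<open>Y1\<close> multiplies a tensor of words by its total number
  \<open>n\<close> of letters, because the summands with \<open>Y1\<close> on the right of a
  factor vanish in \<open>Q\<^sub>1\<close>. The balancing identifies it with multiplication by
  \<open>\<delta>(Y) = 1\<close>. Thus \<open>(n - 1) F(w) = 0\<close>.\<close>

lemma form_weight:
  assumes F: "cochain_form F" and ws: "list_all2 gen_word ws ns" and n: "sum_list ns \<noteq> 1"
  shows "F ws = 0"
proof -
  have len: "length ws = length ns" using ws by (rule list_all2_lengthD)
  \<comment> \<open>Move \<open>Y1\<close> to the right of the factor, where it vanishes in the quotient.\<close>
  have "F (ws[j := Y1 * ws ! j]) = of_nat (ns ! j) * F ws" if j: "j < length ws" for j
  proof -
    define as bs where "as = take j ws" and "bs = drop (Suc j) ws"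
    have up: "ws[j := x] = as @ x # bs" for x unfolding as_def bs_def by (rule upd_conv_take_nth_drop[OF j])
    have lF: "lin (\<lambda>h. F (as @ h # bs))" by (rule multilinD[OF formD(1)[OF F]])
    have w: "gen_word (ws ! j) (ns ! j)" using ws j by (auto simp: list_all2_conv_all_nth)
    have "F (ws[j := Y1 * ws ! j]) = F (as @ (ws ! j * Y1) # bs) + of_nat (ns ! j) * F (as @ ws ! j # bs)"
      unfolding up gen_word_Y[OF w] using linD[OF lF] by simp
    also have "F (as @ (ws ! j * Y1) # bs) = 0" using formD(2)[OF F U_gl1.Y] by (simp add: eps_rules)
    also have "as @ ws ! j # bs = ws" unfolding as_def bs_def by (rule id_take_nth_drop[OF j, symmetric])
    finally show ?thesis by simp
  qed
  then have "act F Y1 ws = (\<Sum>j<length ns. of_nat (ns ! j) * F ws)"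
    unfolding act_Y[OF formD(1)[OF F]] using len by simp
  also have "\<dots> = of_nat (sum_list ns) * F ws"
    by (simp add: sum_distrib_right[symmetric] sum_list_sum_nth atLeast0LessThan)
  finally have "of_nat (sum_list ns) * F ws = F ws"
    using formD(3)[OF F U_gl1.Y, of ws] by (simp add: omega_rules)
  then have "(of_nat (sum_list ns) - 1) * F ws = 0" by (simp add: algebra_simps)
  moreover have "of_nat (sum_list ns) - 1 \<noteq> (0::complex)" using n by (metis eq_iff_diff_eq_0 of_nat_eq_1_iff)
  ultimately show ?thesis by simp
qed

text \<open>Both sides are determined by their values on tensors of words. They vanish there unless the
  tensor has exactly one letter, and in this case it is a \<open>unit_tens\<close>.\<close>

lemma form_expand:
  assumes F: "cochain_form F"
  shows "F hs = (\<Sum>z\<in>UNIV. \<Sum>i<length hs. xi_at z i hs * F (unit_tens z (length hs) i))"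
proof -
  define R where "R = (\<lambda>hs. \<Sum>z\<in>UNIV. \<Sum>i<length hs. xi_at_deg z (length hs) i hs * F (unit_tens z (length hs) i))"
  have bR: "basic R"
    unfolding basic_def multilin_def
  proof (intro conjI allI)
    fix hs ks :: "H1 list"
    show "lin (\<lambda>h. R (hs @ h # ks))"
    proof -
      have "lin (\<lambda>h. \<Sum>z\<in>UNIV. \<Sum>i<Suc (length hs + length ks). xi_at_deg z (Suc (length hs + length ks)) i (hs @ h # ks) * F (unit_tens z (Suc (length hs + length ks)) i))"
        by (intro lin_sum_fun lin_intros multilinD[OF formD(1)[OF form_xi_at_deg]])
      then show ?thesis by (simp add: R_def)
    qed
    show "R (hs @ (h * Y1) # ks) = 0" for h
      using form_basic[OF form_xi_at_deg] by (simp add: R_def basic_def)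
  qed
  have "F hs = R hs"
  proof (rule basic_eq_words[OF form_basic[OF F] bR])
    fix ws assume "set ws \<subseteq> words"
    then obtain ns where ns: "list_all2 gen_word ws ns" by (rule words_weight)
    show "F ws = R ws"
    proof (cases "sum_list ns = 1")
      case False
      then show ?thesis using form_weight[OF F ns] form_weight[OF form_xi_at_deg ns] by (simp add: R_def)
    next
      case True
      then obtain z i where i: "i < length ws" "ws = unit_tens z (length ws) i" using weight_1[OF ns] by blast
      define q where "q = length ws"
      have ws: "ws = unit_tens z q i" "i < q" using i by (simp_all add: q_def)
      have "R ws = (\<Sum>z'\<in>UNIV. \<Sum>i'<q. (if z' = z \<and> i' = i then 1 else 0) * F (unit_tens z' q i'))"
        unfolding R_def xi_at_deg_def ws(1) unit_tens_simps using ws(2) by (simp add: xi_at_unit_tens)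
      also have "\<dots> = (\<Sum>z'\<in>UNIV. if z' = z then F (unit_tens z q i) else 0)"
      proof (rule sum.cong[OF refl])
        fix z' :: bool
        show "(\<Sum>i'<q. (if z' = z \<and> i' = i then 1 else 0) * F (unit_tens z' q i')) = (if z' = z then F (unit_tens z q i) else 0)"
        proof (cases "z' = z")
          case True
          have "(\<Sum>i'<q. (if z' = z \<and> i' = i then 1 else 0) * F (unit_tens z' q i')) = (\<Sum>i'<q. if i' = i then F (unit_tens z q i) else 0)"
            by (rule sum.cong) (auto simp: True)
          then show ?thesis using ws(2) True by simp
        qed simp
      qed
      also have "\<dots> = F ws" by (simp add: ws)
      finally show ?thesis by simp
    qed
  qed
  then show ?thesis by (simp add: R_def xi_at_deg_def)
qed

text \<open>The coordinates of a cochain with respect to the basis \<open>unit_tens z q i\<close> for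
  \<open>i < q\<close>.\<close>

definition coord :: "bool \<Rightarrow> nat \<Rightarrow> nat \<Rightarrow> cochain \<Rightarrow> complex" where
  "coord z q i p = lin_eval (xi_at_deg z q i) p"

text \<open>A cochain outside \<open>cochain_null\<close> is detected by some form, which by
  \<open>form_expand\<close> is a combination of coordinates.\<close>

lemma null_iff: "p \<in> cochain_null \<longleftrightarrow> (\<forall>z q i. coord z q i p = 0)"
proof
  assume "p \<in> cochain_null"
  then show "\<forall>z q i. coord z q i p = 0" by (simp add: coord_def form_null[OF form_xi_at_deg])
next
  assume v: "\<forall>z q i. coord z q i p = 0"
  show "p \<in> cochain_null"
  proof (rule ccontr)
    assume "p \<notin> cochain_null"
    then obtain F where F: "cochain_form F" "lin_eval F p \<noteq> 0" using ex_form by blast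
    define Q where "Q = length ` Poly_Mapping.keys p"
    have Q: "finite Q" by (simp add: Q_def)
    \<comment> \<open>On the finitely many degrees that occur, \<open>F\<close> is a combination of coordinate
      functions.\<close>
    have e: "F hs = (\<Sum>z\<in>UNIV. \<Sum>q\<in>Q. \<Sum>i<q. F (unit_tens z q i) * xi_at_deg z q i hs)" if "hs \<in> Poly_Mapping.keys p" for hs
    proof -
      have "F hs = (\<Sum>z\<in>UNIV. \<Sum>i<length hs. F (unit_tens z (length hs) i) * xi_at z i hs)"
        unfolding form_expand[OF F(1), of hs] by (simp add: mult.commute)
      also have "\<dots> = (\<Sum>z\<in>UNIV. \<Sum>q\<in>Q. \<Sum>i<q. F (unit_tens z q i) * xi_at_deg z q i hs)"
      proof (rule sum.cong[OF refl])
        fix z :: bool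
        have "(\<Sum>q\<in>Q. \<Sum>i<q. F (unit_tens z q i) * xi_at_deg z q i hs) = (\<Sum>q\<in>Q. if q = length hs then \<Sum>i<length hs. F (unit_tens z (length hs) i) * xi_at z i hs else 0)"
          by (rule sum.cong) (auto simp: xi_at_deg_def)
        also have "\<dots> = (\<Sum>i<length hs. F (unit_tens z (length hs) i) * xi_at z i hs)"
          using that Q by (simp add: Q_def)
        finally show "(\<Sum>i<length hs. F (unit_tens z (length hs) i) * xi_at z i hs) = (\<Sum>q\<in>Q. \<Sum>i<q. F (unit_tens z q i) * xi_at_deg z q i hs)" by simp
      qed
      finally show ?thesis .
    qed
    have "lin_eval F p = lin_eval (\<lambda>hs. \<Sum>z\<in>UNIV. \<Sum>q\<in>Q. \<Sum>i<q. F (unit_tens z q i) * xi_at_deg z q i hs) p"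
      unfolding lin_eval_def by (rule sum.cong[OF refl]) (subst e, assumption, rule refl)
    also have "\<dots> = 0" using v by (simp add: lin_eval_fun_linear coord_def)
    finally show False using F(2) by simp
  qed
qed

lemma coord_linear:
  "coord z q i (p + r) = coord z q i p + coord z q i r" "coord z q i (p - r) = coord z q i p - coord z q i r" "coord z q i (c_scale c p) = c * coord z q i p"
  "coord z q i 0 = 0" "coord z q i (\<Sum>j\<in>J. f j) = (\<Sum>j\<in>J. coord z q i (f j))"
  by (simp_all add: coord_def lin_eval_add lin_eval_diff lin_eval_scale lin_eval_sum)

lemma coord_tens: "coord z q i (tens hs) = (if length hs = q then xi_at z i hs else 0)"
  by (simp add: coord_def xi_at_deg_def)

lemma coord_beyond: "q \<le> i \<Longrightarrow> coord z q i p = 0"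
proof -
  assume "q \<le> i"
  then have "xi_at_deg z q i = (\<lambda>_. 0)" by (auto simp: xi_at_deg_def xi_at_beyond)
  then show ?thesis by (simp add: coord_def lin_eval_fun_linear)
qed

lemma approx_iff: "p \<approx> r \<longleftrightarrow> (\<forall>z q i. coord z q i p = coord z q i r)"
  by (simp add: cochain_eq_def null_iff coord_linear)

section \<open>The cocyclic operators in coordinates\<close>

text \<open>An operator given on pure tensors is known in coordinates once it agrees there with a linear
  expression.\<close>

lemma coord_lin_ext:
  assumes "\<And>hs. coord z q i (f hs) = R (tens hs)" "\<And>p r. R (p + r) = R p + R r" "\<And>c p. R (c_scale c p) = c * R p"
  shows "coord z q i (lin_ext f p) = R p"
proof -
  have R0: "R 0 = 0" using assms(3)[of 0 0] by simp
  have Rs: "finite J \<Longrightarrow> R (\<Sum>j\<in>J. g j) = (\<Sum>j\<in>J. R (g j))" for J and g :: "H1 list \<Rightarrow> cochain"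
    by (induction J rule: finite_induct) (auto simp: assms(2) R0)
  have "coord z q i (lin_ext f p) = (\<Sum>hs\<in>Poly_Mapping.keys p. Poly_Mapping.lookup p hs * R (tens hs))"
    by (simp add: lin_ext_def coord_linear assms(1))
  also have "\<dots> = R p"
    by (subst (3) cochain_expand) (simp add: Rs assms(3))
  finally show ?thesis .
qed

lemma xi_at_unit_right: "xi_at z i (ks @ [1]) = xi_at z i ks"
proof (cases "i < length ks")
  case False
  then show ?thesis by (cases "i - length ks") (simp_all add: xi_at_append xi_at_beyond xi_rules)
qed (simp add: xi_at_append eps_rules)

text \<open>Inserting \<open>1\<close> or taking the coproduct of the factor number \<open>j\<close> shifts
  the letters to the right of that place by one position. By counitality a letter in that factor
  itself is found in both of the new positions.\<close>

lemma xi_at_coface: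
  assumes "j \<le> Suc (length hs)"
  shows "coord z (Suc (length hs)) i (coface j hs) = (if i < j then xi_at z i hs else if i = 0 then 0 else xi_at z (i - 1) hs)"
proof -
  consider "j = 0" | "1 \<le> j" "j \<le> length hs" | "j = Suc (length hs)" using assms by linarith
  then show ?thesis
  proof cases
    case 1
    then show ?thesis by (cases i) (simp_all add: coface_def coord_tens xi_rules eps_rules)
  next
    case 3
    then show ?thesis by (simp add: coface_def coord_tens xi_at_unit_right xi_at_beyond)
  next
    case 2
    define as h bs where "as = take (j - 1) hs" and "h = hs ! (j - 1)" and "bs = drop j hs"
    have hs: "hs = as @ h # bs" unfolding as_def h_def bs_def using 2 id_take_nth_drop[of "j - 1" hs] by simp
    have la: "length as = j - 1" "Suc (length as + length bs) = length hs" using 2 by (auto simp: as_def bs_def)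
    have jl: "j = Suc (length as)" using 2 la by simp
    have cf: "coface j hs = (\<Sum>(k, l)\<in>Poly_Mapping.keys (coproduct h). c_scale (Poly_Mapping.lookup (coproduct h) (k, l)) (tens (as @ [k, l] @ bs)))"
      using 2 unfolding coface_def as_def h_def bs_def by simp
    have "coord z (Suc (length hs)) i (coface j hs) = cop_sum h (\<lambda>k l. xi_at z i (as @ k # l # bs))"
      unfolding cf by (simp add: coord_linear coord_tens cop_sum_def tensor_eval_def case_prod_unfold la(2)[symmetric])
    also have "\<dots> = (if i < j then xi_at z i hs else if i = 0 then 0 else xi_at z (i - 1) hs)"
    proof -
      consider "i < length as" | "i = length as" | "i = Suc (length as)" | "i \<ge> Suc (Suc (length as))" by linarith
      then show ?thesis
      proof cases
        case 1
        have e: "xi_at z i (as @ k # l # bs) = (eps k * eps l) * (xi_at z i as * eps_prod bs)" for k l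
          using 1 by (simp add: xi_at_append mult_ac)
        show ?thesis unfolding e cop_sum_linear(3) counit_left[OF lin_eps] using 1 jl by (simp add: hs xi_at_append mult_ac)
      next
        case i: 2
        have e: "xi_at z i (as @ k # l # bs) = (xi z k * eps l) * (eps_prod as * eps_prod bs)" for k l
          using i by (simp add: xi_at_append mult_ac)
        show ?thesis unfolding e cop_sum_linear(3) counit_right[OF lin_xi] using i jl by (simp add: hs xi_at_append mult_ac)
      next
        case 3
        have e: "xi_at z i (as @ k # l # bs) = (eps k * xi z l) * (eps_prod as * eps_prod bs)" for k l
          using 3 by (simp add: xi_at_append mult_ac)
        show ?thesis unfolding e cop_sum_linear(3) counit_left[OF lin_xi] using 3 jl by (simp add: hs xi_at_append mult_ac)
      next
        case ge: 4
        define m where "m = i - Suc (Suc (length as))"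
        have 4: "i = Suc (Suc (length as + m))" using ge by (simp add: m_def)
        have e: "xi_at z i (as @ k # l # bs) = (eps k * eps l) * (eps_prod as * xi_at z m bs)" for k l
          using 4 by (simp add: xi_at_append mult_ac)
        show ?thesis unfolding e cop_sum_linear(3) counit_left[OF lin_eps] using 4 jl by (simp add: hs xi_at_append mult_ac)
      qed
    qed
    finally show ?thesis .
  qed
qed

lemma alternating_split:
  assumes "i \<le> q"
  shows "(\<Sum>j\<le>Suc q. (-1) ^ j * (if i < j then a else b :: complex)) = (of_bool (odd q) - of_bool (even i)) * a + of_bool (even i) * b"
  using assms
proof (induction q rule: dec_induct)
  case base
  have "(\<Sum>j\<le>i. (-1) ^ j * (if i < j then a else b)) = (\<Sum>j\<le>i. (-1) ^ j) * b"
    by (simp add: sum_distrib_right)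
  moreover have "(\<Sum>j\<le>i. (-1) ^ j) = (of_bool (even i) :: complex)"
    by (induction i) auto
  ultimately show ?case by (simp add: of_bool_def)
next
  case (step n)
  then show ?case by (simp add: of_bool_def algebra_simps)
qed

abbreviation prev :: "(nat \<Rightarrow> complex) \<Rightarrow> nat \<Rightarrow> complex" where
  "prev v i \<equiv> (case i of 0 \<Rightarrow> 0 | Suc k \<Rightarrow> v k)"

text \<open>The Hochschild coboundary in coordinates. In position \<open>i\<close>, the cofaces with index
  larger than \<open>i\<close> contribute \<open>v i\<close> and the others \<open>v (i -
  1)\<close>, and the alternating signs cancel in pairs.\<close>

definition b_coord :: "nat \<Rightarrow> (nat \<Rightarrow> complex) \<Rightarrow> nat \<Rightarrow> complex" where
  "b_coord q v i = (of_bool (odd q) - of_bool (even i)) * v i + of_bool (even i) * prev v i"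

lemma length_coface:
  assumes "coord z q i (coface j hs) \<noteq> 0" "j \<le> Suc (length hs)"
  shows "q = Suc (length hs)"
proof (rule ccontr)
  assume q: "q \<noteq> Suc (length hs)"
  have "coord z q i (coface j hs) = 0"
    using q assms(2) by (auto simp: coface_def coord_tens coord_linear case_prod_unfold intro!: sum.neutral)
  with assms(1) show False by simp
qed

lemma coord_b: "coord z (Suc q) i (b_map p) = b_coord q (\<lambda>i. coord z q i p) i" and coord_b_0: "coord z 0 i (b_map p) = 0"
proof -
  have b: "coord z (Suc q) i (\<Sum>j\<le>Suc (length hs). c_scale ((-1) ^ j) (coface j hs)) = b_coord q (\<lambda>i. coord z q i (tens hs)) i" for hs
  proof (cases "length hs = q")
    case True
    have s: "coord z (Suc q) i (\<Sum>j\<le>Suc (length hs). c_scale ((-1) ^ j) (coface j hs))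
        = (\<Sum>j\<le>Suc q. (-1) ^ j * (if i < j then xi_at z i hs else if i = 0 then 0 else xi_at z (i - 1) hs))"
      unfolding coord_linear(5) True by (rule sum.cong[OF refl]) (use xi_at_coface[of _ hs z i] True in \<open>simp add: coord_linear\<close>)
    show ?thesis
    proof (cases "i \<le> q")
      case i: True
      show ?thesis unfolding s alternating_split[OF i] by (cases i) (simp_all add: b_coord_def coord_tens True)
    next
      case False
      then have "xi_at z i hs = 0" "xi_at z (i - 1) hs = 0" using True by (simp_all add: xi_at_beyond)
      then show ?thesis unfolding s using False by (cases i) (simp_all add: b_coord_def coord_tens True)
    qed
  next
    case False
    have "coord z (Suc q) i (coface j hs) = 0" if "j \<le> Suc (length hs)" for j
      using length_coface[OF _ that, of z "Suc q" i] False by auto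
    then have "coord z (Suc q) i (\<Sum>j\<le>Suc (length hs). c_scale ((-1) ^ j) (coface j hs)) = 0"
      unfolding coord_linear(5) by (intro sum.neutral) (simp add: coord_linear)
    then show ?thesis using False by (cases i) (simp_all add: b_coord_def coord_tens)
  qed
  show "coord z (Suc q) i (b_map p) = b_coord q (\<lambda>i. coord z q i p) i"
    unfolding b_map_def
    by (rule coord_lin_ext[where R = "\<lambda>p. b_coord q (\<lambda>i. coord z q i p) i", OF b]) (cases i; simp add: b_coord_def coord_linear algebra_simps)+
  have "coord z 0 i (\<Sum>j\<le>Suc (length hs). c_scale ((-1) ^ j) (coface j hs)) = 0" for hs
    unfolding coord_linear(5) by (intro sum.neutral) (auto simp: coord_linear dest: length_coface)
  then show "coord z 0 i (b_map p) = 0"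
    unfolding b_map_def by (intro coord_lin_ext[where R = "\<lambda>_. 0"]) auto
qed

text \<open>In \<open>S\<^sub>\<delta>(h) \<cdot> (k\<^sub>2 \<otimes> \<dots> \<otimes> 1)\<close> the
  letter of \<open>h\<close>, with the opposite sign, appears at every position; a letter further
  to the right moves one step to the left.\<close>

lemma coord_cyc: "coord z q i (cyc hs) = (if i < q then coord z q (Suc i) (tens hs) - coord z q 0 (tens hs) else 0)"
proof (cases hs)
  case Nil
  then show ?thesis by (simp add: cyc_def coord_tens xi_at_beyond)
next
  case (Cons h ks)
  have "coord z q i (cyc hs) = (if Suc (length ks) = q then act (xi_at z i) (S_delta h) (ks @ [1]) else act (\<lambda>_. 0) (S_delta h) (ks @ [1]))"
    unfolding coord_def Cons cyc_def list.case by (auto simp: xi_at_deg_def simp del: diag_act.simps intro!: act_cong)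
  then show ?thesis
    by (simp add: Cons act_xi_at S_delta_functionals xi_at_unit_right lin_eval_fun_linear coord_tens eps_rules xi_at_beyond del: diag_act.simps)
qed

lemma coord_tau: "coord z q i (tau p) = (if i < q then coord z q (Suc i) p - coord z q 0 p else 0)"
  unfolding tau_def
  by (rule coord_lin_ext[where R = "\<lambda>p. if i < q then coord z q (Suc i) p - coord z q 0 p else 0", OF coord_cyc]) (auto simp: coord_linear algebra_simps)

lemma coord_cyc_sign: "coord z q i (cyc_sign p) = (if i < q then (-1) ^ q * (coord z q (Suc i) p - coord z q 0 p) else 0)"
  unfolding cyc_sign_def
proof (rule coord_lin_ext[where R = "\<lambda>p. if i < q then (-1) ^ q * (coord z q (Suc i) p - coord z q 0 p) else 0"])
  show "coord z q i (c_scale ((-1) ^ length hs) (cyc hs)) = (if i < q then (-1) ^ q * (coord z q (Suc i) (tens hs) - coord z q 0 (tens hs)) else 0)" for hs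
    by (simp add: coord_linear coord_cyc coord_tens)
qed (auto simp: coord_linear algebra_simps)

lemma coord_cyc_sign_mod:
  assumes "i \<le> q"
  shows "coord z q i (cyc_sign p) = (-1) ^ q * (coord z q (Suc i mod Suc q) p - coord z q 0 p)"
  using assms by (cases "i = q") (auto simp: coord_cyc_sign)

text \<open>Put the value \<open>0\<close> in position \<open>q\<close>. Then the cyclic operator is, up to
  sign, the rotation of the \<open>q + 1\<close> positions, normalised by subtracting a constant
  such that the value in position \<open>q\<close> is \<open>0\<close> again.\<close>

lemma coord_cyc_sign_pow:
  "i \<le> q \<Longrightarrow> coord z q i ((cyc_sign ^^ j) p) = (-1) ^ (q * j) * (coord z q ((i + j) mod Suc q) p - coord z q ((q + j) mod Suc q) p)"
proof (induction j arbitrary: i)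
  case 0
  then show ?case by (simp add: coord_beyond)
next
  case (Suc j)
  have m: "Suc i mod Suc q \<le> q" by (simp add: less_Suc_eq_le[symmetric])
  have e: "(Suc i mod Suc q + j) mod Suc q = (i + Suc j) mod Suc q" by (metis add_Suc add_Suc_right mod_add_left_eq)
  have e2: "(q + Suc j) mod Suc q = j mod Suc q" by (metis add_Suc_right add_Suc mod_add_self1)
  show ?case
    unfolding funpow.simps o_def coord_cyc_sign_mod[OF Suc.prems] Suc.IH[OF m] Suc.IH[OF le0] e e2
    by (simp add: power_add algebra_simps)
qed

lemma sum_mod_shift: "(\<Sum>j<Suc q. f ((i + j) mod Suc q)) = (\<Sum>j<Suc q. f j :: complex)"
proof (induction i)
  case (Suc i)
  have "(\<Sum>j<Suc q. f ((Suc i + j) mod Suc q)) + f (i mod Suc q) = (\<Sum>j<Suc (Suc q). f ((i + j) mod Suc q))"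
    by (subst (2) sum.lessThan_Suc_shift) simp
  also have "\<dots> = (\<Sum>j<Suc q. f ((i + j) mod Suc q)) + f (i mod Suc q)"
    by (subst sum.lessThan_Suc) (simp only: mod_add_self2)
  finally show ?case using Suc by simp
qed simp

definition alt_sum :: "nat \<Rightarrow> (nat \<Rightarrow> complex) \<Rightarrow> complex" where
  "alt_sum q v = (\<Sum>k<q. (-1) ^ k * v k)"

text \<open>The sum over all rotations is constant if \<open>q\<close> is even and a multiple of the
  alternating sequence if \<open>q\<close> is odd. After the normalisation only the latter
  survives.\<close>

lemma coord_cyc_norm:
  assumes "i < q"
  shows "coord z q i (cyc_norm p) = (if odd q then (1 + (-1) ^ i) * alt_sum q (\<lambda>k. coord z q k p) else 0)"
proof -
  define v where "v = (\<lambda>k. coord z q k p)"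
  have 1: "coord z q i (cyc_norm p) = (\<Sum>j<Suc q. (-1) ^ (q * j) * (v ((i + j) mod Suc q) - v ((q + j) mod Suc q)))"
    unfolding cyc_norm_def v_def
  proof (rule coord_lin_ext[where R = "\<lambda>p. \<Sum>j<Suc q. (-1) ^ (q * j) * (coord z q ((i + j) mod Suc q) p - coord z q ((q + j) mod Suc q) p)"])
    fix hs
    show "coord z q i (\<Sum>j\<le>length hs. (cyc_sign ^^ j) (tens hs)) = (\<Sum>j<Suc q. (-1) ^ (q * j) * (coord z q ((i + j) mod Suc q) (tens hs) - coord z q ((q + j) mod Suc q) (tens hs)))"
      unfolding coord_linear(5) coord_cyc_sign_pow[OF less_imp_le[OF assms]] lessThan_Suc_atMost
      by (cases "length hs = q") (simp_all add: coord_tens)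
  qed (simp_all add: coord_linear algebra_simps sum.distrib sum_distrib_left sum_subtractf del: sum.lessThan_Suc)
  show ?thesis
  proof (cases "odd q")
    case False
    then have "coord z q i (cyc_norm p) = (\<Sum>j<Suc q. v ((i + j) mod Suc q)) - (\<Sum>j<Suc q. v ((q + j) mod Suc q))"
      unfolding 1 by (simp add: sum_subtractf power_mult del: sum.lessThan_Suc)
    then show ?thesis unfolding sum_mod_shift using False by simp
  next
    case True
    \<comment> \<open>For odd \<open>q\<close> the number \<open>q + 1\<close> of positions is even, so rotation
      is compatible with the alternating signs.\<close>
    have s: "(\<Sum>j<Suc q. (-1) ^ (q * j) * v ((l + j) mod Suc q)) = (-1) ^ l * alt_sum q v" for l
    proof -
      have "(-1) ^ (q * j) * v ((l + j) mod Suc q) = (-1) ^ l * ((-1) ^ ((l + j) mod Suc q) * v ((l + j) mod Suc q))" for j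
      proof -
        have "even ((l + j) mod Suc q) = even (l + j)" using True by (simp add: even_mod_2_iff dvd_mod_iff)
        then have "(-1) ^ ((l + j) mod Suc q) = (-1 :: complex) ^ (l + j)" by (simp add: minus_one_power_iff)
        moreover have "(-1) ^ (q * j) = (-1 :: complex) ^ j" using True by (simp add: power_mult)
        moreover have "(-1) ^ l * (-1) ^ l = (1 :: complex)" by (simp add: power_add[symmetric])
        ultimately show ?thesis by (simp add: power_add mult.assoc[symmetric])
      qed
      then have "(\<Sum>j<Suc q. (-1) ^ (q * j) * v ((l + j) mod Suc q)) = (-1) ^ l * (\<Sum>j<Suc q. (-1) ^ ((l + j) mod Suc q) * v ((l + j) mod Suc q))"
        by (simp only: sum_distrib_left)
      also have "(\<Sum>j<Suc q. (-1) ^ ((l + j) mod Suc q) * v ((l + j) mod Suc q)) = (\<Sum>k<Suc q. (-1) ^ k * v k)"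
        by (rule sum_mod_shift)
      also have "\<dots> = alt_sum q v" by (simp add: alt_sum_def v_def coord_beyond)
      finally show ?thesis .
    qed
    have "coord z q i (cyc_norm p) = (-1) ^ i * alt_sum q v - (-1) ^ q * alt_sum q v"
      unfolding 1 right_diff_distrib sum_subtractf s ..
    then show ?thesis using True by (simp add: v_def algebra_simps)
  qed
qed

lemma coord_extra_codeg: "coord z q i (extra_codeg p) = (if i < q then coord z (Suc q) (Suc i) p - coord z (Suc q) 0 p else 0)"
proof -
  have "coord z q i (extra_codeg p) = (if i < q then coord z (Suc q) i (tau p) else 0)"
    unfolding extra_codeg_def
  proof (rule coord_lin_ext[where R = "\<lambda>p. if i < q then coord z (Suc q) i p else 0"])
    show "coord z q i (if hs = [] then 0 else codegeneracy (length hs - 1) hs) = (if i < q then coord z (Suc q) i (tens hs) else 0)" for hs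
    proof (cases hs rule: rev_cases)
      case Nil
      then show ?thesis by (simp add: coord_linear coord_tens)
    next
      case (snoc ks k)
      then show ?thesis by (auto simp: codegeneracy_def coord_linear coord_tens counit_eq_eps xi_at_append xi_at_beyond)
    qed
  qed (auto simp: coord_linear)
  then show ?thesis by (simp add: coord_tau)
qed

text \<open>For odd \<open>q\<close>, the component of \<open>B_map\<close> in degree \<open>q\<close> is
  this scalar times the sequence \<open>2, 0, 2, 0, \<dots>\<close>.\<close>

definition B_coord :: "nat \<Rightarrow> (nat \<Rightarrow> complex) \<Rightarrow> complex" where
  "B_coord q y = alt_sum q (\<lambda>k. y (Suc k) - y (Suc (Suc k)) - y 0 + y 1)"

lemma coord_B: "coord z q i (B_map p) = (if odd q \<and> i < q then (1 + (-1) ^ i) * B_coord q (\<lambda>k. coord z (Suc q) k p) else 0)"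
  unfolding B_map_def
proof (rule coord_lin_ext[where R = "\<lambda>p. if odd q \<and> i < q then (1 + (-1) ^ i) * B_coord q (\<lambda>k. coord z (Suc q) k p) else 0"])
  fix hs
  have e: "coord z (Suc q) (Suc k) (tens hs - cyc_sign (tens hs)) - coord z (Suc q) 0 (tens hs - cyc_sign (tens hs))
      = coord z (Suc q) (Suc k) (tens hs) - coord z (Suc q) (Suc (Suc k)) (tens hs) - coord z (Suc q) 0 (tens hs) + coord z (Suc q) 1 (tens hs)"
    if "k < q" "odd q" for k
    using that by (simp add: coord_linear coord_cyc_sign)
  have c: "alt_sum q (\<lambda>k. coord z q k (extra_codeg (tens hs - cyc_sign (tens hs)))) = B_coord q (\<lambda>k. coord z (Suc q) k (tens hs))" if "odd q"
    unfolding alt_sum_def B_coord_def by (rule sum.cong[OF refl]) (use e that in \<open>simp add: coord_extra_codeg\<close>)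
  show "coord z q i (if hs = [] then 0 else cyc_norm (extra_codeg (tens hs - cyc_sign (tens hs))))
      = (if odd q \<and> i < q then (1 + (-1) ^ i) * B_coord q (\<lambda>k. coord z (Suc q) k (tens hs)) else 0)"
  proof (cases "i < q")
    case True
    show ?thesis
    proof (cases "hs = []")
      case h: True
      then show ?thesis by (simp add: coord_linear coord_tens B_coord_def alt_sum_def)
    next
      case False
      then show ?thesis using True c by (simp add: coord_cyc_norm)
    qed
  qed (simp add: coord_beyond)
qed (simp_all add: coord_linear B_coord_def alt_sum_def algebra_simps sum.distrib sum_distrib_left sum_subtractf)

lemma coord_tot: "coord z q i (tot_diff p) = coord z q i (b_map p) + coord z q i (B_map p)"
  unfolding tot_diff_def
proof (rule coord_lin_ext[where R = "\<lambda>p. coord z q i (b_map p) + coord z q i (B_map p)"])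
  show "coord z q i (b_map (p + r)) + coord z q i (B_map (p + r)) = coord z q i (b_map p) + coord z q i (B_map p) + (coord z q i (b_map r) + coord z q i (B_map r))" for p r
    by (simp add: b_map_def B_map_def lin_ext_add coord_linear)
  show "coord z q i (b_map (c_scale c p)) + coord z q i (B_map (c_scale c p)) = c * (coord z q i (b_map p) + coord z q i (B_map p))" for c p
    by (simp add: b_map_def B_map_def lin_ext_scale coord_linear algebra_simps)
qed (simp add: coord_linear)

lemma coord_tot_0: "coord z 0 i (tot_diff p) = 0"
  by (simp add: coord_beyond)

lemma coord_tot_Suc:
  "coord z (Suc q) i (tot_diff p) = b_coord q (\<lambda>k. coord z q k p) i +
     (if even q \<and> i < Suc q then (1 + (-1) ^ i) * B_coord (Suc q) (\<lambda>k. coord z (Suc (Suc q)) k p) else 0)"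
  by (simp add: coord_tot coord_b coord_B)

lemma coord_tot_diff_linear: "coord z q i (tot_diff (p - r)) = coord z q i (tot_diff p) - coord z q i (tot_diff r)"
  using tot_diff_add[of "p - r" r] by (simp add: coord_linear algebra_simps)

text \<open>The sum telescopes to \<open>x q\<close>, an entry in a position beyond the range.\<close>

lemma B_coord_b_coord:
  assumes "odd q" "x q = 0"
  shows "B_coord q (b_coord q x) = 0"
proof -
  obtain m where q: "q = 2 * m + 1" using assms(1) by (rule oddE)
  have b: "b_coord q x k = (if odd k then x k else prev x k)" for k using assms(1) by (simp add: b_coord_def)
  have t: "(-1) ^ k * (b_coord q x (Suc k) - b_coord q x (Suc (Suc k)) - b_coord q x 0 + b_coord q x 1) = (-1) ^ k * x 1 + of_bool (odd k) * (x (k + 2) - x k)" for k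
    by (simp add: b)
  have "(\<Sum>k<2 * n + 1. (-1) ^ k * x 1 + of_bool (odd k) * (x (k + 2) - x k)) = x (2 * n + 1)" for n
  proof (induction n)
    case (Suc n)
    have "2 * Suc n + 1 = Suc (Suc (2 * n + 1))" by simp
    then show ?case using Suc by (simp only: sum.lessThan_Suc) (simp add: algebra_simps)
  qed simp
  from this[of m] show ?thesis unfolding B_coord_def alt_sum_def t using assms(2) q by simp
qed

text \<open>In coordinates the square of \<open>b_map\<close> and the composition of \<open>B_map\<close>
  followed by \<open>b_map\<close> vanish entry by entry, and two steps of \<open>B_map\<close>
  never meet because it only connects even degrees to odd ones. For \<open>b_map\<close> followed
  by \<open>B_map\<close> the claim is \<open>B_coord_b_coord\<close>.\<close>

lemma tot_diff_square: "coord z q i (tot_diff (tot_diff x)) = 0"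
proof (cases q)
  case 0
  then show ?thesis by (simp add: coord_tot_0)
next
  case q: (Suc m)
  show ?thesis
  proof (cases "odd m")
    \<comment> \<open>In the odd degree \<open>m\<close> a total coboundary has no entries in odd positions, and
      these are the only ones that \<open>b_map\<close> reads there.\<close>
    case True
    then obtain m' where m': "m = Suc m'" "even m'" by (cases m) auto
    have o: "coord z m j (tot_diff x) = 0" if "odd j" for j
      using that m' unfolding m'(1) coord_tot_Suc by (simp add: b_coord_def)
    have "b_coord m (\<lambda>k. coord z m k (tot_diff x)) i = 0"
      using True o by (cases i) (auto simp: b_coord_def)
    then show ?thesis unfolding q coord_tot_Suc using True by simp
  next
    case False
    have even_deg: "coord z (Suc n) j (tot_diff x) = b_coord n (\<lambda>k. coord z n k x) j" if "odd n" for n j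
      using that by (simp add: coord_tot_Suc)
    have 1: "b_coord m (\<lambda>k. coord z m k (tot_diff x)) i = 0"
    proof (cases m)
      case 0
      then show ?thesis by (cases i) (simp_all add: b_coord_def coord_beyond)
    next
      case (Suc m')
      then have "odd m'" using False by simp
      then show ?thesis unfolding Suc even_deg[OF \<open>odd m'\<close>] by (cases i; cases "i - 1") (auto simp: b_coord_def)
    qed
    have "B_coord (Suc m) (\<lambda>k. coord z (Suc (Suc m)) k (tot_diff x)) = B_coord (Suc m) (b_coord (Suc m) (\<lambda>k. coord z (Suc m) k x))"
      using even_deg[of "Suc m"] False by (simp add: B_coord_def)
    also have "\<dots> = 0" by (rule B_coord_b_coord) (use False in \<open>simp_all add: coord_beyond\<close>)
    finally have 2: "B_coord (Suc m) (\<lambda>k. coord z (Suc (Suc m)) k (tot_diff x)) = 0" .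
    show ?thesis unfolding q coord_tot_Suc[of z m i "tot_diff x"] 1 2 by simp
  qed
qed

section \<open>The total cohomology\<close>

text \<open>The cochain of degree \<open>q\<close> with given coordinates.\<close>

definition realize :: "nat \<Rightarrow> (bool \<Rightarrow> nat \<Rightarrow> complex) \<Rightarrow> cochain" where
  "realize q u = (\<Sum>z\<in>UNIV. \<Sum>i<q. c_scale (u z i) (tens (unit_tens z q i)))"

lemma coord_realize: "coord z q' i (realize q u) = (if q' = q \<and> i < q then u z i else 0)"
proof (cases "q' = q")
  case True
  have "coord z q i (realize q u) = (\<Sum>z'\<in>UNIV. \<Sum>i'<q. u z' i' * (if z = z' \<and> i = i' then 1 else 0))"
    unfolding realize_def coord_linear by (intro sum.cong refl) (simp add: coord_tens unit_tens_simps xi_at_unit_tens)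
  also have "\<dots> = (\<Sum>z'\<in>UNIV. if z = z' then (if i < q then u z i else 0) else 0)"
  proof (rule sum.cong[OF refl])
    fix z' :: bool
    show "(\<Sum>i'<q. u z' i' * (if z = z' \<and> i = i' then 1 else 0)) = (if z = z' then (if i < q then u z i else 0) else 0)"
    proof (cases "z = z'")
      case True
      have "(\<Sum>i'<q. u z' i' * (if z = z' \<and> i = i' then 1 else 0)) = (\<Sum>i'<q. if i' = i then u z i else 0)"
        by (rule sum.cong) (auto simp: True)
      then show ?thesis by (simp add: True)
    qed simp
  qed
  finally show ?thesis using True by simp
next
  case False
  then show ?thesis unfolding realize_def coord_linear by (simp add: coord_tens unit_tens_simps)
qed

text \<open>For even \<open>Q\<close> a cocycle satisfies \<open>y 0 = 0\<close> and \<open>y (k + 1) = y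
  k\<close> for odd \<open>k\<close>; it is the coboundary of \<open>y\<close> itself with the
  last entry dropped. For odd \<open>Q\<close> its odd entries vanish. The coboundaries of
  \<open>u\<close> in the even positions are the differences \<open>u (i - 1) - u i\<close>, which
  are solved with \<open>u\<close> supported in even positions except for the last one.\<close>

lemma b_coord_exact:
  assumes Q: "Q \<ge> 2" and y: "\<And>i. i \<ge> Q \<Longrightarrow> y i = 0" and b: "\<And>i. b_coord Q y i = 0"
  shows "\<exists>u. \<forall>i<Q. b_coord (Q - 1) (\<lambda>k. if k < Q - 1 then u k else 0) i = y i"
proof (cases "even Q")
  case True
  \<comment> \<open>The positions \<open>1, 2\<close> and \<open>3, 4\<close> and so on are paired; the last
    position \<open>Q - 1\<close> is paired with one beyond the range, so that \<open>y\<close>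
    vanishes there.\<close>
  have y0: "y 0 = 0" using b[of 0] True by (simp add: b_coord_def)
  have ye: "y (Suc k) = y k" if "odd k" for k using b[of "Suc k"] True that by (simp add: b_coord_def)
  have yl: "y (Q - 1) = 0" using ye[of "Q - 1"] y[of Q] True Q by (simp add: Suc_diff_1)
  have "b_coord (Q - 1) (\<lambda>k. if k < Q - 1 then y k else 0) i = y i" if "i < Q" for i
  proof (cases "odd i")
    case i: True
    then show ?thesis using that yl True Q by (cases "i = Q - 1") (auto simp: b_coord_def)
  next
    case i: False
    then show ?thesis using that True Q y0 ye by (cases i) (auto simp: b_coord_def)
  qed
  then show ?thesis by blast
next
  case False
  have yo: "y i = 0" if "odd i" for i using b[of i] False that by (simp add: b_coord_def)
  obtain R where R: "Q = Suc (Suc R)" using le_Suc_ex[OF Q] by auto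
  \<comment> \<open>The penultimate position \<open>Q - 2\<close> is odd and carries the last entry of
    \<open>y\<close>, since there is no \<open>u (Q - 1)\<close> to produce it.\<close>
  define u where "u = (\<lambda>k. if even k then - y k else if k = Q - 2 then y (Q - 1) else 0)"
  have "b_coord (Q - 1) (\<lambda>k. if k < Q - 1 then u k else 0) i = y i" if "i < Q" for i
  proof (cases "odd i")
    case True
    then show ?thesis using False yo by (simp add: b_coord_def)
  next
    case i: False
    then show ?thesis using that False yo
      by (cases i) (auto simp: b_coord_def u_def R less_Suc_eq split: if_splits)
  qed
  then show ?thesis by blast
qed

text \<open>In degree \<open>Q + 1\<close> the total differential only sees the top component, through
  \<open>b_map\<close>. This component is therefore a Hochschild cocycle and can be removed by a
  coboundary.\<close>

lemma top_reduce:
  assumes Q: "Q \<ge> 2" and p: "\<And>z q i. q > Q \<Longrightarrow> coord z q i p = 0" and d: "\<And>z i. coord z (Suc Q) i (tot_diff p) = 0"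
  shows "\<exists>x. \<forall>z q i. q \<ge> Q \<longrightarrow> coord z q i (p - tot_diff x) = 0"
proof -
  have b: "b_coord Q (\<lambda>k. coord z Q k p) i = 0" for z i
  proof -
    have "B_coord (Suc Q) (\<lambda>k. coord z (Suc (Suc Q)) k p) = 0" by (simp add: p B_coord_def alt_sum_def)
    then show ?thesis using d[of z i] by (simp add: coord_tot_Suc split: if_splits)
  qed
  have "\<exists>u. \<forall>i<Q. b_coord (Q - 1) (\<lambda>k. if k < Q - 1 then u k else 0) i = coord z Q i p" for z
    by (rule b_coord_exact[OF Q coord_beyond b])
  then obtain u where u: "\<And>z i. i < Q \<Longrightarrow> b_coord (Q - 1) (\<lambda>k. if k < Q - 1 then u z k else 0) i = coord z Q i p" by metis
  define x where "x = realize (Q - 1) u"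
  obtain R where R: "Q = Suc R" using Q by (cases Q) auto
  have "coord z q i (p - tot_diff x) = 0" if qQ: "q \<ge> Q" for z q i
  proof (cases "q = Q")
    case True
    have "coord z Q i (tot_diff x) = coord z Q i p" if "i < Q"
      using u[OF that, of z] unfolding R coord_tot_Suc by (simp add: x_def coord_realize R B_coord_def alt_sum_def)
    then show ?thesis using True by (cases "i < Q") (simp_all add: coord_linear coord_beyond)
  next
    case False
    then obtain r where r: "q = Suc r" "r \<ge> Q" using qQ R by (cases q) auto
    have "coord z q i (tot_diff x) = 0"
      using r R by (cases i) (simp_all add: r(1) coord_tot_Suc x_def coord_realize B_coord_def alt_sum_def b_coord_def)
    then show ?thesis using p[of q z i] False qQ by (simp add: coord_linear)
  qed
  then show ?thesis by blast
qed

text \<open>Besides total cocycles this is also applied to cochains whose total differential is concentrated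
  in low degree; therefore the hypothesis only concerns degrees at least \<open>3\<close>.\<close>

lemma reduce:
  assumes "\<And>z q i. q > Q \<Longrightarrow> coord z q i p = 0" "\<And>z q i. q \<ge> 3 \<Longrightarrow> coord z q i (tot_diff p) = 0"
  shows "\<exists>x. \<forall>z q i. q \<ge> 2 \<longrightarrow> coord z q i (p - tot_diff x) = 0"
  using assms
proof (induction Q arbitrary: p)
  case 0
  then have "\<forall>z q i. q \<ge> 2 \<longrightarrow> coord z q i (p - tot_diff 0) = 0" by (simp add: tot_diff_zero)
  then show ?case by blast
next
  case (Suc Q)
  show ?case
  proof (cases "Suc Q \<ge> 2")
    case True
    obtain x where x: "\<And>z q i. q \<ge> Suc Q \<Longrightarrow> coord z q i (p - tot_diff x) = 0"
      using top_reduce[OF True Suc.prems(1) Suc.prems(2)] True by auto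
    have "\<exists>x'. \<forall>z q i. q \<ge> 2 \<longrightarrow> coord z q i ((p - tot_diff x) - tot_diff x') = 0"
    proof (rule Suc.IH)
      show "coord z q i (p - tot_diff x) = 0" if "q > Q" for z q i using x that by simp
      show "coord z q i (tot_diff (p - tot_diff x)) = 0" if "q \<ge> 3" for z q i
        using Suc.prems(2)[OF that] by (simp add: coord_tot_diff_linear tot_diff_square)
    qed
    then obtain x' where "\<And>z q i. q \<ge> 2 \<Longrightarrow> coord z q i ((p - tot_diff x) - tot_diff x') = 0" by blast
    then have "\<forall>z q i. q \<ge> 2 \<longrightarrow> coord z q i (p - tot_diff (x + x')) = 0"
      by (simp add: tot_diff_add diff_diff_add)
    then show ?thesis by blast
  next
    case False
    then have "\<forall>z q i. q \<ge> 2 \<longrightarrow> coord z q i (p - tot_diff 0) = 0" using Suc.prems(1) by (simp add: tot_diff_zero)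
    then show ?thesis by blast
  qed
qed

lemma coord_bounded: "\<exists>Q. \<forall>z q i. q > Q \<longrightarrow> coord z q i p = 0"
proof -
  obtain Q where Q: "\<And>hs. hs \<in> Poly_Mapping.keys p \<Longrightarrow> length hs \<le> Q"
    using finite_nat_set_iff_bounded_le[of "length ` Poly_Mapping.keys p"] by auto
  have "coord z q i p = 0" if "q > Q" for z q i
    unfolding coord_def lin_eval_def xi_at_deg_def by (intro sum.neutral) (use Q that in force)
  then show ?thesis by blast
qed

text \<open>The general element of the span of the two cocycles, with coefficients indexed by the letters.\<close>

definition combo :: "(bool \<Rightarrow> complex) \<Rightarrow> cochain" where
  "combo c = c_scale (c True) cH0 + c_scale (c False) cH1"

lemma coord_combo: "coord z q i (combo c) = (if q = 1 \<and> i = 0 then c z else 0)"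
proof -
  have "coord z q i (tens [h]) = (if q = 1 \<and> i = 0 then xi z h else 0)" for h
    by (cases i) (simp_all add: coord_tens)
  then show ?thesis by (simp add: combo_def coord_linear cH0_def cH1_def xi_rules)
qed

lemma combo_cocycle: "combo c \<in> tot_cocycles"
proof -
  have "coord z q i (tot_diff (combo c)) = 0" for z q i
    by (cases q; cases i) (auto simp: coord_tot_0 coord_tot_Suc coord_combo b_coord_def B_coord_def alt_sum_def split: nat.splits)
  then show ?thesis by (simp add: tot_cocycles_def approx_iff coord_linear)
qed

text \<open>After \<open>reduce\<close> only degrees \<open>0\<close> and \<open>1\<close> remain. Degree
  \<open>0\<close> is zero, because there is no position for a letter, and in degree
  \<open>1\<close> the coordinates are those of a combination.\<close>

lemma cocycle_combo:
  assumes "p \<in> tot_cocycles"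
  shows "\<exists>c. p - combo c \<in> tot_coboundaries"
proof -
  have d: "coord z q i (tot_diff p) = 0" for z q i using assms by (simp add: tot_cocycles_def approx_iff coord_linear)
  obtain Q where "\<And>z q i. q > Q \<Longrightarrow> coord z q i p = 0" using coord_bounded[of p] by blast
  from reduce[OF this d] obtain x where x: "\<And>z q i. q \<ge> 2 \<Longrightarrow> coord z q i (p - tot_diff x) = 0" by blast
  define c where "c = (\<lambda>z. coord z 1 0 (p - tot_diff x))"
  have "coord z q i (p - tot_diff x) = coord z q i (combo c)" for z q i
  proof (cases "q \<ge> 2")
    case False
    then consider "q = 0" | "q = 1" by linarith
    then show ?thesis by cases (auto simp: coord_combo c_def coord_beyond)
  qed (simp add: x coord_combo)
  then have "p - combo c \<approx> tot_diff x" by (simp add: approx_iff coord_linear algebra_simps)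
  then show ?thesis by (auto simp: tot_coboundaries_def)
qed

text \<open>If \<open>combo c = D x\<close>, then \<open>x\<close> may be replaced by a cochain of degree at
  most \<open>1\<close> by subtracting a coboundary. The total differential of such a cochain has
  no component in degree \<open>1\<close>, since there are no non-zero cochains of degree
  \<open>0\<close> and \<open>B\<close> only reaches degree \<open>1\<close> from degree
  \<open>2\<close>.\<close>

lemma combo_coboundary:
  assumes "combo c \<in> tot_coboundaries"
  shows "c z = 0"
proof -
  obtain x where x: "combo c \<approx> tot_diff x" using assms by (auto simp: tot_coboundaries_def)
  obtain Q where Q: "\<And>z q i. q > Q \<Longrightarrow> coord z q i x = 0" using coord_bounded[of x] by blast
  have "coord z q i (tot_diff x) = 0" if "q \<ge> 3" for z q i
    using x that by (simp add: approx_iff coord_combo) (metis One_nat_def Suc_n_not_le_n numeral_3_eq_3 not_less_eq_eq le_SucI)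
  from reduce[OF Q this] obtain x' where x': "\<And>z q i. q \<ge> 2 \<Longrightarrow> coord z q i (x - tot_diff x') = 0" by blast
  have "coord z 1 0 (tot_diff (x - tot_diff x')) = 0"
    using x'[of 2 z] by (simp add: coord_tot_Suc[of z 0, simplified] b_coord_def B_coord_def alt_sum_def coord_beyond numeral_2_eq_2)
  then have "coord z 1 0 (tot_diff x) = 0" by (simp add: coord_tot_diff_linear tot_diff_square)
  then show ?thesis using x by (simp add: approx_iff coord_combo) (metis coord_combo)
qed

lemma cyclic_cocycle_single: "cyclic_cocycle 1 (combo (\<lambda>z. if z = w then 1 else 0))"
  "combo (\<lambda>z. if z = True then 1 else 0) = cH0" "combo (\<lambda>z. if z = False then 1 else 0) = cH1"
proof -
  show 1: "combo (\<lambda>z. if z = True then 1 else 0) = cH0" "combo (\<lambda>z. if z = False then 1 else 0) = cH1"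
    by (simp_all add: combo_def)
  define c where "c = combo (\<lambda>z. if z = w then 1 else 0)"
  have "c = cH0 \<or> c = cH1" using 1 by (cases w) (auto simp: c_def)
  then have deg: "of_degree 1 c" by (auto simp: of_degree_def cH0_def cH1_def tens_def)
  have "coord z q i (b_map c) = 0" for z q i
    by (cases q; cases i) (auto simp: coord_b_0 coord_b coord_combo c_def b_coord_def split: nat.splits)
  then have b: "b_map c \<approx> 0" by (simp add: approx_iff coord_linear(4))
  have "coord z q i (tau c) = coord z q i (c_scale ((-1) ^ 1) c)" for z q i
    unfolding coord_linear(3) coord_tau by (auto simp: c_def coord_combo)
  then have t: "tau c \<approx> c_scale ((-1) ^ 1) c" unfolding approx_iff by blast
  show "cyclic_cocycle 1 (combo (\<lambda>z. if z = w then 1 else 0))"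
    using deg b t unfolding cyclic_cocycle_def c_def[symmetric] by blast
qed

lemma HP_class_eq_iff:
  assumes "p \<in> tot_cocycles" "r \<in> tot_cocycles"
  shows "HP_class p = HP_class r \<longleftrightarrow> p - r \<in> tot_coboundaries"
proof -
  have "cohomologous p p" "cohomologous r r"
    using assms cc.subspace_0[OF subspace_coboundaries] by (simp_all add: cohomologous_def)
  then have "HP_class p = HP_class r \<longleftrightarrow> cohomologous p r"
    using Quotient3_rel[OF Quotient3_HP, of p r] by blast
  then show ?thesis using assms by (simp add: cohomologous_def)
qed

lemma HP_class_surj: "\<exists>p\<in>tot_cocycles. x = HP_class p"
proof
  show "rep_HP x \<in> tot_cocycles"
    using Quotient3_rep_reflp[OF Quotient3_HP, of x] by (simp add: cohomologous_def)
  show "x = HP_class (rep_HP x)" by (rule Quotient3_abs_rep[OF Quotient3_HP, symmetric])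
qed

lemma cH_cocycles: "cH0 \<in> tot_cocycles" "cH1 \<in> tot_cocycles"
  using combo_cocycle[of "\<lambda>z. if z = True then 1 else 0"] combo_cocycle[of "\<lambda>z. if z = False then 1 else 0"]
  by (simp_all only: cyclic_cocycle_single)

lemma HP_class_combo: "HP_class (combo c) = HP_scale (c True) (HP_class cH0) + HP_scale (c False) (HP_class cH1)"
proof -
  have co: "cohomologous p p" if "p \<in> tot_cocycles" for p
    using that cc.subspace_0[OF subspace_coboundaries] by (simp add: cohomologous_def)
  note s = cc.subspace_scale[OF subspace_cocycles]
  show ?thesis
    unfolding combo_def by (simp add: HP_scale.abs_eq plus_HP.abs_eq co cH_cocycles s)
qed

lemma HP_basis:
  "HP_class cH0 \<noteq> HP_class cH1 \<and> HP.independent {HP_class cH0, HP_class cH1} \<and> HP.span {HP_class cH0, HP_class cH1} = UNIV"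
proof -
  have z: "HP_class 0 = 0" by (simp add: zero_HP_def)
  have ind: "a = 0 \<and> b = 0" if "HP_scale a (HP_class cH0) + HP_scale b (HP_class cH1) = 0" for a b
  proof -
    define c where "c = (\<lambda>z. if z then a else b)"
    have "HP_class (combo c) = HP_class 0" using that by (simp add: HP_class_combo c_def z)
    then have "combo c - 0 \<in> tot_coboundaries"
      by (subst (asm) HP_class_eq_iff) (auto intro: combo_cocycle cc.subspace_0[OF subspace_cocycles])
    then have "c z = 0" for z by (intro combo_coboundary) simp
    from this[of True] this[of False] show ?thesis by (simp add: c_def)
  qed
  have ne: "HP_class cH0 \<noteq> HP_class cH1"
  proof
    assume "HP_class cH0 = HP_class cH1"
    then have "HP_scale 1 (HP_class cH0) + HP_scale (-1) (HP_class cH1) = 0" by simp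
    from ind[OF this] show False by simp
  qed
  have "HP_class cH1 \<noteq> 0" using ind[of 0 1] by auto
  then have i1: "HP.independent {HP_class cH1}" by (simp add: HP.independent_insertI)
  have "HP_class cH0 \<notin> HP.span {HP_class cH1}"
  proof
    assume "HP_class cH0 \<in> HP.span {HP_class cH1}"
    then obtain k where "HP_class cH0 = HP_scale k (HP_class cH1)" by (auto simp: HP.span_singleton)
    then have "HP_scale 1 (HP_class cH0) + HP_scale (- k) (HP_class cH1) = 0" by simp
    from ind[OF this] show False by simp
  qed
  then have i: "HP.independent {HP_class cH0, HP_class cH1}" using i1 by (rule HP.independent_insertI)
  have "x \<in> HP.span {HP_class cH0, HP_class cH1}" for x
  proof -
    obtain p where p: "p \<in> tot_cocycles" "x = HP_class p" using HP_class_surj by blast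
    obtain c where "p - combo c \<in> tot_coboundaries" using cocycle_combo[OF p(1)] by blast
    then have "x = HP_class (combo c)" using HP_class_eq_iff[OF p(1) combo_cocycle] p(2) by simp
    then show ?thesis unfolding HP_class_combo by (auto intro: HP.span_add HP.span_scale HP.span_base)
  qed
  then show ?thesis using ne i by blast
qed

section \<open>The relative characteristic map\<close>

lemma CcR_D: "f \<in> CcR \<Longrightarrow> smooth_on UNIV f"
  by (simp add: CcR_def)

lemma CcR_box:
  assumes "f \<in> CcR"
  obtains r where "r > 0" "\<And>x. x \<notin> {-r..r} \<Longrightarrow> f x = 0"
proof -
  obtain K where K: "compact K" "\<And>x. x \<notin> K \<Longrightarrow> f x = 0" using assms unfolding CcR_def by blast
  obtain B where B: "\<And>x. x \<in> K \<Longrightarrow> \<bar>x\<bar> \<le> B" using compact_imp_bounded[OF K(1)] by (auto simp: bounded_iff)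
  have "f x = 0" if "x \<notin> {-(\<bar>B\<bar> + 1)..\<bar>B\<bar> + 1}" for x
    by (rule K(2)) (use B[of x] that in auto)
  then show ?thesis using that[of "\<bar>B\<bar> + 1"] by auto
qed

lemma zero_CcR [simp]: "0 \<in> CcR"
  by (auto simp: CcR_def zero_fun_def intro: smooth_on_const)

lemma CcR_mult:
  assumes "f \<in> CcR" "smooth_on UNIV g"
  shows "(\<lambda>x. f x * g x) \<in> CcR"
proof -
  obtain K where K: "compact K" "\<forall>x. x \<notin> K \<longrightarrow> f x = 0" using assms(1) unfolding CcR_def by blast
  then show ?thesis unfolding CcR_def using smooth_on_mult[OF open_UNIV CcR_D[OF assms(1)] assms(2)] by auto
qed

lemma plateau_CcR: "(\<lambda>x. complex_of_real (plateau (-r) r 1 x)) \<in> CcR"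
proof -
  have "smooth_on UNIV (\<lambda>x. complex_of_real (plateau (-r) r 1 x))" by (intro smooth_on_of_real open_UNIV smooth_plateau)
  moreover have "compact {-r - 1..r + 1}" "\<forall>x. x \<notin> {-r - 1..r + 1} \<longrightarrow> complex_of_real (plateau (-r) r 1 x) = 0"
    using plateau_0[of 1 _ "-r" r] by auto
  ultimately show ?thesis unfolding CcR_def by blast
qed

lemma CcR_integrable:
  assumes "f \<in> CcR" "continuous_on UNIV g"
  shows "(\<lambda>x. f x * g x) integrable_on UNIV"
proof -
  obtain r where r: "r > 0" "\<And>x. x \<notin> {-r..r} \<Longrightarrow> f x = 0" by (rule CcR_box[OF assms(1)]) blast
  have "continuous_on (cbox (-r) r) (\<lambda>x. f x * g x)"
    by (intro continuous_intros continuous_on_subset[OF assms(2)] continuous_on_subset[OF smooth_on_imp_continuous[OF CcR_D[OF assms(1)]]]) auto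
  then show ?thesis by (rule integral_of_support(1)) (use r in auto)
qed

lemma Diff_mono: "\<phi> \<in> Diff \<Longrightarrow> x < y \<Longrightarrow> \<phi> x < \<phi> y"
  using DERIV_pos_imp_increasing[of x y \<phi>] Diff_DERIV Diff_deriv_pos by blast

text \<open>Substitution on an interval whose image contains the support of \<open>f\<close>.\<close>

lemma change_of_variables:
  assumes f: "f \<in> CcR" and g: "continuous_on UNIV g" and \<phi>: "\<phi> \<in> Diff"
  shows "integral UNIV (\<lambda>u. f (\<phi> u) * g (\<phi> u) * of_real (deriv \<phi> u)) = integral UNIV (\<lambda>x. f x * g x)"
proof -
  obtain r where r: "r > 0" "\<And>x. x \<notin> {-r..r} \<Longrightarrow> f x = 0" by (rule CcR_box[OF f]) blast
  define a b where "a = inv \<phi> (-r)" and "b = inv \<phi> r"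
  have ab: "\<phi> a = -r" "\<phi> b = r" using \<phi> by (simp_all add: a_def b_def)
  have "a < b" using Diff_mono[OF Diff_inv[OF \<phi>], of "-r" r] r(1) by (simp add: a_def b_def)
  have mono: "\<phi> x \<le> \<phi> y" if "x \<le> y" for x y using Diff_mono[OF \<phi>, of x y] that by (cases "x = y") auto
  have c: "continuous_on S (\<lambda>x. f x * g x)" for S
    by (intro continuous_intros continuous_on_subset[OF g] continuous_on_subset[OF smooth_on_imp_continuous[OF CcR_D[OF f]]]) auto
  have "((\<lambda>u. deriv \<phi> u *\<^sub>R (f (\<phi> u) * g (\<phi> u))) has_integral (integral {\<phi> a..\<phi> b} (\<lambda>x. f x * g x))) {a..b}"
  proof (rule has_integral_substitution[where c = "-r" and d = r])
    show "\<phi> ` {a..b} \<subseteq> {-r..r}" using mono ab by force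
    show "(\<phi> has_field_derivative deriv \<phi> x) (at x within {a..b})" for x
      by (rule has_field_derivative_at_within[OF Diff_DERIV[OF \<phi>]])
  qed (use \<open>a < b\<close> r ab c in auto)
  note h = this[unfolded ab]
  have "((\<lambda>u. deriv \<phi> u *\<^sub>R (f (\<phi> u) * g (\<phi> u))) has_integral (integral {-r..r} (\<lambda>x. f x * g x))) UNIV"
  proof (rule has_integral_on_superset[OF h])
    fix u assume "u \<notin> {a..b}"
    then have "\<phi> u \<notin> {-r..r}" using Diff_mono[OF \<phi>, of u a] Diff_mono[OF \<phi>, of b u] ab by auto
    then show "deriv \<phi> u *\<^sub>R (f (\<phi> u) * g (\<phi> u)) = 0" using r(2) by simp
  qed simp
  moreover have "integral {-r..r} (\<lambda>x. f x * g x) = integral UNIV (\<lambda>x. f x * g x)"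
    using integral_of_support(2)[OF c[of "cbox (-r) r"]] r(2) by simp
  ultimately show ?thesis by (simp add: integral_unique scaleR_conv_of_real mult.commute)
qed

lemma A_mem: "a \<in> \<A> \<Longrightarrow> a \<phi> \<in> CcR"
  unfolding \<A>_def crossed_def by (cases "a \<phi> = 0"; auto)

lemma A_supp: "a \<in> \<A> \<Longrightarrow> finite (supp a)" "a \<in> \<A> \<Longrightarrow> supp a \<subseteq> Diff"
  by (auto simp: \<A>_def crossed_def supp_def)

definition lift_fun :: "(real \<Rightarrow> complex) \<Rightarrow> real \<times> real \<Rightarrow> complex" where
  "lift_fun f = (\<lambda>p. if p \<in> FM then f (fst p) else 0)"

lemma lift_elem_eq: "lift_elem a \<phi> = lift_fun (a \<phi>)"
  by (simp add: lift_elem_def lift_fun_def)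

lemma lift_fun_CinfFM:
  assumes "f \<in> CcR" shows "lift_fun f \<in> CinfFM"
proof -
  have "lift_fun f = restrict_FM (\<lambda>p. f (fst p))" by (simp add: lift_fun_def restrict_FM_def)
  then show ?thesis using restrict_FM[OF smooth_fst_comp[OF CcR_D[OF assms]]] by simp
qed

lemma lift_fun_zero [simp]: "lift_fun 0 = 0"
  by (simp add: lift_fun_def fun_eq_iff)

lemma lift_elem_Ahat:
  assumes "a \<in> \<A>" shows "lift_elem a \<in> Ahat"
  by (rule AhatI[of "supp a"])
     (use assms A_supp A_mem in \<open>auto simp: lift_elem_eq supp_def intro!: lift_fun_CinfFM\<close>)

text \<open>The value \<open>\<tau>(a\<^sub>0 h(a\<^sub>1))\<close> of \<open>chi_rel\<close> on a cochain
  of degree \<open>1\<close>.\<close>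

definition chi_pair :: "H1 \<Rightarrow> (real \<Rightarrow> complex) cross \<Rightarrow> (real \<Rightarrow> complex) cross \<Rightarrow> complex" where
  "chi_pair h a0 a1 = trace_tau (at_one (fm_mult (lift_elem a0) (H1_ext h (lift_elem a1))))"

lemma continuous_lifted:
  assumes "\<phi> \<in> Diff" "F \<in> CinfFM"
  shows "continuous_on UNIV (\<lambda>x. F (lift_diff \<phi> (x, 1)))"
proof -
  have "continuous_on FM (\<lambda>p. F (lift_diff \<phi> p))"
    using smooth_on_imp_continuous[OF CinfFM_D(1)[OF CinfFM_lift[OF assms(2,1)]]] by (simp add: o_def)
  then show ?thesis by (rule continuous_on_compose2) (auto intro!: continuous_intros)
qed

text \<open>Only products of a coefficient at \<open>\<phi>\<close> with one at
  \<open>\<phi>\<^sup>-\<^sup>1\<close> contribute to the trace.\<close>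

lemma chi_pair_eq:
  assumes a: "a0 \<in> \<A>" "a1 \<in> \<A>" and S: "finite S" "S \<subseteq> Diff" "supp a0 \<subseteq> S"
  shows "chi_pair h a0 a1 = (\<Sum>\<phi>\<in>S. integral UNIV (\<lambda>x. a0 \<phi> x * dop h (inv \<phi>) (lift_fun (a1 (inv \<phi>))) (lift_diff \<phi> (x, 1))))"
proof -
  have sub: "supp (lift_elem a0) \<subseteq> S"
  proof
    fix \<phi> assume "\<phi> \<in> supp (lift_elem a0)"
    then have "a0 \<phi> \<noteq> 0" by (auto simp: supp_def lift_elem_eq)
    then show "\<phi> \<in> S" using S(3) by (auto simp: supp_def)
  qed
  have "chi_pair h a0 a1 = integral UNIV (\<lambda>x. \<Sum>\<phi>\<in>S. a0 \<phi> x * dop h (inv \<phi>) (lift_fun (a1 (inv \<phi>))) (lift_diff \<phi> (x, 1)))"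
    unfolding chi_pair_def trace_tau_def at_one_def fm_mult_apply[OF S(1,2) sub]
    by (simp add: H1_ext_apply[OF lift_elem_Ahat[OF a(2)]] lift_elem_eq) (simp add: lift_fun_def[of "a0 _"])
  also have "\<dots> = (\<Sum>\<phi>\<in>S. integral UNIV (\<lambda>x. a0 \<phi> x * dop h (inv \<phi>) (lift_fun (a1 (inv \<phi>))) (lift_diff \<phi> (x, 1))))"
  proof (rule integral_sum[OF S(1)])
    fix \<phi> assume "\<phi> \<in> S"
    then have "\<phi> \<in> Diff" using S(2) by auto
    then show "(\<lambda>x. a0 \<phi> x * dop h (inv \<phi>) (lift_fun (a1 (inv \<phi>))) (lift_diff \<phi> (x, 1))) integrable_on UNIV"
      by (intro CcR_integrable A_mem[OF a(1)] continuous_lifted dop_CinfFM Diff_inv lift_fun_CinfFM A_mem[OF a(2)])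
  qed
  finally show ?thesis .
qed

lemma chi_rel_degree_1:
  assumes "of_degree 1 c"
  shows "chi_rel c [a0, a1] = (\<Sum>hs\<in>Poly_Mapping.keys c. Poly_Mapping.lookup c hs * chi_pair (hd hs) a0 a1)"
  unfolding chi_rel_def
proof (rule sum.cong[OF refl])
  fix hs assume "hs \<in> Poly_Mapping.keys c"
  then have "length hs = 1" using assms by (simp add: of_degree_def)
  then obtain h where "hs = [h]" by (cases hs) auto
  then show "Poly_Mapping.lookup c hs * trace_tau (at_one (foldl fm_mult (lift_elem (hd [a0, a1])) (map2 (\<lambda>h a. H1_ext h (lift_elem a)) hs (tl [a0, a1])))) =
    Poly_Mapping.lookup c hs * chi_pair (hd hs) a0 a1" by (simp add: chi_pair_def)
qed

lemma chi_rel_gen: "chi_rel (tens [h]) [a0, a1] = chi_pair h a0 a1"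
  by (simp add: chi_rel_def tens_def chi_pair_def)

text \<open>The element of \<open>H1\<close> obtained by adding up a cochain of degree \<open>1\<close>.\<close>

definition total :: "cochain \<Rightarrow> H1" where
  "total c = (\<Sum>hs\<in>Poly_Mapping.keys c. h_scale (Poly_Mapping.lookup c hs) (hd hs))"

lemma coord_total:
  assumes "of_degree 1 c"
  shows "coord z q i c = (if q = 1 \<and> i = 0 then xi z (total c) else 0)"
proof -
  have l: "length hs = 1" if "hs \<in> Poly_Mapping.keys c" for hs using assms that by (simp add: of_degree_def)
  consider "q = 1" "i = 0" | "q = 1" "i \<noteq> 0" | "q \<noteq> 1" by blast
  then show ?thesis
  proof cases
    case 1
    have "coord z 1 0 c = (\<Sum>hs\<in>Poly_Mapping.keys c. Poly_Mapping.lookup c hs * xi z (hd hs))"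
      unfolding coord_def lin_eval_def
    proof (rule sum.cong[OF refl])
      fix hs assume "hs \<in> Poly_Mapping.keys c"
      then obtain h where "hs = [h]" using l[of hs] by (cases hs) auto
      then show "Poly_Mapping.lookup c hs * xi_at_deg z 1 0 hs = Poly_Mapping.lookup c hs * xi z (hd hs)" by (simp add: xi_at_deg_def)
    qed
    also have "\<dots> = xi z (total c)" unfolding total_def by (rule lin_sum[OF lin_xi, symmetric]) simp
    finally show ?thesis using 1 by simp
  next
    case 2
    then show ?thesis by (simp add: coord_beyond)
  next
    case 3
    then show ?thesis unfolding coord_def lin_eval_def by (auto simp: xi_at_deg_def l intro!: sum.neutral)
  qed
qed

definition csingle :: "diff \<Rightarrow> (real \<Rightarrow> complex) \<Rightarrow> (real \<Rightarrow> complex) cross" where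
  "csingle \<phi> f = (\<lambda>\<psi>. if \<psi> = \<phi> then f else 0)"

lemma csingle_A:
  assumes "\<phi> \<in> Diff" "f \<in> CcR"
  shows "csingle \<phi> f \<in> \<A>"
proof -
  have "{\<psi>. csingle \<phi> f \<psi> \<noteq> 0} \<subseteq> {\<phi>}" by (auto simp: csingle_def)
  then have "finite {\<psi>. csingle \<phi> f \<psi> \<noteq> 0}" by (rule finite_subset) simp
  then show ?thesis unfolding \<A>_def crossed_def using assms by (auto simp: csingle_def)
qed

lemma chi_pair_csingle:
  assumes "\<phi> \<in> Diff" "g \<in> CcR" "f \<in> CcR"
  shows "chi_pair h (csingle \<phi> g) (csingle (inv \<phi>) f) = integral UNIV (\<lambda>x. g x * dop h (inv \<phi>) (lift_fun f) (lift_diff \<phi> (x, 1)))"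
  by (subst chi_pair_eq[of _ _ "{\<phi>}"]) (auto simp: csingle_A assms Diff_inv, auto simp: csingle_def supp_def assms)

lemma plateau_nonneg: "plateau a b e x \<ge> 0"
  using flat_poly_1(1) by (simp add: plateau_def smooth_step_def)

text \<open>Test with a cutoff function times the complex conjugate of \<open>G\<close>.\<close>

lemma integral_test_zero:
  fixes G :: "real \<Rightarrow> complex"
  assumes G: "smooth_on UNIV G" and null: "\<And>g. g \<in> CcR \<Longrightarrow> integral UNIV (\<lambda>x. g x * G x) = 0"
  shows "G x = 0"
proof -
  define r where "r = \<bar>x\<bar> + 1"
  define P where "P = plateau (-r) r 1"
  have "(\<lambda>x. complex_of_real (P x) * cnj (G x)) \<in> CcR"
    unfolding P_def by (rule CcR_mult[OF plateau_CcR smooth_on_linear_image[OF bounded_linear_cnj open_UNIV G]])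
  from null[OF this] have "integral UNIV (\<lambda>x. complex_of_real (P x) * cnj (G x) * G x) = 0" .
  also have "(\<lambda>x. complex_of_real (P x) * cnj (G x) * G x) = (\<lambda>x. complex_of_real (P x * (cmod (G x))\<^sup>2))"
    by (rule ext) (simp only: of_real_mult complex_norm_square mult.assoc mult.commute[of "cnj _"])
  finally have i0: "integral UNIV (\<lambda>x. complex_of_real (P x * (cmod (G x))\<^sup>2)) = 0" .
  have cP: "continuous_on S P" and cG: "continuous_on S G" for S
    unfolding P_def using smooth_on_imp_continuous[OF smooth_plateau] smooth_on_imp_continuous[OF G] continuous_on_subset by blast+
  have c: "continuous_on S (\<lambda>x. complex_of_real (P x * (cmod (G x))\<^sup>2))" "continuous_on S (\<lambda>x. P x * (cmod (G x))\<^sup>2)" for S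
    by (intro continuous_intros cP cG)+
  let ?B = "cbox (-r - 1) (r + 1)"
  have "integral UNIV (\<lambda>x. complex_of_real (P x * (cmod (G x))\<^sup>2)) = integral ?B (\<lambda>x. complex_of_real (P x * (cmod (G x))\<^sup>2))"
    by (rule integral_of_support(2)[OF c(1)]) (use plateau_0[of 1 _ "-r" r] in \<open>auto simp: P_def\<close>)
  then have "integral ?B (\<lambda>x. complex_of_real (P x * (cmod (G x))\<^sup>2)) = 0" using i0 by simp
  then have "integral ?B (Re \<circ> (\<lambda>x. complex_of_real (P x * (cmod (G x))\<^sup>2))) = 0"
    using integral_linear[OF integrable_continuous[OF c(1)] bounded_linear_Re, of "-r - 1" "r + 1"] by simp
  then have i: "integral ?B (\<lambda>x. P x * (cmod (G x))\<^sup>2) = 0" by (simp add: o_def)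
  have "box (-r - 1) (r + 1) \<noteq> {}" by (simp add: r_def)
  from integral_cbox_eq_0_iff[OF c(2) this] i have "\<forall>y\<in>?B. P y * (cmod (G y))\<^sup>2 = 0" by (simp add: P_def plateau_nonneg)
  moreover have "x \<in> ?B" by (auto simp: r_def)
  ultimately have "P x * (cmod (G x))\<^sup>2 = 0" by blast
  moreover have "P x = 1" by (auto simp: P_def r_def intro!: plateau_1)
  ultimately show ?thesis by simp
qed

text \<open>Taking arbitrary \<open>g\<close> gives the vanishing of \<open>h(f)\<close> on the image of the
  line \<open>y = 1\<close> under the lift of \<open>\<phi>\<close>. Composing
  \<open>\<phi>\<close> with dilations, to which the operator is insensitive by
  \<open>dop_affine_left\<close>, covers all of \<open>FM\<close>. Then \<open>h\<close> kills the
  function \<open>x\<close> at the identity and the constant \<open>1\<close> at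
  \<open>exp_diff\<close> near \<open>0\<close>, which are the functions that define
  \<open>xi\<close>.\<close>

lemma annihilating_operator:
  assumes null: "\<And>\<phi> g f. \<phi> \<in> Diff \<Longrightarrow> g \<in> CcR \<Longrightarrow> f \<in> CcR \<Longrightarrow>
     integral UNIV (\<lambda>x. g x * dop h (inv \<phi>) (lift_fun f) (lift_diff \<phi> (x, 1))) = 0"
  shows "xi z h = 0"
proof -
  have 1: "dop h \<psi> (lift_fun f) (lift_diff (inv \<psi>) (x, 1)) = 0" if "\<psi> \<in> Diff" "f \<in> CcR" for \<psi> f x
  proof -
    have I: "inv \<psi> \<in> Diff" using that by auto
    have "smooth_on UNIV (\<lambda>x. (dop h \<psi> (lift_fun f) \<circ> lift_diff (inv \<psi>)) (x, 1))"
      by (rule smooth_on_compose[OF open_UNIV open_FM _ CinfFM_D(1)[OF CinfFM_lift[OF dop_CinfFM[OF that(1) lift_fun_CinfFM[OF that(2)]] I]]])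
         (auto intro: smooth_on_Pair[OF open_UNIV smooth_on_bounded_linear[OF bounded_linear_ident open_UNIV] smooth_on_const])
    moreover have "integral UNIV (\<lambda>x. g x * (dop h \<psi> (lift_fun f) \<circ> lift_diff (inv \<psi>)) (x, 1)) = 0" if "g \<in> CcR" for g
      using null[OF I that \<open>f \<in> CcR\<close>] \<open>\<psi> \<in> Diff\<close> by simp
    ultimately have "(dop h \<psi> (lift_fun f) \<circ> lift_diff (inv \<psi>)) (x, 1) = 0" by (rule integral_test_zero)
    then show ?thesis by simp
  qed
  have 2: "dop h \<psi> (lift_fun f) q = 0" if \<psi>: "\<psi> \<in> Diff" and f: "f \<in> CcR" and q: "q \<in> FM" for \<psi> f q
  proof -
    obtain x y where xy: "lift_diff \<psi> q = (x, y)" by (cases "lift_diff \<psi> q") auto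
    have "lift_diff \<psi> q \<in> FM" using \<psi> q by simp
    then have y: "y > 0" using xy by simp
    \<comment> \<open>A dilation brings the fibre coordinate of the image of \<open>q\<close> to \<open>1\<close>.\<close>
    define \<beta> where "\<beta> = aff (1 / y) 0"
    have \<beta>: "\<beta> \<in> Diff" unfolding \<beta>_def using y by (intro aff_Diff) simp
    have \<beta>\<psi>: "\<beta> \<circ> \<psi> \<in> Diff" by (rule Diff_comp[OF \<psi> \<beta>])
    have "lift_diff (\<beta> \<circ> \<psi>) q = lift_diff \<beta> (x, y)" by (simp add: lift_diff_comp[OF \<psi> \<beta>] xy)
    also have "\<dots> = (x / y, 1)" using y by (simp add: lift_diff_def \<beta>_def deriv_aff) (simp add: aff_def)
    finally have "lift_diff (inv (\<beta> \<circ> \<psi>)) (x / y, 1) = q" using lift_diff_inv(1)[OF \<beta>\<psi>, of q] by simp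
    then have "dop h (\<beta> \<circ> \<psi>) (lift_fun f) q = 0" using 1[OF \<beta>\<psi> f, of "x / y"] by simp
    then show ?thesis using dop_affine_left[of "1 / y" \<psi> "lift_fun f" h 0] y \<psi> lift_fun_CinfFM[OF f] by (simp add: \<beta>_def)
  qed
  \<comment> \<open>The function \<open>x\<close> at the identity, multiplied by a cutoff that is \<open>1\<close>
    near \<open>0\<close>.\<close>
  have X: "xi True h = 0"
  proof -
    define f where "f = (\<lambda>x. complex_of_real (plateau (-1) 1 1 x) * of_real x)"
    have f: "f \<in> CcR" unfolding f_def
      by (rule CcR_mult[OF plateau_CcR]) (intro smooth_on_of_real open_UNIV smooth_on_bounded_linear bounded_linear_ident)
    have "lift_fun f p = affine_fun 0 1 0 p" if "p \<in> strip" for p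
      using that by (auto simp: strip_def lift_fun_def f_def affine_fun_def plateau_1)
    from jetD1[OF jet_spec lift_fun_CinfFM[OF f] strip this, where p = "(0, 1)"]
    have "dop h id (lift_fun f) (0, 1) = xi True h" by (simp add: strip_def affine_fun_def)
    then show ?thesis using 2[OF id_Diff f, of "(0, 1)"] by simp
  qed
  \<comment> \<open>The constant \<open>1\<close> at \<open>exp_diff\<close>, likewise cut off.\<close>
  have D: "xi False h = 0"
  proof -
    define f where "f = (\<lambda>x. complex_of_real (plateau (-1) 1 1 x))"
    have f: "f \<in> CcR" unfolding f_def by (rule plateau_CcR)
    have one: "lift_fun f p = poly_fun 1 p" if "p \<in> strip" for p
      using that by (auto simp: strip_def lift_fun_def f_def poly_fun_def plateau_1)
    obtain T where T: "acts_on_polys h T" "\<And>q. coeff (T q) 1 = omega h * coeff q 1 + xi False h * coeff q 0"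
      using jetD2[OF jet_spec[of h]] by blast
    have "T 1 = 0"
    proof (rule poly_fun_eq_on_strip)
      fix p assume p: "p \<in> strip"
      have "dop h exp_diff (lift_fun f) p = poly_fun (T 1) p"
        by (rule acts_on_polysD[OF T(1) lift_fun_CinfFM[OF f] strip(1) order_refl one p])
      moreover have "p \<in> FM" using p strip(2) by blast
      ultimately show "poly_fun (T 1) p = poly_fun 0 p" using 2[OF exp_diff(1) f, of p] by (simp add: poly_fun_def case_prod_unfold)
    qed
    then show ?thesis using T(2)[of 1] by simp
  qed
  show ?thesis using X D by (cases z) auto
qed

text \<open>The difference of the two cochains pairs to zero with all pairs of monomials.\<close>

lemma chi_rel_injective:
  assumes c: "of_degree 1 c" and eq: "\<And>a0 a1. a0 \<in> \<A> \<Longrightarrow> a1 \<in> \<A> \<Longrightarrow> chi_rel c [a0, a1] = chi_rel (tens [k]) [a0, a1]"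
  shows "c \<approx> tens [k]"
proof -
  define h where "h = total c - k"
  have "xi z h = 0" for z
  proof (rule annihilating_operator)
    fix \<phi> g f assume a: "\<phi> \<in> Diff" "g \<in> CcR" "f \<in> CcR"
    define E where "E = (\<lambda>h. \<lambda>x. g x * dop h (inv \<phi>) (lift_fun f) (lift_diff \<phi> (x, 1)))"
    have int: "E h integrable_on UNIV" for h
      unfolding E_def by (intro CcR_integrable continuous_lifted dop_CinfFM Diff_inv lift_fun_CinfFM a)
    have "integral UNIV (E h) = integral UNIV (\<lambda>x. (\<Sum>hs\<in>Poly_Mapping.keys c. Poly_Mapping.lookup c hs * E (hd hs) x) - E k x)"
      by (simp add: E_def h_def total_def dop_diff dop_sum dop_scale sum_fun_apply algebra_simps sum_distrib_left)
    also have "\<dots> = (\<Sum>hs\<in>Poly_Mapping.keys c. Poly_Mapping.lookup c hs * integral UNIV (E (hd hs))) - integral UNIV (E k)"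
    proof (subst integral_diff)
      have m: "(\<lambda>x. Poly_Mapping.lookup c hs * E (hd hs) x) integrable_on UNIV" for hs
        by (rule integrable_on_mult_right[OF int])
      show "(\<lambda>x. \<Sum>hs\<in>Poly_Mapping.keys c. Poly_Mapping.lookup c hs * E (hd hs) x) integrable_on UNIV"
        by (rule integrable_sum) (simp_all add: m)
      show "integral UNIV (\<lambda>x. \<Sum>hs\<in>Poly_Mapping.keys c. Poly_Mapping.lookup c hs * E (hd hs) x) - integral UNIV (E k) =
         (\<Sum>hs\<in>Poly_Mapping.keys c. Poly_Mapping.lookup c hs * integral UNIV (E (hd hs))) - integral UNIV (E k)"
        by (subst integral_sum) (simp_all add: m)
    qed (rule int)
    also have "\<dots> = chi_rel c [csingle \<phi> g, csingle (inv \<phi>) f] - chi_rel (tens [k]) [csingle \<phi> g, csingle (inv \<phi>) f]"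
      unfolding chi_rel_degree_1[OF c] chi_rel_gen chi_pair_csingle[OF a] E_def ..
    also have "\<dots> = 0" using eq[OF csingle_A[OF a(1,2)] csingle_A[OF Diff_inv[OF a(1)] a(3)]] by simp
    finally show "integral UNIV (\<lambda>x. g x * dop h (inv \<phi>) (lift_fun f) (lift_diff \<phi> (x, 1))) = 0" by (simp add: E_def)
  qed
  then have "xi z (total c) = xi z k" for z using lin_minus(2)[OF lin_xi[of z], of "total c" k] by (simp add: h_def)
  then show ?thesis
    unfolding approx_iff coord_total[OF c] by (auto simp: coord_tens xi_at_beyond)
qed

section \<open>Connes' map in low degree\<close>

lemma form_zero_simps: "wedge 0 \<omega> = 0" "wedge \<omega> 0 = 0" "form_scale c 0 = 0" "grade_sign k 0 = 0" "pullback \<phi> 0 = 0"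
  "form_d 0 = 0"
  by (cases \<omega>; simp add: wedge_def form_scale_def grade_sign_def pullback_def form_d_def zero_prod_def zero_fun_def o_def)+

lemma b_mult_zero: "b_mult 0 b = 0" "b_mult b 0 = 0"
  by (auto simp: b_mult_def form_zero_simps fun_eq_iff)

lemma b_form_zero: "b_form 0 = 0"
  by (auto simp: b_form_def fun_eq_iff)

lemma shuffle_sign_simps: "shuffle_sign {} A = 1" "shuffle_sign A {} = 1"
  by (simp_all add: shuffle_sign_def)

lemma form_one_simps: "form_scale 1 \<omega> = \<omega>" "grade_sign 0 \<omega> = \<omega>" "wedge \<omega> (grade_sign k (\<lambda>x. 1, 0)) = \<omega>"
  "wedge (\<lambda>x. 1, 0) \<omega> = \<omega>"
  by (cases \<omega>; simp add: wedge_def form_scale_def grade_sign_def zero_fun_def)+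

lemma b_mult_form: "finite D \<Longrightarrow> b_mult (b_form \<omega>) b D = wedge \<omega> (b D)"
proof -
  assume D: "finite D"
  have "b_mult (b_form \<omega>) b D = (\<Sum>A\<in>Pow D. if A = {} then wedge \<omega> (b D) else 0)"
    unfolding b_mult_def by (rule sum.cong) (auto simp: b_form_def form_zero_simps form_one_simps shuffle_sign_simps)
  then show ?thesis using D by simp
qed

lemma b_mult_one: "finite D \<Longrightarrow> b_mult b b_one D = b D"
proof -
  assume D: "finite D"
  have "b_mult b b_one D = (\<Sum>A\<in>Pow D. if A = D then b D else 0)"
    unfolding b_mult_def by (rule sum.cong) (auto simp: b_one_def b_form_def form_zero_simps form_one_simps shuffle_sign_simps)
  then show ?thesis using D by simp
qed

lemma b_mult_infinite: "infinite D \<Longrightarrow> b_mult b b' D = 0"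
  by (simp add: b_mult_def)

lemma b_mult_one_eq: "(\<And>D. infinite D \<Longrightarrow> b D = 0) \<Longrightarrow> b_mult b b_one = b"
  by (rule ext) (metis b_mult_infinite b_mult_one)

lemma enum_simps: "enum {} = []" "enum {\<rho>} = [\<rho>]"
proof -
  show "enum {} = []" unfolding enum_def by (rule the_equality) auto
  have "\<rho>s = [\<rho>]" if "set \<rho>s = {\<rho>}" "distinct \<rho>s" for \<rho>s :: "diff list"
    using that by (cases \<rho>s; cases "tl \<rho>s") auto
  then show "enum {\<rho>} = [\<rho>]" unfolding enum_def by (intro the_equality) auto
qed

lemma b_act_superset:
  assumes "finite S" "{A. b A \<noteq> 0} \<subseteq> S"
  shows "b_act \<phi> b = (\<Sum>A\<in>S. b_mult (b_form (pullback \<phi> (b A))) (foldr b_mult (map (\<lambda>\<rho>. gam (\<rho> \<circ> \<phi>) - gam \<phi>) (enum A)) b_one))"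
  unfolding b_act_def
  by (rule sum.mono_neutral_left[OF assms]) (auto simp: form_zero_simps b_form_zero b_mult_zero)

lemma b_act_zero: "b_act \<phi> 0 = 0"
  by (simp add: b_act_def)

lemma b_act_form: "b_act \<phi> (b_form \<omega>) = b_form (pullback \<phi> \<omega>)"
proof -
  have "b_act \<phi> (b_form \<omega>) = b_mult (b_form (pullback \<phi> \<omega>)) b_one"
    by (subst b_act_superset[of "{{}}"]) (auto simp: b_form_def enum_simps)
  also have "\<dots> = b_form (pullback \<phi> \<omega>)" by (rule b_mult_one_eq) (auto simp: b_form_def)
  finally show ?thesis .
qed

lemma b_act_one: "b_act \<phi> b_one = b_one"
  unfolding b_one_def b_act_form by (simp add: pullback_def zero_fun_def o_def)

lemma cc_mult_eq:
  assumes "finite S" "S \<subseteq> Diff" "supp a \<subseteq> S"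
  shows "cc_mult a b \<theta> = (\<Sum>\<phi>\<in>S. b_mult (a \<phi>) (b_act \<phi> (b (\<theta> \<circ> inv \<phi>))))"
  unfolding cc_mult_def by (rule cross_mult_eq[OF assms]) (simp_all add: b_mult_zero b_act_zero)

lemma cc_mult_one:
  assumes S: "finite S" "S \<subseteq> Diff" "supp a \<subseteq> S" and inf: "\<And>\<phi> D. infinite D \<Longrightarrow> a \<phi> D = 0"
  shows "cc_mult a cc_one = a"
proof (rule ext)
  fix \<theta>
  have "cc_mult a cc_one \<theta> = (\<Sum>\<phi>\<in>S. if \<phi> = \<theta> then a \<theta> else 0)"
    unfolding cc_mult_eq[OF S]
  proof (rule sum.cong[OF refl])
    fix \<phi> assume "\<phi> \<in> S"
    then have \<phi>: "\<phi> \<in> Diff" using S(2) by auto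
    have "\<theta> \<circ> inv \<phi> = id \<longleftrightarrow> \<phi> = \<theta>" using Diff_comp_cancel[OF \<phi>, of id \<theta>] by auto
    then show "b_mult (a \<phi>) (b_act \<phi> (cc_one (\<theta> \<circ> inv \<phi>))) = (if \<phi> = \<theta> then a \<theta> else 0)"
      by (simp add: cc_one_def b_act_one b_act_zero b_mult_zero b_mult_one_eq[OF inf])
  qed
  also have "\<dots> = a \<theta>" using S(1,3) by (auto simp: supp_def)
  finally show "cc_mult a cc_one \<theta> = a \<theta>" .
qed

abbreviation dform :: "(real \<Rightarrow> complex) \<Rightarrow> real \<Rightarrow> complex" where
  "dform f \<equiv> \<lambda>x. vector_derivative f (at x)"

text \<open>The formula \<open>d(f U\<^sup>*\<^bsub>\<phi>\<^esub>) = df U\<^sup>*\<^bsub>\<phi>\<^esub> - f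
  \<gamma>\<^bsub>\<phi>\<^esub> U\<^sup>*\<^bsub>\<phi>\<^esub>\<close>.\<close>

lemma cc_diff_embed:
  "cc_diff (cc_embed a) \<phi> D = (if D = {} then (0, dform (a \<phi>)) else if \<phi> \<noteq> id \<and> D = {\<phi>} then (- a \<phi>, 0) else 0)"
proof (cases "finite D")
  case False
  then show ?thesis by (auto simp: cc_diff_def cc_embed_def b_diff_def b_form_def form_zero_simps b_mult_infinite)
next
  case True
  have s: "b_sign (b_form (f, 0)) = b_form (f, 0)" for f
    by (rule ext) (auto simp: b_sign_def b_form_def form_scale_def grade_sign_def zero_fun_def zero_prod_def)
  have e: "cc_diff (cc_embed a) \<phi> D = form_d (b_form (a \<phi>, 0) D) - wedge (a \<phi>, 0) (gam \<phi> D)"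
    by (simp add: cc_diff_def cc_embed_def b_diff_def s b_mult_form[OF True])
  have d: "form_d (a \<phi>, 0) = (0, dform (a \<phi>))" by (simp add: form_d_def)
  have w: "wedge (a \<phi>, 0) (\<lambda>x. 1, 0) = (a \<phi>, 0)" by (simp add: wedge_def zero_fun_def)
  have g: "gam \<phi> {} = 0" by (simp add: gam_def)
  consider "D = {}" | "D \<noteq> {}" "\<phi> \<noteq> id \<and> D = {\<phi>}" | "D \<noteq> {}" "\<not> (\<phi> \<noteq> id \<and> D = {\<phi>})" by blast
  then show ?thesis
  proof cases
    case 1
    then show ?thesis unfolding e by (simp add: b_form_def d g form_zero_simps)
  next
    case 2
    then have "gam \<phi> D = (\<lambda>x. 1, 0)" by (simp add: gam_def)
    then show ?thesis unfolding e using 2 by (simp add: b_form_def w form_zero_simps(6)[unfolded zero_prod_def] zero_prod_def)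
  next
    case 3
    then have "gam \<phi> D = 0" by (auto simp: gam_def)
    then show ?thesis unfolding e using 3 by (auto simp: b_form_def form_zero_simps)
  qed
qed

lemma supp_cc:
  "supp (cc_embed a) \<subseteq> supp a" "supp (cc_diff (cc_embed a)) \<subseteq> supp a"
proof -
  have "a \<phi> = 0 \<Longrightarrow> cc_embed a \<phi> = 0" for \<phi> by (auto simp: cc_embed_def b_form_def fun_eq_iff zero_prod_def)
  then show "supp (cc_embed a) \<subseteq> supp a" by (auto simp: supp_def)
  have "a \<phi> = 0 \<Longrightarrow> cc_diff (cc_embed a) \<phi> = 0" for \<phi>
    by (rule ext) (auto simp: cc_diff_embed zero_prod_def zero_fun_def)
  then show "supp (cc_diff (cc_embed a)) \<subseteq> supp a" by (auto simp: supp_def)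
qed

text \<open>The automorphism maps \<open>\<gamma>\<^bsub>\<phi>\<^sup>-\<^sup>1\<^esub>\<close> to
  \<open>\<gamma>\<^sub>e - \<gamma>\<^bsub>\<phi>\<^esub> = -
  \<gamma>\<^bsub>\<phi>\<^esub>\<close>.\<close>

lemma b_act_de:
  assumes \<phi>: "\<phi> \<in> Diff"
  shows "b_act \<phi> (cc_diff (cc_embed a) (inv \<phi>)) {} = (0, \<lambda>x. dform (a (inv \<phi>)) (\<phi> x) * of_real (deriv \<phi> x))"
    "b_act \<phi> (cc_diff (cc_embed a) (inv \<phi>)) {\<rho>} = (if \<phi> \<noteq> id \<and> \<rho> = \<phi> then (a (inv \<phi>) \<circ> \<phi>, 0) else 0)"
proof -
  define b where "b = cc_diff (cc_embed a) (inv \<phi>)"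
  have "{A. b A \<noteq> 0} \<subseteq> {{}, {inv \<phi>}}" by (auto simp: b_def cc_diff_embed split: if_splits)
  from b_act_superset[OF _ this, of \<phi>]
  have e: "b_act \<phi> b = b_mult (b_form (pullback \<phi> (b {}))) b_one + b_mult (b_form (pullback \<phi> (b {inv \<phi>}))) (b_mult (gam (inv \<phi> \<circ> \<phi>) - gam \<phi>) b_one)"
    by (simp add: enum_simps)
  have g: "b_mult (gam (inv \<phi> \<circ> \<phi>) - gam \<phi>) b_one D = - gam \<phi> D" if "finite D" for D
    unfolding b_mult_one[OF that] using \<phi> by (simp add: gam_def)
  have ne: "inv \<phi> = id \<longleftrightarrow> \<phi> = id" using Diff_inv_simps(5)[OF \<phi>] by (metis inv_id)
  show "b_act \<phi> (cc_diff (cc_embed a) (inv \<phi>)) {} = (0, \<lambda>x. dform (a (inv \<phi>)) (\<phi> x) * of_real (deriv \<phi> x))"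
    unfolding b_def[symmetric] e plus_fun_apply b_mult_form[OF finite.emptyI] g[OF finite.emptyI]
    by (simp add: b_def cc_diff_embed gam_def form_zero_simps form_one_simps b_mult_one b_one_def b_form_def pullback_def wedge_def zero_fun_def o_def zero_prod_def)
  show "b_act \<phi> (cc_diff (cc_embed a) (inv \<phi>)) {\<rho>} = (if \<phi> \<noteq> id \<and> \<rho> = \<phi> then (a (inv \<phi>) \<circ> \<phi>, 0) else 0)"
  proof -
    have f: "finite {\<rho>}" by simp
    have o: "b_one {\<rho>} = 0" by (simp add: b_one_def b_form_def)
    have e': "b_act \<phi> b {\<rho>} = wedge (pullback \<phi> (b {inv \<phi>})) (- gam \<phi> {\<rho>})"
      unfolding e plus_fun_apply b_mult_form[OF f] g[OF f] o by (simp add: form_zero_simps)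
    consider "\<phi> = id" | "\<phi> \<noteq> id" "\<rho> \<noteq> \<phi>" | "\<phi> \<noteq> id" "\<rho> = \<phi>" by blast
    then show ?thesis
    proof cases
      case 1
      then have "b {inv \<phi>} = 0" by (simp add: b_def cc_diff_embed)
      then show ?thesis unfolding b_def[symmetric] e' using 1 by (simp add: form_zero_simps)
    next
      case 2
      then have "gam \<phi> {\<rho>} = 0" by (auto simp: gam_def)
      then show ?thesis unfolding b_def[symmetric] e' using 2 by (simp add: form_zero_simps)
    next
      case 3
      then have "gam \<phi> {\<rho>} = (\<lambda>x. 1, 0)" by (simp add: gam_def)
      moreover have "b {inv \<phi>} = (- a (inv \<phi>), 0)" using 3(1) ne by (simp add: b_def cc_diff_embed)
      moreover have "wedge (pullback \<phi> (- a (inv \<phi>), 0)) (- (\<lambda>x. 1, 0)) = (a (inv \<phi>) \<circ> \<phi>, 0)"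
        by (simp add: pullback_def wedge_def o_def fun_eq_iff zero_fun_def)
      ultimately show ?thesis unfolding b_def[symmetric] e' using 3 by simp
    qed
  qed
qed

lemma term_e_de:
  assumes \<phi>: "\<phi> \<in> Diff"
  shows "b_mult (cc_embed a0 \<phi>) (b_act \<phi> (cc_diff (cc_embed a1) (inv \<phi>))) {} =
     (0, \<lambda>x. a0 \<phi> x * (dform (a1 (inv \<phi>)) (\<phi> x) * of_real (deriv \<phi> x)))"
    "b_mult (cc_embed a0 \<phi>) (b_act \<phi> (cc_diff (cc_embed a1) (inv \<phi>))) {\<rho>} =
     (if \<phi> \<noteq> id \<and> \<rho> = \<phi> then (\<lambda>x. a0 \<phi> x * a1 (inv \<phi>) (\<phi> x), 0) else 0)"
proof -
  have f: "finite {\<rho>}" by simp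
  show "b_mult (cc_embed a0 \<phi>) (b_act \<phi> (cc_diff (cc_embed a1) (inv \<phi>))) {} =
     (0, \<lambda>x. a0 \<phi> x * (dform (a1 (inv \<phi>)) (\<phi> x) * of_real (deriv \<phi> x)))"
    unfolding cc_embed_def[of a0] b_mult_form[OF finite.emptyI] b_act_de(1)[OF \<phi>] by (simp add: wedge_def zero_fun_def)
  show "b_mult (cc_embed a0 \<phi>) (b_act \<phi> (cc_diff (cc_embed a1) (inv \<phi>))) {\<rho>} =
     (if \<phi> \<noteq> id \<and> \<rho> = \<phi> then (\<lambda>x. a0 \<phi> x * a1 (inv \<phi>) (\<phi> x), 0) else 0)"
    unfolding cc_embed_def[of a0] b_mult_form[OF f] b_act_de(2)[OF \<phi>] by (simp add: wedge_def zero_fun_def zero_prod_def)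
qed

lemma term_de_e:
  shows "b_mult (cc_diff (cc_embed a1) \<psi>) (b_act \<psi> (cc_embed a0 (inv \<psi>))) {} =
     (0, \<lambda>x. dform (a1 \<psi>) x * a0 (inv \<psi>) (\<psi> x))"
    "b_mult (cc_diff (cc_embed a1) \<psi>) (b_act \<psi> (cc_embed a0 (inv \<psi>))) {\<rho>} =
     (if \<psi> \<noteq> id \<and> \<rho> = \<psi> then (\<lambda>x. - a1 \<psi> x * a0 (inv \<psi>) (\<psi> x), 0) else 0)"
proof -
  have e: "b_act \<psi> (cc_embed a0 (inv \<psi>)) = b_form (\<lambda>x. a0 (inv \<psi>) (\<psi> x), 0)"
    unfolding cc_embed_def b_act_form by (simp add: pullback_def zero_fun_def o_def)
  show "b_mult (cc_diff (cc_embed a1) \<psi>) (b_act \<psi> (cc_embed a0 (inv \<psi>))) {} =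
     (0, \<lambda>x. dform (a1 \<psi>) x * a0 (inv \<psi>) (\<psi> x))"
    unfolding e b_mult_def by (simp add: cc_diff_embed b_form_def shuffle_sign_simps form_one_simps wedge_def zero_fun_def)
  have P: "Pow {\<rho>} = {{}, {\<rho>}}" by auto
  show "b_mult (cc_diff (cc_embed a1) \<psi>) (b_act \<psi> (cc_embed a0 (inv \<psi>))) {\<rho>} =
     (if \<psi> \<noteq> id \<and> \<rho> = \<psi> then (\<lambda>x. - a1 \<psi> x * a0 (inv \<psi>) (\<psi> x), 0) else 0)"
    unfolding e b_mult_def P
    by (auto simp: cc_diff_embed b_form_def shuffle_sign_simps form_one_simps form_zero_simps wedge_def grade_sign_def zero_fun_def zero_prod_def)
qed

text \<open>The pairing with \<open>c0\<close> is integration of the component without exterior generators.\<close>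

lemma tilde_0: "tilde 0 c0 c = form_integral (c id {})"
proof -
  have e: "{A. finite A \<and> card A = 0 \<and> c id A \<noteq> 0} = (if c id {} = 0 then {} else {{}})"
    by (auto simp: card_eq_0_iff card_gt_0_iff)
  have w: "wedge (c0 \<rho>s) \<omega> = \<omega>" for \<rho>s \<omega> by (simp only: c0_def form_one_simps)
  have "form_integral 0 = 0" by (simp add: form_integral_def zero_prod_def zero_fun_def)
  then show ?thesis unfolding tilde_def e by (cases "c id {} = 0") (simp_all add: w)
qed

text \<open>As \<open>c1(1, \<rho>) = - (\<rho>'' / \<rho>') dx\<close>, only the coefficients of single
  generators contribute.\<close>

lemma tilde_1:
  assumes "finite R" "\<And>\<rho>. \<rho> \<notin> R \<Longrightarrow> c id {\<rho>} = 0"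
  shows "tilde 1 c1 c = (\<Sum>\<rho>\<in>R. integral UNIV (\<lambda>x. - of_real (nonlin \<rho> x) * fst (c id {\<rho>}) x))"
proof -
  let ?T = "{A. finite A \<and> card A = 1 \<and> c id A \<noteq> 0}"
  have sub: "?T \<subseteq> (\<lambda>\<rho>. {\<rho>}) ` R" using assms(2) by (auto simp: card_1_singleton_iff)
  have "tilde 1 c1 c = (\<Sum>A\<in>(\<lambda>\<rho>. {\<rho>}) ` R. form_integral (wedge (c1 (id # enum A)) (c id A)))"
    unfolding tilde_def
  proof (rule sum.mono_neutral_left[OF _ sub])
    show "\<forall>A\<in>(\<lambda>\<rho>. {\<rho>}) ` R - ?T. form_integral (wedge (c1 (id # enum A)) (c id A)) = 0"
    proof
      fix A assume "A \<in> (\<lambda>\<rho>. {\<rho>}) ` R - ?T"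
      then have z: "c id A = 0" by auto
      show "form_integral (wedge (c1 (id # enum A)) (c id A)) = 0"
        unfolding z form_zero_simps by (simp add: form_integral_def zero_prod_def zero_fun_def)
    qed
  qed (use assms in auto)
  also have "\<dots> = (\<Sum>\<rho>\<in>R. form_integral (wedge (c1 [id, \<rho>]) (c id {\<rho>})))"
    by (subst sum.reindex) (auto simp: inj_on_def enum_simps)
  also have "\<dots> = (\<Sum>\<rho>\<in>R. integral UNIV (\<lambda>x. - of_real (nonlin \<rho> x) * fst (c id {\<rho>}) x))"
    by (rule sum.cong[OF refl])
       (simp add: c1_def wedge_def form_integral_def case_prod_unfold nonlin_def)
  finally show ?thesis .
qed

lemma fst_sum_fun: "fst (\<Sum>i\<in>I. f i) = (\<Sum>i\<in>I. fst (f i))" "snd (\<Sum>i\<in>I. f i) = (\<Sum>i\<in>I. snd (f i))"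
  by (induction I rule: infinite_finite_induct) auto

context
  fixes a0 a1 :: "(real \<Rightarrow> complex) cross" and S :: "diff set"
  assumes a: "a0 \<in> \<A>" "a1 \<in> \<A>" and S: "finite S" "S \<subseteq> Diff" "supp a0 \<subseteq> S" "supp a1 \<subseteq> inv ` S"
begin

text \<open>The contributions of \<open>\<phi>\<close> to \<open>\<tau>(a\<^sub>0 X1(a\<^sub>1))\<close> and
  to \<open>\<tau>(a\<^sub>0 delta1(a\<^sub>1))\<close>. They are the common value to which both
  sides of the two identities are reduced.\<close>

definition dx_pairing :: "diff \<Rightarrow> complex" where
  "dx_pairing \<phi> = integral UNIV (\<lambda>x. a0 \<phi> x * (dform (a1 (inv \<phi>)) (\<phi> x) * of_real (deriv \<phi> x)))"

definition nonlin_pairing :: "diff \<Rightarrow> complex" where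
  "nonlin_pairing \<phi> = integral UNIV (\<lambda>x. - of_real (nonlin \<phi> x) * (a0 \<phi> x * a1 (inv \<phi>) (\<phi> x)))"

lemma S': "finite (inv ` S)" "inv ` S \<subseteq> Diff" "supp a1 \<subseteq> inv ` S"
  using S by auto

lemma inj_inv_S: "inj_on inv S"
  by (rule inj_onI) (metis S(2) Diff_inv_simps(5) subsetD)

lemma cont_CcR: "f \<in> CcR \<Longrightarrow> continuous_on UNIV f"
  by (rule smooth_on_imp_continuous[OF CcR_D])

lemma cont_comp: "f \<in> CcR \<Longrightarrow> \<phi> \<in> Diff \<Longrightarrow> continuous_on UNIV (\<lambda>x. f (\<phi> x))"
  by (rule continuous_on_compose2[OF cont_CcR smooth_on_imp_continuous[OF Diff_smooth]]) auto

lemma dform_CcR: "f \<in> CcR \<Longrightarrow> dform f \<in> CcR"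
proof -
  assume f: "f \<in> CcR"
  obtain K where K: "compact K" "\<And>x. x \<notin> K \<Longrightarrow> f x = 0" using f unfolding CcR_def by blast
  have "dform f x = 0" if "x \<notin> K" for x
  proof (rule vector_derivative_at)
    have "open (- K)" using K(1) by (simp add: compact_imp_closed open_Compl)
    moreover have "((\<lambda>_. 0) has_vector_derivative 0) (at x)" by (rule has_vector_derivative_const)
    ultimately show "(f has_vector_derivative 0) (at x)"
      using K(2) that by (auto intro: has_vector_derivative_transform_within_open[of "\<lambda>_. 0" 0 x "- K" f])
  qed
  then show ?thesis using K(1) smooth_on_vector_derivative(2)[OF open_UNIV CcR_D[OF f]] unfolding CcR_def by blast
qed

text \<open>The lift of \<open>\<phi>\<close> maps \<open>(x, 1)\<close> to \<open>(\<phi>(x),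
  \<phi>'(x))\<close>. This provides the factor \<open>\<phi>'\<close> for \<open>X1\<close>, and
  for \<open>delta1\<close> it turns the cocycle of \<open>\<phi>\<^sup>-\<^sup>1\<close> into
  minus that of \<open>\<phi>\<close>.\<close>

lemma chi_pair_gen: "chi_pair X1 a0 a1 = (\<Sum>\<phi>\<in>S. dx_pairing \<phi>)" "chi_pair delta1 a0 a1 = (\<Sum>\<phi>\<in>S. nonlin_pairing \<phi>)"
proof -
  show "chi_pair X1 a0 a1 = (\<Sum>\<phi>\<in>S. dx_pairing \<phi>)"
    unfolding chi_pair_eq[OF a S(1-3)]
  proof (rule sum.cong[OF refl])
    fix \<phi> assume "\<phi> \<in> S"
    then have \<phi>: "\<phi> \<in> Diff" using S(2) by auto
    have "X_fun (lift_fun f) (x, y) = of_real y * dform f x" if "y > 0" for f x y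
      using that by (simp add: X_fun_def lift_fun_def)
    then show "integral UNIV (\<lambda>x. a0 \<phi> x * dop X1 (inv \<phi>) (lift_fun (a1 (inv \<phi>))) (lift_diff \<phi> (x, 1))) = dx_pairing \<phi>"
      using Diff_deriv_pos[OF \<phi>]
      by (simp add: dx_pairing_def dop_rules Diff_inv[OF \<phi>] lift_fun_CinfFM[OF A_mem[OF a(2)]] lift_diff_def mult.commute[of "of_real _"])
  qed
  show "chi_pair delta1 a0 a1 = (\<Sum>\<phi>\<in>S. nonlin_pairing \<phi>)"
    unfolding chi_pair_eq[OF a S(1-3)]
  proof (rule sum.cong[OF refl])
    fix \<phi> assume "\<phi> \<in> S"
    then have \<phi>: "\<phi> \<in> Diff" using S(2) by auto
    have n: "deriv \<phi> x * nonlin (inv \<phi>) (\<phi> x) = - nonlin \<phi> x" for x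
      using nonlin_inv[OF \<phi>, of x] by (simp add: mult.commute)
    have "D_fun (inv \<phi>) (lift_fun f) (lift_diff \<phi> (x, 1)) = - of_real (nonlin \<phi> x) * f (\<phi> x)" for f x
      unfolding lift_diff_def D_fun_def prod.case mult_1_right n using Diff_deriv_pos[OF \<phi>, of x] by (simp add: lift_fun_def)
    then show "integral UNIV (\<lambda>x. a0 \<phi> x * dop delta1 (inv \<phi>) (lift_fun (a1 (inv \<phi>))) (lift_diff \<phi> (x, 1))) = nonlin_pairing \<phi>"
      by (simp add: nonlin_pairing_def dop_rules Diff_inv[OF \<phi>] lift_fun_CinfFM[OF A_mem[OF a(2)]] mult.left_commute)
  qed
qed

lemma cc_one_simps:
  assumes "b \<in> \<A>"
  shows "cc_mult (cc_embed b) cc_one = cc_embed b" "cc_mult (cc_diff (cc_embed b)) cc_one = cc_diff (cc_embed b)"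
proof -
  show "cc_mult (cc_embed b) cc_one = cc_embed b"
    by (rule cc_mult_one[OF A_supp(1)[OF assms] A_supp(2)[OF assms] supp_cc(1)]) (auto simp: cc_embed_def b_form_def)
  show "cc_mult (cc_diff (cc_embed b)) cc_one = cc_diff (cc_embed b)"
    by (rule cc_mult_one[OF A_supp(1)[OF assms] A_supp(2)[OF assms] supp_cc(2)]) (auto simp: cc_diff_embed)
qed

lemma product_e_de:
  "cc_mult (cc_embed a0) (cc_diff (cc_embed a1)) id D = (\<Sum>\<phi>\<in>S. b_mult (cc_embed a0 \<phi>) (b_act \<phi> (cc_diff (cc_embed a1) (inv \<phi>))) D)"
  by (subst cc_mult_eq[OF S(1,2) order_trans[OF supp_cc(1) S(3)]]) (simp add: sum_fun_apply)

lemma product_de_e: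
  "cc_mult (cc_diff (cc_embed a1)) (cc_embed a0) id D = (\<Sum>\<psi>\<in>inv ` S. b_mult (cc_diff (cc_embed a1) \<psi>) (b_act \<psi> (cc_embed a0 (inv \<psi>))) D)"
  by (subst cc_mult_eq[OF S'(1,2) order_trans[OF supp_cc(2) S'(3)]]) (simp add: sum_fun_apply)

lemma tilde_e_de: "tilde 0 c0 (cc_mult (cc_embed a0) (cc_diff (cc_embed a1))) = (\<Sum>\<phi>\<in>S. dx_pairing \<phi>)"
  "tilde 1 c1 (cc_mult (cc_embed a0) (cc_diff (cc_embed a1))) = (\<Sum>\<phi>\<in>S. nonlin_pairing \<phi>)"
proof -
  have D: "\<phi> \<in> Diff" if "\<phi> \<in> S" for \<phi> using S(2) that by auto
  have int: "(\<lambda>x. a0 \<phi> x * (dform (a1 (inv \<phi>)) (\<phi> x) * of_real (deriv \<phi> x))) integrable_on UNIV" if "\<phi> \<in> S" for \<phi>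
    by (intro CcR_integrable A_mem[OF a(1)] continuous_intros cont_comp dform_CcR A_mem[OF a(2)] D that
       smooth_on_imp_continuous[OF Diff_smooth_deriv])
  have "tilde 0 c0 (cc_mult (cc_embed a0) (cc_diff (cc_embed a1))) =
     integral UNIV (\<lambda>x. \<Sum>\<phi>\<in>S. a0 \<phi> x * (dform (a1 (inv \<phi>)) (\<phi> x) * of_real (deriv \<phi> x)))"
    unfolding tilde_0 product_e_de form_integral_def
    by (simp add: term_e_de(1) D fst_sum_fun sum_fun_apply[abs_def] cong: sum.cong)
  also have "\<dots> = (\<Sum>\<phi>\<in>S. dx_pairing \<phi>)" unfolding dx_pairing_def by (rule integral_sum[OF S(1) int])
  finally show "tilde 0 c0 (cc_mult (cc_embed a0) (cc_diff (cc_embed a1))) = (\<Sum>\<phi>\<in>S. dx_pairing \<phi>)" .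
  have c: "cc_mult (cc_embed a0) (cc_diff (cc_embed a1)) id {\<rho>} =
      (if \<rho> \<in> S \<and> \<rho> \<noteq> id then (\<lambda>x. a0 \<rho> x * a1 (inv \<rho>) (\<rho> x), 0) else 0)" for \<rho>
  proof -
    have "cc_mult (cc_embed a0) (cc_diff (cc_embed a1)) id {\<rho>} = (\<Sum>\<phi>\<in>S. if \<phi> = \<rho> then (if \<rho> \<noteq> id then (\<lambda>x. a0 \<rho> x * a1 (inv \<rho>) (\<rho> x), 0) else 0) else 0)"
      unfolding product_e_de by (rule sum.cong[OF refl]) (auto simp: term_e_de(2) D)
    then show ?thesis using S(1) by simp
  qed
  have "tilde 1 c1 (cc_mult (cc_embed a0) (cc_diff (cc_embed a1))) =
     (\<Sum>\<rho>\<in>S. integral UNIV (\<lambda>x. - of_real (nonlin \<rho> x) * fst (cc_mult (cc_embed a0) (cc_diff (cc_embed a1)) id {\<rho>}) x))"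
    by (rule tilde_1[OF S(1)]) (simp add: c)
  also have "\<dots> = (\<Sum>\<phi>\<in>S. nonlin_pairing \<phi>)"
    unfolding nonlin_pairing_def c by (rule sum.cong[OF refl]) (auto simp: zero_prod_def)
  finally show "tilde 1 c1 (cc_mult (cc_embed a0) (cc_diff (cc_embed a1))) = (\<Sum>\<phi>\<in>S. nonlin_pairing \<phi>)" .
qed

text \<open>The cyclically permuted term runs over the inverses of the elements of \<open>S\<close>;
  substitution along \<open>\<phi>\<close> identifies it with the term of
  \<open>tilde_e_de\<close>.\<close>

lemma tilde_de_e: "tilde 0 c0 (cc_mult (cc_diff (cc_embed a1)) (cc_embed a0)) = (\<Sum>\<phi>\<in>S. dx_pairing \<phi>)"
  "tilde 1 c1 (cc_mult (cc_diff (cc_embed a1)) (cc_embed a0)) = (\<Sum>\<phi>\<in>S. nonlin_pairing \<phi>)"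
proof -
  have D: "\<phi> \<in> Diff" if "\<phi> \<in> S" for \<phi> using S(2) that by auto
  have D': "\<psi> \<in> Diff" if "\<psi> \<in> inv ` S" for \<psi> using S'(2) that by auto
  have int: "(\<lambda>x. dform (a1 \<psi>) x * a0 (inv \<psi>) (\<psi> x)) integrable_on UNIV" if "\<psi> \<in> inv ` S" for \<psi>
    by (intro CcR_integrable dform_CcR A_mem[OF a(2)] cont_comp A_mem[OF a(1)] D' that)
  have "tilde 0 c0 (cc_mult (cc_diff (cc_embed a1)) (cc_embed a0)) =
     integral UNIV (\<lambda>x. \<Sum>\<psi>\<in>inv ` S. dform (a1 \<psi>) x * a0 (inv \<psi>) (\<psi> x))"
    unfolding tilde_0 product_de_e form_integral_def
    by (simp only: term_de_e(1) fst_sum_fun sum_fun_apply[abs_def] snd_conv)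
  also have "\<dots> = (\<Sum>\<psi>\<in>inv ` S. integral UNIV (\<lambda>x. dform (a1 \<psi>) x * a0 (inv \<psi>) (\<psi> x)))" by (rule integral_sum[OF S'(1) int])
  also have "\<dots> = (\<Sum>\<phi>\<in>S. integral UNIV (\<lambda>x. dform (a1 (inv \<phi>)) x * a0 \<phi> (inv \<phi> x)))"
    by (subst sum.reindex[OF inj_inv_S]) (simp add: D)
  also have "\<dots> = (\<Sum>\<phi>\<in>S. dx_pairing \<phi>)"
  proof (rule sum.cong[OF refl])
    fix \<phi> assume "\<phi> \<in> S"
    note \<phi> = D[OF this]
    show "integral UNIV (\<lambda>x. dform (a1 (inv \<phi>)) x * a0 \<phi> (inv \<phi> x)) = dx_pairing \<phi>"
      using change_of_variables[OF dform_CcR[OF A_mem[OF a(2), of "inv \<phi>"]] cont_comp[OF A_mem[OF a(1), of \<phi>] Diff_inv[OF \<phi>]] \<phi>] \<phi>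
      by (simp add: dx_pairing_def mult.commute mult.left_commute)
  qed
  finally show "tilde 0 c0 (cc_mult (cc_diff (cc_embed a1)) (cc_embed a0)) = (\<Sum>\<phi>\<in>S. dx_pairing \<phi>)" .
  have c: "cc_mult (cc_diff (cc_embed a1)) (cc_embed a0) id {\<rho>} =
      (if \<rho> \<in> inv ` S \<and> \<rho> \<noteq> id then (\<lambda>x. - a1 \<rho> x * a0 (inv \<rho>) (\<rho> x), 0) else 0)" for \<rho>
  proof -
    have "cc_mult (cc_diff (cc_embed a1)) (cc_embed a0) id {\<rho>} = (\<Sum>\<psi>\<in>inv ` S. if \<psi> = \<rho> then (if \<rho> \<noteq> id then (\<lambda>x. - a1 \<rho> x * a0 (inv \<rho>) (\<rho> x), 0) else 0) else 0)"
      unfolding product_de_e by (rule sum.cong[OF refl]) (auto simp: term_de_e(2))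
    then show ?thesis using S'(1) by simp
  qed
  have "tilde 1 c1 (cc_mult (cc_diff (cc_embed a1)) (cc_embed a0)) =
     (\<Sum>\<rho>\<in>inv ` S. integral UNIV (\<lambda>x. - of_real (nonlin \<rho> x) * fst (cc_mult (cc_diff (cc_embed a1)) (cc_embed a0) id {\<rho>}) x))"
    by (rule tilde_1[OF S'(1)]) (simp only: c simp_thms if_False)
  also have "\<dots> = (\<Sum>\<rho>\<in>inv ` S. integral UNIV (\<lambda>x. a1 \<rho> x * (of_real (nonlin \<rho> x) * a0 (inv \<rho>) (\<rho> x))))"
    unfolding c by (rule sum.cong[OF refl]) (auto simp: zero_prod_def mult.left_commute)
  also have "\<dots> = (\<Sum>\<phi>\<in>S. integral UNIV (\<lambda>x. a1 (inv \<phi>) x * (of_real (nonlin (inv \<phi>) x) * a0 \<phi> (inv \<phi> x))))"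
    by (subst sum.reindex[OF inj_inv_S]) (simp add: D)
  also have "\<dots> = (\<Sum>\<phi>\<in>S. nonlin_pairing \<phi>)"
  proof (rule sum.cong[OF refl])
    fix \<phi> assume "\<phi> \<in> S"
    note \<phi> = D[OF this]
    have n: "nonlin (inv \<phi>) (\<phi> x) * deriv \<phi> x = - nonlin \<phi> x" for x by (rule nonlin_inv[OF \<phi>])
    have cn: "continuous_on UNIV (\<lambda>x. of_real (nonlin (inv \<phi>) x) * a0 \<phi> (inv \<phi> x))"
      by (intro continuous_intros cont_comp A_mem[OF a(1)] Diff_inv \<phi> smooth_on_imp_continuous[OF smooth_nonlin])
    have "integral UNIV (\<lambda>x. a1 (inv \<phi>) x * (of_real (nonlin (inv \<phi>) x) * a0 \<phi> (inv \<phi> x))) =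
       integral UNIV (\<lambda>u. a1 (inv \<phi>) (\<phi> u) * (of_real (nonlin (inv \<phi>) (\<phi> u)) * a0 \<phi> (inv \<phi> (\<phi> u))) * of_real (deriv \<phi> u))"
      by (rule change_of_variables[OF A_mem[OF a(2)] cn \<phi>, symmetric])
    also have "(\<lambda>u. a1 (inv \<phi>) (\<phi> u) * (of_real (nonlin (inv \<phi>) (\<phi> u)) * a0 \<phi> (inv \<phi> (\<phi> u))) * of_real (deriv \<phi> u)) =
       (\<lambda>u. of_real (nonlin (inv \<phi>) (\<phi> u) * deriv \<phi> u) * (a0 \<phi> u * a1 (inv \<phi>) (\<phi> u)))"
      using \<phi> by (simp add: mult_ac)
    finally show "integral UNIV (\<lambda>x. a1 (inv \<phi>) x * (of_real (nonlin (inv \<phi>) x) * a0 \<phi> (inv \<phi> x))) = nonlin_pairing \<phi>"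
      unfolding n by (simp add: nonlin_pairing_def)
  qed
  finally show "tilde 1 c1 (cc_mult (cc_diff (cc_embed a1)) (cc_embed a0)) = (\<Sum>\<phi>\<in>S. nonlin_pairing \<phi>)" .
qed

text \<open>The two summands of Connes' formula are equal, which cancels the factor \<open>1 / 2!\<close>.\<close>

lemma Phi_C_eq: "Phi_C 0 0 c0 [a0, a1] = (\<Sum>\<phi>\<in>S. dx_pairing \<phi>)" "Phi_C 1 1 c1 [a0, a1] = (\<Sum>\<phi>\<in>S. nonlin_pairing \<phi>)"
proof -
  have j: "{..1::nat} = {0, 1}" by auto
  show "Phi_C 0 0 c0 [a0, a1] = (\<Sum>\<phi>\<in>S. dx_pairing \<phi>)"
    using tilde_de_e(1) tilde_e_de(1) by (simp add: Phi_C_def Let_def j cc_one_simps a)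
  show "Phi_C 1 1 c1 [a0, a1] = (\<Sum>\<phi>\<in>S. nonlin_pairing \<phi>)"
    using tilde_de_e(2) tilde_e_de(2) by (simp add: Phi_C_def Let_def j cc_one_simps a)
qed

end

lemma chi_rel_eq_Phi_C:
  "eq_on_A 1 (chi_rel cH0) (Phi_C 0 0 c0)" "eq_on_A 1 (chi_rel cH1) (Phi_C 1 1 c1)"
proof -
  have "chi_rel cH0 as = Phi_C 0 0 c0 as \<and> chi_rel cH1 as = Phi_C 1 1 c1 as" if as: "length as = 1 + 1" "set as \<subseteq> \<A>" for as
  proof -
    obtain a0 a1 where e: "as = [a0, a1]" using as(1) by (auto simp: length_Suc_conv numeral_2_eq_2)
    then have a: "a0 \<in> \<A>" "a1 \<in> \<A>" using as(2) by auto
    \<comment> \<open>A finite set that contains the support of \<open>a0\<close> and the inverses of the support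
      of \<open>a1\<close>, the only indices that contribute.\<close>
    define S where "S = supp a0 \<union> inv ` supp a1"
    have S: "finite S" "S \<subseteq> Diff" "supp a0 \<subseteq> S" "supp a1 \<subseteq> inv ` S"
    proof -
      show "finite S" "S \<subseteq> Diff" "supp a0 \<subseteq> S" using A_supp a by (auto simp: S_def)
      show "supp a1 \<subseteq> inv ` S"
      proof
        fix \<phi> assume m: "\<phi> \<in> supp a1"
        then have "\<phi> = inv (inv \<phi>)" using A_supp(2)[OF a(2)] by auto
        then show "\<phi> \<in> inv ` S" using m by (auto simp: S_def)
      qed
    qed
    show ?thesis
      using chi_pair_gen[OF a S] Phi_C_eq[OF a S] by (simp add: e cH0_def cH1_def chi_rel_gen)
  qed
  then show "eq_on_A 1 (chi_rel cH0) (Phi_C 0 0 c0)" "eq_on_A 1 (chi_rel cH1) (Phi_C 1 1 c1)"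
    by (auto simp: eq_on_A_def)
qed

lemma chi_rel_unique:
  assumes "of_degree 1 c" "eq_on_A 1 (chi_rel c) F" "eq_on_A 1 (chi_rel (tens [k])) F"
  shows "c \<approx> tens [k]"
  by (rule chi_rel_injective[OF assms(1)]) (use assms(2,3) in \<open>auto simp: eq_on_A_def\<close>)

theorem proposition6p2:
  "(cyclic_cocycle 1 cH0 \<and> cyclic_cocycle 1 cH1) \<and>
   (eq_on_A 1 (chi_rel cH0) (Phi_C 0 0 c0) \<and>
    (\<forall>c. of_degree 1 c \<and> eq_on_A 1 (chi_rel c) (Phi_C 0 0 c0) \<longrightarrow> c \<approx> cH0)) \<and>
   (eq_on_A 1 (chi_rel cH1) (Phi_C 1 1 c1) \<and>
    (\<forall>c. of_degree 1 c \<and> eq_on_A 1 (chi_rel c) (Phi_C 1 1 c1) \<longrightarrow> c \<approx> cH1)) \<and>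
   (HP_class cH0 \<noteq> HP_class cH1 \<and>
    HP.independent {HP_class cH0, HP_class cH1} \<and>
    HP.span {HP_class cH0, HP_class cH1} = UNIV)"
proof (intro conjI allI impI)
  show "cyclic_cocycle 1 cH0" "cyclic_cocycle 1 cH1"
    using cyclic_cocycle_single(1)[of True] cyclic_cocycle_single(1)[of False] by (simp_all only: cyclic_cocycle_single(2,3))
  show e0: "eq_on_A 1 (chi_rel cH0) (Phi_C 0 0 c0)" and e1: "eq_on_A 1 (chi_rel cH1) (Phi_C 1 1 c1)"
    by (rule chi_rel_eq_Phi_C)+
  show "c \<approx> cH0" if "of_degree 1 c \<and> eq_on_A 1 (chi_rel c) (Phi_C 0 0 c0)" for c
    using chi_rel_unique that e0 unfolding cH0_def by blast
  show "c \<approx> cH1" if "of_degree 1 c \<and> eq_on_A 1 (chi_rel c) (Phi_C 1 1 c1)" for c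
    using chi_rel_unique that e1 unfolding cH1_def by blast
qed (use HP_basis in blast)+

end
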